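(* Let $\Omega=\{x\in\mathbb{R}^2: 1/2<|x|<1\}$, let $x_0\in\mathbb{R}^2$ with $|x_0|=1/2$ (so $x_0\in\partial\Omega$), let $\beta\in(0,1/2)$, and let $a,b,c,d$ be positive real numbers. Then there exist constants $C=C(a,b,c,d,\beta,x_0,\Omega)$ and $C'=C'(a,b,c,d,\beta,x_0,\Omega)$, depending only on the indicated quantities, such that the following holds. Let $V,W:\Omega\to\mathbb{R}$ be Lipschitz functions with $$0<a\le V\le b,\qquad \|\nabla V\|_{L^\infty(\Omega)}\le A=\frac{a}{2(1+2^{2\beta})},$$ $$0<c\le W\le d,\qquad \|\nabla W\|_{L^\infty(\Omega)}\le B=\frac{c}{2}.$$ Let $u,v\in W_0^{1,1}(\Omega)$ be such that $e^u\in L^1(\Omega)$, $e^v\in L^1(\Omega)$, and $(u,v)$ is a solution, in the sense of distributions, of $$-\Delta u=(1+|x-x_0|^{2\beta})\,V e^{v}\ \text{ in }\Omega,\qquad -\Delta v=W e^{u}\ \text{ in }\Omega,\qquad u=v=0\ \text{ on }\partial\Omega.$$ Then $$\int_\Omega e^u\,dx\le C\qquad\text{and}\qquad \int_\Omega e^v\,dx\le C'.$$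
   Context: $\Delta=\partial_{11}+\partial_{22}$ is the Laplacian on $\mathbb{R}^2$, with $\Omega$ the open annulus of radii $1$ and $1/2$ centered at the origin. The functions $u,v$ are real-valued. The equations are understood in the sense of distributions on $\Omega$ (the right-hand sides are in $L^1(\Omega)$), and the Dirichlet boundary condition is encoded by $u,v\in W_0^{1,1}(\Omega)$. *)

theory Defs
  imports "HOL-Analysis.Analysis"
begin

definition annulus :: "(real^2) set" where
  "annulus = {x. 1/2 < norm x \<and> norm x < 1}"


subsection \<open>Classical derivatives and test functions\<close>

definition partial_deriv ::
    "'a::euclidean_space \<Rightarrow> ('a \<Rightarrow> real) \<Rightarrow> 'a \<Rightarrow> real" where
  "partial_deriv e f x = frechet_derivative f (at x) e"

definition gradient :: "('a::euclidean_space \<Rightarrow> real) \<Rightarrow> 'a \<Rightarrow> 'a" where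
  "gradient f x = (\<Sum>e\<in>Basis. partial_deriv e f x *\<^sub>R e)"

definition laplacian :: "('a::euclidean_space \<Rightarrow> real) \<Rightarrow> 'a \<Rightarrow> real" where
  "laplacian f x = (\<Sum>e\<in>Basis. partial_deriv e (partial_deriv e f) x)"

primrec is_Ck :: "nat \<Rightarrow> ('a::euclidean_space \<Rightarrow> real) \<Rightarrow> bool" where
  "is_Ck 0 f \<longleftrightarrow> continuous_on UNIV f"
| "is_Ck (Suc k) f \<longleftrightarrow>
     f differentiable_on UNIV \<and> (\<forall>e\<in>Basis. is_Ck k (partial_deriv e f))"

text \<open>The space of test functions on an open set \<open>\<Omega>\<close>; its elements are represented by
  their extensions by zero to the whole space.\<close>

definition test_functions :: "'a::euclidean_space set \<Rightarrow> ('a \<Rightarrow> real) set" where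
  "test_functions \<Omega> =
     {\<phi>. (\<forall>k. is_Ck k \<phi>) \<and> compact (closure (support_on UNIV \<phi>)) \<and>
          closure (support_on UNIV \<phi>) \<subseteq> \<Omega>}"


subsection \<open>Distributional derivatives and Sobolev spaces\<close>

text \<open>Elements of Lebesgue and Sobolev spaces over \<open>\<Omega>\<close> are represented by total functions, of
  which only the values on \<open>\<Omega>\<close> matter, up to null sets.\<close>

definition locally_integrable ::
    "'a::euclidean_space set \<Rightarrow> ('a \<Rightarrow> 'b::euclidean_space) \<Rightarrow> bool" where
  "locally_integrable \<Omega> f \<longleftrightarrow>
     (\<forall>K. compact K \<longrightarrow> K \<subseteq> \<Omega> \<longrightarrow> f absolutely_integrable_on K)"

definition has_weak_gradient ::
    "'a::euclidean_space set \<Rightarrow> ('a \<Rightarrow> real) \<Rightarrow> ('a \<Rightarrow> 'a) \<Rightarrow> bool" where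
  "has_weak_gradient \<Omega> f G \<longleftrightarrow>
     locally_integrable \<Omega> f \<and> locally_integrable \<Omega> G \<and>
     (\<forall>\<phi>\<in>test_functions \<Omega>. \<forall>e\<in>Basis.
        (LINT x:\<Omega>|lebesgue. f x * partial_deriv e \<phi> x) =
        - (LINT x:\<Omega>|lebesgue. (G x \<bullet> e) * \<phi> x))"

definition sobolev_W11 :: "'a::euclidean_space set \<Rightarrow> ('a \<Rightarrow> real) set" where
  "sobolev_W11 \<Omega> =
     {f. f absolutely_integrable_on \<Omega> \<and>
         (\<exists>G. has_weak_gradient \<Omega> f G \<and> G absolutely_integrable_on \<Omega>)}"

text \<open>The closure of the test functions in the \<open>W\<^sup>1\<^sup>,\<^sup>1\<close> norm.\<close>

definition sobolev_W11_0 :: "'a::euclidean_space set \<Rightarrow> ('a \<Rightarrow> real) set" where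
  "sobolev_W11_0 \<Omega> =
     {f \<in> sobolev_W11 \<Omega>.
        \<exists>G \<phi>. has_weak_gradient \<Omega> f G \<and> G absolutely_integrable_on \<Omega> \<and>
          (\<forall>n::nat. \<phi> n \<in> test_functions \<Omega>) \<and>
          (\<lambda>n. LINT x:\<Omega>|lebesgue. \<bar>f x - \<phi> n x\<bar>) \<longlonglongrightarrow> 0 \<and>
          (\<lambda>n. LINT x:\<Omega>|lebesgue. norm (G x - gradient (\<phi> n) x)) \<longlonglongrightarrow> 0}"

text \<open>The bound \<open>\<parallel>\<nabla>f\<parallel> \<le> M\<close> in \<open>L\<^sup>\<infinity>(\<Omega>)\<close>, for the distributional gradient of \<open>f\<close> (which is
  unique up to null sets and, for Lipschitz \<open>f\<close>, agrees a.e. with the classical gradient).\<close>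

definition gradient_Linf_le ::
    "'a::euclidean_space set \<Rightarrow> ('a \<Rightarrow> real) \<Rightarrow> real \<Rightarrow> bool" where
  "gradient_Linf_le \<Omega> f M \<longleftrightarrow>
     (\<exists>G. has_weak_gradient \<Omega> f G \<and> (AE x in lebesgue_on \<Omega>. norm (G x) \<le> M))"

text \<open>The equation \<open>-\<Delta>u = F\<close> in \<open>\<Omega>\<close>, in the sense of distributions.\<close>

definition neg_laplacian_distr ::
    "'a::euclidean_space set \<Rightarrow> ('a \<Rightarrow> real) \<Rightarrow> ('a \<Rightarrow> real) \<Rightarrow> bool" where
  "neg_laplacian_distr \<Omega> u F \<longleftrightarrow>
     locally_integrable \<Omega> u \<and> locally_integrable \<Omega> F \<and>
     (\<forall>\<phi>\<in>test_functions \<Omega>.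
        - (LINT x:\<Omega>|lebesgue. u x * laplacian \<phi> x) = (LINT x:\<Omega>|lebesgue. F x * \<phi> x))"

end

theory Submission
  imports Defs
begin

text \<open>Testing the equations against \<open>\<tau> + 4\<tau>\<^sup>2\<close>, where \<open>\<tau>\<close> vanishes on the boundary of the annulus, and
  using \<open>t \<le> e\<^sup>t / K + ln K\<close> bounds \<open>e\<^sup>u\<close> and \<open>e\<^sup>v\<close> in \<open>L\<^sup>1\<close> away from the boundary. Near the boundary the
  mass is controlled by moving spheres: for suitable circles, centred at the origin for the inner
  boundary and outside the disc for the outer one, \<open>u\<close> and \<open>v\<close> are at most their reflections
  by inversion, because the gradient bounds make \<open>\<bar>x - Q\<bar>\<^sup>2\<close> times the coefficients increase under
  reflection. Hence \<open>u(x) \<le> u(6x/5)\<close> near the inner and \<open>u(x) \<le> u(9x/10)\<close> near the outer boundary,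
  and the interior bound applies. The spheres are moved with the maximum principle for sets of
  small measure, which works directly for continuous very weak solutions. Continuity up to the
  boundary follows from odd reflection across both circles together with the Brezis--Merle
  inequality.\<close>

subsection \<open>Smooth functions on open sets\<close>

text \<open>The circles must reconcile two demands. In the plane the Kelvin transform carries no
  factor, so reflection only multiplies the right-hand side by the Jacobian, and this exceeds 1 only
  on caps lying inside the circle; hence the outer boundary is reached from centres outside the
  disc. If \<open>r\<close> is the distance of a point to the centre and \<open>d\<close> its
  distance to the image, the Jacobian is \<open>(1 + d / r)^2\<close>. It has to beat the possible
  loss \<open>(1 + d / 4) * (1 + 2 * d)\<close> of the coefficients, and \<open>r \<le> 3/4\<close>
  suffices for that. The weight is not Lipschitz at \<open>x0\<close>, but reflection in circles
  about the origin only moves points away from \<open>x0\<close>, and near the outer boundary all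
  points concerned keep a distance of at least \<open>1/4\<close> from it. The annulus is not
  convex, so the gradient bounds are used only along segments inside it. The interior bound closes
  because each tested equation estimates one exponential mass by a small multiple of the other plus
  a constant. Bounds that depend on the solutions, such as their maxima, enter only the choice of
  how far a sphere may move at a time, never the final constant.\<close>

named_theorems smooth_intros

text \<open>Logarithmic kernels and inversions are smooth only off one point, so
  \<open>is_Ck\<close> is localised to a set. Derivatives are taken in the full space, which makes
  the notion natural for open sets and monotone in the set.\<close>

primrec ck_on :: "nat \<Rightarrow> 'a::euclidean_space set \<Rightarrow> ('a \<Rightarrow> real) \<Rightarrow> bool" where
  "ck_on 0 S f \<longleftrightarrow> continuous_on S f"
| "ck_on (Suc k) S f \<longleftrightarrow>
     (\<forall>x\<in>S. f differentiable (at x)) \<and> (\<forall>e\<in>Basis. ck_on k S (partial_deriv e f))"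

definition smooth_on :: "'a::euclidean_space set \<Rightarrow> ('a \<Rightarrow> real) \<Rightarrow> bool" where
  "smooth_on S f \<longleftrightarrow> (\<forall>k. ck_on k S f)"

lemma is_Ck_iff_ck_on: "is_Ck k f \<longleftrightarrow> ck_on k UNIV f"
  by (induction k arbitrary: f) (auto simp: differentiable_on_def)

lemma partial_deriv_cong:
  assumes "open S" "x \<in> S" "\<And>y. y \<in> S \<Longrightarrow> f y = g y"
  shows "partial_deriv e f x = partial_deriv e g x"
proof -
  have "(f has_derivative f') (at x) \<longleftrightarrow> (g has_derivative f') (at x)" for f'
    using assms has_derivative_transform_within_open[of f f' x UNIV S g]
      has_derivative_transform_within_open[of g f' x UNIV S f] by auto
  then show ?thesis unfolding partial_deriv_def frechet_derivative_def by simp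
qed

lemma partial_deriv_eqI:
  "(f has_derivative f') (at x) \<Longrightarrow> partial_deriv e f x = f' e"
  unfolding partial_deriv_def using frechet_derivative_at by metis

text \<open>Differentiation is local on an open set. The inductions below use this to replace
  \<open>partial_deriv e f\<close> by the formula that a product or chain rule gives on the set
  only.\<close>

lemma ck_on_cong:
  assumes "open S" "\<And>y. y \<in> S \<Longrightarrow> f y = g y"
  shows "ck_on k S f \<longleftrightarrow> ck_on k S g"
  using assms(2)
proof (induction k arbitrary: f g)
  case 0
  then show ?case by (auto cong: continuous_on_cong)
next
  case (Suc k)
  have "f differentiable (at x) \<longleftrightarrow> g differentiable (at x)" if "x \<in> S" for x
    unfolding differentiable_def
    using assms(1) that Suc.prems has_derivative_transform_within_open[of f _ x UNIV S g]
      has_derivative_transform_within_open[of g _ x UNIV S f] by metis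
  moreover have "ck_on k S (partial_deriv e f) \<longleftrightarrow> ck_on k S (partial_deriv e g)" for e
    by (rule Suc.IH) (use assms(1) Suc.prems partial_deriv_cong in blast)
  ultimately show ?case by auto
qed

lemma ck_on_Suc_imp: "ck_on (Suc k) S f \<Longrightarrow> ck_on k S f"
proof (induction k arbitrary: f)
  case 0
  then show ?case
    by (auto intro!: continuous_at_imp_continuous_on differentiable_imp_continuous_within)
next
  case (Suc k)
  then show ?case by auto
qed

lemma ck_on_subset: "ck_on k S f \<Longrightarrow> T \<subseteq> S \<Longrightarrow> ck_on k T f"
  by (induction k arbitrary: f) (auto intro: continuous_on_subset)

lemma ck_on_Un: "open S \<Longrightarrow> open T \<Longrightarrow> ck_on k S f \<Longrightarrow> ck_on k T f \<Longrightarrow> ck_on k (S \<union> T) f"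
  by (induction k arbitrary: f) (auto intro: continuous_on_open_Un)

lemma ck_on_const: "ck_on k S (\<lambda>x. c)"
proof (induction k arbitrary: c)
  case (Suc k)
  have "partial_deriv e (\<lambda>x. c) = (\<lambda>x. 0)" for e :: 'a
    by (auto simp: partial_deriv_def)
  with Suc show ?case by auto
qed auto

lemma has_derivative_partial_deriv:
  fixes f :: "'a::euclidean_space \<Rightarrow> real"
  assumes "f differentiable (at x)"
  shows "(f has_derivative (\<lambda>h. \<Sum>e\<in>Basis. (h \<bullet> e) * partial_deriv e f x)) (at x)"
proof -
  let ?D = "frechet_derivative f (at x)"
  have D: "(f has_derivative ?D) (at x)" using assms frechet_derivative_works by blast
  then have l: "linear ?D" by (simp add: has_derivative_linear)
  have "?D h = (\<Sum>e\<in>Basis. (h \<bullet> e) * partial_deriv e f x)" for h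
  proof -
    have "?D h = ?D (\<Sum>e\<in>Basis. (h \<bullet> e) *\<^sub>R e)" by (simp add: euclidean_representation)
    also have "\<dots> = (\<Sum>e\<in>Basis. (h \<bullet> e) * partial_deriv e f x)"
      using l by (simp add: linear_sum linear_scale partial_deriv_def)
    finally show ?thesis .
  qed
  then show ?thesis using D by (metis (no_types, lifting) ext)
qed

lemma ck_on_inner: "ck_on k S (\<lambda>x. x \<bullet> b)"
proof (cases k)
  case (Suc n)
  have "partial_deriv e (\<lambda>x::'a. x \<bullet> b) = (\<lambda>x. e \<bullet> b)" for e
    by (rule ext, rule partial_deriv_eqI) (auto intro!: derivative_eq_intros)
  then show ?thesis using Suc by (auto simp: ck_on_const)
qed (auto intro!: continuous_intros)

lemma partial_deriv_add:
  "f differentiable (at x) \<Longrightarrow> g differentiable (at x) \<Longrightarrow>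
   partial_deriv e (\<lambda>x. f x + g x) x = partial_deriv e f x + partial_deriv e g x"
  by (rule partial_deriv_eqI[THEN trans, OF has_derivative_add])
     (auto simp: partial_deriv_def frechet_derivative_works)

lemma partial_deriv_mult:
  fixes f g :: "'a::euclidean_space \<Rightarrow> real"
  assumes "f differentiable (at x)" "g differentiable (at x)"
  shows "partial_deriv e (\<lambda>x. f x * g x) x = f x * partial_deriv e g x + partial_deriv e f x * g x"
  unfolding partial_deriv_def
  by (rule arg_cong[where f="\<lambda>h. h e", OF frechet_derivative_at[symmetric], simplified])
     (use assms frechet_derivative_works has_derivative_mult in blast)

lemma partial_deriv_sum:
  "finite I \<Longrightarrow> (\<And>i. i \<in> I \<Longrightarrow> f i differentiable (at x)) \<Longrightarrow>
   partial_deriv e (\<lambda>x. \<Sum>i\<in>I. f i x) x = (\<Sum>i\<in>I. partial_deriv e (f i) x)"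
proof (induction I rule: finite_induct)
  case empty
  then show ?case by (simp add: partial_deriv_def)
next
  case (insert i I)
  have "(\<lambda>x. \<Sum>i\<in>I. f i x) differentiable (at x)"
    using insert by (intro differentiable_sum) auto
  then show ?case using insert by (simp add: partial_deriv_add)
qed

lemma ck_on_add:
  "open S \<Longrightarrow> ck_on k S f \<Longrightarrow> ck_on k S g \<Longrightarrow> ck_on k S (\<lambda>x. f x + g x)"
proof (induction k arbitrary: f g)
  case (Suc k)
  have "ck_on k S (partial_deriv e (\<lambda>x. f x + g x)) =
     ck_on k S (\<lambda>x. partial_deriv e f x + partial_deriv e g x)" for e
    using Suc.prems by (intro ck_on_cong) (auto simp: partial_deriv_add)
  then show ?case using Suc by auto
qed (auto intro: continuous_intros)

lemma ck_on_mult: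
  "open S \<Longrightarrow> ck_on k S f \<Longrightarrow> ck_on k S g \<Longrightarrow> ck_on k S (\<lambda>x. f x * g x)"
proof (induction k arbitrary: f g)
  case (Suc k)
  have "ck_on k S (partial_deriv e (\<lambda>x. f x * g x)) =
     ck_on k S (\<lambda>x. f x * partial_deriv e g x + partial_deriv e f x * g x)" for e
    using Suc.prems by (intro ck_on_cong) (auto simp: partial_deriv_mult)
  moreover have "ck_on k S f" "ck_on k S g" using Suc.prems ck_on_Suc_imp by blast+
  ultimately show ?case using Suc by (auto intro!: ck_on_add)
qed (auto intro: continuous_intros)

lemma ck_on_sum:
  "open S \<Longrightarrow> (\<And>i. i \<in> I \<Longrightarrow> ck_on k S (f i)) \<Longrightarrow> ck_on k S (\<lambda>x. \<Sum>i\<in>I. f i x)"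
  by (induction I rule: infinite_finite_induct) (auto simp: ck_on_const ck_on_add)

lemma differentiable_componentwise:
  fixes m :: "'a::euclidean_space \<Rightarrow> 'b::euclidean_space"
  shows "(\<And>j. j \<in> Basis \<Longrightarrow> (\<lambda>x. m x \<bullet> j) differentiable (at x)) \<Longrightarrow> m differentiable (at x)"
  using differentiable_componentwise_within[of m x UNIV] by auto

lemma partial_deriv_compose:
  fixes m :: "'a::euclidean_space \<Rightarrow> 'b::euclidean_space"
  assumes f: "f differentiable (at (m x))" and m: "\<And>j. j \<in> Basis \<Longrightarrow> (\<lambda>x. m x \<bullet> j) differentiable (at x)"
  shows "partial_deriv e (\<lambda>x. f (m x)) x =
    (\<Sum>j\<in>Basis. partial_deriv e (\<lambda>x. m x \<bullet> j) x * partial_deriv j f (m x))"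
proof -
  obtain m' where m': "(m has_derivative m') (at x)"
    using differentiable_componentwise[OF m] unfolding differentiable_def by blast
  have j: "partial_deriv e (\<lambda>x. m x \<bullet> j) x = m' e \<bullet> j" for j
    by (rule partial_deriv_eqI) (use m' in \<open>auto intro!: derivative_eq_intros\<close>)
  have "((\<lambda>x. f (m x)) has_derivative (\<lambda>h. \<Sum>j\<in>Basis. (m' h \<bullet> j) * partial_deriv j f (m x))) (at x)"
    using has_derivative_compose[OF m' has_derivative_partial_deriv[OF f]] .
  from partial_deriv_eqI[OF this] show ?thesis by (simp add: j)
qed

text \<open>Each partial derivative of the composition is a sum of products of derivatives of the
  components of \<open>m\<close> with compositions of the same kind, one order lower. The components
  are assumed to be of every order so that the induction on \<open>k\<close> has to vary
  \<open>f\<close> alone.\<close>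

lemma ck_on_compose:
  fixes m :: "'a::euclidean_space \<Rightarrow> 'b::euclidean_space"
  assumes "open S" "m ` S \<subseteq> T" "\<And>j k. j \<in> Basis \<Longrightarrow> ck_on k S (\<lambda>x. m x \<bullet> j)"
  shows "ck_on k T f \<Longrightarrow> ck_on k S (\<lambda>x. f (m x))"
proof (induction k arbitrary: f)
  case 0
  have "continuous_on S m"
    using assms(3)[where k=0] by (auto intro: continuous_on_componentwise[THEN iffD2])
  then show ?case using 0 assms(2) by (auto intro: continuous_on_compose2)
next
  case (Suc k)
  have d: "(\<lambda>x. m x \<bullet> j) differentiable (at x)" if "x \<in> S" "j \<in> Basis" for x j
    using assms(3)[OF that(2), where k="Suc 0"] that by auto
  have f: "f differentiable (at (m x))" if "x \<in> S" for x
    using Suc.prems assms(2) that by auto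
  have 1: "(\<lambda>x. f (m x)) differentiable (at x)" if "x \<in> S" for x
    using differentiable_chain_at[OF differentiable_componentwise[OF d] f] that by (auto simp: o_def)
  have "ck_on k S (partial_deriv e (\<lambda>x. f (m x))) =
     ck_on k S (\<lambda>x. \<Sum>j\<in>Basis. partial_deriv e (\<lambda>x. m x \<bullet> j) x * partial_deriv j f (m x))" for e
    using assms(1) d f by (intro ck_on_cong) (auto simp: partial_deriv_compose)
  moreover have "ck_on k S (\<lambda>x. \<Sum>j\<in>Basis. partial_deriv e (\<lambda>x. m x \<bullet> j) x * partial_deriv j f (m x))"
    if "e \<in> Basis" for e
    using assms(1) assms(3)[where k="Suc k"] Suc that by (auto intro!: ck_on_sum ck_on_mult)
  ultimately show ?case using 1 by simp
qed

lemma smooth_on_cong: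
  "open S \<Longrightarrow> (\<And>y. y \<in> S \<Longrightarrow> f y = g y) \<Longrightarrow> smooth_on S f \<longleftrightarrow> smooth_on S g"
  unfolding smooth_on_def using ck_on_cong by blast

lemma smooth_on_subset: "smooth_on S f \<Longrightarrow> T \<subseteq> S \<Longrightarrow> smooth_on T f"
  unfolding smooth_on_def using ck_on_subset by blast

lemma smooth_on_Un: "open S \<Longrightarrow> open T \<Longrightarrow> smooth_on S f \<Longrightarrow> smooth_on T f \<Longrightarrow> smooth_on (S \<union> T) f"
  unfolding smooth_on_def using ck_on_Un by blast

lemma smooth_on_const [intro, smooth_intros]: "smooth_on S (\<lambda>x. c)"
  and smooth_on_inner [intro, smooth_intros]: "smooth_on S (\<lambda>x. x \<bullet> b)"
  by (auto simp: smooth_on_def ck_on_const ck_on_inner)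

lemma smooth_on_ident [intro, smooth_intros]: "smooth_on S (\<lambda>x::real. x)"
  using smooth_on_inner[of S 1] by simp

lemma smooth_on_add [intro, smooth_intros]:
  "open S \<Longrightarrow> smooth_on S f \<Longrightarrow> smooth_on S g \<Longrightarrow> smooth_on S (\<lambda>x. f x + g x)"
  and smooth_on_mult [intro, smooth_intros]:
  "open S \<Longrightarrow> smooth_on S f \<Longrightarrow> smooth_on S g \<Longrightarrow> smooth_on S (\<lambda>x. f x * g x)"
  by (auto simp: smooth_on_def ck_on_add ck_on_mult)

lemma smooth_on_uminus [intro, smooth_intros]: "open S \<Longrightarrow> smooth_on S f \<Longrightarrow> smooth_on S (\<lambda>x. - f x)"
  using smooth_on_mult[of S "\<lambda>x. -1" f] by auto

lemma smooth_on_diff [intro, smooth_intros]: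
  "open S \<Longrightarrow> smooth_on S f \<Longrightarrow> smooth_on S g \<Longrightarrow> smooth_on S (\<lambda>x. f x - g x)"
  using smooth_on_add[of S f "\<lambda>x. - g x"] by auto

lemma smooth_on_sum [intro, smooth_intros]:
  "open S \<Longrightarrow> (\<And>i. i \<in> I \<Longrightarrow> smooth_on S (f i)) \<Longrightarrow> smooth_on S (\<lambda>x. \<Sum>i\<in>I. f i x)"
  by (auto simp: smooth_on_def ck_on_sum)

lemma smooth_on_power [intro, smooth_intros]: "open S \<Longrightarrow> smooth_on S f \<Longrightarrow> smooth_on S (\<lambda>x. f x ^ n)"
  by (induction n) auto

declare open_UNIV [smooth_intros]

lemma smooth_on_compose_map:
  fixes m :: "'a::euclidean_space \<Rightarrow> 'b::euclidean_space"
  assumes "smooth_on T f" "open S" "m ` S \<subseteq> T" "\<And>j. j \<in> Basis \<Longrightarrow> smooth_on S (\<lambda>x. m x \<bullet> j)"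
  shows "smooth_on S (\<lambda>x. f (m x))"
  unfolding smooth_on_def
proof
  fix k
  show "ck_on k S (\<lambda>x. f (m x))"
    by (rule ck_on_compose[OF assms(2,3)]) (use assms(1,4) in \<open>auto simp: smooth_on_def\<close>)
qed

lemma smooth_on_compose:
  fixes m :: "'a::euclidean_space \<Rightarrow> real"
  assumes "smooth_on T f" "open S" "m ` S \<subseteq> T" "smooth_on S m"
  shows "smooth_on S (\<lambda>x. f (m x))"
  using assms smooth_on_compose_map by fastforce

lemma smooth_on_partial_deriv [intro, smooth_intros]:
  "e \<in> Basis \<Longrightarrow> smooth_on S f \<Longrightarrow> smooth_on S (partial_deriv e f)"
  unfolding smooth_on_def by (metis ck_on.simps(2))

lemma smooth_on_differentiable: "smooth_on S f \<Longrightarrow> x \<in> S \<Longrightarrow> f differentiable (at x)"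
  unfolding smooth_on_def using ck_on.simps(2) by blast

lemma smooth_on_continuous: "smooth_on S f \<Longrightarrow> continuous_on S f"
  unfolding smooth_on_def using ck_on.simps(1) by blast

lemma smooth_on_laplacian [intro, smooth_intros]:
  assumes "open S" "smooth_on S f" shows "smooth_on S (laplacian f)"
proof -
  have "laplacian f = (\<lambda>x. \<Sum>e\<in>Basis. partial_deriv e (partial_deriv e f) x)"
    by (auto simp: laplacian_def)
  then show ?thesis
    using smooth_on_sum[OF assms(1), of Basis "\<lambda>e. partial_deriv e (partial_deriv e f)"]
      smooth_on_partial_deriv assms(2) by metis
qed

lemma smooth_on_real_iff_Suc:
  fixes f f' :: "real \<Rightarrow> real"
  assumes "open S" "\<And>x. x \<in> S \<Longrightarrow> (f has_real_derivative f' x) (at x)"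
  shows "ck_on (Suc k) S f \<longleftrightarrow> ck_on k S f'"
proof -
  have "ck_on k S (partial_deriv 1 f) = ck_on k S f'"
    using assms by (intro ck_on_cong) (auto intro!: partial_deriv_eqI[where f'="\<lambda>h. f' _ * h", THEN trans] simp: has_field_derivative_def)
  then show ?thesis using assms by (auto simp: has_field_derivative_def differentiable_def)
qed

lemma smooth_on_antiderivative:
  fixes f f' :: "real \<Rightarrow> real"
  assumes "open S" "\<And>x. x \<in> S \<Longrightarrow> (f has_real_derivative f' x) (at x)" "smooth_on S f'"
  shows "smooth_on S f"
  using assms smooth_on_real_iff_Suc unfolding smooth_on_def
  by (metis ck_on_Suc_imp)

lemma smooth_on_inverse: "smooth_on (-{0::real}) inverse"
proof -
  have "ck_on k (-{0::real}) inverse" for k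
  proof (induction k)
    case 0
    then show ?case by (auto intro!: continuous_intros)
  next
    case (Suc k)
    have "ck_on k (-{0::real}) (\<lambda>x. (-1) * (inverse x * inverse x))"
      by (intro ck_on_mult ck_on_const Suc) auto
    then show ?case
      by (subst smooth_on_real_iff_Suc) (auto intro!: derivative_eq_intros simp: power2_eq_square divide_simps)
  qed
  then show ?thesis by (simp add: smooth_on_def)
qed

lemma smooth_on_ln: "smooth_on {0<..} (ln :: real \<Rightarrow> real)"
  by (rule smooth_on_antiderivative[of _ _ inverse])
     (auto intro!: derivative_eq_intros smooth_on_subset[OF smooth_on_inverse] simp: divide_simps)

lemma smooth_on_divide [intro, smooth_intros]:
  fixes f g :: "'a::euclidean_space \<Rightarrow> real"
  assumes "open S" "smooth_on S f" "smooth_on S g" "\<And>x. x \<in> S \<Longrightarrow> g x \<noteq> 0"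
  shows "smooth_on S (\<lambda>x. f x / g x)"
  unfolding divide_inverse using assms
  by (intro smooth_on_mult smooth_on_compose[OF smooth_on_inverse]) auto

section \<open>A smooth bump on the line, its two antiderivatives and a smooth step\<close>

definition flat :: "nat \<Rightarrow> real \<Rightarrow> real" where
  "flat n x = (if 0 < x then exp (- 1 / x) / x ^ n else 0)"

lemma continuous_on_has_real_derivative:
  "(\<And>x. (f has_real_derivative f' x) (at x)) \<Longrightarrow> continuous_on S f"
  using DERIV_continuous_on has_field_derivative_at_within by blast

lemma flat_tendsto_0: "(flat n \<longlongrightarrow> 0) (at 0)"
proof -
  have "((\<lambda>y::real. y ^ n / exp y) \<longlongrightarrow> 0) at_top"
    by (rule tendsto_power_div_exp_0)
  then have "((\<lambda>x::real. inverse x ^ n / exp (inverse x)) \<longlongrightarrow> 0) (at_right 0)"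
    by (rule filterlim_compose[OF _ filterlim_inverse_at_top_right])
  moreover have "inverse x ^ n / exp (inverse x) = flat n x" if "x > 0" for x
    using that by (simp add: flat_def exp_minus divide_simps)
  ultimately have "(flat n \<longlongrightarrow> 0) (at_right 0)"
    by (subst filterlim_cong[OF refl refl, of _ "\<lambda>x. inverse x ^ n / exp (inverse x)"])
       (auto simp: eventually_at_filter)
  moreover have "(flat n \<longlongrightarrow> 0) (at_left 0)"
    by (rule tendsto_eventually) (auto simp: eventually_at_filter flat_def)
  ultimately show ?thesis by (simp add: filterlim_split_at)
qed

text \<open>The family is closed under differentiation up to linear combinations, so one induction
  over all \<open>n\<close> simultaneously gives its smoothness.\<close>

lemma flat_deriv: "(flat n has_real_derivative (flat (n + 2) x - real n * flat (n + 1) x)) (at x)"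
proof (cases x "0::real" rule: linorder_cases)
  case less
  have "((\<lambda>x. 0) has_real_derivative 0) (at x)" by simp
  then have "(flat n has_real_derivative 0) (at x)"
    by (rule has_field_derivative_transform_within_open[where S="{..<0}"]) (use less in \<open>auto simp: flat_def\<close>)
  then show ?thesis using less by (simp add: flat_def)
next
  case equal
  \<comment> \<open>The difference quotient at the origin is itself the next member of the family,
    which tends to 0; at \<open>h = 0\<close> both sides are 0 because division by zero gives
    0.\<close>
  have "(\<lambda>h. (flat n (0 + h) - flat n 0) / h) = flat (n + 1)"
    by (auto simp: flat_def fun_eq_iff)
  then have "(flat n has_real_derivative 0) (at 0)"
    unfolding DERIV_def using flat_tendsto_0 by metis
  then show ?thesis using equal by (simp add: flat_def)
next
  case greater
  have "((\<lambda>x. exp (- 1 / x) / x ^ n) has_real_derivative (flat (n + 2) x - real n * flat (n + 1) x)) (at x)"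
  proof (cases n)
    case (Suc m)
    have "((\<lambda>x. x ^ Suc m) has_real_derivative (1 + real m) * x ^ m) (at x)"
      using DERIV_power_Suc[OF DERIV_ident, of m x UNIV] by simp
    then show ?thesis using greater unfolding Suc
      by (auto intro!: derivative_eq_intros simp del: power_Suc) (auto simp: flat_def field_simps power2_eq_square)
  qed (use greater in \<open>auto intro!: derivative_eq_intros simp: flat_def field_simps power2_eq_square\<close>)
  then show ?thesis
    by (rule has_field_derivative_transform_within_open[where S="{0<..}"]) (use greater in \<open>auto simp: flat_def\<close>)
qed

lemma smooth_on_flat: "smooth_on UNIV (flat n)"
proof -
  have "ck_on k UNIV (flat n)" for k
  proof (induction k arbitrary: n)
    case 0
    then show ?case using continuous_on_has_real_derivative[OF flat_deriv] by simp
  next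
    case (Suc k)
    have "ck_on k UNIV (\<lambda>x. flat (n + 2) x + (- real n) * flat (n + 1) x)"
      by (intro ck_on_add ck_on_mult ck_on_const Suc) auto
    then show ?case using smooth_on_real_iff_Suc[OF open_UNIV flat_deriv] by simp
  qed
  then show ?thesis by (simp add: smooth_on_def)
qed

text \<open>Supported in the interval from -1 to 0, the place where the double antiderivative
  \<open>hinge\<close> bends from an affine function to zero.\<close>

definition bump :: "real \<Rightarrow> real" where
  "bump t = flat 0 (- t) * flat 0 (t + 1)"

lemma bump_nonneg: "bump t \<ge> 0" and bump_pos_iff: "bump t > 0 \<longleftrightarrow> -1 < t \<and> t < 0"
  by (auto simp: bump_def flat_def)

lemma bump_eq_0: "t \<le> -1 \<or> 0 \<le> t \<Longrightarrow> bump t = 0"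
  by (auto simp: bump_def flat_def)

lemma bump_le_1: "bump t \<le> 1"
  by (auto simp: bump_def flat_def intro!: mult_le_one)

lemma smooth_on_bump: "smooth_on UNIV bump"
proof -
  have "smooth_on UNIV (\<lambda>t. flat 0 (- t) * flat 0 (t + 1))"
    by (intro smooth_intros smooth_on_compose[OF smooth_on_flat]) (rule subset_UNIV)+
  then show ?thesis by (simp add: bump_def[abs_def])
qed

lemma exists_antiderivative_real:
  fixes f :: "real \<Rightarrow> real"
  assumes "continuous_on UNIV f"
  shows "\<exists>F. (\<forall>x. (F has_real_derivative f x) (at x)) \<and> F 0 = 0"
proof -
  define F where "F x = integral {0..x} f - integral {x..0} f" for x
  have "(F has_real_derivative f x) (at x)" for x
  proof -
    \<comment> \<open>The interval from \<open>-N\<close> to \<open>N\<close> has both 0 and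
      \<open>x\<close> in its interior, so near \<open>x\<close> the function \<open>F\<close>
      differs from the integral starting at \<open>-N\<close> by a constant.\<close>
    define N where "N = \<bar>x\<bar> + 1"
    have int: "f integrable_on {a..b}" for a b
      using assms by (auto intro!: integrable_continuous_interval intro: continuous_on_subset)
    have "((\<lambda>x. integral {-N..x} f) has_real_derivative f x) (at x within {-N..N})"
      using assms by (intro integral_has_real_derivative continuous_on_subset[OF assms]) (auto simp: N_def)
    moreover have "at x within {-N..N} = at x"
      by (rule at_within_interior) (auto simp: N_def)
    ultimately have "((\<lambda>x. integral {-N..x} f) has_real_derivative f x) (at x)" by simp
    then have D: "((\<lambda>x. integral {-N..x} f - integral {-N..0} f) has_real_derivative f x) (at x)"
      by (auto intro!: derivative_eq_intros)
    show ?thesis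
    proof (rule has_field_derivative_transform_within_open[OF D, of "{-N<..<N}"])
      fix y assume y: "y \<in> {-N<..<N}"
      show "integral {-N..y} f - integral {-N..0} f = F y"
      proof (cases "y \<ge> 0")
        case True
        have "integral {-N..0} f + integral {0..y} f = integral {-N..y} f"
          using y True int by (intro Henstock_Kurzweil_Integration.integral_combine) (auto simp: N_def)
        then show ?thesis using True by (cases "y = 0") (auto simp: F_def)
      next
        case False
        have "integral {-N..y} f + integral {y..0} f = integral {-N..0} f"
          using y False int by (intro Henstock_Kurzweil_Integration.integral_combine) (auto simp: N_def)
        then show ?thesis using False by (auto simp: F_def)
      qed
    qed (auto simp: N_def)
  qed
  moreover have "F 0 = 0" by (simp add: F_def)
  ultimately show ?thesis by blast
qed

lemma eq_if_deriv_0: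
  fixes f f' :: "real \<Rightarrow> real"
  assumes "\<And>x. (f has_real_derivative f' x) (at x)" "a \<le> b" "\<And>x. a < x \<Longrightarrow> x < b \<Longrightarrow> f' x = 0"
  shows "f b = f a"
proof (cases "a = b")
  case False
  have "DERIV f x :> 0" if "a < x" "x < b" for x using assms(1)[of x] assms(3)[OF that] by simp
  with False assms(2) show ?thesis
    by (intro DERIV_isconst_end continuous_on_has_real_derivative[OF assms(1)]) auto
qed simp

lemma less_if_deriv_pos:
  fixes f f' :: "real \<Rightarrow> real"
  assumes "\<And>x. (f has_real_derivative f' x) (at x)" "a < b" "\<And>x. a < x \<Longrightarrow> x < b \<Longrightarrow> f' x > 0"
  shows "f a < f b"
  by (rule DERIV_pos_imp_increasing_open[OF assms(2) _ continuous_on_has_real_derivative[OF assms(1)]])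
     (use assms in blast)

definition slope :: "real \<Rightarrow> real" where
  "slope = (SOME F. (\<forall>x. (F has_real_derivative bump x) (at x)) \<and> F 0 = 0)"

text \<open>Normalising both antiderivatives at 0 makes them vanish on the positive axis. Below -1
  the bump is over, so \<open>slope\<close> is the constant \<open>- hslope\<close> and
  \<open>hinge\<close> is affine there: evaluated at a logarithm it becomes a truncated
  logarithm.\<close>

definition hinge :: "real \<Rightarrow> real" where
  "hinge = (SOME F. (\<forall>x. (F has_real_derivative slope x) (at x)) \<and> F 0 = 0)"

definition hslope :: real where "hslope = - slope (-1)"

lemma slope_deriv: "(slope has_real_derivative bump x) (at x)" and slope_0: "slope 0 = 0"
  using someI_ex[OF exists_antiderivative_real[OF smooth_on_continuous[OF smooth_on_bump]]]
  unfolding slope_def[symmetric] by blast+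

lemma smooth_on_slope: "smooth_on UNIV slope"
  using smooth_on_antiderivative[OF _ slope_deriv smooth_on_bump] by auto

lemma hinge_deriv: "(hinge has_real_derivative slope x) (at x)" and hinge_0: "hinge 0 = 0"
  using someI_ex[OF exists_antiderivative_real[OF smooth_on_continuous[OF smooth_on_slope]]]
  unfolding hinge_def[symmetric] by blast+

lemma smooth_on_hinge: "smooth_on UNIV hinge"
  using smooth_on_antiderivative[OF _ hinge_deriv smooth_on_slope] by auto

lemma slope_mono: "s \<le> t \<Longrightarrow> slope s \<le> slope t"
  by (rule DERIV_nonneg_imp_nondecreasing) (use slope_deriv bump_nonneg in blast)+

lemma slope_pos: "t \<ge> 0 \<Longrightarrow> slope t = 0"
  using eq_if_deriv_0[OF slope_deriv, of 0 t] slope_0 bump_eq_0 by auto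

lemma slope_neg: "t \<le> -1 \<Longrightarrow> slope t = - hslope"
  using eq_if_deriv_0[OF slope_deriv, of t "-1"] bump_eq_0 by (auto simp: hslope_def)

lemma slope_bounds: "- hslope \<le> slope t" "slope t \<le> 0"
proof -
  show "slope t \<le> 0"
    using slope_mono[of t 0] slope_pos[of t] slope_0 by (cases "t \<ge> 0") auto
  show "- hslope \<le> slope t"
    using slope_mono[of "-1" t] slope_neg[of t] hslope_def by (cases "t \<ge> -1") auto
qed

lemma slope_neg_strict: "t < 0 \<Longrightarrow> slope t < 0"
proof -
  have "slope t < 0" if "-1 \<le> t" "t < 0" for t
    using less_if_deriv_pos[OF slope_deriv, of t 0] bump_pos_iff that slope_0 by auto
  from this[of "max t (-1)"] show "t < 0 \<Longrightarrow> slope t < 0"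
    using slope_mono[of t "max t (-1)"] by auto
qed

lemma hslope_pos: "hslope > 0"
  using slope_neg_strict[of "-1"] by (simp add: hslope_def)

lemma hinge_pos: "t \<ge> 0 \<Longrightarrow> hinge t = 0"
  using eq_if_deriv_0[OF hinge_deriv, of 0 t] hinge_0 slope_pos by auto

lemma hinge_antimono: "s \<le> t \<Longrightarrow> hinge t \<le> hinge s"
  by (rule DERIV_nonpos_imp_nonincreasing) (use hinge_deriv slope_bounds in blast)+

lemma hinge_nonneg: "hinge t \<ge> 0"
  using hinge_antimono[of t 0] hinge_pos[of t] hinge_0 by (cases "t \<ge> 0") auto

lemma hinge_gt_0: "t < 0 \<Longrightarrow> hinge t > 0"
  using less_if_deriv_pos[OF DERIV_minus[OF hinge_deriv], of t 0] slope_neg_strict hinge_0 by auto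

lemma hinge_Lipschitz: "s \<le> t \<Longrightarrow> hinge s \<le> hinge t + hslope * (t - s)"
proof -
  assume "s \<le> t"
  have "((\<lambda>t. hinge t + hslope * t) has_real_derivative slope x + hslope) (at x)" for x
    by (auto intro!: derivative_eq_intros hinge_deriv)
  moreover have "0 \<le> hslope + slope x" for x using slope_bounds(1)[of x] by simp
  ultimately have "hinge s + hslope * s \<le> hinge t + hslope * t"
    using \<open>s \<le> t\<close> slope_bounds(1)
    by (intro DERIV_nonneg_imp_nondecreasing[of s t "\<lambda>t. hinge t + hslope * t"])
       (auto intro!: exI[of _ "slope _ + hslope"] simp: minus_le_iff add.commute[of "slope _"])
  then show ?thesis by (simp add: algebra_simps)
qed

lemma hinge_affine: "s \<le> -1 \<Longrightarrow> t \<le> -1 \<Longrightarrow> hinge s - hinge t = hslope * (t - s)"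
proof -
  have *: "hinge s + hslope * s = hinge (-1) + hslope * (-1)" if "s \<le> -1" for s
  proof -
    have "((\<lambda>t. hinge t + hslope * t) has_real_derivative slope x + hslope) (at x)" for x
      by (auto intro!: derivative_eq_intros hinge_deriv)
    from eq_if_deriv_0[OF this, of s "-1"] show ?thesis using slope_neg that by auto
  qed
  show "s \<le> -1 \<Longrightarrow> t \<le> -1 \<Longrightarrow> hinge s - hinge t = hslope * (t - s)"
    using *[of s] *[of t] by (simp add: algebra_simps)
qed

text \<open>A rescaled \<open>slope\<close>: the argument \<open>2 * s - 2\<close> runs from -1 to 0
  as \<open>s\<close> goes from \<open>1/2\<close> to 1, and division by \<open>hslope\<close>
  normalises the total rise to 1.\<close>

definition step :: "real \<Rightarrow> real" where
  "step s = 1 + slope (2 * s - 2) / hslope"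

lemma smooth_on_step: "smooth_on UNIV step"
proof -
  have "smooth_on UNIV (\<lambda>s. 1 + slope (2 * s - 2) / hslope)"
    using hslope_pos by (intro smooth_intros smooth_on_compose[OF smooth_on_slope]) auto
  then show ?thesis by (simp add: step_def[abs_def])
qed

lemma step_eq_0: "s \<le> 1/2 \<Longrightarrow> step s = 0"
  and step_eq_1: "s \<ge> 1 \<Longrightarrow> step s = 1"
  and step_bounds: "0 \<le> step s" "step s \<le> 1"
  using slope_neg[of "2 * s - 2"] slope_pos[of "2 * s - 2"] slope_bounds[of "2 * s - 2"] hslope_pos
  by (auto simp: step_def field_simps)

lemma step_deriv: "(step has_real_derivative 2 * bump (2 * s - 2) / hslope) (at s)"
  unfolding step_def using hslope_pos by (auto intro!: derivative_eq_intros DERIV_chain2[OF slope_deriv])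

lemma smooth_on_inner_self: "smooth_on UNIV (\<lambda>x::'a::euclidean_space. x \<bullet> x)"
  by (subst euclidean_inner) (intro smooth_intros)

subsection \<open>Test functions\<close>

lemma test_functionsI:
  assumes "smooth_on UNIV \<phi>" "compact K" "K \<subseteq> D" "\<And>x. x \<notin> K \<Longrightarrow> \<phi> x = 0"
  shows "\<phi> \<in> test_functions D"
proof -
  have "support_on UNIV \<phi> \<subseteq> K" using assms(4) by (auto simp: support_on_def)
  then have "closure (support_on UNIV \<phi>) \<subseteq> K"
    using assms(2) by (simp add: closure_minimal compact_imp_closed)
  moreover from this have "compact (closure (support_on UNIV \<phi>))"
    using assms(2) by (meson compact_closure bounded_subset closure_subset compact_imp_bounded subset_trans)
  ultimately show ?thesis using assms unfolding test_functions_def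
    by (auto simp: is_Ck_iff_ck_on smooth_on_def)
qed

lemma test_functionsD:
  assumes "\<phi> \<in> test_functions D"
  shows "smooth_on UNIV \<phi>" "\<exists>K. compact K \<and> K \<subseteq> D \<and> (\<forall>x. x \<notin> K \<longrightarrow> \<phi> x = 0)"
proof -
  show "smooth_on UNIV \<phi>" using assms by (auto simp: test_functions_def is_Ck_iff_ck_on smooth_on_def)
  have "\<phi> x = 0" if "x \<notin> closure (support_on UNIV \<phi>)" for x
    using that closure_subset[of "support_on UNIV \<phi>"] by (auto simp: support_on_def)
  then show "\<exists>K. compact K \<and> K \<subseteq> D \<and> (\<forall>x. x \<notin> K \<longrightarrow> \<phi> x = 0)"
    using assms unfolding test_functions_def by blast
qed

lemma test_functions_mono: "D \<subseteq> E \<Longrightarrow> test_functions D \<subseteq> test_functions E"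
  by (auto simp: test_functions_def)

lemma partial_deriv_eq_0:
  assumes "compact K" "\<And>x. x \<notin> K \<Longrightarrow> \<phi> x = (0::real)" "x \<notin> K"
  shows "partial_deriv e \<phi> x = 0"
proof -
  have "partial_deriv e \<phi> x = partial_deriv e (\<lambda>x. 0) x"
    using assms by (intro partial_deriv_cong[of "-K"]) (auto simp: compact_imp_closed open_Compl)
  also have "\<dots> = 0" by (simp add: partial_deriv_def)
  finally show ?thesis .
qed

lemma test_functions_partial_deriv:
  assumes "\<phi> \<in> test_functions D" "e \<in> Basis"
  shows "partial_deriv e \<phi> \<in> test_functions D"
proof -
  obtain K where K: "compact K" "K \<subseteq> D" "\<And>x. x \<notin> K \<Longrightarrow> \<phi> x = 0"
    using test_functionsD[OF assms(1)] by auto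
  with test_functionsD[OF assms(1)] assms(2) show ?thesis
    by (intro test_functionsI[of _ K]) (auto intro: partial_deriv_eq_0)
qed

lemma test_functions_laplacian:
  assumes "\<phi> \<in> test_functions D"
  shows "laplacian \<phi> \<in> test_functions D"
proof -
  obtain K where K: "compact K" "K \<subseteq> D" "\<And>x. x \<notin> K \<Longrightarrow> \<phi> x = 0"
    using test_functionsD[OF assms(1)] by auto
  have "partial_deriv e (partial_deriv e \<phi>) x = 0" if "x \<notin> K" for x e
    by (rule partial_deriv_eq_0[OF K(1) _ that], rule partial_deriv_eq_0[OF K(1) _]) (auto simp: K)
  with K test_functionsD[OF assms(1)] show ?thesis
    by (intro test_functionsI[of _ K]) (auto simp: laplacian_def)
qed

text \<open>The open sets \<open>S\<close> and \<open>- K\<close> cover the space, and the extension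
  is \<open>f\<close> on the first and 0 on the second. This turns functions that are smooth only
  off a point into test functions.\<close>

lemma test_functions_extend:
  assumes "open S" "smooth_on S f" "compact K" "K \<subseteq> S" "K \<subseteq> D" "\<And>x. x \<in> S - K \<Longrightarrow> f x = 0"
  shows "(\<lambda>x. if x \<in> S then f x else 0) \<in> test_functions D"
proof (rule test_functionsI[of _ K])
  let ?g = "\<lambda>x. if x \<in> S then f x else 0"
  have "smooth_on S ?g" using assms by (subst smooth_on_cong[of _ _ f]) auto
  moreover have "smooth_on (-K) ?g"
    using assms by (subst smooth_on_cong[of _ _ "\<lambda>x. 0"]) (auto simp: compact_imp_closed open_Compl)
  ultimately have "smooth_on (S \<union> - K) ?g"
    using assms by (intro smooth_on_Un) (auto simp: compact_imp_closed open_Compl)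
  moreover have "S \<union> - K = UNIV" using assms by auto
  ultimately show "smooth_on UNIV ?g" by simp
qed (use assms in auto)

lemma test_functions_bounded:
  assumes "\<phi> \<in> test_functions D"
  shows "\<exists>C. \<forall>x. \<bar>\<phi> x\<bar> \<le> C"
proof -
  obtain K where K: "compact K" "\<And>x. x \<notin> K \<Longrightarrow> \<phi> x = 0"
    using test_functionsD[OF assms(1)] by auto
  have "continuous_on K \<phi>"
    using test_functionsD(1)[OF assms] smooth_on_continuous continuous_on_subset by blast
  then have "bounded (\<phi> ` K)" using K(1) compact_continuous_image compact_imp_bounded by blast
  then obtain C where "\<forall>x\<in>K. \<bar>\<phi> x\<bar> \<le> C" by (auto simp: bounded_iff)
  then have "\<bar>\<phi> x\<bar> \<le> max C 0" for x using K(2)[of x] by (cases "x \<in> K") force+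
  then show ?thesis by blast
qed

lemma borel_measurable_test:
  "\<phi> \<in> test_functions D \<Longrightarrow> \<phi> \<in> borel_measurable borel"
  using test_functionsD(1) smooth_on_continuous borel_measurable_continuous_onI by blast

text \<open>The mean value bound, with the sum of the bounds of the partial derivatives, each of
  which is again a test function.\<close>

lemma test_functions_Lipschitz:
  assumes "\<phi> \<in> test_functions D"
  shows "\<exists>C\<ge>0. \<forall>x y. \<bar>\<phi> x - \<phi> y\<bar> \<le> C * norm (x - y)"
proof -
  have "\<exists>C. \<forall>x. \<bar>partial_deriv e \<phi> x\<bar> \<le> C" if "e \<in> Basis" for e
    using test_functions_bounded[OF test_functions_partial_deriv[OF assms that]] .
  then obtain C where C: "\<And>e x. e \<in> Basis \<Longrightarrow> \<bar>partial_deriv e \<phi> x\<bar> \<le> C e" by metis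
  define B where "B = (\<Sum>e\<in>(Basis::'a set). C e)"
  have "B \<ge> 0" by (auto simp: B_def intro!: sum_nonneg order_trans[OF abs_ge_zero C])
  moreover have "\<bar>\<phi> x - \<phi> y\<bar> \<le> B * norm (x - y)" for x y
  proof -
    have "norm (\<phi> x - \<phi> y) \<le> B * norm (x - y)"
    proof (rule differentiable_bound)
      fix z :: 'a
      have "\<phi> differentiable (at z)" using test_functionsD(1)[OF assms] smooth_on_differentiable by blast
      then show "(\<phi> has_derivative (\<lambda>h. \<Sum>e\<in>Basis. (h \<bullet> e) * partial_deriv e \<phi> z)) (at z within UNIV)"
        using has_derivative_partial_deriv by auto
      have "norm (\<Sum>e\<in>Basis. (h \<bullet> e) * partial_deriv e \<phi> z) \<le> B * norm h" for h
      proof -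
        have "norm (\<Sum>e\<in>Basis. (h \<bullet> e) * partial_deriv e \<phi> z) \<le> (\<Sum>e\<in>Basis. norm h * C e)"
          by (rule order_trans[OF norm_sum], rule sum_mono)
             (use C Basis_le_norm in \<open>auto simp: abs_mult intro!: mult_mono\<close>)
        also have "\<dots> = B * norm h" by (simp add: B_def sum_distrib_left mult.commute)
        finally show ?thesis .
      qed
      then show "onorm (\<lambda>h. \<Sum>e\<in>Basis. (h \<bullet> e) * partial_deriv e \<phi> z) \<le> B"
        using \<open>B \<ge> 0\<close> by (intro onorm_bound)
    qed auto
    then show ?thesis by simp
  qed
  ultimately show ?thesis by blast
qed

lemma partial_deriv_shift:
  fixes f :: "'a::euclidean_space \<Rightarrow> real"
  shows "partial_deriv e (\<lambda>y. f (y + a)) x = partial_deriv e f (x + a)"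
proof -
  have 1: "((\<lambda>y. f (y + a)) has_derivative f') (at x)" if "(f has_derivative f') (at (x + a))"
    for f f' :: "'a \<Rightarrow> real" and a x
  proof -
    have "((\<lambda>y. y + a) has_derivative (\<lambda>h. h)) (at x)"
      by (auto intro!: derivative_eq_intros)
    from has_derivative_compose[OF this, of f f'] show ?thesis using that by simp
  qed
  have "((\<lambda>y. f (y + a)) has_derivative f') (at x) \<longleftrightarrow> (f has_derivative f') (at (x + a))" for f'
    using 1[of f f' x a] 1[of "\<lambda>y. f (y + a)" f' "x + a" "-a"] by auto
  then show ?thesis unfolding partial_deriv_def frechet_derivative_def by simp
qed

lemma laplacian_shift: "laplacian (\<lambda>y. f (y + a)) x = laplacian f (x + a)"
  unfolding laplacian_def by (simp add: partial_deriv_shift[abs_def])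

subsection \<open>Affine changes of variables\<close>

lemma nn_integral_lborel_affine:
  fixes t :: "'a::euclidean_space"
  assumes [measurable]: "f \<in> borel_measurable borel" and c: "c \<noteq> 0"
  shows "(\<integral>\<^sup>+x. f x \<partial>lborel) = ennreal (\<bar>c\<bar> ^ DIM('a)) * (\<integral>\<^sup>+x. f (t + c *\<^sub>R x) \<partial>lborel)"
  by (subst lborel_affine[OF c, of t])
     (simp add: nn_integral_density nn_integral_distr nn_integral_cmult)

lemma integrable_lborel_affine:
  fixes t :: "'a::euclidean_space" and f :: "'a \<Rightarrow> real"
  assumes f: "integrable lborel f" and c: "c \<noteq> 0"
  shows "integrable lborel (\<lambda>x. f (t + c *\<^sub>R x))"
  using f f[THEN borel_measurable_integrable] c unfolding integrable_iff_bounded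
  by (subst (asm) nn_integral_lborel_affine[where c=c and t=t]) (auto simp: ennreal_mult_less_top)

lemma integral_lborel_affine:
  fixes t :: "'a::euclidean_space" and f :: "'a \<Rightarrow> real"
  assumes f: "integrable lborel f" and c: "c \<noteq> 0"
  shows "(\<integral>x. f x \<partial>lborel) = \<bar>c\<bar> ^ DIM('a) * (\<integral>x. f (t + c *\<^sub>R x) \<partial>lborel)"
  using c f f[THEN borel_measurable_integrable] integrable_lborel_affine[OF f, of c t]
  by (subst lborel_affine[OF c, of t]) (simp add: integral_density integral_distr)

lemma integrable_lborel_reflect:
  fixes f :: "'a::euclidean_space \<Rightarrow> real"
  shows "integrable lborel (\<lambda>y. f (x - y)) \<longleftrightarrow> integrable lborel f"
  using integrable_lborel_affine[of f "-1" x] integrable_lborel_affine[of "\<lambda>y. f (x - y)" "-1" x]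
  by auto

lemma integral_lborel_reflect:
  fixes f :: "'a::euclidean_space \<Rightarrow> real"
  shows "(\<integral>y. f (x - y) \<partial>lborel) = (\<integral>y. f y \<partial>lborel)"
proof (cases "integrable lborel f")
  case True
  then show ?thesis using integral_lborel_affine[of f "-1" x] by simp
next
  case False
  then show ?thesis by (simp add: not_integrable_integral_eq integrable_lborel_reflect)
qed

lemma integrable_test:
  assumes "\<phi> \<in> test_functions D" shows "integrable lborel \<phi>"
proof -
  obtain K where K: "compact K" "\<And>x. x \<notin> K \<Longrightarrow> \<phi> x = 0"
    using test_functionsD[OF assms(1)] by auto
  have "integrable lborel (\<lambda>x. indicator K x *\<^sub>R \<phi> x)"
    using K(1) continuous_on_subset[OF smooth_on_continuous[OF test_functionsD(1)[OF assms]]]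
    by (intro borel_integrable_compact) auto
  moreover have "(\<lambda>x. indicator K x *\<^sub>R \<phi> x) = \<phi>" using K(2) by (auto simp: indicator_def fun_eq_iff)
  ultimately show ?thesis by simp
qed

lemma integrable_mult_bounded:
  fixes f g :: "'a::euclidean_space \<Rightarrow> real"
  assumes "integrable lborel f" "g \<in> borel_measurable borel" "\<And>x. \<bar>g x\<bar> \<le> C"
  shows "integrable lborel (\<lambda>x. f x * g x)"
proof (rule Bochner_Integration.integrable_bound[of _ "\<lambda>x. C * f x"])
  show "AE x in lborel. norm (f x * g x) \<le> norm (C * f x)"
  proof (rule AE_I2)
    fix x
    have "\<bar>f x\<bar> * \<bar>g x\<bar> \<le> \<bar>f x\<bar> * \<bar>C\<bar>" using assms(3)[of x] by (intro mult_left_mono) auto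
    then show "norm (f x * g x) \<le> norm (C * f x)" by (simp add: abs_mult mult.commute)
  qed
qed (use assms in auto)

lemma integrable_mult_test:
  assumes "integrable lborel f" "\<phi> \<in> test_functions D"
  shows "integrable lborel (\<lambda>x. f x * \<phi> x)"
  using test_functions_bounded[OF assms(2)] integrable_mult_bounded[OF assms(1) borel_measurable_test[OF assms(2)]]
  by blast

lemma emeasure_lborel_open_neq_0:
  assumes "open S" "x \<in> S" shows "emeasure lborel S \<noteq> 0"
proof
  assume "emeasure lborel S = 0"
  then have "S \<in> null_sets lborel" using assms by auto
  then have "negligible S" using negligible_iff_null_sets null_sets_completionI by blast
  then show False using open_not_negligible[OF assms(1)] assms(2) by blast
qed

subsection \<open>A regularised logarithmic kernel\<close>

text \<open>In the variable \<open>s = x \<bullet> x\<close> no square root appears: the gradient of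
  \<open>s\<close> is \<open>2 x\<close>, so the trace of the second derivative is
  \<open>4 * s * k''\<close> plus \<open>2 * k'\<close> for each of the two coordinates. It is
  applied to the kernel off the origin and to the barrier.\<close>

lemma laplacian_radial:
  fixes x :: "real^2" and k k' :: "real \<Rightarrow> real" and k'' :: real
  assumes S: "open S" "x \<in> S" and k: "\<And>y. y \<in> S \<Longrightarrow> (k has_real_derivative k' (y \<bullet> y)) (at (y \<bullet> y))"
    and k': "(k' has_real_derivative k'') (at (x \<bullet> x))"
  shows "laplacian (\<lambda>y. k (y \<bullet> y)) x = 4 * (k' (x \<bullet> x) + (x \<bullet> x) * k'')"
proof -
  have 1: "partial_deriv e (\<lambda>y. k (y \<bullet> y)) y = k' (y \<bullet> y) * (2 * (y \<bullet> e))" if "y \<in> S" for y e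
  proof -
    have "((\<lambda>y. y \<bullet> y) has_derivative (\<lambda>h. 2 * (y \<bullet> h))) (at y)"
      by (auto intro!: derivative_eq_intros simp: inner_commute)
    from partial_deriv_eqI[OF has_derivative_compose[OF this k[OF that, unfolded has_field_derivative_def]]]
    show ?thesis by simp
  qed
  have 2: "partial_deriv e (partial_deriv e (\<lambda>y. k (y \<bullet> y))) x = 4 * (x \<bullet> e)^2 * k'' + 2 * k' (x \<bullet> x)" if "e \<in> Basis" for e
  proof -
    have "partial_deriv e (partial_deriv e (\<lambda>y. k (y \<bullet> y))) x = partial_deriv e (\<lambda>y. k' (y \<bullet> y) * (2 * (y \<bullet> e))) x"
      by (rule partial_deriv_cong[OF S 1])
    also have "\<dots> = 4 * (x \<bullet> e)^2 * k'' + 2 * k' (x \<bullet> x)"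
    proof -
      have "((\<lambda>y. y \<bullet> y) has_derivative (\<lambda>h. 2 * (x \<bullet> h))) (at x)"
        by (auto intro!: derivative_eq_intros simp: inner_commute)
      from has_derivative_compose[OF this k'[unfolded has_field_derivative_def]]
      have "((\<lambda>y. k' (y \<bullet> y) * (2 * (y \<bullet> e))) has_derivative
          (\<lambda>h. k' (x \<bullet> x) * (2 * (h \<bullet> e)) + k'' * (2 * (x \<bullet> h)) * (2 * (x \<bullet> e)))) (at x)"
        by (auto intro!: derivative_eq_intros)
      from partial_deriv_eqI[OF this] show ?thesis using that by (simp add: power2_eq_square algebra_simps)
    qed
    finally show ?thesis .
  qed
  have "(\<Sum>e\<in>Basis. (x \<bullet> e)^2) = x \<bullet> x"
    by (subst (2) euclidean_inner) (simp add: power2_eq_square)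
  then have "(\<Sum>e\<in>Basis. 4 * (x \<bullet> e)^2 * k'') = 4 * (x \<bullet> x) * k''"
    unfolding sum_distrib_left[symmetric] sum_distrib_right[symmetric] by simp
  then show ?thesis unfolding laplacian_def by (simp add: 2 sum.distrib algebra_simps)
qed

text \<open>The integral of the unnormalised mollifier of radius 1. The measure
  \<open>dx / (x \<bullet> x)\<close> is invariant under dilations of the plane, so the same
  constant normalises every radius.\<close>

definition mass :: real where
  "mass = (\<integral>x. 4 * bump (ln (x \<bullet> x)) / (x \<bullet> x) \<partial>(lborel :: (real^2) measure))"

definition moll :: "real \<Rightarrow> real^2 \<Rightarrow> real" where
  "moll R x = 4 * bump (ln (x \<bullet> x / R\<^sup>2)) / (x \<bullet> x) / mass"

text \<open>Since \<open>hinge\<close> vanishes on the positive axis and is affine below \<open>-1\<close>, \<open>kern R\<close> is supported in the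
  disc of radius \<open>R\<close> and is there a fundamental solution of \<open>-\<Delta>\<close> up to the smooth error \<open>moll R\<close>.\<close>

definition kern :: "real \<Rightarrow> real^2 \<Rightarrow> real" where
  "kern R x = hinge (ln (x \<bullet> x / R\<^sup>2)) / mass"

text \<open>It makes the mollifier of radius \<open>R\<close> vanish on the ball of radius
  \<open>R/2\<close>: the squared ratio is at most \<open>1/4\<close> there, and the bump is 0 below
  -1.\<close>

lemma ln_quarter: "ln (1/4::real) \<le> -1"
proof -
  have "exp (1::real) \<le> 4" using exp_le by simp
  then have "1 \<le> ln (4::real)" by (subst ln_ge_iff) auto
  then show ?thesis by (simp add: ln_div)
qed

lemma ln_ratio_nonneg: "R > 0 \<Longrightarrow> norm (x::real^2) \<ge> R \<Longrightarrow> 0 \<le> ln (x \<bullet> x / R\<^sup>2)"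
  by (simp add: dot_square_norm power_mono divide_simps)

lemma ln_ratio_neg: "R > 0 \<Longrightarrow> x \<noteq> 0 \<Longrightarrow> norm (x::real^2) < R \<Longrightarrow> ln (x \<bullet> x / R\<^sup>2) < 0"
  by (subst ln_less_zero_iff) (auto simp: dot_square_norm divide_simps intro!: power_strict_mono)

lemma ln_ratio_le_m1: "R > 0 \<Longrightarrow> x \<noteq> 0 \<Longrightarrow> norm (x::real^2) \<le> R/2 \<Longrightarrow> ln (x \<bullet> x / R\<^sup>2) \<le> -1"
proof -
  assume R: "R > 0" "x \<noteq> 0" "norm x \<le> R/2"
  have "(norm x)^2 \<le> (R/2)^2" using R by (intro power_mono) auto
  then have "x \<bullet> x / R\<^sup>2 \<le> 1/4" using R by (simp add: dot_square_norm power_divide field_simps)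
  then have "ln (x \<bullet> x / R\<^sup>2) \<le> ln (1/4)" using R by (subst ln_le_cancel_iff) auto
  then show ?thesis using ln_quarter by simp
qed

lemma smooth_on_ln_ratio: "R > 0 \<Longrightarrow> smooth_on (-{0::real^2}) (\<lambda>x. ln (x \<bullet> x / R\<^sup>2))"
  by (rule smooth_on_compose[OF smooth_on_ln])
     (auto intro!: smooth_intros smooth_on_subset[OF smooth_on_inner_self] divide_pos_pos)

lemma smooth_on_unnormalised:
  assumes "R > 0"
  shows "smooth_on UNIV (\<lambda>x::real^2. 4 * bump (ln (x \<bullet> x / R\<^sup>2)) / (x \<bullet> x))"
proof -
  let ?f = "\<lambda>x::real^2. 4 * bump (ln (x \<bullet> x / R\<^sup>2)) / (x \<bullet> x)"
  have 1: "smooth_on (-{0}) ?f"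
    by (intro smooth_intros smooth_on_compose[OF smooth_on_bump] smooth_on_ln_ratio[OF assms]
         smooth_on_subset[OF smooth_on_inner_self]) auto
  have "?f x = 0" if "x \<in> ball 0 (R/2)" for x
    using ln_ratio_le_m1[OF assms, of x] bump_eq_0[of "ln (x \<bullet> x / R\<^sup>2)"] that by (cases "x = 0") auto
  then have 2: "smooth_on (ball 0 (R/2)) ?f"
    using smooth_on_cong[of "ball 0 (R/2)" ?f "\<lambda>x. 0"] smooth_on_const by blast
  have "-{0} \<union> ball 0 (R/2) = (UNIV :: (real^2) set)" using assms by auto
  then show ?thesis using smooth_on_Un[OF _ _ 1 2] by (metis open_Compl open_ball closed_singleton)
qed

lemma unnormalised_test:
  "R > 0 \<Longrightarrow> (\<lambda>x::real^2. 4 * bump (ln (x \<bullet> x / R\<^sup>2)) / (x \<bullet> x)) \<in> test_functions UNIV"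
proof (rule test_functionsI[OF smooth_on_unnormalised, of _ "cball 0 R"])
  fix x :: "real^2" assume "R > 0" "x \<notin> cball 0 R"
  then show "4 * bump (ln (x \<bullet> x / R\<^sup>2)) / (x \<bullet> x) = 0"
    using ln_ratio_nonneg[of R x] bump_eq_0 by simp
qed auto

text \<open>The squared ratio exceeds \<open>49/100\<close>, which is more than
  \<open>exp (-1)\<close>. The positivity arguments below use this explicit shell between
  \<open>7/10 * R\<close> and \<open>R\<close> instead of the exact support.\<close>

lemma bump_ln_ratio_pos:
  assumes "R > 0" "7/10 * R < norm (x::real^2)" "norm x < R"
  shows "bump (ln (x \<bullet> x / R\<^sup>2)) > 0"
proof -
  have x: "x \<noteq> 0" using assms by auto
  then have "ln (x \<bullet> x / R\<^sup>2) < 0" using assms by (intro ln_ratio_neg) auto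
  moreover have "-1 < ln (x \<bullet> x / R\<^sup>2)"
  proof -
    have "(7/10 * R)^2 < (norm x)^2" using assms by (intro power_strict_mono) auto
    then have "49/100 < x \<bullet> x / R\<^sup>2"
      using assms by (simp add: dot_square_norm power_mult_distrib power_divide field_simps)
    moreover have "exp (-1::real) \<le> 49/100"
    proof -
      have "exp (1::real) \<ge> 1 + 1 + 1^2/2" by (rule exp_lower_Taylor_quadratic) auto
      then have "inverse (exp (1::real)) \<le> inverse (5/2)" by (intro le_imp_inverse_le) auto
      then show ?thesis by (simp add: exp_minus)
    qed
    ultimately have "exp (-1) < x \<bullet> x / R\<^sup>2" by linarith
    then show ?thesis using ln_less_cancel_iff[of "exp (-1)" "x \<bullet> x / R\<^sup>2"]
      by (metis exp_gt_zero less_trans ln_exp)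
  qed
  ultimately show ?thesis using bump_pos_iff by simp
qed

lemma mass_pos: "mass > 0"
proof -
  let ?f = "\<lambda>x::real^2. 4 * bump (ln (x \<bullet> x)) / (x \<bullet> x)"
  have int: "integrable lborel ?f" and bm: "?f \<in> borel_measurable borel"
    using integrable_test[OF unnormalised_test[of 1]] borel_measurable_test[OF unnormalised_test[of 1]] by simp_all
  have nn: "?f x \<ge> 0" for x using bump_nonneg by simp
  have "mass \<noteq> 0"
  proof
    assume "mass = 0"
    then have "AE x in lborel. ?f x = 0"
      using integral_nonneg_eq_0_iff_AE[OF int] nn unfolding mass_def by simp
    then have "AE x in lborel. (x::real^2) \<notin> ball 0 1 - cball 0 (7/10::real)"
    proof eventually_elim
      case (elim x)
      show ?case
      proof
        assume "x \<in> ball 0 1 - cball 0 (7/10)"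
        then have "bump (ln (x \<bullet> x)) > 0" "x \<bullet> x > 0" using bump_ln_ratio_pos[of 1 x] by auto
        with elim show False by simp
      qed
    qed
    then have "emeasure lborel (ball 0 1 - cball 0 (7/10::real) :: (real^2) set) = 0"
      by (subst (asm) AE_iff_null) (auto simp: set_diff_eq not_le not_less conj_commute)
    moreover have "open (ball 0 1 - cball 0 (7/10) :: (real^2) set)" by auto
    moreover have "(9/10) *\<^sub>R axis 1 1 \<in> (ball 0 1 - cball 0 (7/10::real) :: (real^2) set)"
      by simp
    ultimately show False
      using emeasure_lborel_open_neq_0 by blast
  qed
  moreover have "mass \<ge> 0" unfolding mass_def using nn by (intro integral_nonneg_AE) auto
  ultimately show ?thesis by simp
qed

lemma moll_pos: "R > 0 \<Longrightarrow> 7/10 * R < norm x \<Longrightarrow> norm x < R \<Longrightarrow> moll R x > 0"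
  using bump_ln_ratio_pos[of R x] mass_pos
  by (cases "x = 0") (auto simp: moll_def intro!: divide_pos_pos mult_pos_pos)

lemma moll_nonneg: "moll R x \<ge> 0"
  using bump_nonneg mass_pos by (simp add: moll_def)

lemma moll_eq_0: "R > 0 \<Longrightarrow> norm x \<ge> R \<Longrightarrow> moll R x = 0"
  using ln_ratio_nonneg[of R x] bump_eq_0 by (simp add: moll_def)

lemma moll_eq_0_inner: "R > 0 \<Longrightarrow> norm x \<le> R/2 \<Longrightarrow> moll R x = 0"
  using ln_ratio_le_m1[of R x] bump_eq_0 by (cases "x = 0") (auto simp: moll_def)

lemma moll_test: "R > 0 \<Longrightarrow> moll R \<in> test_functions UNIV"
proof (rule test_functionsI[of _ "cball 0 R"])
  assume "R > 0"
  show "smooth_on UNIV (moll R)"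
    unfolding moll_def[abs_def]
    by (rule smooth_on_divide[OF open_UNIV smooth_on_unnormalised[OF \<open>R > 0\<close>] smooth_on_const])
       (use mass_pos in simp)
  fix x :: "real^2" assume "x \<notin> cball 0 R" then show "moll R x = 0"
    using moll_eq_0 \<open>R > 0\<close> by simp
qed auto

lemma moll_measurable [measurable]: "moll R \<in> borel_measurable borel"
proof -
  have "bump \<in> borel_measurable borel"
    using smooth_on_continuous[OF smooth_on_bump] borel_measurable_continuous_onI by blast
  then show ?thesis unfolding moll_def[abs_def] by measurable
qed

lemma moll_integrable: "R > 0 \<Longrightarrow> integrable lborel (moll R)"
  using integrable_test[OF moll_test] .

lemma moll_minus: "moll R (- x) = moll R x"
  by (simp add: moll_def)

lemma kern_minus: "kern R (- x) = kern R x"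
  by (simp add: kern_def)

lemma moll_integral: "R > 0 \<Longrightarrow> (\<integral>x. moll R x \<partial>lborel) = 1"
proof -
  assume R: "R > 0"
  have "moll 1 x = R^2 * moll R (R *\<^sub>R x)" for x
    using R by (simp add: moll_def power2_eq_square)
  moreover have "(\<integral>x. moll R x \<partial>lborel) = R^2 * (\<integral>x. moll R (R *\<^sub>R x) \<partial>lborel)"
    using integral_lborel_affine[OF moll_integrable[OF R], of R 0] R by (simp add: power2_eq_square)
  ultimately have "(\<integral>x. moll R x \<partial>lborel) = (\<integral>x. moll 1 x \<partial>lborel)" by simp
  also have "\<dots> = mass / mass"
    unfolding moll_def integral_divide_zero by (simp add: mass_def)
  also have "\<dots> = 1" using mass_pos by simp
  finally show ?thesis .
qed

lemma kern_nonneg: "kern R x \<ge> 0"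
  using hinge_nonneg mass_pos by (simp add: kern_def)

lemma kern_eq_0: "R > 0 \<Longrightarrow> norm x \<ge> R \<Longrightarrow> kern R x = 0"
  using ln_ratio_nonneg[of R x] hinge_pos by (simp add: kern_def)

lemma kern_pos: "R > 0 \<Longrightarrow> x \<noteq> 0 \<Longrightarrow> norm x < R \<Longrightarrow> kern R x > 0"
  using ln_ratio_neg[of R x] hinge_gt_0 mass_pos by (simp add: kern_def)

lemma kern_measurable [measurable]: "kern R \<in> borel_measurable borel"
proof -
  have "hinge \<in> borel_measurable borel"
    using smooth_on_continuous[OF smooth_on_hinge] borel_measurable_continuous_onI by blast
  then show ?thesis unfolding kern_def[abs_def] by measurable
qed

lemma smooth_on_kern: "R > 0 \<Longrightarrow> smooth_on (-{0}) (kern R)"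
  unfolding kern_def[abs_def] using mass_pos
  by (intro smooth_intros smooth_on_compose[OF smooth_on_hinge] smooth_on_ln_ratio) auto

text \<open>The expression \<open>4 * (k' + s * k'')\<close> is \<open>4 / s\<close> times the
  second derivative of \<open>k\<close> with respect to \<open>ln s\<close>. Since the kernel is
  \<open>hinge\<close> of a logarithm, only the second derivative \<open>bump\<close> of
  \<open>hinge\<close> survives.\<close>

lemma laplacian_kern:
  assumes "R > 0" "x \<noteq> 0" shows "laplacian (kern R) x = moll R x"
proof -
  let ?k = "\<lambda>s. hinge (ln (s / R\<^sup>2)) / mass"
  have d1: "(?k has_real_derivative (slope (ln (s / R\<^sup>2)) / s / mass)) (at s)" if "s > 0" for s
    using assms that mass_pos
    by (auto intro!: derivative_eq_intros DERIV_chain2[OF hinge_deriv] simp: divide_simps)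
  have d2: "((\<lambda>s. slope (ln (s / R\<^sup>2)) / s / mass) has_real_derivative
      ((bump (ln (s / R\<^sup>2)) / s^2 - slope (ln (s / R\<^sup>2)) / s^2) / mass)) (at s)" if "s > 0" for s
    using assms that mass_pos
    by (auto intro!: derivative_eq_intros DERIV_chain2[OF slope_deriv] simp: divide_simps power2_eq_square)
       (simp add: algebra_simps)
  have "x \<bullet> x > 0" using assms by simp
  have "laplacian (\<lambda>y. ?k (y \<bullet> y)) x = 4 * (slope (ln (x \<bullet> x / R\<^sup>2)) / (x \<bullet> x) / mass + (x \<bullet> x) *
     ((bump (ln (x \<bullet> x / R\<^sup>2)) / (x \<bullet> x)^2 - slope (ln (x \<bullet> x / R\<^sup>2)) / (x \<bullet> x)^2) / mass))"
    by (rule laplacian_radial[of "-{0}"]) (use assms d1 d2 in auto)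
  also have "\<dots> = moll R x" using \<open>x \<bullet> x > 0\<close> mass_pos
    by (simp add: moll_def field_simps power2_eq_square)
  finally show ?thesis by (simp add: kern_def[abs_def])
qed

text \<open>The value at the origin is the one that makes the difference of two kernels continuous.\<close>

definition kdiff :: "real \<Rightarrow> real \<Rightarrow> real^2 \<Rightarrow> real" where
  "kdiff R d x = (if x = 0 then hslope * ln (R\<^sup>2 / d\<^sup>2) / mass else kern R x - kern d x)"

text \<open>Within distance \<open>d/2\<close> of the origin both logarithms are below -1, where
  \<open>hinge\<close> is affine; the logarithmic singularities cancel and a constant
  remains.\<close>

lemma kdiff_const:
  assumes "0 < d" "d \<le> R" "norm x \<le> d/2"
  shows "kdiff R d x = hslope * ln (R\<^sup>2 / d\<^sup>2) / mass"
proof (cases "x = 0")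
  case False
  have "ln (x \<bullet> x / R\<^sup>2) \<le> -1" "ln (x \<bullet> x / d\<^sup>2) \<le> -1" using ln_ratio_le_m1 assms False by auto
  from hinge_affine[OF this] False assms show ?thesis
    by (simp add: kdiff_def kern_def diff_divide_distrib[symmetric] ln_div)
qed (simp add: kdiff_def)

lemma kdiff_test:
  assumes "0 < d" "d \<le> R"
  shows "kdiff R d \<in> test_functions UNIV"
proof (rule test_functionsI[of _ "cball 0 R"])
  have 1: "smooth_on (-{0}) (kdiff R d)"
    using assms by (subst smooth_on_cong[of _ _ "\<lambda>x. kern R x - kern d x"])
       (auto simp: kdiff_def intro!: smooth_on_diff smooth_on_kern)
  have 2: "smooth_on (ball 0 (d/2)) (kdiff R d)"
    using assms kdiff_const by (subst smooth_on_cong[of _ _ "\<lambda>x. hslope * ln (R\<^sup>2 / d\<^sup>2) / mass"]) auto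
  have "-{0} \<union> ball 0 (d/2) = (UNIV :: (real^2) set)" using assms by auto
  then show "smooth_on UNIV (kdiff R d)" using smooth_on_Un[OF _ _ 1 2] by (metis open_Compl open_ball closed_singleton)
qed (use assms kern_eq_0 in \<open>auto simp: kdiff_def\<close>)

lemma kdiff_eq_0: "0 < d \<Longrightarrow> d \<le> R \<Longrightarrow> norm x \<ge> R \<Longrightarrow> kdiff R d x = 0"
  by (cases "x = 0") (auto simp: kdiff_def kern_eq_0)

lemma kdiff_minus: "kdiff R d (- x) = kdiff R d x"
  by (simp add: kdiff_def kern_minus)

lemma laplacian_kdiff:
  assumes "0 < d" "d \<le> R"
  shows "laplacian (kdiff R d) x = moll R x - moll d x"
proof (cases "x = 0")
  case True
  have "partial_deriv e (kdiff R d) y = 0" if "y \<in> ball 0 (d/2)" for e y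
    using that kdiff_const[OF assms]
    by (subst partial_deriv_cong[of "ball 0 (d/2)" _ _ "\<lambda>x. hslope * ln (R\<^sup>2 / d\<^sup>2) / mass"])
       (auto simp: partial_deriv_def)
  then have "partial_deriv e (partial_deriv e (kdiff R d)) x = 0" for e
    using True assms
    by (subst partial_deriv_cong[of "ball 0 (d/2)" _ _ "\<lambda>x. 0"]) (auto simp: partial_deriv_def)
  \<comment> \<open>Both mollifiers have the value 0 at the origin, because the quotient by
    \<open>x \<bullet> x = 0\<close> is 0.\<close>
  then show ?thesis using True by (simp add: laplacian_def moll_def)
next
  case False
  have "smooth_on (-{0}) (kern R)" "smooth_on (-{0}) (kern d)" using assms smooth_on_kern by auto
  then have dd: "kern R differentiable (at y)" "kern d differentiable (at y)"
    "e \<in> Basis \<Longrightarrow> partial_deriv e (kern R) differentiable (at y)"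
    "e \<in> Basis \<Longrightarrow> partial_deriv e (kern d) differentiable (at y)" if "y \<noteq> 0" for y e
    using that smooth_on_differentiable smooth_on_partial_deriv by blast+
  have p: "partial_deriv e (\<lambda>x. f x - g x) y = partial_deriv e f y - partial_deriv e g y"
    if "f differentiable (at y)" "g differentiable (at y)" for f g :: "real^2 \<Rightarrow> real" and e y
    using that by (intro partial_deriv_eqI[THEN trans, OF has_derivative_diff])
       (auto simp: partial_deriv_def frechet_derivative_works)
  have "partial_deriv e (kdiff R d) y = partial_deriv e (kern R) y - partial_deriv e (kern d) y" if "y \<noteq> 0" for e y
    using that dd by (subst partial_deriv_cong[of "-{0}" _ _ "\<lambda>x. kern R x - kern d x"]) (auto simp: kdiff_def p)
  then have "partial_deriv e (partial_deriv e (kdiff R d)) x =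
      partial_deriv e (partial_deriv e (kern R)) x - partial_deriv e (partial_deriv e (kern d)) x" if "e \<in> Basis" for e
    using that dd False
    by (subst partial_deriv_cong[of "-{0}" _ _ "\<lambda>x. partial_deriv e (kern R) x - partial_deriv e (kern d) x"]) (auto simp: p)
  then have "laplacian (kdiff R d) x = laplacian (kern R) x - laplacian (kern d) x"
    by (simp add: laplacian_def sum_subtractf)
  then show ?thesis using laplacian_kern assms False by simp
qed

text \<open>Enlarging the radius lowers the logarithm, and \<open>hinge\<close> is decreasing. This
  gives \<open>kdiff\<close> its sign and its domination by \<open>kern R\<close>.\<close>

lemma kern_antimono: "0 < d \<Longrightarrow> d \<le> R \<Longrightarrow> kern d x \<le> kern R x"
proof (cases "x = 0")
  case False
  assume "0 < d" "d \<le> R"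
  then have "x \<bullet> x / R\<^sup>2 \<le> x \<bullet> x / d\<^sup>2" by (intro divide_left_mono) auto
  then have "ln (x \<bullet> x / R\<^sup>2) \<le> ln (x \<bullet> x / d\<^sup>2)"
    using False \<open>0 < d\<close> \<open>d \<le> R\<close> by (subst ln_le_cancel_iff) (auto intro!: divide_pos_pos)
  then show ?thesis using hinge_antimono mass_pos by (auto simp: kern_def divide_right_mono)
qed (simp add: kern_def hinge_0)

lemma kdiff_bounds:
  assumes "0 < d" "d \<le> R" "x \<noteq> 0" shows "0 \<le> kdiff R d x" "kdiff R d x \<le> kern R x"
  using kern_antimono[OF assms(1,2), of x] kern_nonneg[of d x] assms by (auto simp: kdiff_def)

definition kern_const :: real where "kern_const = 2 * hslope / mass"

lemma kern_const_pos: "kern_const > 0"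
  using hslope_pos mass_pos by (simp add: kern_const_def)

lemma kern_le_ln:
  assumes "R > 0" "x \<noteq> 0" "norm x \<le> R" shows "kern R x \<le> kern_const * ln (R / norm x)"
proof -
  have "x \<bullet> x / R\<^sup>2 \<le> 1" using assms by (simp add: dot_square_norm power_mono divide_simps)
  then have "ln (x \<bullet> x / R\<^sup>2) \<le> 0" using assms by (subst ln_le_zero_iff) auto
  then have "hinge (ln (x \<bullet> x / R\<^sup>2)) \<le> hslope * (- ln (x \<bullet> x / R\<^sup>2))"
    using hinge_Lipschitz[of "ln (x \<bullet> x / R\<^sup>2)" 0] hinge_0 by simp
  also have "- ln (x \<bullet> x / R\<^sup>2) = 2 * ln (R / norm x)"
    using assms by (simp add: dot_square_norm ln_div ln_realpow)
  finally show ?thesis using mass_pos by (simp add: kern_def kern_const_def divide_right_mono field_simps)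
qed

text \<open>A dyadic decomposition: at distances between \<open>R / 2^(n+1)\<close> and
  \<open>R / 2^n\<close> the function is at most \<open>2^(n+1) / R\<close>, and this bound times
  the area of the ball of radius \<open>R / 2^n\<close> is geometric in \<open>n\<close>.\<close>

lemma integrable_inverse_norm:
  assumes "R > 0"
  shows "integrable lborel (\<lambda>x::real^2. indicator (ball 0 R) x / norm x)"
proof (rule integrableI_bounded)
  let ?w = "unit_ball_vol (real DIM(real^2))"
  let ?a = "\<lambda>n::nat. 2 ^ (n + 1) / R"
  have le: "ennreal (norm (indicator (ball 0 R) x / norm x)) \<le>
      (\<Sum>n. ennreal (?a n) * indicator (ball 0 (R / 2 ^ n)) x)" for x :: "real^2"
  proof (cases "x \<in> ball 0 R \<and> x \<noteq> 0")
    case True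
    then obtain m where m: "(1/2::real) ^ m < norm x / R"
      using real_arch_pow_inv[of "norm x / R" "1/2"] assms by auto
    \<comment> \<open>The index of the dyadic shell of \<open>x\<close>: minimality gives
      \<open>norm x / R < (1/2)^n\<close>, and for \<open>n = 0\<close> this is membership in the
      ball.\<close>
    define n where "n = (LEAST n. (1/2::real) ^ Suc n \<le> norm x / R)"
    have ex: "(1/2::real) ^ Suc m \<le> norm x / R"
    proof -
      have "(1/2::real) ^ Suc m \<le> (1/2::real) ^ m" by simp
      then show ?thesis using m by linarith
    qed
    have n1: "(1/2::real) ^ Suc n \<le> norm x / R" unfolding n_def by (rule LeastI[of _ m]) (rule ex)
    have n2: "norm x / R < (1/2::real) ^ n"
    proof (cases n)
      case 0
      then show ?thesis using True assms by simp
    next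
      case (Suc k)
      then show ?thesis using not_less_Least[of k "\<lambda>n. (1/2::real) ^ Suc n \<le> norm x / R"] n_def by auto
    qed
    define g where "g n = ennreal (?a n) * indicator (ball 0 (R / 2 ^ n)) x" for n
    have "norm (indicator (ball 0 R) x / norm x) \<le> ?a n"
      using True n1 assms by (simp add: field_simps power_divide)
    moreover have "x \<in> ball 0 (R / 2 ^ n)" using n2 assms by (simp add: field_simps power_divide)
    ultimately have "ennreal (norm (indicator (ball 0 R) x / norm x)) \<le> g n"
      by (simp add: g_def ennreal_leI)
    also have "\<dots> \<le> (\<Sum>n. g n)"
      using sum_le_suminf[of g "{n}"] by simp
    finally show ?thesis by (simp add: g_def)
  qed auto
  have "(\<integral>\<^sup>+x. ennreal (norm (indicator (ball 0 R) (x::real^2) / norm x)) \<partial>lborel) \<le>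
     (\<integral>\<^sup>+x. (\<Sum>n. ennreal (?a n) * indicator (ball 0 (R / 2 ^ n)) (x::real^2)) \<partial>lborel)"
    by (rule nn_integral_mono) (rule le)
  also have "\<dots> = (\<Sum>n. \<integral>\<^sup>+x. ennreal (?a n) * indicator (ball 0 (R / 2 ^ n)) (x::real^2) \<partial>lborel)"
    by (rule nn_integral_suminf)
       (intro borel_measurable_times_ennreal borel_measurable_const borel_measurable_indicator; simp)
  also have "\<dots> = (\<Sum>n. ennreal (2 * R * ?w * (1/2)^n))"
  proof (rule suminf_cong)
    fix n
    have "(\<integral>\<^sup>+x. ennreal (?a n) * indicator (ball 0 (R / 2 ^ n)) (x::real^2) \<partial>lborel) = ennreal (?a n) * ennreal (?w * (R/2^n)^2)"
      using assms emeasure_ball[of "R/2^n" "0::real^2"] by (subst nn_integral_cmult_indicator) auto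
    also have "\<dots> = ennreal (?a n * (?w * (R/2^n)^2))" using assms by (subst ennreal_mult) auto
    also have "?a n * (?w * (R/2^n)^2) = 2 * R * ?w * (1/2)^n"
      using assms by (simp add: power_divide power2_eq_square field_simps)
    finally show "(\<integral>\<^sup>+x. ennreal (?a n) * indicator (ball 0 (R / 2 ^ n)) (x::real^2) \<partial>lborel) = ennreal (2 * R * ?w * (1/2)^n)" .
  qed
  also have "\<dots> < \<infinity>"
  proof -
    have "(\<Sum>n. ennreal (2 * R * ?w * (1/2)^n)) \<noteq> top"
      using assms by (intro ennreal_suminf_neq_top summable_mult summable_geometric) auto
    then show ?thesis by (simp add: less_top)
  qed
  finally show "(\<integral>\<^sup>+x. ennreal (norm (indicator (ball 0 R) (x::real^2) / norm x)) \<partial>lborel) < \<infinity>" .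
  show "(\<lambda>x::real^2. indicator (ball 0 R) x / norm x) \<in> borel_measurable lborel"
    by (intro borel_measurable_divide borel_measurable_indicator borel_measurable_norm) auto
qed

text \<open>Inside the disc the kernel is at most \<open>kern_const * ln (R / norm x)\<close>, so
  the exponential is at most the first power of \<open>R / norm x\<close>, which is integrable in
  the plane.\<close>

lemma exp_kern_le:
  assumes "R > 0" "0 \<le> s" "s * kern_const \<le> 1"
  shows "exp (s * kern R x) \<le> 1 + R * (indicator (ball 0 R) x / norm x)"
proof (cases "x = 0 \<or> norm x \<ge> R")
  case True
  \<comment> \<open>At the origin the kernel has the value 0 too, by the convention
    \<open>ln 0 = 0\<close>.\<close>
  then have "kern R x = 0" using kern_eq_0[OF assms(1), of x] by (auto simp: kern_def hinge_0)
  moreover have "0 \<le> R * (indicator (ball 0 R) x / norm x)" using assms by simp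
  ultimately show ?thesis by simp
next
  case False
  then have l: "ln (R / norm x) \<ge> 0" using assms by simp
  have "s * kern R x \<le> s * (kern_const * ln (R / norm x))"
    using kern_le_ln[of R x] False assms by (intro mult_left_mono) auto
  also have "\<dots> \<le> 1 * ln (R / norm x)"
    using assms(3) l unfolding mult.assoc[symmetric] by (intro mult_right_mono) auto
  finally have "exp (s * kern R x) \<le> exp (ln (R / norm x))" by simp
  also have "\<dots> = R / norm x" using False assms by (intro exp_ln) auto
  finally show ?thesis using False by auto
qed

text \<open>From \<open>ln y = 2 * ln (sqrt y) \<le> 2 * sqrt y\<close> the squared logarithm is at
  most \<open>4 * y\<close>, so the square of the kernel is dominated by the inverse norm.\<close>

lemma kern_square_le:
  assumes "R > 0"
  shows "(kern R x)\<^sup>2 \<le> 4 * kern_const\<^sup>2 * R * (indicator (ball 0 R) x / norm x)"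
proof (cases "x = 0 \<or> norm x \<ge> R")
  case True
  then show ?thesis using kern_eq_0[OF assms(1), of x] assms by (auto simp: kern_def hinge_0)
next
  case False
  define y where "y = R / norm x"
  have y: "y \<ge> 1" using False assms by (simp add: y_def)
  have "ln y = 2 * ln (sqrt y)" using y by (simp add: ln_sqrt)
  also have "\<dots> \<le> 2 * sqrt y" using y ln_bound[of "sqrt y"] by simp
  finally have "(ln y)\<^sup>2 \<le> (2 * sqrt y)\<^sup>2" using y by (intro power_mono) auto
  then have l: "(ln y)\<^sup>2 \<le> 4 * y" using y by (simp add: power_mult_distrib)
  have "(kern R x)\<^sup>2 \<le> (kern_const * ln y)\<^sup>2"
    using kern_le_ln[of R x] False assms kern_nonneg by (intro power_mono) (auto simp: y_def)
  also have "\<dots> \<le> kern_const\<^sup>2 * (4 * y)" unfolding power_mult_distrib using l by (intro mult_left_mono) auto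
  also have "\<dots> = 4 * kern_const\<^sup>2 * R * (indicator (ball 0 R) x / norm x)" using False by (simp add: y_def)
  finally show ?thesis .
qed

lemma kern_square_integrable: "R > 0 \<Longrightarrow> integrable lborel (\<lambda>x. (kern R x)\<^sup>2)"
  using kern_square_le[of R] kern_const_pos
  by (intro Bochner_Integration.integrable_bound[OF integrable_mult_right[OF integrable_inverse_norm[of R], of "4 * kern_const\<^sup>2 * R"]])
     (auto intro!: AE_I2 order_trans[OF kern_square_le])

lemma kern_integrable:
  assumes "R > 0" shows "integrable lborel (kern R)"
proof (rule Bochner_Integration.integrable_bound)
  show "integrable lborel (\<lambda>x. (kern R x)\<^sup>2 + indicator (ball 0 R) x)"
    using kern_square_integrable[OF assms]
    by (intro Bochner_Integration.integrable_add integrable_real_indicator emeasure_bounded_finite) auto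
  show "AE x in lborel. norm (kern R x) \<le> norm ((kern R x)\<^sup>2 + indicator (ball 0 R) x)"
  proof (rule AE_I2)
    fix x
    have "kern R x \<le> (kern R x)\<^sup>2 + 1" using kern_nonneg[of R x] zero_le_power2[of "kern R x - 1"]
      by (simp add: power2_diff)
    then show "norm (kern R x) \<le> norm ((kern R x)\<^sup>2 + indicator (ball 0 R) x)"
      using kern_eq_0[OF assms, of x] kern_nonneg[of R x] by (cases "x \<in> ball 0 R") auto
  qed
qed auto

subsection \<open>Convolutions\<close>

text \<open>For fixed \<open>y\<close> the integral of the modulus in \<open>x\<close> is
  \<open>\<bar>f y\<bar>\<close> times the integral of \<open>\<bar>k\<bar>\<close>, by translation
  invariance.\<close>

lemma convolution_integrable:
  fixes f k :: "'a::euclidean_space \<Rightarrow> real"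
  assumes f: "integrable lborel f" and k: "integrable lborel k"
  shows "integrable (lborel \<Otimes>\<^sub>M lborel) (\<lambda>(y, x). f y * k (x - y))"
proof (rule lborel_pair.Fubini_integrable)
  note [measurable] = borel_measurable_integrable[OF f] borel_measurable_integrable[OF k]
  show "(\<lambda>(y, x). f y * k (x - y)) \<in> borel_measurable (lborel \<Otimes>\<^sub>M lborel)" by measurable
  have sh: "integrable lborel (\<lambda>x. k (x - y))" for y
    using integrable_lborel_affine[OF k, of 1 "-y"] by (simp add: algebra_simps)
  have "(\<integral>x. norm (f y * k (x - y)) \<partial>lborel) = \<bar>f y\<bar> * (\<integral>x. \<bar>k x\<bar> \<partial>lborel)" for y
    using integral_lborel_affine[OF integrable_abs[OF k], of 1 "-y"] by (simp add: abs_mult algebra_simps)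
  then show "integrable lborel (\<lambda>y. \<integral>x. norm (case (y, x) of (y, x) \<Rightarrow> f y * k (x - y)) \<partial>lborel)"
    using f by simp
  show "AE y in lborel. integrable lborel (\<lambda>x. case (y, x) of (y, x) \<Rightarrow> f y * k (x - y))"
    using sh by simp
qed

lemma convolution_integrable':
  fixes f k :: "'a::euclidean_space \<Rightarrow> real"
  assumes f: "integrable lborel f" and k: "integrable lborel k"
  shows "integrable lborel (\<lambda>x. \<integral>y. f y * k (x - y) \<partial>lborel)"
    and "AE x in lborel. integrable lborel (\<lambda>y. f y * k (x - y))"
  using lborel_pair.integrable_snd[OF convolution_integrable[OF f k]]
    lborel_pair.AE_integrable_snd[OF convolution_integrable[OF f k]] by auto

lemma convolution_Fubini:
  fixes f k w :: "'a::euclidean_space \<Rightarrow> real"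
  assumes f: "integrable lborel f" and k: "integrable lborel k"
    and w: "w \<in> borel_measurable borel" "\<And>x. \<bar>w x\<bar> \<le> C"
  shows "(\<integral>x. w x * (\<integral>y. f y * k (x - y) \<partial>lborel) \<partial>lborel) = (\<integral>y. f y * (\<integral>x. w x * k (x - y) \<partial>lborel) \<partial>lborel)"
proof -
  note [measurable] = borel_measurable_integrable[OF f] borel_measurable_integrable[OF k] w(1)
  have "integrable (lborel \<Otimes>\<^sub>M lborel) (\<lambda>(y, x). w x * (f y * k (x - y)))"
  proof (rule Bochner_Integration.integrable_bound[OF integrable_mult_right[OF convolution_integrable[OF f k], of C]])
    have "\<bar>w x\<bar> * z \<le> \<bar>C\<bar> * z" if "z \<ge> 0" for x z
      using w(2)[of x] that by (intro mult_right_mono) auto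
    then show "AE z in lborel \<Otimes>\<^sub>M lborel. norm (case z of (y, x) \<Rightarrow> w x * (f y * k (x - y)))
       \<le> norm (C * (case z of (y, x) \<Rightarrow> f y * k (x - y)))"
      by (auto intro!: AE_I2 simp: abs_mult)
  qed measurable
  from lborel_pair.Fubini_integral[OF this]
  have "(\<integral>x. (\<integral>y. w x * (f y * k (x - y)) \<partial>lborel) \<partial>lborel) = (\<integral>y. (\<integral>x. w x * (f y * k (x - y)) \<partial>lborel) \<partial>lborel)"
    by simp
  moreover have "(\<integral>y. w x * (f y * k (x - y)) \<partial>lborel) = w x * (\<integral>y. f y * k (x - y) \<partial>lborel)" for x by simp
  moreover have "(\<integral>x. w x * (f y * k (x - y)) \<partial>lborel) = f y * (\<integral>x. w x * k (x - y) \<partial>lborel)" for y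
    by (subst integral_mult_right_zero[symmetric]) (simp add: algebra_simps)
  ultimately show ?thesis by simp
qed

definition molconv :: "real \<Rightarrow> (real^2 \<Rightarrow> real) \<Rightarrow> real^2 \<Rightarrow> real" where
  "molconv R u x = (\<integral>y. u y * moll R (x - y) \<partial>lborel)"

definition pot :: "real \<Rightarrow> (real^2 \<Rightarrow> real) \<Rightarrow> real^2 \<Rightarrow> real" where
  "pot R F x = (\<integral>y. F y * kern R (x - y) \<partial>lborel)"

lemma test_shift:
  fixes \<phi> :: "'a::euclidean_space \<Rightarrow> real"
  assumes "\<phi> \<in> test_functions UNIV"
  shows "(\<lambda>y. \<phi> (x - y)) \<in> test_functions UNIV"
proof -
  obtain K where K: "compact K" "\<And>x. x \<notin> K \<Longrightarrow> \<phi> x = 0"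
    using test_functionsD[OF assms(1)] by auto
  have "smooth_on UNIV (\<lambda>y. \<phi> (x - y))"
    by (rule smooth_on_compose_map[OF test_functionsD(1)[OF assms]])
       (auto simp: inner_diff_left intro!: smooth_intros)
  moreover have "compact ((\<lambda>k. x - k) ` K)"
    using K(1) by (intro compact_continuous_image continuous_intros)
  moreover have "\<phi> (x - y) = 0" if "y \<notin> (\<lambda>k. x - k) ` K" for y
    using that by (intro K(2)) (auto intro!: image_eqI[of _ _ "x - y"])
  ultimately show ?thesis by (intro test_functionsI) auto
qed

lemma test_convolution:
  fixes \<phi> :: "'a::euclidean_space \<Rightarrow> real"
  assumes u: "integrable lborel u" and \<phi>: "\<phi> \<in> test_functions UNIV"
  shows "continuous_on UNIV (\<lambda>x. \<integral>y. u y * \<phi> (x - y) \<partial>lborel)"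
    and "\<exists>C. \<forall>x. \<bar>\<integral>y. u y * \<phi> (x - y) \<partial>lborel\<bar> \<le> C"
proof -
  note int = integrable_mult_test[OF u test_shift[OF \<phi>]]
  obtain L where L: "0 \<le> L" "\<And>x y. \<bar>\<phi> x - \<phi> y\<bar> \<le> L * norm (x - y)"
    using test_functions_Lipschitz[OF \<phi>] by blast
  obtain B where B: "\<And>x. \<bar>\<phi> x\<bar> \<le> B" using test_functions_bounded[OF \<phi>] by blast
  have "\<bar>(\<integral>y. u y * \<phi> (x - y) \<partial>lborel) - (\<integral>y. u y * \<phi> (z - y) \<partial>lborel)\<bar> \<le> (L * (\<integral>y. \<bar>u y\<bar> \<partial>lborel)) * norm (x - z)" for x z
  proof -
    have "(\<integral>y. u y * \<phi> (x - y) \<partial>lborel) - (\<integral>y. u y * \<phi> (z - y) \<partial>lborel) = (\<integral>y. u y * (\<phi> (x - y) - \<phi> (z - y)) \<partial>lborel)"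
      using int by (simp add: right_diff_distrib)
    also have "\<bar>\<dots>\<bar> \<le> (\<integral>y. \<bar>u y\<bar> * (L * norm (x - z)) \<partial>lborel)"
    proof (rule order_trans[OF integral_abs_bound], rule integral_mono)
      show "integrable lborel (\<lambda>y. \<bar>u y * (\<phi> (x - y) - \<phi> (z - y))\<bar>)" using int by (simp add: right_diff_distrib)
      show "\<bar>u y * (\<phi> (x - y) - \<phi> (z - y))\<bar> \<le> \<bar>u y\<bar> * (L * norm (x - z))" for y
        using L(2)[of "x - y" "z - y"] by (simp add: abs_mult mult_left_mono)
    qed (use u in auto)
    finally show ?thesis by (simp add: mult_ac)
  qed
  then have "(L * (\<integral>y. \<bar>u y\<bar> \<partial>lborel))-lipschitz_on UNIV (\<lambda>x. \<integral>y. u y * \<phi> (x - y) \<partial>lborel)"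
    using L(1) by (intro lipschitz_onI) (auto simp: dist_norm)
  then show "continuous_on UNIV (\<lambda>x. \<integral>y. u y * \<phi> (x - y) \<partial>lborel)"
    using lipschitz_on_continuous_on by blast
  have "\<bar>\<integral>y. u y * \<phi> (x - y) \<partial>lborel\<bar> \<le> (\<integral>y. \<bar>u y\<bar> * B \<partial>lborel)" for x
  proof (rule order_trans[OF integral_abs_bound], rule integral_mono)
    show "\<bar>u y * \<phi> (x - y)\<bar> \<le> \<bar>u y\<bar> * B" for y using B[of "x - y"] by (simp add: abs_mult mult_left_mono)
  qed (use u int in auto)
  then show "\<exists>C. \<forall>x. \<bar>\<integral>y. u y * \<phi> (x - y) \<partial>lborel\<bar> \<le> C" by blast
qed

subsection \<open>The weak Poisson equation and its local representation formula\<close>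

text \<open>Only the test functions are localised to \<open>D\<close>. The functions
  \<open>u\<close> and \<open>F\<close> are integrable on the whole plane, so convolutions with them
  need no cutoff; their values outside \<open>D\<close> do not influence the equation.\<close>

definition wlap :: "(real^2) set \<Rightarrow> (real^2 \<Rightarrow> real) \<Rightarrow> (real^2 \<Rightarrow> real) \<Rightarrow> bool" where
  "wlap D u F \<longleftrightarrow> integrable lborel u \<and> integrable lborel F \<and>
     (\<forall>\<phi>\<in>test_functions D. - (\<integral>x. u x * laplacian \<phi> x \<partial>lborel) = (\<integral>x. F x * \<phi> x \<partial>lborel))"

lemma wlapD:
  assumes "wlap D u F"
  shows "integrable lborel u" "integrable lborel F"
    "\<phi> \<in> test_functions D \<Longrightarrow> - (\<integral>x. u x * laplacian \<phi> x \<partial>lborel) = (\<integral>x. F x * \<phi> x \<partial>lborel)"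
  using assms unfolding wlap_def by auto

lemma wlap_subset: "wlap D u F \<Longrightarrow> E \<subseteq> D \<Longrightarrow> wlap E u F"
  unfolding wlap_def using test_functions_mono by blast

lemma wlap_lin:
  assumes "wlap D u F" "wlap D v G"
  shows "wlap D (\<lambda>x. s * u x + t * v x) (\<lambda>x. s * F x + t * G x)"
  unfolding wlap_def
proof (intro conjI ballI)
  show "integrable lborel (\<lambda>x. s * u x + t * v x)" "integrable lborel (\<lambda>x. s * F x + t * G x)"
    using wlapD[OF assms(1)] wlapD[OF assms(2)] by auto
  fix \<phi> :: "real^2 \<Rightarrow> real" assume \<phi>: "\<phi> \<in> test_functions D"
  note l = test_functions_laplacian[OF \<phi>]
  have "(\<integral>x. (s * u x + t * v x) * laplacian \<phi> x \<partial>lborel) =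
      s * (\<integral>x. u x * laplacian \<phi> x \<partial>lborel) + t * (\<integral>x. v x * laplacian \<phi> x \<partial>lborel)"
    using integrable_mult_test[OF wlapD(1)[OF assms(1)] l] integrable_mult_test[OF wlapD(1)[OF assms(2)] l]
    by (simp add: distrib_right mult.assoc)
  moreover have "(\<integral>x. (s * F x + t * G x) * \<phi> x \<partial>lborel) =
      s * (\<integral>x. F x * \<phi> x \<partial>lborel) + t * (\<integral>x. G x * \<phi> x \<partial>lborel)"
    using integrable_mult_test[OF wlapD(2)[OF assms(1)] \<phi>] integrable_mult_test[OF wlapD(2)[OF assms(2)] \<phi>]
    by (simp add: distrib_right mult.assoc)
  ultimately show "- (\<integral>x. (s * u x + t * v x) * laplacian \<phi> x \<partial>lborel) = (\<integral>x. (s * F x + t * G x) * \<phi> x \<partial>lborel)"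
    by (simp add: wlapD(3)[OF assms(1) \<phi>, symmetric] wlapD(3)[OF assms(2) \<phi>, symmetric])
qed

lemma kdiff_shift_test:
  assumes "0 < d" "d \<le> R" "cball x R \<subseteq> D"
  shows "(\<lambda>y. kdiff R d (x - y)) \<in> test_functions D"
proof (rule test_functionsI[of _ "cball x R"])
  show "smooth_on UNIV (\<lambda>y. kdiff R d (x - y))"
    using test_functionsD(1)[OF test_shift[OF kdiff_test[OF assms(1,2)]]] .
  show "kdiff R d (x - y) = 0" if "y \<notin> cball x R" for y
    using kdiff_eq_0[OF assms(1,2)] that by (simp add: dist_norm)
qed (use assms in auto)

text \<open>The test function is the difference of two kernels centred at \<open>x\<close>: smooth
  because the singularities cancel, supported in the ball of radius \<open>R\<close>, and with the
  difference of the two mollifiers as Laplacian. Letting \<open>d\<close> tend to 0 produces the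
  representation formulas.\<close>

lemma wlap_mollifier_difference:
  assumes w: "wlap D u F" and d: "0 < d" "d \<le> R" and sub: "cball x R \<subseteq> D"
  shows "molconv R u x = molconv d u x - (\<integral>y. F y * kdiff R d (x - y) \<partial>lborel)"
proof -
  have eq: "laplacian (\<lambda>y. kdiff R d (x - y)) y = moll R (x - y) - moll d (x - y)" for y
  proof -
    have "(\<lambda>y. kdiff R d (x - y)) = (\<lambda>y. kdiff R d (y + (- x)))"
      using kdiff_minus[of R d "x - _"] by (metis add.commute diff_minus_eq_add minus_diff_eq uminus_add_conv_diff)
    then have "laplacian (\<lambda>y. kdiff R d (x - y)) y = laplacian (kdiff R d) (y + (- x))"
      by (simp only: laplacian_shift)
    also have "\<dots> = moll R (- (x - y)) - moll d (- (x - y))" using laplacian_kdiff[OF d] by simp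
    finally show ?thesis by (simp only: moll_minus)
  qed
  have "- (\<integral>y. u y * laplacian (\<lambda>y. kdiff R d (x - y)) y \<partial>lborel) = (\<integral>y. F y * kdiff R d (x - y) \<partial>lborel)"
    by (rule wlapD(3)[OF w kdiff_shift_test[OF d sub]])
  moreover have "(\<integral>y. u y * laplacian (\<lambda>y. kdiff R d (x - y)) y \<partial>lborel) = molconv R u x - molconv d u x"
    using integrable_mult_test[OF wlapD(1)[OF w] test_shift[OF moll_test]] d
    by (simp add: eq right_diff_distrib molconv_def)
  ultimately show ?thesis by simp
qed

lemma radii_tendsto_0: "(\<lambda>n. R / real (Suc n)) \<longlonglongrightarrow> 0"
  using tendsto_mult_right_zero[OF LIMSEQ_inverse_real_of_nat, of R] by (simp add: divide_inverse)

text \<open>Away from \<open>x\<close> the small kernel eventually vanishes, and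
  \<open>kdiff\<close> is dominated by \<open>kern R\<close>. The single point \<open>y = x\<close>,
  where \<open>kdiff\<close> carries an artificial value, is null.\<close>

lemma pot_limit:
  assumes "R > 0" "F \<in> borel_measurable borel" "integrable lborel (\<lambda>y. F y * kern R (x - y))"
  shows "(\<lambda>n. \<integral>y. F y * kdiff R (R / real (Suc n)) (x - y) \<partial>lborel) \<longlonglongrightarrow> pot R F x"
    and "\<bar>\<integral>y. F y * kdiff R (R / real (Suc n)) (x - y) \<partial>lborel\<bar> \<le> (\<integral>y. \<bar>F y\<bar> * kern R (x - y) \<partial>lborel)"
proof -
  let ?d = "\<lambda>n. R / real (Suc n)"
  have d: "0 < ?d n" "?d n \<le> R" for n
    using assms(1) by (auto simp: divide_le_eq mult_le_cancel_left1)
  have AEx: "AE y in lborel. y \<noteq> x"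
    by (rule AE_lborel_singleton)
  have bd: "AE y in lborel. norm (F y * kdiff R (?d n) (x - y)) \<le> norm (F y * kern R (x - y))" for n
    using AEx
  proof eventually_elim
    case (elim y)
    then show ?case using kdiff_bounds[OF d[of n], of "x - y"] kern_nonneg[of R "x - y"]
      by (simp add: abs_mult mult_left_mono)
  qed
  have meas: "(\<lambda>y. F y * kdiff R (?d n) (x - y)) \<in> borel_measurable lborel" for n
    using assms(2) borel_measurable_test[OF test_shift[OF kdiff_test[OF d]]] by auto
  show "(\<lambda>n. \<integral>y. F y * kdiff R (?d n) (x - y) \<partial>lborel) \<longlonglongrightarrow> pot R F x"
    unfolding pot_def
  proof (rule integral_dominated_convergence[OF _ meas _ _ bd])
    show "integrable lborel (\<lambda>y. norm (F y * kern R (x - y)))" using assms(3) by simp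
    show "AE y in lborel. (\<lambda>n. F y * kdiff R (?d n) (x - y)) \<longlonglongrightarrow> F y * kern R (x - y)"
      using AEx
    proof eventually_elim
      case (elim y)
      have "eventually (\<lambda>n. ?d n < norm (x - y)) sequentially"
        using radii_tendsto_0[of R] elim by (intro order_tendstoD(2)) auto
      then have "eventually (\<lambda>n. F y * kdiff R (?d n) (x - y) = F y * kern R (x - y)) sequentially"
      proof eventually_elim
        case (elim n)
        then show ?case using \<open>y \<noteq> x\<close> kern_eq_0[OF d(1)[of n], of "x - y"] by (simp add: kdiff_def)
      qed
      then show ?case by (rule tendsto_eventually)
    qed
  qed (use assms in measurable)
  have "\<bar>\<integral>y. F y * kdiff R (?d n) (x - y) \<partial>lborel\<bar> \<le> (\<integral>y. norm (F y * kern R (x - y)) \<partial>lborel)"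
    using assms(3) Bochner_Integration.integrable_bound[OF assms(3) meas bd] bd[of n]
    by (intro order_trans[OF integral_abs_bound] integral_mono_AE) auto
  then show "\<bar>\<integral>y. F y * kdiff R (?d n) (x - y) \<partial>lborel\<bar> \<le> (\<integral>y. \<bar>F y\<bar> * kern R (x - y) \<partial>lborel)"
    using kern_nonneg by (simp add: abs_mult)
qed

lemma molconv_tendsto:
  assumes u: "integrable lborel u" and c: "isCont u x" and R: "R > 0"
  shows "(\<lambda>n. molconv (R / real (Suc n)) u x) \<longlonglongrightarrow> u x"
proof (rule LIMSEQ_I)
  fix r :: real assume r: "0 < r"
  let ?d = "\<lambda>n. R / real (Suc n)"
  obtain s where s: "s > 0" "\<And>y. dist y x < s \<Longrightarrow> dist (u y) (u x) < r/2"
    using c r unfolding continuous_at_eps_delta by (metis half_gt_zero)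
  have "eventually (\<lambda>n. ?d n < s) sequentially"
    using radii_tendsto_0[of R] s by (intro order_tendstoD(2)) auto
  then obtain N where N: "\<And>n. n \<ge> N \<Longrightarrow> ?d n < s" by (auto simp: eventually_sequentially)
  have "norm (molconv (?d n) u x - u x) < r" if "n \<ge> N" for n
  proof -
    let ?m = "\<lambda>y. moll (?d n) (x - y)"
    have d: "?d n > 0" using R by simp
    have im: "integrable lborel ?m" using integrable_test[OF test_shift[OF moll_test[OF d]]] .
    have iu: "integrable lborel (\<lambda>y. u y * ?m y)"
      using integrable_mult_test[OF u test_shift[OF moll_test[OF d]]] .
    have m1: "(\<integral>y. ?m y \<partial>lborel) = 1" using integral_lborel_reflect[of "moll (?d n)" x] moll_integral[OF d] by simp
    have "molconv (?d n) u x - u x = (\<integral>y. (u y - u x) * ?m y \<partial>lborel)"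
      using iu im m1 by (simp add: molconv_def left_diff_distrib)
    also have "\<bar>\<dots>\<bar> \<le> (\<integral>y. r/2 * ?m y \<partial>lborel)"
    proof (rule order_trans[OF integral_abs_bound], rule integral_mono)
      show "integrable lborel (\<lambda>y. \<bar>(u y - u x) * ?m y\<bar>)" using iu im by (simp add: left_diff_distrib)
      show "integrable lborel (\<lambda>y. r/2 * ?m y)" using im by simp
      show "\<bar>(u y - u x) * ?m y\<bar> \<le> r/2 * ?m y" for y
      proof (cases "norm (x - y) < ?d n")
        case True
        then have "dist (u y) (u x) < r/2" using N[OF that] by (intro s(2)) (simp add: dist_norm norm_minus_commute)
        then have "\<bar>u y - u x\<bar> * ?m y \<le> r/2 * ?m y"
          using moll_nonneg[of "?d n" "x - y"] by (intro mult_right_mono) (auto simp: dist_real_def)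
        then show ?thesis using moll_nonneg[of "?d n" "x - y"] by (simp add: abs_mult)
      next
        case False
        then show ?thesis using moll_eq_0[OF d, of "x - y"] by simp
      qed
    qed
    also have "\<dots> = r / 2" using m1 by simp
    finally show ?thesis using r by simp
  qed
  then show "\<exists>N. \<forall>n\<ge>N. norm (molconv (?d n) u x - u x) < r" by blast
qed

lemma representation_continuous:
  assumes w: "wlap D u F" and R: "R > 0" "cball x R \<subseteq> D" and c: "isCont u x"
    and int: "integrable lborel (\<lambda>y. F y * kern R (x - y))"
  shows "u x = molconv R u x + pot R F x"
proof -
  let ?d = "\<lambda>n. R / real (Suc n)"
  have d: "0 < ?d n" "?d n \<le> R" for n
    using R by (auto simp: divide_le_eq mult_le_cancel_left1)
  have "(\<lambda>n. molconv (?d n) u x - (\<integral>y. F y * kdiff R (?d n) (x - y) \<partial>lborel)) \<longlonglongrightarrow> u x - pot R F x"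
    using R wlapD(2)[OF w] int by (intro tendsto_diff molconv_tendsto[OF wlapD(1)[OF w] c] pot_limit) auto
  moreover have "molconv (?d n) u x - (\<integral>y. F y * kdiff R (?d n) (x - y) \<partial>lborel) = molconv R u x" for n
    using wlap_mollifier_difference[OF w d R(2)] by simp
  ultimately have "molconv R u x = u x - pot R F x" by (simp add: LIMSEQ_const_iff)
  then show ?thesis by simp
qed

text \<open>Inner regularity: the set where \<open>g\<close> is positive is exhausted up to small
  measure by compact sets, and each of these is null because the integral of \<open>g\<close> over
  it vanishes. The same applies to \<open>- g\<close>.\<close>

lemma AE_eq_0_if_compact_integrals_eq_0:
  fixes g :: "'a::euclidean_space \<Rightarrow> real"
  assumes g: "integrable lborel g" and S: "S \<in> sets borel"
    and 0: "\<And>C. compact C \<Longrightarrow> C \<subseteq> S \<Longrightarrow> (\<integral>x. indicator C x * g x \<partial>lborel) = 0"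
  shows "AE x in lborel. x \<in> S \<longrightarrow> g x = 0"
proof -
  have main: "AE x in lborel. \<not> (x \<in> S \<and> h x > 0)"
    if h: "integrable lborel h" and 0: "\<And>C. compact C \<Longrightarrow> C \<subseteq> S \<Longrightarrow> (\<integral>x. indicator C x * h x \<partial>lborel) = 0" for h :: "'a \<Rightarrow> real"
  proof -
    note [measurable] = borel_measurable_integrable[OF h] S
    define A where "A = {x\<in>S. h x > 0}"
    have A [measurable]: "A \<in> sets borel" unfolding A_def by measurable
    have cpt: "emeasure lborel C = 0" if C: "compact C" "C \<subseteq> A" for C
    proof -
      have [measurable]: "C \<in> sets borel" using C by (simp add: compact_imp_closed)
      have "integrable lborel (\<lambda>x. indicator C x * h x)"
        using integrable_mult_indicator[of C lborel h] h by simp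
      moreover have "AE x in lborel. 0 \<le> indicator C x * h x"
        using C(2) by (intro AE_I2) (auto simp: indicator_def A_def)
      moreover have "(\<integral>x. indicator C x * h x \<partial>lborel) = 0" using C by (intro 0) (auto simp: A_def)
      ultimately have "AE x in lborel. indicator C x * h x = 0"
        using integral_nonneg_eq_0_iff_AE by blast
      then have "AE x in lborel. x \<notin> C"
      proof eventually_elim
        case (elim x)
        then show ?case using C(2) by (auto simp: A_def)
      qed
      then show ?thesis using AE_iff_null_sets[of C lborel] by auto
    qed
    have le: "emeasure lborel A \<le> ennreal e" if e: "e > 0" for e
    proof -
      obtain T where T: "closed T" "T \<subseteq> A" "A - T \<in> lmeasurable" "emeasure lebesgue (A - T) < ennreal e"
        by (rule sets_lebesgue_inner_closed[of A e]) (use A e in auto)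
      have "emeasure lborel (T \<inter> cball 0 (real n)) = 0" for n
        by (rule cpt) (use T in \<open>auto intro: closed_Int_compact\<close>)
      moreover have "T = (\<Union>n. T \<inter> cball 0 (real n))" using real_arch_simple by auto
      moreover have "emeasure lborel (\<Union>n. T \<inter> cball 0 (real n)) \<le> (\<Sum>n. emeasure lborel (T \<inter> cball 0 (real n)))"
        by (rule emeasure_subadditive_countably) (use T in \<open>auto simp: closed_Int borel_closed\<close>)
      ultimately have "emeasure lborel T = 0" by simp
      moreover have "emeasure lborel A \<le> emeasure lborel T + emeasure lborel (A - T)"
        using emeasure_subadditive[of T lborel "A - T"] T A by (auto simp: Un_absorb1 borel_closed)
      moreover have "emeasure lborel (A - T) = emeasure lebesgue (A - T)"
        using T A by (simp add: borel_closed)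
      ultimately show ?thesis using T(4) by auto
    qed
    have "emeasure lborel A \<le> 0"
    proof (rule ennreal_le_epsilon)
      fix e :: real assume "0 < e"
      then show "emeasure lborel A \<le> 0 + ennreal e" using le by simp
    qed
    then have "emeasure lborel A = 0" by simp
    then have "AE x in lborel. x \<notin> A" using AE_iff_null_sets[of A lborel] A by auto
    then show ?thesis by (simp add: A_def)
  qed
  have "AE x in lborel. \<not> (x \<in> S \<and> g x > 0)" "AE x in lborel. \<not> (x \<in> S \<and> - g x > 0)"
    using main[OF g 0] main[of "\<lambda>x. - g x"] g 0 by simp_all
  then show ?thesis by eventually_elim auto
qed

text \<open>Without continuity the mollifications of \<open>u\<close> have no evident pointwise
  limit. The identity is therefore integrated against a continuous \<open>w\<close>, and Fubini
  moves the mollifier from \<open>u\<close> to \<open>w\<close>, where it converges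
  everywhere.\<close>

lemma representation_AE:
  assumes w: "wlap D u F" and R: "R > 0" and S: "open S" "\<And>x. x \<in> S \<Longrightarrow> cball x R \<subseteq> D"
  shows "AE x in lborel. x \<in> S \<longrightarrow> u x = molconv R u x + pot R F x"
proof -
  let ?d = "\<lambda>n. R / real (Suc n)"
  have d: "0 < ?d n" "?d n \<le> R" for n
    using R by (auto simp: divide_le_eq mult_le_cancel_left1)
  note iu = wlapD(1)[OF w] and iF = wlapD(2)[OF w]
  note [measurable] = borel_measurable_integrable[OF iu] borel_measurable_integrable[OF iF]
  have ik: "integrable lborel (kern R)" using kern_integrable R by blast
  have im: "integrable lborel (molconv (?d n) u)" for n
    unfolding molconv_def[abs_def] by (rule convolution_integrable'(1)[OF iu moll_integrable[OF d(1)]])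
  have imR: "integrable lborel (molconv R u)"
    unfolding molconv_def[abs_def] by (rule convolution_integrable'(1)[OF iu moll_integrable[OF R]])
  have ip: "integrable lborel (pot R F)"
    unfolding pot_def[abs_def] by (rule convolution_integrable'(1)[OF iF ik])
  have iP: "integrable lborel (\<lambda>x. \<integral>y. \<bar>F y\<bar> * kern R (x - y) \<partial>lborel)"
    using convolution_integrable'(1)[OF integrable_abs[OF iF] ik] .
  define g where "g x = u x - molconv R u x - pot R F x" for x
  have ig: "integrable lborel g" unfolding g_def[abs_def] using iu imR ip by auto
  have test: "(\<integral>x. w x * g x \<partial>lborel) = 0"
    if w: "continuous_on UNIV w" "\<And>x. \<bar>w x\<bar> \<le> B" "\<And>x. x \<notin> S \<Longrightarrow> w x = 0" and iw: "integrable lborel w" for w B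
  proof -
    have [measurable]: "w \<in> borel_measurable borel" using w(1) borel_measurable_continuous_onI by blast
    let ?q = "\<lambda>n x. \<integral>y. F y * kdiff R (?d n) (x - y) \<partial>lborel"
    have eq: "w x * ?q n x = w x * molconv (?d n) u x - w x * molconv R u x" for n x
    proof (cases "x \<in> S")
      case True
      show ?thesis using wlap_mollifier_difference[OF \<open>wlap D u F\<close> d(1)[of n] d(2)[of n] S(2)[OF True]]
        by (simp only: right_diff_distrib)
    qed (simp add: w(3))
    have iwf: "integrable lborel (\<lambda>x. w x * f x)" if "integrable lborel f" for f
      using integrable_mult_bounded[OF that _ w(2)] by (simp add: mult.commute)
    have 1: "(\<lambda>n. \<integral>x. w x * ?q n x \<partial>lborel) \<longlonglongrightarrow> (\<integral>x. w x * pot R F x \<partial>lborel)"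
    proof (rule integral_dominated_convergence)
      show "integrable lborel (\<lambda>x. \<bar>w x * (\<integral>y. \<bar>F y\<bar> * kern R (x - y) \<partial>lborel)\<bar>)" using iwf[OF iP] by simp
      have AE: "AE x in lborel. integrable lborel (\<lambda>y. F y * kern R (x - y))"
        by (rule convolution_integrable'(2)[OF iF ik])
      show "AE x in lborel. (\<lambda>n. w x * ?q n x) \<longlonglongrightarrow> w x * pot R F x"
        using AE by eventually_elim (intro tendsto_mult_left pot_limit[OF R]; simp)
      show "AE x in lborel. norm (w x * ?q n x) \<le> \<bar>w x * (\<integral>y. \<bar>F y\<bar> * kern R (x - y) \<partial>lborel)\<bar>" for n
        using AE
      proof eventually_elim
        case (elim x)
        have "\<bar>?q n x\<bar> \<le> (\<integral>y. \<bar>F y\<bar> * kern R (x - y) \<partial>lborel)" by (rule pot_limit[OF R _ elim]) simp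
        then have "\<bar>w x\<bar> * \<bar>?q n x\<bar> \<le> \<bar>w x\<bar> * \<bar>\<integral>y. \<bar>F y\<bar> * kern R (x - y) \<partial>lborel\<bar>"
          by (intro mult_left_mono) auto
        then show ?case by (simp add: abs_mult)
      qed
      show "(\<lambda>x. w x * ?q n x) \<in> borel_measurable lborel" for n
        unfolding eq using borel_measurable_integrable[OF im[of n]] borel_measurable_integrable[OF imR] by measurable
      show "(\<lambda>x. w x * pot R F x) \<in> borel_measurable lborel"
        using borel_measurable_integrable[OF ip] by measurable
    qed
    have 2: "(\<lambda>n. \<integral>x. w x * molconv (?d n) u x \<partial>lborel) \<longlonglongrightarrow> (\<integral>x. u x * w x \<partial>lborel)"
    proof -
      \<comment> \<open>The mollifier is even, so convolution with it is its own adjoint.\<close>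
      have F: "(\<integral>x. w x * molconv (?d n) u x \<partial>lborel) = (\<integral>y. u y * molconv (?d n) w y \<partial>lborel)" for n
      proof -
        have "moll (?d n) (x - y) = moll (?d n) (y - x)" for x y :: "real^2"
          using moll_minus[of "?d n" "x - y"] by simp
        then show ?thesis
          unfolding molconv_def using convolution_Fubini[OF iu moll_integrable[OF d(1)[of n]] _ w(2)] by simp
      qed
      have B: "\<bar>molconv (?d n) w y\<bar> \<le> B" for n y
      proof -
        have im: "integrable lborel (\<lambda>x. moll (?d n) (y - x))" using integrable_test[OF test_shift[OF moll_test[OF d(1)]]] .
        have "\<bar>molconv (?d n) w y\<bar> \<le> (\<integral>x. B * moll (?d n) (y - x) \<partial>lborel)"
          unfolding molconv_def
        proof (rule order_trans[OF integral_abs_bound], rule integral_mono)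
          show "integrable lborel (\<lambda>x. \<bar>w x * moll (?d n) (y - x)\<bar>)"
            using integrable_mult_bounded[OF im _ w(2)] by (simp add: mult.commute)
          show "\<bar>w x * moll (?d n) (y - x)\<bar> \<le> B * moll (?d n) (y - x)" for x
            using w(2)[of x] moll_nonneg[of "?d n" "y - x"] by (simp add: abs_mult mult_right_mono)
        qed (use im in simp)
        also have "\<dots> = B" using integral_lborel_reflect[of "moll (?d n)" y] moll_integral[OF d(1)] by simp
        finally show ?thesis .
      qed
      have mw [measurable]: "molconv (?d n) w \<in> borel_measurable borel" for n
        using test_convolution(1)[OF iw moll_test[OF d(1)]] borel_measurable_continuous_onI unfolding molconv_def[abs_def] by blast
      show ?thesis unfolding F
      proof (rule integral_dominated_convergence[where w="\<lambda>y. \<bar>u y\<bar> * B"])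
        show "AE y in lborel. (\<lambda>n. u y * molconv (?d n) w y) \<longlonglongrightarrow> u y * w y"
          using w(1) by (intro AE_I2 tendsto_mult_left molconv_tendsto[OF iw _ R]) (simp add: continuous_on_eq_continuous_at)
        show "AE y in lborel. norm (u y * molconv (?d n) w y) \<le> \<bar>u y\<bar> * B" for n
          using B by (intro AE_I2) (simp add: abs_mult mult_left_mono)
        show "(\<lambda>y. u y * molconv (?d n) w y) \<in> borel_measurable lborel" for n
          using mw[of n] by simp
      qed (use iu in auto)
    qed
    have "(\<integral>x. w x * ?q n x \<partial>lborel) = (\<integral>x. w x * molconv (?d n) u x \<partial>lborel) - (\<integral>x. w x * molconv R u x \<partial>lborel)" for n
      unfolding eq using iwf[OF im] iwf[OF imR] by simp
    with 1 have "(\<lambda>n. (\<integral>x. w x * molconv (?d n) u x \<partial>lborel) - (\<integral>x. w x * molconv R u x \<partial>lborel)) \<longlonglongrightarrow> (\<integral>x. w x * pot R F x \<partial>lborel)"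
      by simp
    moreover have "(\<lambda>n. (\<integral>x. w x * molconv (?d n) u x \<partial>lborel) - (\<integral>x. w x * molconv R u x \<partial>lborel)) \<longlonglongrightarrow>
        (\<integral>x. u x * w x \<partial>lborel) - (\<integral>x. w x * molconv R u x \<partial>lborel)"
      using 2 by (intro tendsto_intros)
    ultimately have "(\<integral>x. w x * pot R F x \<partial>lborel) = (\<integral>x. u x * w x \<partial>lborel) - (\<integral>x. w x * molconv R u x \<partial>lborel)"
      using LIMSEQ_unique by blast
    then show ?thesis
      using iwf[OF iu] iwf[OF imR] iwf[OF ip] by (simp add: g_def right_diff_distrib mult.commute)
  qed
  have "AE x in lborel. x \<in> S \<longrightarrow> g x = 0"
  proof (rule AE_eq_0_if_compact_integrals_eq_0[OF ig])
    fix C assume C: "compact C" "C \<subseteq> S"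
    show "(\<integral>x. indicator C x * g x \<partial>lborel) = 0"
    proof (cases "C = {}")
      case False
      \<comment> \<open>Continuous functions between 0 and 1 that decrease to the indicator of
        \<open>C\<close>; as soon as \<open>n > 1 / e\<close> they are supported in the closed
        \<open>e\<close>-neighbourhood of \<open>C\<close>, which lies in \<open>S\<close>.\<close>
      define h where "h n x = max 0 (1 - real n * infdist x C)" for n x
      obtain e where e: "e > 0" "\<And>x. infdist x C \<le> e \<Longrightarrow> x \<in> S" "compact {x. infdist x C \<le> e}"
      proof -
        obtain e where e: "e > 0" "{x. infdist x C \<le> e} \<subseteq> S"
          using compact_in_open_separated[OF False C(1) S(1) C(2)] by auto
        then show ?thesis using that[of e] compact_infdist_le[OF False C(1), of e] by auto
      qed
      have h0: "h n x = 0" if "infdist x C > e" "real n > 1 / e" for n x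
      proof -
        have "1 < real n * e" using that e by (simp add: field_simps)
        also have "\<dots> \<le> real n * infdist x C" using that by (intro mult_left_mono) auto
        finally show ?thesis by (simp add: h_def)
      qed
      obtain N where N: "real N > 1 / e" using reals_Archimedean2 by blast
      have hc: "continuous_on UNIV (h n)" for n unfolding h_def[abs_def] by (intro continuous_intros)
      have hb: "\<bar>h n x\<bar> \<le> 1" for n x by (auto simp: h_def infdist_nonneg)
      have ih: "integrable lborel (h n)" if "n \<ge> N" for n
      proof -
        have n: "real n > 1 / e" using N that by (meson less_le_trans of_nat_mono)
        have "integrable lborel (\<lambda>x. indicator {x. infdist x C \<le> e} x *\<^sub>R h n x)"
          using e(3) continuous_on_subset[OF hc] by (intro borel_integrable_compact) auto
        moreover have "(\<lambda>x. indicator {x. infdist x C \<le> e} x *\<^sub>R h n x) = h n"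
          using h0[OF _ n] by (auto simp: fun_eq_iff indicator_def not_le)
        ultimately show ?thesis by simp
      qed
      have z: "(\<integral>x. h n x * g x \<partial>lborel) = 0" if "n \<ge> N" for n
      proof (rule test[OF hc hb _ ih[OF that]])
        have n: "real n > 1 / e" using N that by (meson less_le_trans of_nat_mono)
        show "h n x = 0" if "x \<notin> S" for x using h0[OF _ n] e(2)[of x] that by force
      qed
      have [measurable]: "h n \<in> borel_measurable borel" for n using hc borel_measurable_continuous_onI by blast
      note [measurable] = borel_measurable_integrable[OF ig]
      have [measurable]: "C \<in> sets borel" using C by (simp add: compact_imp_closed)
      have "(\<lambda>n. \<integral>x. h n x * g x \<partial>lborel) \<longlonglongrightarrow> (\<integral>x. indicator C x * g x \<partial>lborel)"
      proof (rule integral_dominated_convergence[where w="\<lambda>x. \<bar>g x\<bar>"])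
        show "AE x in lborel. (\<lambda>n. h n x * g x) \<longlonglongrightarrow> indicator C x * g x"
        proof (intro AE_I2 tendsto_mult_right)
          fix x
          show "(\<lambda>n. h n x) \<longlonglongrightarrow> indicator C x"
          proof (cases "x \<in> C")
            case True
            then show ?thesis by (simp add: h_def)
          next
            case False
            then have p: "infdist x C > 0"
              using C \<open>C \<noteq> {}\<close> by (metis compact_imp_closed in_closed_iff_infdist_zero infdist_nonneg less_eq_real_def)
            obtain M where M: "real M > 1 / infdist x C" using reals_Archimedean2 by blast
            have "h n x = 0" if "n \<ge> M" for n
            proof -
              have "1 < real M * infdist x C" using M p by (simp add: field_simps)
              also have "\<dots> \<le> real n * infdist x C" using that p by (intro mult_right_mono) auto
              finally show ?thesis by (simp add: h_def)
            qed
            then show ?thesis using False by (intro tendsto_eventually) (auto simp: eventually_sequentially)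
          qed
        qed
        show "AE x in lborel. norm (h n x * g x) \<le> \<bar>g x\<bar>" for n
          using hb by (intro AE_I2) (simp add: abs_mult mult_left_le_one_le)
      qed (use ig in auto)
      moreover have "(\<lambda>n. \<integral>x. h n x * g x \<partial>lborel) \<longlonglongrightarrow> 0"
        using z by (intro tendsto_eventually) (auto simp: eventually_sequentially)
      ultimately show ?thesis using LIMSEQ_unique by blast
    qed simp
  qed (use S in auto)
  then show ?thesis by eventually_elim (auto simp: g_def)
qed

subsection \<open>Integration by parts against test functions\<close>

text \<open>Lebesgue measure is translation invariant, so every difference quotient has integral 0;
  the Lipschitz bound and the compact support dominate the passage to the limit.\<close>

lemma integral_partial_deriv_test:
  fixes p :: "'a::euclidean_space \<Rightarrow> real"
  assumes p: "p \<in> test_functions UNIV" and e: "e \<in> Basis"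
  shows "(\<integral>x. partial_deriv e p x \<partial>lborel) = 0"
proof -
  obtain K where K: "compact K" "\<And>x. x \<notin> K \<Longrightarrow> p x = 0" using test_functionsD[OF p] by auto
  obtain r where r: "K \<subseteq> cball 0 r"
    using compact_imp_bounded[OF K(1)] unfolding bounded_iff by (auto simp: subset_iff)
  obtain L where L: "0 \<le> L" "\<And>x y. \<bar>p x - p y\<bar> \<le> L * norm (x - y)"
    using test_functions_Lipschitz[OF p] by blast
  define h where "h n = 1 / real (Suc n)" for n
  have h: "0 < h n" "h n \<le> 1" "h \<longlonglongrightarrow> 0" for n
    using LIMSEQ_inverse_real_of_nat by (auto simp: h_def[abs_def] inverse_eq_divide)
  have ip: "integrable lborel p" using integrable_test[OF p] .
  have ish: "integrable lborel (\<lambda>x. p (x + h n *\<^sub>R e))" for n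
    using integrable_lborel_affine[OF ip, of 1 "h n *\<^sub>R e"] by (simp add: add.commute)
  have 0: "(\<integral>x. (p (x + h n *\<^sub>R e) - p x) / h n \<partial>lborel) = 0" for n
    using integral_lborel_affine[OF ip, of 1 "h n *\<^sub>R e"] ip ish by (simp add: add.commute)
  have [measurable]: "p \<in> borel_measurable borel" "partial_deriv e p \<in> borel_measurable borel"
    using borel_measurable_test[OF p] borel_measurable_test[OF test_functions_partial_deriv[OF p e]] .
  have "(\<lambda>n. \<integral>x. (p (x + h n *\<^sub>R e) - p x) / h n \<partial>lborel) \<longlonglongrightarrow> (\<integral>x. partial_deriv e p x \<partial>lborel)"
  proof (rule integral_dominated_convergence[where w="\<lambda>x. L * indicator (cball 0 (r + 1)) x"])
    show "integrable lborel (\<lambda>x. L * indicator (cball 0 (r + 1)) (x::'a))"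
      by (intro integrable_mult_right integrable_real_indicator emeasure_bounded_finite) auto
    show "AE x in lborel. (\<lambda>n. (p (x + h n *\<^sub>R e) - p x) / h n) \<longlonglongrightarrow> partial_deriv e p x"
    proof (rule AE_I2)
      fix x
      have "(p has_derivative (\<lambda>h. \<Sum>e\<in>Basis. (h \<bullet> e) * partial_deriv e p x)) (at x)"
        using has_derivative_partial_deriv smooth_on_differentiable[OF test_functionsD(1)[OF p]] by blast
      then have "((\<lambda>t. p (x + t *\<^sub>R e)) has_derivative (\<lambda>t. \<Sum>b\<in>Basis. ((t *\<^sub>R e) \<bullet> b) * partial_deriv b p x)) (at 0)"
        by (intro has_derivative_compose[of "\<lambda>t. x + t *\<^sub>R e" "\<lambda>t. t *\<^sub>R e" 0 UNIV p])
           (auto intro!: derivative_eq_intros)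
      moreover have "(\<Sum>b\<in>Basis. ((t *\<^sub>R e) \<bullet> b) * partial_deriv b p x) = partial_deriv e p x * t" for t
        using e by (simp add: inner_Basis if_distrib if_distribR sum.delta' cong: if_cong)
      ultimately have "((\<lambda>t. p (x + t *\<^sub>R e)) has_real_derivative partial_deriv e p x) (at 0)"
        by (simp add: has_field_derivative_def)
      then have "((\<lambda>t. (p (x + t *\<^sub>R e) - p x) / t) \<longlongrightarrow> partial_deriv e p x) (at 0)"
        by (simp add: DERIV_def)
      moreover have "filterlim h (at 0) sequentially"
        unfolding filterlim_at using h(1,3) by (simp add: less_imp_neq[symmetric])
      ultimately show "(\<lambda>n. (p (x + h n *\<^sub>R e) - p x) / h n) \<longlonglongrightarrow> partial_deriv e p x"
        using filterlim_compose by fast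
    qed
    show "AE x in lborel. norm ((p (x + h n *\<^sub>R e) - p x) / h n) \<le> L * indicator (cball 0 (r + 1)) x" for n
    proof (rule AE_I2)
      fix x
      show "norm ((p (x + h n *\<^sub>R e) - p x) / h n) \<le> L * indicator (cball 0 (r + 1)) x"
      proof (cases "x \<in> cball 0 (r + 1)")
        case True
        have "\<bar>p (x + h n *\<^sub>R e) - p x\<bar> \<le> L * h n" using L(2)[of "x + h n *\<^sub>R e" x] h(1)[of n] e by simp
        then show ?thesis using True h(1)[of n] by (simp add: field_simps)
      next
        case False
        have "norm x \<le> norm (x + h n *\<^sub>R e) + norm (h n *\<^sub>R e)"
          by (metis add_diff_cancel norm_triangle_ineq4)
        then have "norm (x + h n *\<^sub>R e) > r" using False h(1,2)[of n] e by simp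
        then have "p (x + h n *\<^sub>R e) = 0" "p x = 0" using r False by (auto intro!: K(2))
        then show ?thesis using L(1) by simp
      qed
    qed
  qed auto
  then have "(\<lambda>n. 0) \<longlonglongrightarrow> (\<integral>x. partial_deriv e p x \<partial>lborel)" unfolding 0 .
  then show ?thesis by (simp add: LIMSEQ_const_iff)
qed

text \<open>The function \<open>g\<close> is smooth on \<open>S\<close> only, but its products with
  test functions of \<open>S\<close> extend smoothly by zero. Then the integral of the derivative of
  a product vanishes.\<close>

lemma integral_by_parts_test:
  fixes \<phi> g :: "'a::euclidean_space \<Rightarrow> real"
  assumes S: "open S" and \<phi>: "\<phi> \<in> test_functions S" and g: "smooth_on S g" and e: "e \<in> Basis"
  shows "integrable lborel (\<lambda>x. \<phi> x * partial_deriv e g x)"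
    and "(\<integral>x. \<phi> x * partial_deriv e g x \<partial>lborel) = - (\<integral>x. partial_deriv e \<phi> x * g x \<partial>lborel)"
proof -
  obtain K where K: "compact K" "K \<subseteq> S" "\<And>x. x \<notin> K \<Longrightarrow> \<phi> x = 0" using test_functionsD[OF \<phi>] by auto
  have s\<phi>: "smooth_on S \<phi>" using test_functionsD(1)[OF \<phi>] smooth_on_subset by blast
  have ext: "(\<lambda>x. if x \<in> S then f x * q x else 0) \<in> test_functions UNIV"
    if "f \<in> test_functions S" "\<And>x. x \<notin> K \<Longrightarrow> f x = 0" "smooth_on S q" for f q
    using that K smooth_on_subset[OF test_functionsD(1)[OF that(1)], of S] S
    by (intro test_functions_extend[of _ _ K]) auto
  have z: "partial_deriv e \<phi> x = 0" if "x \<notin> K" for x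
    by (rule partial_deriv_eq_0[OF K(1,3) that])
  have 1: "(\<lambda>x. if x \<in> S then \<phi> x * partial_deriv e g x else 0) = (\<lambda>x. \<phi> x * partial_deriv e g x)"
    "(\<lambda>x. if x \<in> S then partial_deriv e \<phi> x * g x else 0) = (\<lambda>x. partial_deriv e \<phi> x * g x)"
    "(\<lambda>x. if x \<in> S then \<phi> x * g x else 0) = (\<lambda>x. \<phi> x * g x)"
    using K(2,3) z by (auto simp: fun_eq_iff)
  have t1: "(\<lambda>x. \<phi> x * partial_deriv e g x) \<in> test_functions UNIV"
    using ext[OF \<phi> K(3) smooth_on_partial_deriv[OF e g]] unfolding 1 .
  have t2: "(\<lambda>x. partial_deriv e \<phi> x * g x) \<in> test_functions UNIV"
    using ext[OF test_functions_partial_deriv[OF \<phi> e] z g] unfolding 1 .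
  have t3: "(\<lambda>x. \<phi> x * g x) \<in> test_functions UNIV" using ext[OF \<phi> K(3) g] unfolding 1 .
  have "partial_deriv e (\<lambda>x. \<phi> x * g x) x = \<phi> x * partial_deriv e g x + partial_deriv e \<phi> x * g x" for x
  proof (cases "x \<in> S")
    case True
    then show ?thesis using smooth_on_differentiable[OF s\<phi>] smooth_on_differentiable[OF g]
      by (intro partial_deriv_mult) auto
  next
    case False
    then have "x \<notin> K" using K by auto
    then show ?thesis using partial_deriv_eq_0[OF K(1), of "\<lambda>x. \<phi> x * g x" x e] K(3) z by auto
  qed
  then have "(\<integral>x. \<phi> x * partial_deriv e g x + partial_deriv e \<phi> x * g x \<partial>lborel) = 0"
    using integral_partial_deriv_test[OF t3 e] by simp
  then show "(\<integral>x. \<phi> x * partial_deriv e g x \<partial>lborel) = - (\<integral>x. partial_deriv e \<phi> x * g x \<partial>lborel)"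
    using integrable_test[OF t1] integrable_test[OF t2] by simp
  show "integrable lborel (\<lambda>x. \<phi> x * partial_deriv e g x)" using integrable_test[OF t1] .
qed

lemma integral_laplacian_by_parts:
  fixes \<phi> g :: "'a::euclidean_space \<Rightarrow> real"
  assumes S: "open S" and \<phi>: "\<phi> \<in> test_functions S" and g: "smooth_on S g"
  shows "(\<integral>x. \<phi> x * laplacian g x \<partial>lborel) = - (\<Sum>e\<in>Basis. \<integral>x. partial_deriv e \<phi> x * partial_deriv e g x \<partial>lborel)"
proof -
  have "(\<integral>x. \<phi> x * laplacian g x \<partial>lborel) = (\<Sum>e\<in>Basis. \<integral>x. \<phi> x * partial_deriv e (partial_deriv e g) x \<partial>lborel)"
    unfolding laplacian_def sum_distrib_left
    by (rule Bochner_Integration.integral_sum)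
       (rule integral_by_parts_test(1)[OF S \<phi> smooth_on_partial_deriv[OF _ g]])
  also have "\<dots> = (\<Sum>e\<in>Basis. - (\<integral>x. partial_deriv e \<phi> x * partial_deriv e g x \<partial>lborel))"
    by (rule sum.cong[OF refl]) (rule integral_by_parts_test(2)[OF S \<phi> smooth_on_partial_deriv[OF _ g]])
  finally show ?thesis by (simp add: sum_negf)
qed

lemma wlap_test:
  assumes "\<phi> \<in> test_functions UNIV"
  shows "wlap UNIV \<phi> (\<lambda>x. - laplacian \<phi> x)"
  unfolding wlap_def
proof (intro conjI ballI)
  show "integrable lborel \<phi>" "integrable lborel (\<lambda>x. - laplacian \<phi> x)"
    using integrable_test[OF assms] integrable_test[OF test_functions_laplacian[OF assms]] by auto
  fix \<psi> :: "real^2 \<Rightarrow> real" assume \<psi>: "\<psi> \<in> test_functions UNIV"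
  show "- (\<integral>x. \<phi> x * laplacian \<psi> x \<partial>lborel) = (\<integral>x. - laplacian \<phi> x * \<psi> x \<partial>lborel)"
    using integral_laplacian_by_parts[OF open_UNIV assms test_functionsD(1)[OF \<psi>]]
      integral_laplacian_by_parts[OF open_UNIV \<psi> test_functionsD(1)[OF assms]]
    by (simp add: mult.commute)
qed

lemma bounded_mult_kern_integrable:
  assumes "R > 0" "F \<in> borel_measurable borel" "\<And>y. \<bar>F y\<bar> \<le> C"
  shows "integrable lborel (\<lambda>y. F y * kern R (x - y))"
  using integrable_mult_bounded[OF _ assms(2,3), of "\<lambda>y. kern R (x - y)"]
    integrable_lborel_reflect[of "kern R" x] kern_integrable[OF assms(1)] by (simp add: mult.commute)

text \<open>Two points of the ball of radius \<open>R/4\<close> are closer than \<open>R/2\<close>,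
  and at such distances \<open>moll R\<close> vanishes, so the smooth error of the truncated kernel
  is not felt. By the symmetry of the kernel the claim reduces to the representation formula for
  test functions.\<close>

lemma wlap_pot:
  assumes R: "R > 0" and D: "D \<subseteq> ball 0 (R/4)" and f: "integrable lborel f" "\<And>x. x \<notin> ball 0 (R/4) \<Longrightarrow> f x = 0"
  shows "wlap D (pot R f) f"
  unfolding wlap_def
proof (intro conjI ballI f(1))
  have ik: "integrable lborel (kern R)" using kern_integrable R by blast
  show "integrable lborel (pot R f)" unfolding pot_def[abs_def] by (rule convolution_integrable'(1)[OF f(1) ik])
  fix \<phi> :: "real^2 \<Rightarrow> real" assume \<phi>: "\<phi> \<in> test_functions D"
  then have \<phi>': "\<phi> \<in> test_functions UNIV" using test_functions_mono by blast
  have l: "laplacian \<phi> \<in> test_functions UNIV" using test_functions_laplacian[OF \<phi>'] .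
  obtain C where C: "\<And>x. \<bar>laplacian \<phi> x\<bar> \<le> C" using test_functions_bounded[OF l] by blast
  have "kern R (x - y) = kern R (y - x)" for x y :: "real^2" using kern_minus[of R "x - y"] by simp
  then have "(\<integral>x. laplacian \<phi> x * pot R f x \<partial>lborel) = (\<integral>y. f y * pot R (laplacian \<phi>) y \<partial>lborel)"
    using convolution_Fubini[OF f(1) ik borel_measurable_test[OF l] C] by (simp add: pot_def)
  also have "\<dots> = (\<integral>y. - (f y * \<phi> y) \<partial>lborel)"
  proof (rule Bochner_Integration.integral_cong[OF refl])
    fix y
    show "f y * pot R (laplacian \<phi>) y = - (f y * \<phi> y)"
    proof (cases "y \<in> ball 0 (R/4)")
      case True
      have "isCont \<phi> y"
        using smooth_on_continuous[OF test_functionsD(1)[OF \<phi>]] by (simp add: continuous_on_eq_continuous_at)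
      moreover have "integrable lborel (\<lambda>x. - laplacian \<phi> x * kern R (y - x))"
        using bounded_mult_kern_integrable[OF R borel_measurable_test[OF l] C, of y] by simp
      ultimately have "\<phi> y = molconv R \<phi> y + pot R (\<lambda>x. - laplacian \<phi> x) y"
        by (intro representation_continuous[OF wlap_test[OF \<phi>'] R]) auto
      moreover have "molconv R \<phi> y = 0"
      proof -
        have "\<phi> x * moll R (y - x) = 0" for x
        proof (cases "x \<in> D")
          case True
          have "norm (y - x) \<le> norm y + norm x" by (rule norm_triangle_ineq4)
          also have "\<dots> \<le> R/2" using True D \<open>y \<in> ball 0 (R/4)\<close> by force
          finally show ?thesis using moll_eq_0_inner R by simp
        next
          case False
          then show ?thesis using test_functionsD(2)[OF \<phi>] by auto
        qed
        then show ?thesis unfolding molconv_def by (simp only: integral_zero)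
      qed
      moreover have "pot R (\<lambda>x. - laplacian \<phi> x) y = - pot R (laplacian \<phi>) y" by (simp add: pot_def)
      ultimately show ?thesis by simp
    qed (use f(2) in simp)
  qed
  finally show "- (\<integral>x. pot R f x * laplacian \<phi> x \<partial>lborel) = (\<integral>x. f x * \<phi> x \<partial>lborel)"
    by (simp add: mult.commute)
qed

subsection \<open>The maximum principle\<close>

lemma integral_nonpos_AE: "AE x in M. f x \<le> (0::real) \<Longrightarrow> (\<integral>x. f x \<partial>M) \<le> 0"
  using integral_nonneg_AE[where f="\<lambda>x. - f x" and M=M] by simp

text \<open>The last integral is strictly negative as soon as \<open>F < 0\<close>; this replaces the strong maximum
  principle below.\<close>

lemma mean_value_inequality:
  assumes w: "wlap D u F" and F: "AE y in lborel. y \<in> D \<longrightarrow> F y \<le> 0"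
    and R: "R > 0" "cball x R \<subseteq> D" and c: "isCont u x"
  shows "u x \<le> molconv R u x + (\<integral>y. F y * kdiff R (R/2) (x - y) \<partial>lborel)"
proof -
  let ?d = "\<lambda>n. R / real (Suc n)"
  have d: "0 < ?d n" "?d n \<le> R" for n
    using R by (auto simp: divide_le_eq mult_le_cancel_left1)
  have "molconv (?d n) u x \<le> molconv R u x + (\<integral>y. F y * kdiff R (R/2) (x - y) \<partial>lborel)" if "n \<ge> 1" for n
  proof -
    have "(\<integral>y. F y * kdiff R (?d n) (x - y) \<partial>lborel) \<le> (\<integral>y. F y * kdiff R (R/2) (x - y) \<partial>lborel)"
    proof (rule integral_mono_AE)
      show "integrable lborel (\<lambda>y. F y * kdiff R (?d n) (x - y))"
        using d by (intro integrable_mult_test[OF wlapD(2)[OF w] test_shift[OF kdiff_test]]) auto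
      show "integrable lborel (\<lambda>y. F y * kdiff R (R/2) (x - y))"
        using R by (intro integrable_mult_test[OF wlapD(2)[OF w] test_shift[OF kdiff_test]]) auto
      have "AE y in lborel. y \<noteq> x" by (rule AE_lborel_singleton)
      then show "AE y in lborel. F y * kdiff R (?d n) (x - y) \<le> F y * kdiff R (R/2) (x - y)"
        using F
      proof eventually_elim
        case (elim y)
        show ?case
        proof (cases "y \<in> D")
          case True
          have "?d n \<le> R / 2" using that R by (intro divide_left_mono) auto
          then have "kdiff R (R/2) (x - y) \<le> kdiff R (?d n) (x - y)"
            using kern_antimono[OF d(1)[of n], of "R/2" "x - y"] elim by (simp add: kdiff_def)
          then show ?thesis using True elim by (intro mult_left_mono_neg) auto
        next
          case False
          then have "norm (x - y) > R" using R(2) by (auto simp: subset_iff dist_norm not_le[symmetric])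
          then show ?thesis using kdiff_eq_0[OF d(1)[of n] d(2)] kdiff_eq_0[of "R/2" R] R by simp
        qed
      qed
    qed
    then show ?thesis using wlap_mollifier_difference[OF w d(1)[of n] d(2)[of n] R(2)] by simp
  qed
  then show ?thesis
    by (intro LIMSEQ_le_const2[OF molconv_tendsto[OF wlapD(1)[OF w] c R(1)]]) auto
qed

text \<open>At an interior maximum the mean value inequality forces \<open>h\<close> to equal its
  maximum almost everywhere where \<open>moll R\<close> is positive. Among all maximum points one
  with the largest first coordinate is taken, which makes this impossible on the part of the shell
  with larger first coordinate.\<close>

lemma max_principle_continuous:
  assumes D: "open D" "bounded D" and w: "wlap D h F" and F: "AE y in lborel. y \<in> D \<longrightarrow> F y \<le> 0"
    and c: "continuous_on (closure D) h" and b: "\<And>x. x \<in> frontier D \<Longrightarrow> h x \<le> 0" and x: "x \<in> D"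
  shows "h x \<le> 0"
proof (rule ccontr)
  assume "\<not> h x \<le> 0"
  have cpt: "compact (closure D)" using D by simp
  obtain z0 where z0: "z0 \<in> closure D" "\<And>y. y \<in> closure D \<Longrightarrow> h y \<le> h z0"
    using continuous_attains_sup[OF cpt _ c] x closure_subset by blast
  define m where "m = h z0"
  have m: "m > 0" using z0(2)[of x] \<open>\<not> h x \<le> 0\<close> x closure_subset[of D] by (force simp: m_def)
  define Z where "Z = {y\<in>closure D. h y = m}"
  have "closed Z" unfolding Z_def using continuous_closedin_preimage_constant[OF c, of m]
    by (rule closedin_closed_trans[OF _ closed_closure])
  moreover have "closure D \<inter> Z = Z" by (auto simp: Z_def)
  ultimately have "compact Z" using compact_Int_closed[OF cpt, of Z] by simp
  moreover have "Z \<noteq> {}" using z0 by (auto simp: Z_def m_def)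
  ultimately obtain z where z: "z \<in> Z" "\<And>y. y \<in> Z \<Longrightarrow> y $ 1 \<le> z $ 1"
    using continuous_attains_sup[of Z "\<lambda>y. y $ 1"] continuous_on_component[OF continuous_on_id, of Z 1] by auto
  have "z \<in> D"
  proof (rule ccontr)
    assume "z \<notin> D"
    then have "z \<in> frontier D" using z D by (simp add: Z_def frontier_def interior_open)
    then show False using b[of z] z m by (simp add: Z_def)
  qed
  then obtain R where R: "R > 0" "cball z R \<subseteq> D" using D open_contains_cball by blast
  have "continuous_on D h" using c closure_subset continuous_on_subset by blast
  then have "isCont h z" using \<open>z \<in> D\<close> D by (simp add: continuous_on_eq_continuous_at)
  from mean_value_inequality[OF w F R this]
  have "h z \<le> molconv R h z + (\<integral>y. F y * kdiff R (R/2) (z - y) \<partial>lborel)" .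
  moreover have "(\<integral>y. F y * kdiff R (R/2) (z - y) \<partial>lborel) \<le> 0"
  proof (rule integral_nonpos_AE)
    have "AE y in lborel. y \<noteq> z" by (rule AE_lborel_singleton)
    then show "AE y in lborel. F y * kdiff R (R/2) (z - y) \<le> 0"
      using F
    proof eventually_elim
      case (elim y)
      show ?case
      proof (cases "y \<in> D")
        case True
        then show ?thesis using elim kdiff_bounds(1)[of "R/2" R "z - y"] R by (simp add: mult_nonpos_nonneg)
      next
        case False
        then have "norm (z - y) > R" using R(2) by (auto simp: subset_iff dist_norm not_le[symmetric])
        then show ?thesis using kdiff_eq_0[of "R/2" R] R by simp
      qed
    qed
  qed
  ultimately have le: "m \<le> molconv R h z" using z by (simp add: Z_def)
  let ?m = "\<lambda>y. moll R (z - y)"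
  have im: "integrable lborel ?m" using integrable_test[OF test_shift[OF moll_test[OF R(1)]]] .
  have ih: "integrable lborel (\<lambda>y. h y * ?m y)"
    using integrable_mult_test[OF wlapD(1)[OF w] test_shift[OF moll_test[OF R(1)]]] .
  have m1: "(\<integral>y. ?m y \<partial>lborel) = 1" using integral_lborel_reflect[of "moll R" z] moll_integral[OF R(1)] by simp
  have nn: "(m - h y) * ?m y \<ge> 0" for y
  proof (cases "norm (z - y) < R")
    case True
    then have "y \<in> closure D" using R(2) closure_subset by (force simp: dist_norm)
    then show ?thesis using z0(2) moll_nonneg by (simp add: m_def)
  qed (use moll_eq_0 R in simp)
  have "(\<integral>y. (m - h y) * ?m y \<partial>lborel) = m - molconv R h z"
    using im ih m1 by (simp add: left_diff_distrib molconv_def)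
  then have "(\<integral>y. (m - h y) * ?m y \<partial>lborel) = 0"
    using le integral_nonneg_AE[where M=lborel and f="\<lambda>y. (m - h y) * ?m y"] nn by simp
  moreover have "integrable lborel (\<lambda>y. (m - h y) * ?m y)" using im ih by (simp add: left_diff_distrib)
  ultimately have ae: "AE y in lborel. (m - h y) * ?m y = 0"
    using integral_nonneg_eq_0_iff_AE nn by blast
  \<comment> \<open>The part of the shell to the right of \<open>z\<close>: open and nonempty, yet
    almost none of its points can satisfy \<open>h y = m\<close>, by the choice of \<open>z\<close>,
    while almost all of them do.\<close>
  define U where "U = {y. 7/10 * R < norm (z - y) \<and> norm (z - y) < R \<and> z $ 1 < y $ 1}"
  have "AE y in lborel. y \<notin> U"
    using ae
  proof eventually_elim
    case (elim y)
    show ?case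
    proof
      assume y: "y \<in> U"
      then have "?m y > 0" using moll_pos R by (simp add: U_def)
      then have "h y = m" using elim by simp
      moreover have "y \<in> closure D" using y R(2) closure_subset by (force simp: dist_norm U_def)
      ultimately have "y $ 1 \<le> z $ 1" using z(2) by (simp add: Z_def)
      then show False using y by (simp add: U_def)
    qed
  qed
  moreover have "open U" unfolding U_def by (intro open_Collect_conj open_Collect_less continuous_intros)
  ultimately have "emeasure lborel U = 0" using AE_iff_null_sets[of U lborel] by auto
  moreover have "z + (9/10 * R) *\<^sub>R axis 1 1 \<in> U" using R by (simp add: U_def)
  ultimately show False using emeasure_lborel_open_neq_0[OF \<open>open U\<close>] by blast
qed

text \<open>The average of \<open>h\<close> is nonpositive, and the integral of \<open>F\<close>
  against \<open>kdiff R (R/2)\<close> is strictly negative because that kernel is positive on the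
  shell between \<open>R/2\<close> and \<open>R\<close>, where the smaller kernel has already
  vanished.\<close>

lemma strictly_negative:
  assumes D: "open D" and w: "wlap D h F" and F: "AE y in lborel. y \<in> D \<longrightarrow> F y < 0"
    and c: "continuous_on D h" and h: "\<And>y. y \<in> D \<Longrightarrow> h y \<le> 0" and x: "x \<in> D"
  shows "h x < 0"
proof -
  obtain R where R: "R > 0" "cball x R \<subseteq> D" using D x open_contains_cball by blast
  have c': "isCont h x" using c D x by (simp add: continuous_on_eq_continuous_at)
  have F': "AE y in lborel. y \<in> D \<longrightarrow> F y \<le> 0" using F by eventually_elim auto
  let ?g = "\<lambda>y. F y * kdiff R (R/2) (x - y)"
  have "molconv R h x \<le> 0"
    unfolding molconv_def
  proof (rule integral_nonpos_AE, rule AE_I2)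
    fix y
    show "h y * moll R (x - y) \<le> 0"
    proof (cases "norm (x - y) < R")
      case True
      then have "y \<in> D" using R(2) by (force simp: dist_norm)
      then show ?thesis using h moll_nonneg by (simp add: mult_nonpos_nonneg)
    qed (use moll_eq_0 R in simp)
  qed
  moreover have "(\<integral>y. ?g y \<partial>lborel) < 0"
  proof -
    have int: "integrable lborel ?g"
      using R by (intro integrable_mult_test[OF wlapD(2)[OF w] test_shift[OF kdiff_test]]) auto
    have AEx: "AE y in lborel. y \<noteq> x" by (rule AE_lborel_singleton)
    have np: "AE y in lborel. ?g y \<le> 0"
      using AEx F'
    proof eventually_elim
      case (elim y)
      show ?case
      proof (cases "y \<in> D")
        case True
        then show ?thesis using elim kdiff_bounds(1)[of "R/2" R "x - y"] R by (simp add: mult_nonpos_nonneg)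
      next
        case False
        then have "norm (x - y) > R" using R(2) by (auto simp: subset_iff dist_norm not_le[symmetric])
        then show ?thesis using kdiff_eq_0[of "R/2" R] R by simp
      qed
    qed
    have "(\<integral>y. ?g y \<partial>lborel) \<noteq> 0"
    proof
      assume "(\<integral>y. ?g y \<partial>lborel) = 0"
      then have "AE y in lborel. - ?g y = 0"
        using integral_nonneg_eq_0_iff_AE[of lborel "\<lambda>y. - ?g y"] int np by simp
      then have "AE y in lborel. y \<notin> ball x R - cball x (R/2)"
        using F AEx
      proof eventually_elim
        case (elim y)
        show ?case
        proof
          assume y: "y \<in> ball x R - cball x (R/2)"
          then have "kdiff R (R/2) (x - y) > 0"
            using kern_pos[of R "x - y"] kern_eq_0[of "R/2" "x - y"] elim R by (auto simp: kdiff_def dist_norm)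
          moreover have "y \<in> D" using y R by auto
          ultimately show False using elim by simp
        qed
      qed
      then have "emeasure lborel (ball x R - cball x (R/2)) = 0"
        using AE_iff_null_sets[of "ball x R - cball x (R/2)" lborel] by auto
      moreover have "x + (9/10 * R) *\<^sub>R axis 1 1 \<in> ball x R - cball x (R/2)" using R by (simp add: dist_norm)
      ultimately show False using emeasure_lborel_open_neq_0[of "ball x R - cball x (R/2)"] by blast
    qed
    moreover have "(\<integral>y. ?g y \<partial>lborel) \<le> 0" by (rule integral_nonpos_AE[OF np])
    ultimately show ?thesis by simp
  qed
  ultimately show ?thesis using mean_value_inequality[OF w F' R c'] by simp
qed

subsection \<open>Logarithmic potentials\<close>

lemma kern_square_tendsto_0:
  assumes "R > 0"
  shows "(\<lambda>n. \<integral>x. (kern (R / real (Suc n)) x)\<^sup>2 \<partial>lborel) \<longlonglongrightarrow> 0"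
proof -
  let ?d = "\<lambda>n. R / real (Suc n)"
  have d: "0 < ?d n" "?d n \<le> R" for n
    using assms by (auto simp: divide_le_eq mult_le_cancel_left1)
  have "(\<lambda>n. \<integral>x. (kern (?d n) x)\<^sup>2 \<partial>lborel) \<longlonglongrightarrow> (\<integral>x. 0 \<partial>(lborel :: (real^2) measure))"
  proof (rule integral_dominated_convergence[where w="\<lambda>x. (kern R x)\<^sup>2"])
    show "AE x in lborel. (\<lambda>n. (kern (?d n) x)\<^sup>2) \<longlonglongrightarrow> 0"
    proof (rule eventually_mono[OF AE_lborel_singleton[of 0]])
      fix x :: "real^2" assume x: "x \<noteq> 0"
      have "eventually (\<lambda>n. ?d n < norm x) sequentially"
        using radii_tendsto_0[of R] x by (intro order_tendstoD(2)) auto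
      then have "eventually (\<lambda>n. (kern (?d n) x)\<^sup>2 = 0) sequentially"
        by eventually_elim (use kern_eq_0 d in simp)
      then show "(\<lambda>n. (kern (?d n) x)\<^sup>2) \<longlonglongrightarrow> 0" by (rule tendsto_eventually)
    qed
    show "AE x in lborel. norm ((kern (?d n) x)\<^sup>2) \<le> (kern R x)\<^sup>2" for n
      using kern_antimono[OF d] kern_nonneg by (intro AE_I2) (auto intro!: power_mono)
  qed (use kern_square_integrable assms in auto)
  then show ?thesis by simp
qed

text \<open>The free parameter takes the place of the Cauchy--Schwarz inequality: it shifts the
  weight between the two square integrals, so that smallness of either one can be exploited.\<close>

lemma mult_le_weighted_squares:
  fixes a b s :: real assumes "s > 0" shows "\<bar>a * b\<bar> \<le> s / 2 * a\<^sup>2 + b\<^sup>2 / (2 * s)"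
proof -
  have "0 \<le> (s * \<bar>a\<bar> - \<bar>b\<bar>)\<^sup>2 / (2 * s)" using assms by simp
  also have "\<dots> = s / 2 * a\<^sup>2 + b\<^sup>2 / (2 * s) - \<bar>a * b\<bar>"
    using assms by (simp add: power2_diff abs_mult power2_eq_square field_simps)
  finally show ?thesis by simp
qed

lemma kern_conv_L2:
  assumes R: "R > 0" and F: "F \<in> borel_measurable borel" "integrable lborel (\<lambda>y. (F y)\<^sup>2)" and s: "s > 0"
  shows "integrable lborel (\<lambda>y. F y * kern R (x - y))"
    and "\<bar>\<integral>y. F y * kern R (x - y) \<partial>lborel\<bar> \<le> s / 2 * (\<integral>y. (F y)\<^sup>2 \<partial>lborel) + (\<integral>y. (kern R y)\<^sup>2 \<partial>lborel) / (2 * s)"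
proof -
  have k: "integrable lborel (\<lambda>y. (kern R (x - y))\<^sup>2)"
    using integrable_lborel_reflect[of "\<lambda>y. (kern R y)\<^sup>2" x] kern_square_integrable[OF R] by simp
  have i: "integrable lborel (\<lambda>y. s / 2 * (F y)\<^sup>2 + (kern R (x - y))\<^sup>2 / (2 * s))" using F(2) k by auto
  show int: "integrable lborel (\<lambda>y. F y * kern R (x - y))"
    using mult_le_weighted_squares[OF s] F(1)
    by (intro Bochner_Integration.integrable_bound[OF i]) (auto intro!: AE_I2 order_trans[OF mult_le_weighted_squares[OF s]])
  have "\<bar>\<integral>y. F y * kern R (x - y) \<partial>lborel\<bar> \<le> (\<integral>y. s / 2 * (F y)\<^sup>2 + (kern R (x - y))\<^sup>2 / (2 * s) \<partial>lborel)"
    using int i by (intro order_trans[OF integral_abs_bound] integral_mono mult_le_weighted_squares s) auto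
  also have "\<dots> = s / 2 * (\<integral>y. (F y)\<^sup>2 \<partial>lborel) + (\<integral>y. (kern R (x - y))\<^sup>2 \<partial>lborel) / (2 * s)"
    using F(2) k by simp
  finally show "\<bar>\<integral>y. F y * kern R (x - y) \<partial>lborel\<bar> \<le> s / 2 * (\<integral>y. (F y)\<^sup>2 \<partial>lborel) + (\<integral>y. (kern R y)\<^sup>2 \<partial>lborel) / (2 * s)"
    using integral_lborel_reflect[of "\<lambda>y. (kern R y)\<^sup>2" x] by simp
qed

text \<open>The potential differs from the convolution with the smooth \<open>kdiff R d\<close> by a
  potential with kernel \<open>kern d\<close>, whose square integral tends to 0 with
  \<open>d\<close>. Hence it is a uniform limit of continuous functions.\<close>

lemma pot_continuous:
  assumes R: "R > 0" and F: "integrable lborel F" "integrable lborel (\<lambda>y. (F y)\<^sup>2)"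
  shows "continuous_on UNIV (pot R F)"
proof -
  let ?d = "\<lambda>n. R / real (Suc n)"
  have d: "0 < ?d n" "?d n \<le> R" for n
    using R by (auto simp: divide_le_eq mult_le_cancel_left1)
  note meas = borel_measurable_integrable[OF F(1), simplified]
  let ?q = "\<lambda>n x. \<integral>y. F y * kdiff R (?d n) (x - y) \<partial>lborel"
  have diff: "pot R F x - ?q n x = (\<integral>y. F y * kern (?d n) (x - y) \<partial>lborel)" for n x
  proof -
    have "pot R F x - ?q n x = (\<integral>y. F y * kern R (x - y) - F y * kdiff R (?d n) (x - y) \<partial>lborel)"
      using kern_conv_L2(1)[OF R meas F(2), of 1 x] integrable_mult_test[OF F(1) test_shift[OF kdiff_test[OF d]]]
      by (simp add: pot_def)
    also have "\<dots> = (\<integral>y. F y * kern (?d n) (x - y) \<partial>lborel)"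
    proof (rule integral_cong_AE)
      show "AE y in lborel. F y * kern R (x - y) - F y * kdiff R (?d n) (x - y) = F y * kern (?d n) (x - y)"
        by (rule eventually_mono[OF AE_lborel_singleton[of x]]) (simp add: kdiff_def algebra_simps)
    qed (use meas borel_measurable_test[OF test_shift[OF kdiff_test[OF d]]] in auto)
    finally show ?thesis .
  qed
  define A where "A = (\<integral>y. (F y)\<^sup>2 \<partial>lborel)"
  have A: "A \<ge> 0" unfolding A_def by (intro integral_nonneg_AE) auto
  have "uniform_limit UNIV ?q (pot R F) sequentially"
  proof (rule uniform_limitI)
    fix e :: real assume e: "e > 0"
    \<comment> \<open>This makes \<open>s / 2 * A < e / 2\<close>; the \<open>+ 1\<close> covers the
      case \<open>A = 0\<close>.\<close>
    define s where "s = e / (A + 1)"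
    have s: "s > 0" using e A by (simp add: s_def)
    have sA: "s / 2 * A < e / 2"
    proof -
      have "s * A < s * (A + 1)" using s by simp
      also have "\<dots> = e" using A by (simp add: s_def)
      finally show ?thesis by simp
    qed
    have "eventually (\<lambda>n. (\<integral>x. (kern (?d n) x)\<^sup>2 \<partial>lborel) < e * s) sequentially"
      using kern_square_tendsto_0[OF R] e s by (intro order_tendstoD(2)) auto
    then show "eventually (\<lambda>n. \<forall>x\<in>UNIV. dist (?q n x) (pot R F x) < e) sequentially"
    proof eventually_elim
      case (elim n)
      show ?case
      proof
        fix x
        have "dist (?q n x) (pot R F x) = \<bar>\<integral>y. F y * kern (?d n) (x - y) \<partial>lborel\<bar>"
          using diff[of x n] by (simp add: dist_real_def abs_minus_commute)
        also have "\<dots> \<le> s / 2 * A + (\<integral>y. (kern (?d n) y)\<^sup>2 \<partial>lborel) / (2 * s)"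
          using kern_conv_L2(2)[OF d(1) meas F(2) s] by (simp add: A_def)
        also have "\<dots> < e / 2 + e / 2" using elim s sA by (intro add_strict_mono) (auto simp: field_simps)
        finally show "dist (?q n x) (pot R F x) < e" by simp
      qed
    qed
  qed
  then show ?thesis
    using test_convolution(1)[OF F(1) kdiff_test[OF d]]
    by (intro uniform_limit_theorem[where F=sequentially]) auto
qed

text \<open>An indicator is its own square, so its square integral is the measure of the set. First
  \<open>s\<close> is chosen to make the kernel term at most \<open>e / 2\<close>, then the measure
  is taken below \<open>e / s\<close>.\<close>

lemma pot_indicator_small:
  assumes R: "R > 0" and e: "e > 0"
  shows "\<exists>\<delta>>0. \<forall>B x. B \<in> sets borel \<longrightarrow> bounded B \<longrightarrow> measure lborel B < \<delta> \<longrightarrow> pot R (indicator B) x \<le> e"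
proof -
  define A where "A = (\<integral>y. (kern R y)\<^sup>2 \<partial>lborel)"
  have A: "A \<ge> 0" unfolding A_def by (intro integral_nonneg_AE) auto
  define s where "s = (A + 1) / e"
  have s: "s > 0" using A e by (simp add: s_def)
  have sA: "A / (2 * s) \<le> e / 2" using A e by (simp add: s_def field_simps)
  have "pot R (indicator B) x \<le> e" if B: "B \<in> sets borel" "bounded B" "measure lborel B < e / s" for B x
  proof -
    have sq: "(\<lambda>y. (indicator B y :: real)\<^sup>2) = indicator B" by (auto simp: indicator_def fun_eq_iff)
    have "integrable lborel (indicator B :: _ \<Rightarrow> real)"
      using B by (intro integrable_real_indicator emeasure_bounded_finite) auto
    then have "\<bar>\<integral>y. indicator B y * kern R (x - y) \<partial>lborel\<bar> \<le> s / 2 * (\<integral>y. indicator B y \<partial>lborel) + A / (2 * s)"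
      using kern_conv_L2(2)[OF R _ _ s, of "indicator B" x] B(1) by (simp add: sq A_def)
    also have "(\<integral>y. indicator B y \<partial>lborel) = measure lborel B" using B by simp
    also have "s / 2 * measure lborel B + A / (2 * s) \<le> e / 2 + e / 2"
      using B(3) s sA by (intro add_mono) (auto simp: field_simps)
    finally show ?thesis by (simp add: pot_def)
  qed
  then show ?thesis using s e by (intro exI[of _ "e / s"]) auto
qed

lemma pot_indicator_nonneg: "pot R (indicator B) x \<ge> 0"
  unfolding pot_def using kern_nonneg by (intro integral_nonneg_AE) auto

text \<open>If the common maximum \<open>m\<close> of \<open>w\<close> and \<open>z\<close> were
  positive, both right-hand sides would be at most \<open>M * m\<close>, and comparison with
  \<open>M * m\<close> times the potential of the indicator of \<open>D - K\<close> would bound both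
  functions by \<open>m / 2\<close>. The compact set \<open>K\<close> collects points where the sign
  is already known, so only \<open>D - K\<close> has to be small. The kernel radius 4 fits
  \<open>wlap_pot\<close> to the unit ball.\<close>

lemma small_measure_max_principle:
  assumes M: "M > 0"
  shows "\<exists>\<delta>>0. \<forall>D K w z f g. open D \<longrightarrow> D \<subseteq> ball 0 1 \<longrightarrow> compact K \<longrightarrow> measure lborel (D - K) < \<delta> \<longrightarrow>
     continuous_on (closure D) w \<longrightarrow> continuous_on (closure D) z \<longrightarrow>
     (\<forall>x\<in>K \<union> frontier D. w x \<le> 0 \<and> z x \<le> 0) \<longrightarrow> wlap D w f \<longrightarrow> wlap D z g \<longrightarrow>
     (\<forall>x\<in>D. f x \<le> M * max 0 (z x)) \<longrightarrow> (\<forall>x\<in>D. g x \<le> M * max 0 (w x)) \<longrightarrow>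
     (\<forall>x\<in>D. w x \<le> 0 \<and> z x \<le> 0)"
proof -
  obtain \<delta> where \<delta>: "\<delta> > 0" "\<And>B x. B \<in> sets borel \<Longrightarrow> bounded B \<Longrightarrow> measure lborel B < \<delta> \<Longrightarrow>
      pot 4 (indicator B) x \<le> 1 / (2 * M)"
    using pot_indicator_small[of 4 "1 / (2 * M)"] M by auto
  have main: "\<forall>x\<in>D. w x \<le> 0 \<and> z x \<le> 0"
    if D: "open D" "D \<subseteq> ball 0 1" and K: "compact K" "measure lborel (D - K) < \<delta>"
      and c: "continuous_on (closure D) w" "continuous_on (closure D) z"
      and b: "\<And>x. x \<in> K \<union> frontier D \<Longrightarrow> w x \<le> 0 \<and> z x \<le> 0" and wl: "wlap D w f" "wlap D z g"
      and fg: "\<And>x. x \<in> D \<Longrightarrow> f x \<le> M * max 0 (z x)" "\<And>x. x \<in> D \<Longrightarrow> g x \<le> M * max 0 (w x)"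
    for D K w z f g
  proof (cases "D = {}")
    case False
    have bd: "bounded D" using D(2) bounded_ball bounded_subset by blast
    then have cpt: "compact (closure D)" by simp
    have "continuous_on (closure D) (\<lambda>x. max (w x) (z x))" using c by (intro continuous_intros)
    moreover have "closure D \<noteq> {}" using False by simp
    ultimately obtain q where q: "q \<in> closure D" "\<And>y. y \<in> closure D \<Longrightarrow> max (w y) (z y) \<le> max (w q) (z q)"
      using continuous_attains_sup[OF cpt] by blast
    define m where "m = max (w q) (z q)"
    show ?thesis
    proof (cases "m \<le> 0")
      case True
      then show ?thesis using q(2) closure_subset[of D] by (fastforce simp: m_def)
    next
      case m: False
      define B where "B = D - K"
      have B: "open B" "bounded B" "B \<subseteq> D" "B \<in> sets borel"
        using D(1) K(1) bd by (auto simp: B_def compact_imp_closed open_Diff bounded_diff)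
      have iB: "integrable lborel (indicator B :: _ \<Rightarrow> real)"
        using B by (intro integrable_real_indicator emeasure_bounded_finite) auto
      have sq: "(\<lambda>y. (indicator B y :: real)\<^sup>2) = indicator B" by (auto simp: indicator_def fun_eq_iff)
      have P: "wlap B (pot 4 (indicator B)) (indicator B)"
      proof (rule wlap_pot[OF _ _ iB])
        show "B \<subseteq> ball 0 (4/4)" using B(3) D(2) by simp
        then show "indicator B x = (0::real)" if "x \<notin> ball 0 (4/4)" for x using that by (auto simp: indicator_def)
      qed simp
      have Pc: "continuous_on S (pot 4 (indicator B))" for S
      proof -
        have "integrable lborel (\<lambda>y. (indicator B y :: real)\<^sup>2)" using iB unfolding sq .
        from pot_continuous[OF _ iB this, of 4] show ?thesis by (rule continuous_on_subset) auto
      qed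
      have fr: "frontier B \<subseteq> K \<union> frontier D"
        using closure_mono[OF B(3)] B(1) D(1) by (auto simp: frontier_def interior_open B_def)
      \<comment> \<open>Stated for a generic \<open>h\<close> because it is used for both unknowns:
        once the other unknown is replaced by its upper bound \<open>m\<close>, the system
        decouples.\<close>
      have half: "h x \<le> m / 2"
        if h: "continuous_on (closure D) h" "wlap D h F" "\<And>x. x \<in> K \<union> frontier D \<Longrightarrow> h x \<le> 0"
          "\<And>x. x \<in> D \<Longrightarrow> F x \<le> M * m" and x: "x \<in> closure D" for h F x
      proof (cases "x \<in> B")
        case True
        have "1 * h x + (- (M * m)) * pot 4 (indicator B) x \<le> 0"
        proof (rule max_principle_continuous[OF B(1,2) wlap_lin[OF wlap_subset[OF h(2) B(3)] P] _ _ _ True])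
          show "AE y in lborel. y \<in> B \<longrightarrow> 1 * F y + - (M * m) * indicator B y \<le> 0"
            using h(4) B(3) by (intro AE_I2) auto
          show "continuous_on (closure B) (\<lambda>x. 1 * h x + - (M * m) * pot 4 (indicator B) x)"
            using continuous_on_subset[OF h(1) closure_mono[OF B(3)]] Pc by (intro continuous_intros)
          show "1 * h x + - (M * m) * pot 4 (indicator B) x \<le> 0" if "x \<in> frontier B" for x
          proof -
            have "h x \<le> 0" using h(3)[of x] that fr by blast
            moreover have "0 \<le> (M * m) * pot 4 (indicator B) x"
              using pot_indicator_nonneg[of 4 B x] M m by (intro mult_nonneg_nonneg) auto
            ultimately show ?thesis by simp
          qed
        qed
        then have "h x \<le> (M * m) * pot 4 (indicator B) x" by simp
        also have "\<dots> \<le> (M * m) * (1 / (2 * M))"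
          using \<delta>(2)[OF B(4,2), of x] K(2) M m by (intro mult_left_mono) (auto simp: B_def)
        also have "\<dots> = m / 2" using M by simp
        finally show ?thesis .
      next
        case False
        then have "x \<in> K \<union> frontier D" using x D(1) by (auto simp: B_def frontier_def interior_open)
        then show ?thesis using h(3)[of x] m by linarith
      qed
      have "f x \<le> M * m \<and> g x \<le> M * m" if "x \<in> D" for x
      proof -
        have "max (w x) (z x) \<le> m" using q(2)[of x] that closure_subset[of D] by (auto simp: m_def)
        then have "M * max 0 (z x) \<le> M * m" "M * max 0 (w x) \<le> M * m"
          using M m by (auto intro!: mult_left_mono)
        then show ?thesis using fg[OF that] by linarith
      qed
      then have "w q \<le> m / 2" "z q \<le> m / 2"
        using half[OF c(1) wl(1) _ _ q(1)] half[OF c(2) wl(2) _ _ q(1)] b by simp_all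
      then have "max (w q) (z q) \<le> m / 2" by (rule max.boundedI)
      then have "m \<le> m / 2" unfolding m_def .
      then show ?thesis using m by linarith
    qed
  qed simp
  show ?thesis
  proof (intro exI[of _ \<delta>] conjI allI impI \<delta>(1))
    fix D K w z f g
    assume a: "open D" "D \<subseteq> ball 0 1" "compact K" "measure lborel (D - K) < \<delta>"
      "continuous_on (closure D) w" "continuous_on (closure D) z"
      "\<forall>x\<in>K \<union> frontier D. w x \<le> 0 \<and> z x \<le> 0" "wlap D w f" "wlap D z g"
      "\<forall>x\<in>D. f x \<le> M * max 0 (z x)" "\<forall>x\<in>D. g x \<le> M * max 0 (w x)"
    show "\<forall>x\<in>D. w x \<le> 0 \<and> z x \<le> 0"
      by (rule main[OF a(1-6) bspec[OF a(7)] a(8,9) bspec[OF a(10)] bspec[OF a(11)]])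
  qed
qed

subsection \<open>Exponential integrability\<close>

text \<open>The Brezis--Merle argument: Jensen's inequality for the measure \<open>F dy / m\<close>, completed by an
  atom of mass \<open>1 - \<parallel>F\<parallel>\<^sub>1 / m\<close>, moves the exponential inside the potential.\<close>

lemma exp_pot_le:
  assumes R: "R > 0" and F: "\<And>y. F y \<ge> 0" "integrable lborel F" "(\<integral>y. F y \<partial>lborel) \<le> m"
    and m: "m > 0" "2 * m * kern_const \<le> 1"
    and int1: "integrable lborel (\<lambda>y. F y * kern R (x - y))"
    and int2: "integrable lborel (\<lambda>y. F y * (indicator (ball 0 R) (x - y) / norm (x - y)))"
  shows "exp (2 * pot R F x) \<le> 2 + R / m * (\<integral>y. F y * (indicator (ball 0 R) (x - y) / norm (x - y)) \<partial>lborel)"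
proof -
  define A where "A = 2 * pot R F x"
  define q where "q y = indicator (ball 0 R) (x - y) / norm (x - y)" for y
  have int2: "integrable lborel (\<lambda>y. F y * q y)" using int2 by (simp add: q_def)
  let ?m1 = "\<integral>y. F y \<partial>lborel"
  have m1: "0 \<le> ?m1" using F(1) by (intro integral_nonneg_AE) auto
  \<comment> \<open>The tangent of the exponential at \<open>A\<close>, which is the mean of
    \<open>2 * m * kern\<close> under the completed probability measure.\<close>
  have pt: "F y * (exp A * (1 + 2 * m * kern R (x - y) - A)) \<le> F y * (1 + R * q y)" for y
  proof (rule mult_left_mono[OF _ F(1)])
    have "exp A * (1 + 2 * m * kern R (x - y) - A) \<le> exp A * exp (2 * m * kern R (x - y) - A)"
      using exp_ge_add_one_self[of "2 * m * kern R (x - y) - A"] by (intro mult_left_mono) (auto simp: algebra_simps)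
    also have "\<dots> = exp (2 * m * kern R (x - y))" by (simp add: exp_add[symmetric])
    also have "\<dots> \<le> 1 + R * q y" unfolding q_def by (rule exp_kern_le) (use R m in auto)
    finally show "exp A * (1 + 2 * m * kern R (x - y) - A) \<le> 1 + R * q y" .
  qed
  have e1: "F y * (exp A * (1 + 2 * m * kern R (x - y) - A)) =
      exp A * (1 - A) * F y + exp A * 2 * m * (F y * kern R (x - y))" for y by (simp add: algebra_simps)
  have e2: "F y * (1 + R * q y) = F y + R * (F y * q y)" for y by (simp add: algebra_simps)
  have "(\<integral>y. F y * (exp A * (1 + 2 * m * kern R (x - y) - A)) \<partial>lborel) \<le> (\<integral>y. F y * (1 + R * q y) \<partial>lborel)"
    unfolding e1 e2
    by (intro integral_mono Bochner_Integration.integrable_add integrable_mult_right F(2) int1 int2 pt[unfolded e1 e2])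
  then have "exp A * (1 - A) * ?m1 + exp A * 2 * m * pot R F x \<le> ?m1 + R * (\<integral>y. F y * q y \<partial>lborel)"
    unfolding e1 e2 using F(2) int1 int2 by (simp add: pot_def)
  then have "exp A * (1 - A) * ?m1 + exp A * m * A \<le> ?m1 + R * (\<integral>y. F y * q y \<partial>lborel)"
    by (simp add: A_def mult_ac)
  \<comment> \<open>The contribution of the atom, where the kernel counts as 0: the tangent at
    \<open>A\<close>, evaluated at 0, is at most \<open>exp 0 = 1\<close>.\<close>
  moreover have "(m - ?m1) * (exp A * (1 - A)) \<le> (m - ?m1) * 1"
  proof (rule mult_left_mono)
    have "exp A * (1 - A) \<le> exp A * exp (- A)" using exp_ge_add_one_self[of "- A"] by (intro mult_left_mono) auto
    then show "exp A * (1 - A) \<le> 1" by (simp add: exp_add[symmetric])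
  qed (use F(3) in simp)
  ultimately have "m * exp A \<le> m + R * (\<integral>y. F y * q y \<partial>lborel)" by (simp add: algebra_simps)
  then have "exp A \<le> 1 + R / m * (\<integral>y. F y * q y \<partial>lborel)" using m(1) by (simp add: field_simps)
  then show ?thesis by (simp add: A_def q_def)
qed

text \<open>Cut \<open>F\<close> at a high level \<open>n\<close>. The part above the level has
  integral below the threshold \<open>m\<close> and is handled by \<open>exp_pot_le\<close>; the
  part below adds at most \<open>n\<close> times the integral of the kernel to the potential, hence
  the factor \<open>B\<close>. The 2 in the exponent later makes right-hand sides square
  integrable.\<close>

lemma exp_pot_integrable:
  assumes R: "R > 0" and F: "integrable lborel F" and S: "bounded S" "S \<in> sets borel"
  shows "integrable lborel (\<lambda>x. indicator S x * exp (2 * pot R F x))"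
proof -
  note [measurable] = borel_measurable_integrable[OF F] S(2)
  define m where "m = 1 / (2 * kern_const)"
  have m: "m > 0" "2 * m * kern_const \<le> 1" using kern_const_pos by (auto simp: m_def)
  have "(\<lambda>n. \<integral>y. max 0 (F y - real n) \<partial>lborel) \<longlonglongrightarrow> (\<integral>y. 0 \<partial>(lborel :: (real^2) measure))"
  proof (rule integral_dominated_convergence[where w="\<lambda>y. \<bar>F y\<bar>"])
    show "AE y in lborel. (\<lambda>n. max 0 (F y - real n)) \<longlonglongrightarrow> 0"
    proof (rule AE_I2)
      fix y
      obtain N where "real N > F y" using reals_Archimedean2 by blast
      then have "\<forall>n\<ge>N. max 0 (F y - real n) = 0" by (auto simp: max_def)
      then show "(\<lambda>n. max 0 (F y - real n)) \<longlonglongrightarrow> 0" by (intro tendsto_eventually) (auto simp: eventually_sequentially)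
    qed
  qed (use F in auto)
  then have "eventually (\<lambda>n. (\<integral>y. max 0 (F y - real n) \<partial>lborel) < m) sequentially"
    using m(1) by (intro order_tendstoD(2)) auto
  then obtain n where n: "(\<integral>y. max 0 (F y - real n) \<partial>lborel) < m" by (auto simp: eventually_sequentially)
  define F1 where "F1 y = max 0 (F y - real n)" for y
  have F1: "integrable lborel F1" unfolding F1_def[abs_def]
    by (rule Bochner_Integration.integrable_bound[OF F]) auto
  have ik: "integrable lborel (kern R)" using kern_integrable R by blast
  have iq: "integrable lborel (\<lambda>x::real^2. indicator (ball 0 R) x / norm x)" using integrable_inverse_norm R by blast
  let ?Q = "\<lambda>x. \<integral>y. F1 y * (indicator (ball 0 R) (x - y) / norm (x - y)) \<partial>lborel"
  define B where "B = exp (2 * (real n * (\<integral>y. kern R y \<partial>lborel)))"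
  have iQ: "integrable lborel ?Q" using convolution_integrable'(1)[OF F1 iq] .
  have bound: "AE x in lborel. exp (2 * pot R F x) \<le> B * (2 + R / m * ?Q x)"
    using convolution_integrable'(2)[OF F ik] convolution_integrable'(2)[OF F1 ik] convolution_integrable'(2)[OF F1 iq]
  proof eventually_elim
    case (elim x)
    have ik': "integrable lborel (\<lambda>y. kern R (x - y))" using integrable_lborel_reflect[of "kern R"] ik by blast
    have "pot R F x \<le> (\<integral>y. F1 y * kern R (x - y) + real n * kern R (x - y) \<partial>lborel)"
      unfolding pot_def
    proof (rule integral_mono)
      show "integrable lborel (\<lambda>y. F1 y * kern R (x - y) + real n * kern R (x - y))" using elim(2) ik' by auto
      fix y
      have "F y * kern R (x - y) \<le> (F1 y + real n) * kern R (x - y)"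
        using kern_nonneg by (intro mult_right_mono) (auto simp: F1_def)
      then show "F y * kern R (x - y) \<le> F1 y * kern R (x - y) + real n * kern R (x - y)" by (simp add: algebra_simps)
    qed (use elim in simp)
    also have "\<dots> = pot R F1 x + real n * (\<integral>y. kern R y \<partial>lborel)"
      using elim(2) ik' integral_lborel_reflect[of "kern R" x] by (simp add: pot_def)
    finally have "exp (2 * pot R F x) \<le> exp (2 * pot R F1 x + 2 * (real n * (\<integral>y. kern R y \<partial>lborel)))" by simp
    also have "\<dots> = B * exp (2 * pot R F1 x)" by (simp add: exp_add B_def)
    also have "\<dots> \<le> B * (2 + R / m * ?Q x)"
      using n elim by (intro mult_left_mono exp_pot_le[OF R _ F1 _ m]) (auto simp: F1_def B_def)
    finally show ?case .
  qed
  show ?thesis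
  proof (rule Bochner_Integration.integrable_bound)
    show "integrable lborel (\<lambda>x. indicator S x * (B * (2 + R / m * ?Q x)))"
    proof -
      have "integrable lborel (indicator S :: _ \<Rightarrow> real)"
        using S by (intro integrable_real_indicator emeasure_bounded_finite) auto
      moreover have "integrable lborel (\<lambda>x. indicator S x * ?Q x)"
        using integrable_mult_indicator[of S lborel ?Q] iQ S(2) by simp
      moreover have "indicator S x * (B * (2 + R / m * ?Q x)) = 2 * B * indicator S x + B * R / m * (indicator S x * ?Q x)" for x
        by (simp add: algebra_simps)
      ultimately show ?thesis by simp
    qed
    show "AE x in lborel. norm (indicator S x * exp (2 * pot R F x)) \<le> norm (indicator S x * (B * (2 + R / m * ?Q x)))"
      using bound
    proof eventually_elim
      case (elim x)
      then have "exp (2 * pot R F x) \<le> \<bar>B * (2 + R / m * ?Q x)\<bar>" by linarith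
      then show ?case by (simp add: indicator_def)
    qed
    have "pot R F \<in> borel_measurable lborel"
      unfolding pot_def[abs_def] by (rule borel_measurable_integrable[OF convolution_integrable'(1)[OF F ik]])
    then show "(\<lambda>x. indicator S x * exp (2 * pot R F x)) \<in> borel_measurable lborel" by measurable
  qed
qed

subsection \<open>Inversion in a circle\<close>

definition inversion :: "real^2 \<Rightarrow> real \<Rightarrow> real^2 \<Rightarrow> real^2" where
  "inversion Q l x = Q + (l\<^sup>2 / ((x - Q) \<bullet> (x - Q))) *\<^sub>R (x - Q)"

text \<open>In the plane this is both the modulus of the Jacobian determinant and the square of the
  conformal factor. At the centre it is 0 by division by zero, while \<open>inversion\<close> fixes
  the centre.\<close>

definition inv_jac :: "real^2 \<Rightarrow> real \<Rightarrow> real^2 \<Rightarrow> real" where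
  "inv_jac Q l x = l ^ 4 / ((x - Q) \<bullet> (x - Q))\<^sup>2"

lemma inversion_self: "inversion Q l Q = Q"
  by (simp add: inversion_def)

lemma inversion_minus: "inversion Q l x - Q = (l\<^sup>2 / ((x - Q) \<bullet> (x - Q))) *\<^sub>R (x - Q)"
  by (simp add: inversion_def)

lemma norm_inversion: "x \<noteq> Q \<Longrightarrow> norm (inversion Q l x - Q) = l\<^sup>2 / norm (x - Q)"
  unfolding inversion_minus by (simp add: dot_square_norm power2_eq_square)

lemma inversion_eq_iff: "l \<noteq> 0 \<Longrightarrow> inversion Q l x = Q \<longleftrightarrow> x = Q"
  using inversion_minus[of Q l x] by (metis divide_eq_0_iff eq_iff_diff_eq_0 inner_eq_zero_iff scaleR_eq_0_iff zero_eq_power2)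

lemma inversion_involution: "l \<noteq> 0 \<Longrightarrow> inversion Q l (inversion Q l x) = x"
proof (cases "x = Q")
  case False
  assume l: "l \<noteq> 0"
  define s where "s = (x - Q) \<bullet> (x - Q)"
  have s: "s \<noteq> 0" using False by (simp add: s_def)
  have i: "inversion Q l x - Q = (l\<^sup>2 / s) *\<^sub>R (x - Q)" by (simp add: inversion_minus s_def)
  have "(inversion Q l x - Q) \<bullet> (inversion Q l x - Q) = (l\<^sup>2 / s)\<^sup>2 * s"
    unfolding i by (simp add: s_def power2_eq_square)
  then have "inversion Q l (inversion Q l x) = Q + (l\<^sup>2 / ((l\<^sup>2 / s)\<^sup>2 * s) * (l\<^sup>2 / s)) *\<^sub>R (x - Q)"
    unfolding inversion_def[of Q l "inversion Q l x"] i by simp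
  also have "l\<^sup>2 / ((l\<^sup>2 / s)\<^sup>2 * s) * (l\<^sup>2 / s) = 1" using s l by (simp add: power2_eq_square field_simps)
  finally show ?thesis by simp
qed (simp add: inversion_self)

lemma inv_jac_nonneg: "inv_jac Q l x \<ge> 0"
  by (simp add: inv_jac_def)

lemma inv_jac_norm: "inv_jac Q l x = l ^ 4 / norm (x - Q) ^ 4"
proof -
  have "((x - Q) \<bullet> (x - Q))\<^sup>2 = norm (x - Q) ^ 4"
    unfolding dot_square_norm power_mult[symmetric] by simp
  then show ?thesis by (simp add: inv_jac_def)
qed

lemma sum_Basis2: "(\<Sum>e\<in>(Basis :: (real^2) set). f e) = f (axis 1 1) + f (axis 2 1)"
proof -
  have B: "(Basis :: (real^2) set) = {axis 1 1, axis 2 1}" by (auto simp: Basis_vec_def UNIV_2)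
  have "axis 1 1 \<noteq> (axis 2 1 :: real^2)" by (simp add: axis_eq_axis)
  then show ?thesis unfolding B by simp
qed

lemma inversion_component_derivative:
  assumes "x \<noteq> Q"
  shows "((\<lambda>x. inversion Q l x \<bullet> j) has_derivative
     (\<lambda>h. l\<^sup>2 * ((h \<bullet> j) / ((x - Q) \<bullet> (x - Q)) - 2 * ((x - Q) \<bullet> h) * ((x - Q) \<bullet> j) / ((x - Q) \<bullet> (x - Q))\<^sup>2))) (at x)"
proof -
  have s: "(x - Q) \<bullet> (x - Q) \<noteq> 0" using assms by simp
  have e: "inversion Q l x \<bullet> j = Q \<bullet> j + l\<^sup>2 * (((x - Q) \<bullet> j) / ((x - Q) \<bullet> (x - Q)))" for x
    by (simp add: inversion_def inner_add_left)
  have 1: "((\<lambda>x. (x - Q) \<bullet> j) has_derivative (\<lambda>h. h \<bullet> j)) (at x)"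
    by (auto intro!: derivative_eq_intros)
  have 2: "((\<lambda>x. (x - Q) \<bullet> (x - Q)) has_derivative (\<lambda>h. 2 * ((x - Q) \<bullet> h))) (at x)"
    by (auto intro!: derivative_eq_intros simp: inner_commute)
  have "((\<lambda>x. Q \<bullet> j + l\<^sup>2 * (((x - Q) \<bullet> j) / ((x - Q) \<bullet> (x - Q)))) has_derivative
     (\<lambda>h. 0 + l\<^sup>2 * (((h \<bullet> j) * ((x - Q) \<bullet> (x - Q)) - ((x - Q) \<bullet> j) * (2 * ((x - Q) \<bullet> h))) /
        (((x - Q) \<bullet> (x - Q)) * ((x - Q) \<bullet> (x - Q)))))) (at x)"
    by (intro has_derivative_add has_derivative_const has_derivative_mult_right has_derivative_divide' 1 2 s)
  then show ?thesis unfolding e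
    by (rule has_derivative_eq_rhs) (use s in \<open>simp add: fun_eq_iff field_simps power2_eq_square\<close>)
qed

lemma smooth_on_inversion: "smooth_on (-{Q}) (\<lambda>x. inversion Q l x \<bullet> j)"
proof -
  have d: "(x - Q) \<bullet> (x - Q) = x \<bullet> x - 2 * (x \<bullet> Q) + Q \<bullet> Q" for x
    by (simp add: inner_diff_left inner_diff_right inner_commute)
  have "inversion Q l x \<bullet> j = Q \<bullet> j + (l\<^sup>2 * (x \<bullet> j - Q \<bullet> j)) / (x \<bullet> x - 2 * (x \<bullet> Q) + Q \<bullet> Q)" for x
    unfolding inversion_def d by (simp add: inner_add_left inner_diff_left)
  moreover have "x \<bullet> x - 2 * (x \<bullet> Q) + Q \<bullet> Q \<noteq> 0" if "x \<noteq> Q" for x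
    unfolding d[symmetric] using that by simp
  ultimately show ?thesis
    by (auto intro!: smooth_intros smooth_on_subset[OF smooth_on_inner_self])
qed

lemma smooth_on_compose_inversion:
  "smooth_on UNIV \<phi> \<Longrightarrow> smooth_on (-{Q}) (\<lambda>x. \<phi> (inversion Q l x))"
  by (rule smooth_on_compose_map[where T=UNIV]) (auto intro: smooth_on_inversion)

text \<open>With \<open>y1\<close>, \<open>y2\<close> the coordinates relative to the centre, this
  is the squared length of the gradient of one component of the inversion: half of
  conformality.\<close>

lemma inversion_coeff_diag:
  fixes y1 y2 s l :: real
  assumes "s \<noteq> 0" "s = y1\<^sup>2 + y2\<^sup>2"
  shows
  "(l\<^sup>2 * (1 / s - 2 * y1 * y1 / s\<^sup>2)) * (l\<^sup>2 * (1 / s - 2 * y1 * y1 / s\<^sup>2)) + (l\<^sup>2 * (- 2 * y1 * y2 / s\<^sup>2)) * (l\<^sup>2 * (- 2 * y1 * y2 / s\<^sup>2)) = l ^ 4 / s\<^sup>2"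
proof -
  have "(l\<^sup>2 * (1 / s - 2 * y1 * y1 / s\<^sup>2)) * (l\<^sup>2 * (1 / s - 2 * y1 * y1 / s\<^sup>2)) + (l\<^sup>2 * (- 2 * y1 * y2 / s\<^sup>2)) * (l\<^sup>2 * (- 2 * y1 * y2 / s\<^sup>2))
    = l^4 * (s\<^sup>2 - 4 * y1\<^sup>2 * s + 4 * y1\<^sup>2 * (y1\<^sup>2 + y2\<^sup>2)) / s^4"
   using assms(1) by (simp add: field_simps power2_eq_square power4_eq_xxxx)
  also have "s\<^sup>2 - 4 * y1\<^sup>2 * s + 4 * y1\<^sup>2 * (y1\<^sup>2 + y2\<^sup>2) = s\<^sup>2" unfolding assms(2)[symmetric] by simp
  finally show ?thesis using assms(1) by (simp add: power2_eq_square power4_eq_xxxx)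
qed

text \<open>The other half of conformality: the gradients of the two components are
  orthogonal.\<close>

lemma inversion_coeff_mixed:
  fixes y1 y2 s l :: real
  assumes "s \<noteq> 0" "s = y1\<^sup>2 + y2\<^sup>2"
  shows
  "(l\<^sup>2 * (1 / s - 2 * y1 * y1 / s\<^sup>2)) * (l\<^sup>2 * (- 2 * y1 * y2 / s\<^sup>2)) + (l\<^sup>2 * (- 2 * y1 * y2 / s\<^sup>2)) * (l\<^sup>2 * (1 / s - 2 * y2 * y2 / s\<^sup>2)) = 0"
proof -
  have "(l\<^sup>2 * (1 / s - 2 * y1 * y1 / s\<^sup>2)) * (l\<^sup>2 * (- 2 * y1 * y2 / s\<^sup>2)) + (l\<^sup>2 * (- 2 * y1 * y2 / s\<^sup>2)) * (l\<^sup>2 * (1 / s - 2 * y2 * y2 / s\<^sup>2))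
    = l^4 * (- 4 * y1 * y2) * (s - (y1\<^sup>2 + y2\<^sup>2)) / s^4"
   using assms(1) by (simp add: field_simps power2_eq_square power4_eq_xxxx)
  then show ?thesis using assms(2) by simp
qed

text \<open>The components of a planar inversion are harmonic. The two pure second derivatives are
  kept in the shape in which the quotient rule delivers them, with the entries 0 and 1 of the
  coordinate inner products.\<close>

lemma inversion_coeff_harmonic:
  fixes y1 y2 s l :: real
  assumes "s \<noteq> 0" "s = y1\<^sup>2 + y2\<^sup>2"
  shows
  "l\<^sup>2 * (- 1 * 2 * y1 / s\<^sup>2 - 2 * 1 * y1 / s\<^sup>2 - 2 * y1 * 1 / s\<^sup>2 + 8 * y1 * y1 * y1 / s ^ 3) + l\<^sup>2 * (- 0 * 2 * y2 / s\<^sup>2 - 2 * 1 * y1 / s\<^sup>2 - 2 * y2 * 0 / s\<^sup>2 + 8 * y2 * y1 * y2 / s ^ 3) = 0"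
proof -
  have "l\<^sup>2 * (- 1 * 2 * y1 / s\<^sup>2 - 2 * 1 * y1 / s\<^sup>2 - 2 * y1 * 1 / s\<^sup>2 + 8 * y1 * y1 * y1 / s ^ 3) + l\<^sup>2 * (- 0 * 2 * y2 / s\<^sup>2 - 2 * 1 * y1 / s\<^sup>2 - 2 * y2 * 0 / s\<^sup>2 + 8 * y2 * y1 * y2 / s ^ 3)
   = l\<^sup>2 * 8 * y1 * ((y1\<^sup>2 + y2\<^sup>2) - s) / s^3"
   using assms(1) by (simp add: field_simps power2_eq_square power3_eq_cube)
  then show ?thesis using assms(2) by simp
qed

text \<open>Planar inversion is anticonformal with harmonic components. In the chain rule the
  first-order terms therefore cancel, the mixed second derivatives drop out, and the pure ones
  receive the common factor \<open>inv_jac\<close>.\<close>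

lemma laplacian_inversion:
  assumes \<phi>: "smooth_on UNIV \<phi>" and x: "x \<noteq> Q"
  shows "laplacian (\<lambda>x. \<phi> (inversion Q l x)) x = inv_jac Q l x * laplacian \<phi> (inversion Q l x)"
proof -
  let ?m = "inversion Q l"
  define P where "P e j x = l\<^sup>2 * ((e \<bullet> j) / ((x - Q) \<bullet> (x - Q)) - 2 * ((x - Q) \<bullet> e) * ((x - Q) \<bullet> j) / ((x - Q) \<bullet> (x - Q))\<^sup>2)" for e j x
  have P: "partial_deriv e (\<lambda>x. ?m x \<bullet> j) x = P e j x" if "x \<noteq> Q" for e j x
    unfolding P_def using partial_deriv_eqI[OF inversion_component_derivative[OF that]] .
  have Pd: "(\<lambda>x. ?m x \<bullet> j) differentiable (at x)" if "x \<noteq> Q" for j x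
    using inversion_component_derivative[OF that] by (auto simp: differentiable_def)
  have d1: "\<phi> differentiable (at y)" "j \<in> Basis \<Longrightarrow> partial_deriv j \<phi> differentiable (at y)" for y j
    using \<phi> smooth_on_differentiable smooth_on_partial_deriv by blast+
  have p1: "partial_deriv e (\<lambda>x. \<phi> (?m x)) y = (\<Sum>j\<in>Basis. P e j y * partial_deriv j \<phi> (?m y))" if "y \<noteq> Q" for e y
    using partial_deriv_compose[where m="?m" and f=\<phi> and x=y and e=e] d1 Pd P that by simp
  define s where "s = (x - Q) \<bullet> (x - Q)"
  define Y where "Y = x - Q"
  have s: "s \<noteq> 0" using x by (simp add: s_def)
  have sY: "Y \<bullet> Y = s" by (simp add: s_def Y_def)
  have Pder: "((\<lambda>x. P e j x) has_derivative (\<lambda>h. l\<^sup>2 * (- (e \<bullet> j) * 2 * (Y \<bullet> h) / s\<^sup>2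
       - 2 * (h \<bullet> e) * (Y \<bullet> j) / s\<^sup>2 - 2 * (Y \<bullet> e) * (h \<bullet> j) / s\<^sup>2
       + 8 * (Y \<bullet> e) * (Y \<bullet> j) * (Y \<bullet> h) / s ^ 3))) (at x)" for e j
  proof -
    have 1: "((\<lambda>x. (x - Q) \<bullet> j) has_derivative (\<lambda>h. h \<bullet> j)) (at x)" for j
      by (auto intro!: derivative_eq_intros)
    have 2: "((\<lambda>x. (x - Q) \<bullet> (x - Q)) has_derivative (\<lambda>h. 2 * (Y \<bullet> h))) (at x)"
      by (auto intro!: derivative_eq_intros simp: inner_commute Y_def)
    have 3: "((\<lambda>x. ((x - Q) \<bullet> (x - Q))\<^sup>2) has_derivative (\<lambda>h. 2 * s * (2 * (Y \<bullet> h)))) (at x)"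
      using has_derivative_power[OF 2, of 2] by (simp add: s_def mult_ac)
    have 4: "((\<lambda>x. 2 * ((x - Q) \<bullet> e) * ((x - Q) \<bullet> j)) has_derivative (\<lambda>h. 2 * (Y \<bullet> e) * (h \<bullet> j) + 2 * (h \<bullet> e) * (Y \<bullet> j))) (at x)"
      unfolding Y_def by (intro has_derivative_mult has_derivative_mult_right 1)
    have 5: "((\<lambda>x. P e j x) has_derivative (\<lambda>h. l\<^sup>2 * ((0 * s - (e \<bullet> j) * (2 * (Y \<bullet> h))) / (s * s) -
        ((2 * (Y \<bullet> e) * (h \<bullet> j) + 2 * (h \<bullet> e) * (Y \<bullet> j)) * s\<^sup>2 - (2 * (Y \<bullet> e) * (Y \<bullet> j)) * (2 * s * (2 * (Y \<bullet> h)))) / (s\<^sup>2 * s\<^sup>2)))) (at x)"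
      unfolding P_def using has_derivative_divide'[OF has_derivative_const[of "e \<bullet> j"] 2]
        has_derivative_divide'[OF 4 3] s
      by (intro has_derivative_mult_right has_derivative_diff) (auto simp: s_def Y_def)
    show ?thesis
      by (rule has_derivative_eq_rhs[OF 5])
         (use s in \<open>simp add: fun_eq_iff field_simps power2_eq_square power3_eq_cube\<close>)
  qed
  have Pdiff: "(\<lambda>x. P e j x) differentiable (at x)" for e j using Pder by (auto simp: differentiable_def)
  define DP where "DP e j = partial_deriv e (\<lambda>x. P e j x) x" for e j
  have DP: "DP e j = l\<^sup>2 * (- (e \<bullet> j) * 2 * (Y \<bullet> e) / s\<^sup>2
       - 2 * (e \<bullet> e) * (Y \<bullet> j) / s\<^sup>2 - 2 * (Y \<bullet> e) * (e \<bullet> j) / s\<^sup>2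
       + 8 * (Y \<bullet> e) * (Y \<bullet> j) * (Y \<bullet> e) / s ^ 3)" for e j
    unfolding DP_def by (rule partial_deriv_eqI[OF Pder])
  define H where "H k j = partial_deriv k (partial_deriv j \<phi>) (?m x)" for k j
  have p2: "partial_deriv e (partial_deriv e (\<lambda>x. \<phi> (?m x))) x =
     (\<Sum>j\<in>Basis. P e j x * (\<Sum>k\<in>Basis. P e k x * H k j) + DP e j * partial_deriv j \<phi> (?m x))" for e
  proof -
    have cd: "(\<lambda>x. partial_deriv j \<phi> (?m x)) differentiable (at x)" if "j \<in> Basis" for j
      using differentiable_chain_at[OF differentiable_componentwise[OF Pd[OF x]] d1(2)[OF that]] by (simp add: o_def)
    have "partial_deriv e (partial_deriv e (\<lambda>x. \<phi> (?m x))) x = partial_deriv e (\<lambda>y. \<Sum>j\<in>Basis. P e j y * partial_deriv j \<phi> (?m y)) x"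
      by (rule partial_deriv_cong[of "-{Q}"]) (use x p1 in auto)
    also have "\<dots> = (\<Sum>j\<in>Basis. partial_deriv e (\<lambda>y. P e j y * partial_deriv j \<phi> (?m y)) x)"
      using Pdiff cd by (intro partial_deriv_sum differentiable_mult) auto
    also have "\<dots> = (\<Sum>j\<in>Basis. P e j x * (\<Sum>k\<in>Basis. P e k x * H k j) + DP e j * partial_deriv j \<phi> (?m x))"
    proof (rule sum.cong[OF refl])
      fix j :: "real^2" assume j: "j \<in> Basis"
      have "partial_deriv e (\<lambda>y. partial_deriv j \<phi> (?m y)) x = (\<Sum>k\<in>Basis. P e k x * H k j)"
        using partial_deriv_compose[where m="?m" and f="partial_deriv j \<phi>" and x=x and e=e] d1(2)[OF j] Pd P x
        by (simp add: H_def)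
      then show "partial_deriv e (\<lambda>y. P e j y * partial_deriv j \<phi> (?m y)) x =
          P e j x * (\<Sum>k\<in>Basis. P e k x * H k j) + DP e j * partial_deriv j \<phi> (?m x)"
        using partial_deriv_mult[OF Pdiff cd[OF j], of e e j] by (simp add: DP_def)
    qed
    finally show ?thesis .
  qed
  define y1 y2 where "y1 = Y $ 1" and "y2 = Y $ 2"
  have ys: "s = y1\<^sup>2 + y2\<^sup>2" by (simp add: s_def y1_def y2_def Y_def inner_vec_def sum_2 power2_eq_square)
  have ax: "Y \<bullet> axis 1 1 = y1" "Y \<bullet> axis 2 1 = y2" by (simp_all add: y1_def y2_def inner_axis)
  have axx: "axis 1 1 \<bullet> (axis 1 1 :: real^2) = 1" "axis 2 1 \<bullet> (axis 2 1 :: real^2) = 1"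
    "axis 1 1 \<bullet> (axis 2 1 :: real^2) = 0" "axis 2 1 \<bullet> (axis 1 1 :: real^2) = 0"
    by (simp_all add: inner_axis_axis)
  have Pval: "P (axis 1 1) (axis 1 1) x = l\<^sup>2 * (1 / s - 2 * y1 * y1 / s\<^sup>2)" "P (axis 2 1) (axis 2 1) x = l\<^sup>2 * (1 / s - 2 * y2 * y2 / s\<^sup>2)"
    "P (axis 1 1) (axis 2 1) x = l\<^sup>2 * (- 2 * y1 * y2 / s\<^sup>2)" "P (axis 2 1) (axis 1 1) x = l\<^sup>2 * (- 2 * y1 * y2 / s\<^sup>2)"
    unfolding P_def Y_def[symmetric] sY ax axx by simp_all
  let ?a = "axis 1 1 :: real^2" and ?b = "axis 2 1 :: real^2"
  have o1: "P ?a ?a x * P ?a ?a x + P ?b ?a x * P ?b ?a x = l ^ 4 / s\<^sup>2"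
    "P ?a ?b x * P ?a ?b x + P ?b ?b x * P ?b ?b x = l ^ 4 / s\<^sup>2"
    "P ?a ?a x * P ?a ?b x + P ?b ?a x * P ?b ?b x = 0"
    unfolding Pval using inversion_coeff_diag[OF s ys, of l] inversion_coeff_diag[of s y2 y1 l] s ys
      inversion_coeff_mixed[OF s ys, of l] by (simp_all add: add.commute mult.commute mult.left_commute)
  have o2: "DP ?a ?a + DP ?b ?a = 0" "DP ?a ?b + DP ?b ?b = 0"
    unfolding DP ax axx using inversion_coeff_harmonic[OF s ys, of l] inversion_coeff_harmonic[of s y2 y1 l] s ys
    by (simp_all add: add.commute)
  have "laplacian (\<lambda>x. \<phi> (?m x)) x =
     (P ?a ?a x * P ?a ?a x + P ?b ?a x * P ?b ?a x) * H ?a ?a + (P ?a ?b x * P ?a ?b x + P ?b ?b x * P ?b ?b x) * H ?b ?b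
     + (P ?a ?a x * P ?a ?b x + P ?b ?a x * P ?b ?b x) * (H ?a ?b + H ?b ?a)
     + (DP ?a ?a + DP ?b ?a) * partial_deriv ?a \<phi> (?m x) + (DP ?a ?b + DP ?b ?b) * partial_deriv ?b \<phi> (?m x)"
    unfolding laplacian_def p2 sum_Basis2 by (simp add: algebra_simps)
  also have "\<dots> = l ^ 4 / s\<^sup>2 * (H ?a ?a + H ?b ?b)" unfolding o1 o2 by (simp add: distrib_left)
  also have "\<dots> = inv_jac Q l x * laplacian \<phi> (?m x)"
    by (simp add: inv_jac_def s_def laplacian_def sum_Basis2 H_def)
  finally show ?thesis .
qed

section \<open>Change of variables under inversion\<close>

lemma inversion_has_derivative:
  assumes "x \<noteq> Q"
  shows "(inversion Q l has_derivative (\<lambda>h. (l\<^sup>2 / ((x - Q) \<bullet> (x - Q))) *\<^sub>R h -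
     (l\<^sup>2 * (2 * ((x - Q) \<bullet> h)) / ((x - Q) \<bullet> (x - Q))\<^sup>2) *\<^sub>R (x - Q))) (at x)"
proof (subst has_derivative_componentwise_within, rule ballI)
  fix j :: "real^2" assume "j \<in> Basis"
  define Y where "Y = x - Q"
  show "((\<lambda>x. inversion Q l x \<bullet> j) has_derivative (\<lambda>h. ((l\<^sup>2 / ((x - Q) \<bullet> (x - Q))) *\<^sub>R h -
     (l\<^sup>2 * (2 * ((x - Q) \<bullet> h)) / ((x - Q) \<bullet> (x - Q))\<^sup>2) *\<^sub>R (x - Q)) \<bullet> j)) (at x)"
    by (rule has_derivative_eq_rhs[OF inversion_component_derivative[OF assms]], unfold Y_def[symmetric])
       (simp add: fun_eq_iff inner_diff_left right_diff_distrib)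
qed

lemma inversion_det:
  assumes "x \<noteq> Q"
  shows "\<bar>det (matrix (\<lambda>h. (l\<^sup>2 / ((x - Q) \<bullet> (x - Q))) *\<^sub>R h -
     (l\<^sup>2 * (2 * ((x - Q) \<bullet> h)) / ((x - Q) \<bullet> (x - Q))\<^sup>2) *\<^sub>R (x - Q)))\<bar> = inv_jac Q l x"
proof -
  define Y where "Y = x - Q"
  define s where "s = Y \<bullet> Y"
  have s: "s \<noteq> 0" using assms by (simp add: s_def Y_def)
  have ys: "s = (Y $ 1)\<^sup>2 + (Y $ 2)\<^sup>2" by (simp add: s_def inner_vec_def sum_2 power2_eq_square)
  have "det (matrix (\<lambda>h. (l\<^sup>2 / s) *\<^sub>R h - (l\<^sup>2 * (2 * (Y \<bullet> h)) / s\<^sup>2) *\<^sub>R Y)) =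
     (l\<^sup>2 / s - l\<^sup>2 * (2 * Y $ 1) / s\<^sup>2 * Y $ 1) * (l\<^sup>2 / s - l\<^sup>2 * (2 * Y $ 2) / s\<^sup>2 * Y $ 2)
      - (l\<^sup>2 * (2 * Y $ 2) / s\<^sup>2 * Y $ 1) * (l\<^sup>2 * (2 * Y $ 1) / s\<^sup>2 * Y $ 2)"
  proof -
    have "axis i (1::real) $ j = (if j = i then 1 else 0)" for i j :: 2 by (simp add: axis_def)
    then show ?thesis by (simp add: det_2 matrix_def inner_axis)
  qed
  also have "\<dots> = l ^ 4 / s\<^sup>2 - 2 * l ^ 4 * ((Y $ 1)\<^sup>2 + (Y $ 2)\<^sup>2) / s ^ 3"
    using s by (simp add: field_simps power2_eq_square power3_eq_cube power4_eq_xxxx)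
  also have "\<dots> = - (l ^ 4 / s\<^sup>2)"
    unfolding ys[symmetric] using s by (simp add: power2_eq_square power3_eq_cube)
  finally show ?thesis by (simp add: inv_jac_def Y_def[symmetric] s_def[symmetric])
qed

lemma inversion_measurable [measurable]: "inversion Q l \<in> borel_measurable borel"
  unfolding inversion_def[abs_def] by measurable

lemma inv_jac_measurable [measurable]: "inv_jac Q l \<in> borel_measurable borel"
  unfolding inv_jac_def[abs_def] by measurable

lemma integrable_inversion_aux:
  fixes f :: "real^2 \<Rightarrow> real"
  assumes l: "l \<noteq> 0" and f: "integrable lborel f"
  shows "integrable lborel (\<lambda>x. inv_jac Q l x * f (inversion Q l x)) \<and>
     (\<integral>x. inv_jac Q l x * f (inversion Q l x) \<partial>lborel) = (\<integral>x. f x \<partial>lborel)"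
proof -
  note [measurable] = borel_measurable_integrable[OF f]
  let ?S = "-{Q}"
  let ?g = "\<lambda>x. inv_jac Q l x * f (inversion Q l x)"
  let ?I = "inversion Q l"
  have img: "?I ` ?S = ?S"
  proof (intro equalityI subsetI)
    fix x assume "x \<in> ?S"
    then have "?I x \<in> ?S" using inversion_eq_iff[OF l] by simp
    then show "x \<in> ?I ` ?S" using inversion_involution[OF l, of Q x] by (intro image_eqI[of _ _ "?I x"]) auto
  qed (use inversion_eq_iff[OF l] in auto)
  have inj: "inj_on ?I ?S" using inversion_involution[OF l] by (intro inj_on_inverseI[of _ ?I]) auto
  have S: "?S \<in> sets lebesgue" "?S \<in> sets borel" by auto
  have fS: "f absolutely_integrable_on ?S"
  proof -
    have "integrable lebesgue f" using f by (simp add: integrable_completion)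
    then show ?thesis unfolding set_integrable_def using integrable_mult_indicator S(1) by blast
  qed
  let ?d = "\<lambda>x h. (l\<^sup>2 / ((x - Q) \<bullet> (x - Q))) *\<^sub>R h - (l\<^sup>2 * (2 * ((x - Q) \<bullet> h)) / ((x - Q) \<bullet> (x - Q))\<^sup>2) *\<^sub>R (x - Q)"
  \<comment> \<open>The change of variables theorem speaks of vector-valued functions, so
    \<open>f\<close> is read as a map into \<open>real^1\<close>.\<close>
  have "(\<lambda>x. vec (f x) :: real^1) absolutely_integrable_on ?I ` ?S \<and> integral (?I ` ?S) (\<lambda>x. vec (f x) :: real^1) = vec (integral ?S f)"
    unfolding img by (simp add: absolutely_integrable_on_1_iff integral_on_1_eq fS)
  moreover have "(\<lambda>x. \<bar>det (matrix (?d x))\<bar> *\<^sub>R vec (f (?I x)) :: real^1) absolutely_integrable_on ?S \<and>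
      integral ?S (\<lambda>x. \<bar>det (matrix (?d x))\<bar> *\<^sub>R vec (f (?I x)) :: real^1) = vec (integral ?S f)
    \<longleftrightarrow> (\<lambda>x. vec (f x) :: real^1) absolutely_integrable_on ?I ` ?S \<and> integral (?I ` ?S) (\<lambda>x. vec (f x) :: real^1) = vec (integral ?S f)"
    using inversion_has_derivative has_derivative_at_withinI
    by (intro has_absolute_integral_change_of_variables[OF S(1) _ inj]) blast
  ultimately have "(\<lambda>x. \<bar>det (matrix (?d x))\<bar> * f (?I x)) absolutely_integrable_on ?S \<and>
      integral ?S (\<lambda>x. \<bar>det (matrix (?d x))\<bar> * f (?I x)) = integral ?S f"
    by (simp add: absolutely_integrable_on_1_iff integral_on_1_eq vec_eq_iff)
  moreover have "(\<lambda>x. \<bar>det (matrix (?d x))\<bar> * f (?I x)) absolutely_integrable_on ?S \<longleftrightarrow> ?g absolutely_integrable_on ?S"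
    unfolding set_integrable_def
    by (rule Bochner_Integration.integrable_cong[OF refl]) (auto simp: indicator_def inversion_det)
  moreover have "integral ?S (\<lambda>x. \<bar>det (matrix (?d x))\<bar> * f (?I x)) = integral ?S ?g"
    by (rule Henstock_Kurzweil_Integration.integral_cong) (simp add: inversion_det)
  ultimately have g: "?g absolutely_integrable_on ?S" "integral ?S ?g = integral ?S f" by auto
  \<comment> \<open>At \<open>Q\<close> the Jacobian is 0, so putting the centre back changes
    nothing.\<close>
  have g0: "indicator ?S x *\<^sub>R ?g x = ?g x" for x by (cases "x = Q") (simp_all add: inv_jac_def)
  have ig: "integrable lebesgue ?g" using g(1) unfolding set_integrable_def g0 .
  then have "integrable lborel ?g" by (subst (asm) integrable_completion) auto
  moreover have "(\<integral>x. ?g x \<partial>lborel) = (\<integral>x. f x \<partial>lborel)"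
  proof -
    have "(\<integral>x. ?g x \<partial>lborel) = (LINT x:?S|lebesgue. ?g x)"
      unfolding set_lebesgue_integral_def g0 by (subst integral_completion) auto
    also have "\<dots> = (LINT x:?S|lebesgue. f x)"
      using set_lebesgue_integral_eq_integral(2)[OF g(1)] set_lebesgue_integral_eq_integral(2)[OF fS] g(2) by simp
    also have "\<dots> = (\<integral>x. indicator ?S x *\<^sub>R f x \<partial>lborel)"
      unfolding set_lebesgue_integral_def by (subst integral_completion) auto
    also have "\<dots> = (\<integral>x. f x \<partial>lborel)"
      by (rule integral_cong_AE) (auto intro!: eventually_mono[OF AE_lborel_singleton[of Q]])
    finally show ?thesis .
  qed
  ultimately show ?thesis by (rule conjI)
qed

lemma integrable_inversion:
  fixes f :: "real^2 \<Rightarrow> real"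
  assumes "l \<noteq> 0" "integrable lborel f"
  shows "integrable lborel (\<lambda>x. inv_jac Q l x * f (inversion Q l x))"
    and "(\<integral>x. inv_jac Q l x * f (inversion Q l x) \<partial>lborel) = (\<integral>x. f x \<partial>lborel)"
  using integrable_inversion_aux[OF assms] by auto

text \<open>Where the composition does not vanish, \<open>norm (x - Q)\<close> is at most
  \<open>l^2 / e\<close>. There the Jacobian is at least \<open>e^4 / l^4\<close>, so it can be
  inserted at the cost of a constant.\<close>

lemma integrable_compose_inversion:
  fixes f :: "real^2 \<Rightarrow> real"
  assumes l: "l \<noteq> 0" and f: "integrable lborel f" and e: "e > 0" "\<And>x. norm (x - Q) < e \<Longrightarrow> f x = 0"
  shows "integrable lborel (\<lambda>x. f (inversion Q l x))"
proof (rule Bochner_Integration.integrable_bound)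
  note [measurable] = borel_measurable_integrable[OF f]
  show "integrable lborel (\<lambda>x. (l ^ 4 / e ^ 4) * (inv_jac Q l x * f (inversion Q l x)))"
    using integrable_inversion(1)[OF l f] by simp
  show "(\<lambda>x. f (inversion Q l x)) \<in> borel_measurable lborel" by measurable
  show "AE x in lborel. norm (f (inversion Q l x)) \<le> norm ((l ^ 4 / e ^ 4) * (inv_jac Q l x * f (inversion Q l x)))"
  proof (rule AE_I2)
    fix x
    show "norm (f (inversion Q l x)) \<le> norm ((l ^ 4 / e ^ 4) * (inv_jac Q l x * f (inversion Q l x)))"
    proof (cases "norm (inversion Q l x - Q) < e")
      case False
      then have x: "x \<noteq> Q" using e(1) by (auto simp: inversion_self)
      define r where "r = norm (x - Q)"
      have r: "r > 0" using x by (simp add: r_def)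
      have "e * r \<le> l\<^sup>2" using False norm_inversion[OF x, of l] r by (simp add: r_def field_simps)
      then have "(e * r) ^ 4 \<le> (l\<^sup>2) ^ 4" using e(1) r by (intro power_mono) auto
      then have "1 \<le> l ^ 4 / e ^ 4 * (l ^ 4 / r ^ 4)"
        using e(1) r by (simp add: power_mult_distrib power_mult[symmetric] field_simps power_add[symmetric])
      then have "1 * \<bar>f (inversion Q l x)\<bar> \<le> l ^ 4 / e ^ 4 * inv_jac Q l x * \<bar>f (inversion Q l x)\<bar>"
        unfolding inv_jac_norm r_def[symmetric] by (intro mult_right_mono) auto
      then show ?thesis using e(1) inv_jac_nonneg[of Q l x] by (simp add: abs_mult mult_ac)
    qed (use e in simp)
  qed
qed

text \<open>An involution can be moved from one factor of a product integral to the other, at the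
  price of the Jacobian on one side. These adjoint relations carry weak equations through
  reflections.\<close>

lemma integral_inversion_test:
  fixes f q :: "real^2 \<Rightarrow> real"
  assumes l: "l \<noteq> 0" and q: "q \<in> test_functions D"
  shows "integrable lborel f \<Longrightarrow> (\<integral>x. inv_jac Q l x * f (inversion Q l x) * q x \<partial>lborel) = (\<integral>x. f x * q (inversion Q l x) \<partial>lborel)"
    and "integrable lborel f \<Longrightarrow> integrable lborel (\<lambda>x. f x * q (inversion Q l x))"
    and "integrable lborel (\<lambda>x. f (inversion Q l x)) \<Longrightarrow> (\<integral>x. f (inversion Q l x) * q x \<partial>lborel) = (\<integral>x. f x * (inv_jac Q l x * q (inversion Q l x)) \<partial>lborel)"
    and "integrable lborel (\<lambda>x. f (inversion Q l x)) \<Longrightarrow> integrable lborel (\<lambda>x. f x * (inv_jac Q l x * q (inversion Q l x)))"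
proof -
  note [measurable] = borel_measurable_test[OF q]
  obtain C where C: "\<And>x. \<bar>q x\<bar> \<le> C" using test_functions_bounded[OF q] by blast
  note inv = inversion_involution[OF l]
  {
    assume f: "integrable lborel f"
    have "(\<lambda>x. q (inversion Q l x)) \<in> borel_measurable borel" by measurable
    then show i: "integrable lborel (\<lambda>x. f x * q (inversion Q l x))"
      using integrable_mult_bounded[OF f _ C] by simp
    show "(\<integral>x. inv_jac Q l x * f (inversion Q l x) * q x \<partial>lborel) = (\<integral>x. f x * q (inversion Q l x) \<partial>lborel)"
      using integrable_inversion(2)[OF l i, of Q] by (simp add: inv mult.assoc)
  next
    assume f: "integrable lborel (\<lambda>x. f (inversion Q l x))"
    have i: "integrable lborel (\<lambda>x. f (inversion Q l x) * q x)" by (rule integrable_mult_test[OF f q])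
    show "integrable lborel (\<lambda>x. f x * (inv_jac Q l x * q (inversion Q l x)))"
      using integrable_inversion(1)[OF l i, of Q] by (simp add: inv mult_ac)
    show "(\<integral>x. f (inversion Q l x) * q x \<partial>lborel) = (\<integral>x. f x * (inv_jac Q l x * q (inversion Q l x)) \<partial>lborel)"
      using integrable_inversion(2)[OF l i, of Q] by (simp add: inv mult_ac)
  }
qed

text \<open>The planar Kelvin transform: no power of the distance in front of \<open>u\<close>,
  since the Laplacian of the reflected test function is the Jacobian times the reflected Laplacian.
  The Jacobian passes to the right-hand side by the adjoint relations.\<close>

lemma wlap_inversion:
  assumes l: "l \<noteq> 0" and w: "wlap D u F" and E: "Q \<notin> E" "inversion Q l ` E \<subseteq> D"
    and i: "integrable lborel (\<lambda>x. u (inversion Q l x))"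
  shows "wlap E (\<lambda>x. u (inversion Q l x)) (\<lambda>x. inv_jac Q l x * F (inversion Q l x))"
  unfolding wlap_def
proof (intro conjI ballI i integrable_inversion(1)[OF l wlapD(2)[OF w]])
  fix \<phi> :: "real^2 \<Rightarrow> real" assume \<phi>: "\<phi> \<in> test_functions E"
  let ?I = "inversion Q l"
  obtain K where K: "compact K" "K \<subseteq> E" "\<And>x. x \<notin> K \<Longrightarrow> \<phi> x = 0" using test_functionsD[OF \<phi>] by auto
  have QK: "K \<subseteq> -{Q}" using K E by auto
  have "continuous_on (-{Q}) ?I"
    using smooth_on_continuous[OF smooth_on_inversion] by (auto intro: continuous_on_componentwise[THEN iffD2])
  then have cI: "compact (?I ` K)" using K(1) QK compact_continuous_image continuous_on_subset by metis
  have "(\<lambda>x. if x \<in> -{Q} then \<phi> (?I x) else 0) \<in> test_functions D"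
  proof (rule test_functions_extend[of _ _ "?I ` K"])
    show "smooth_on (-{Q}) (\<lambda>x. \<phi> (?I x))" by (rule smooth_on_compose_inversion[OF test_functionsD(1)[OF \<phi>]])
    show "?I ` K \<subseteq> -{Q}" using QK unfolding image_subset_iff by (simp add: inversion_eq_iff[OF l] subset_iff)
    show "\<phi> (?I x) = 0" if "x \<in> -{Q} - ?I ` K" for x
      using that inversion_involution[OF l, of Q x] by (intro K(3)) (metis DiffD2 imageI)
  qed (use cI K E in auto)
  moreover have "(\<lambda>x. if x \<in> -{Q} then \<phi> (?I x) else 0) = (\<lambda>x. \<phi> (?I x))"
    using K(3) QK by (auto simp: fun_eq_iff inversion_self)
  ultimately have t: "(\<lambda>x. \<phi> (?I x)) \<in> test_functions D" by simp
  have "(\<integral>x. u (?I x) * laplacian \<phi> x \<partial>lborel) = (\<integral>x. u x * (inv_jac Q l x * laplacian \<phi> (?I x)) \<partial>lborel)"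
    by (rule integral_inversion_test(3)[OF l test_functions_laplacian[OF \<phi>] i])
  also have "\<dots> = (\<integral>x. u x * laplacian (\<lambda>x. \<phi> (?I x)) x \<partial>lborel)"
  proof (rule integral_cong_AE)
    show "AE x in lborel. u x * (inv_jac Q l x * laplacian \<phi> (?I x)) = u x * laplacian (\<lambda>x. \<phi> (?I x)) x"
      by (rule eventually_mono[OF AE_lborel_singleton[of Q]]) (simp add: laplacian_inversion[OF test_functionsD(1)[OF \<phi>]])
    show "(\<lambda>x. u x * (inv_jac Q l x * laplacian \<phi> (?I x))) \<in> borel_measurable lborel"
      using borel_measurable_integrable[OF integral_inversion_test(4)[OF l test_functions_laplacian[OF \<phi>] i]] .
    show "(\<lambda>x. u x * laplacian (\<lambda>x. \<phi> (?I x)) x) \<in> borel_measurable lborel"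
      using borel_measurable_integrable[OF integrable_mult_test[OF wlapD(1)[OF w] test_functions_laplacian[OF t]]] .
  qed
  finally show "- (\<integral>x. u (?I x) * laplacian \<phi> x \<partial>lborel) = (\<integral>x. inv_jac Q l x * F (?I x) * \<phi> x \<partial>lborel)"
    using wlapD(3)[OF w t] integral_inversion_test(1)[OF l \<phi> wlapD(2)[OF w], of Q] by simp
qed

subsection \<open>The Dirichlet problem on the annulus\<close>

lemma open_annulus: "open annulus"
  unfolding annulus_def by (intro open_Collect_conj open_Collect_less continuous_intros)

lemma annulus_borel [measurable]: "annulus \<in> sets borel"
  using open_annulus by simp

lemma annulus_subset_ball: "annulus \<subseteq> ball 0 1"
  by (auto simp: annulus_def)

lemma closure_annulus: "closure annulus \<subseteq> {x. 1/2 \<le> norm x \<and> norm x \<le> 1}"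
proof (rule closure_minimal)
  show "closed {x::real^2. 1/2 \<le> norm x \<and> norm x \<le> 1}"
    by (intro closed_Collect_conj closed_Collect_le continuous_intros)
qed (auto simp: annulus_def)

lemma compact_closed_annulus: "compact {x::real^2. 1/2 \<le> norm x \<and> norm x \<le> 1}"
proof -
  have "{x::real^2. 1/2 \<le> norm x \<and> norm x \<le> 1} = cball 0 1 \<inter> {x. 1/2 \<le> norm x}" by auto
  then show ?thesis
    using compact_Int_closed[OF compact_cball closed_Collect_le[of "\<lambda>x. 1/2" "norm :: real^2 \<Rightarrow> real"], of 0 1]
    by (simp add: continuous_on_norm_id)
qed

lemma frontier_annulus: "x \<in> frontier annulus \<Longrightarrow> norm x = 1/2 \<or> norm x = 1"
  using closure_annulus open_annulus by (force simp: frontier_def interior_open annulus_def)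

text \<open>The very weak formulation, in which the boundary condition is encoded by test functions that
  are smooth up to the boundary and vanish there.\<close>

definition annulus_dirichlet :: "(real^2 \<Rightarrow> real) \<Rightarrow> (real^2 \<Rightarrow> real) \<Rightarrow> bool" where
  "annulus_dirichlet u F \<longleftrightarrow> integrable lborel u \<and> integrable lborel F \<and>
     (\<forall>x. x \<notin> annulus \<longrightarrow> u x = 0 \<and> F x = 0) \<and>
     (\<forall>\<psi>. smooth_on (-{0}) \<psi> \<longrightarrow> (\<forall>x. norm x = 1/2 \<or> norm x = 1 \<longrightarrow> \<psi> x = 0) \<longrightarrow>
        - (\<integral>x. u x * laplacian \<psi> x \<partial>lborel) = (\<integral>x. F x * \<psi> x \<partial>lborel))"

lemma annulus_dirichletD:
  assumes "annulus_dirichlet u F"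
  shows "integrable lborel u" "integrable lborel F" "x \<notin> annulus \<Longrightarrow> u x = 0" "x \<notin> annulus \<Longrightarrow> F x = 0"
    "smooth_on (-{0}) \<psi> \<Longrightarrow> (\<And>x. norm x = 1/2 \<or> norm x = 1 \<Longrightarrow> \<psi> x = 0) \<Longrightarrow>
        - (\<integral>x. u x * laplacian \<psi> x \<partial>lborel) = (\<integral>x. F x * \<psi> x \<partial>lborel)"
  using assms unfolding annulus_dirichlet_def by auto

lemma annulus_dirichlet_wlap: "annulus_dirichlet u F \<Longrightarrow> wlap annulus u F"
  unfolding wlap_def
proof (intro conjI ballI)
  assume d: "annulus_dirichlet u F"
  show "integrable lborel u" "integrable lborel F" using annulus_dirichletD[OF d] by auto
  fix \<phi> assume \<phi>: "\<phi> \<in> test_functions annulus"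
  then obtain K where "K \<subseteq> annulus" "\<And>x. x \<notin> K \<Longrightarrow> \<phi> x = 0" using test_functionsD by blast
  then have "\<phi> x = 0" if "norm x = 1/2 \<or> norm x = 1" for x
  proof -
    have "x \<notin> annulus" using that by (auto simp: annulus_def)
    then show ?thesis using \<open>K \<subseteq> annulus\<close> \<open>\<And>x. x \<notin> K \<Longrightarrow> \<phi> x = 0\<close> by blast
  qed
  then show "- (\<integral>x. u x * laplacian \<phi> x \<partial>lborel) = (\<integral>x. F x * \<phi> x \<partial>lborel)"
    using annulus_dirichletD(5)[OF d] smooth_on_subset[OF test_functionsD(1)[OF \<phi>]] by auto
qed

text \<open>A function vanishing off the annulus sees \<open>q\<close> only on the closed annulus,
  where continuity off the origin gives a bound.\<close>

lemma integrable_annulus_mult: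
  fixes u q :: "real^2 \<Rightarrow> real"
  assumes u: "integrable lborel u" "\<And>x. x \<notin> annulus \<Longrightarrow> u x = 0" and q: "continuous_on (-{0}) q"
  shows "integrable lborel (\<lambda>x. u x * q x)"
proof -
  let ?A = "{x::real^2. 1/2 \<le> norm x \<and> norm x \<le> 1}"
  have c: "continuous_on ?A q" by (rule continuous_on_subset[OF q]) auto
  then have "bounded (q ` ?A)" using compact_closed_annulus compact_continuous_image compact_imp_bounded by blast
  then obtain C where C: "\<And>x. x \<in> ?A \<Longrightarrow> \<bar>q x\<bar> \<le> C" by (auto simp: bounded_iff)
  have C0: "C \<ge> 0" using C[of "axis 1 1"] by auto
  have "?A \<in> sets borel" using compact_closed_annulus by (simp add: compact_imp_closed borel_closed)
  then have "(\<lambda>x. if x \<in> ?A then q x else 0) \<in> borel_measurable borel"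
    using borel_measurable_continuous_on_if[OF _ c, of "\<lambda>x. 0"] by simp
  then have "integrable lborel (\<lambda>x. u x * (if x \<in> ?A then q x else 0))"
    using C C0 by (intro integrable_mult_bounded[OF u(1), of _ C]) auto
  moreover have "u x * (if x \<in> ?A then q x else 0) = u x * q x" for x
    using u(2)[of x] by (auto simp: annulus_def)
  ultimately show ?thesis by (simp only:)
qed

section \<open>Odd reflection across the two boundary circles\<close>

definition odd_ext :: "(real^2 \<Rightarrow> real) \<Rightarrow> real^2 \<Rightarrow> real" where
  "odd_ext u x = u x - u (inversion 0 1 x) - u (inversion 0 (1/2) x)"

definition odd_ext_rhs :: "(real^2 \<Rightarrow> real) \<Rightarrow> real^2 \<Rightarrow> real" where
  "odd_ext_rhs F x = F x - inv_jac 0 1 x * F (inversion 0 1 x) - inv_jac 0 (1/2) x * F (inversion 0 (1/2) x)"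

lemma laplacian_diff:
  assumes "open S" "smooth_on S f" "smooth_on S g" "x \<in> S"
  shows "laplacian (\<lambda>x. f x - g x) x = laplacian f x - laplacian g x"
proof -
  have p: "partial_deriv e (\<lambda>x. f x - g x) y = partial_deriv e f y - partial_deriv e g y"
    if "f differentiable (at y)" "g differentiable (at y)" for f g :: "'a \<Rightarrow> real" and e y
    using that by (intro partial_deriv_eqI[THEN trans, OF has_derivative_diff])
       (auto simp: partial_deriv_def frechet_derivative_works)
  have "partial_deriv e (partial_deriv e (\<lambda>x. f x - g x)) x = partial_deriv e (partial_deriv e f) x - partial_deriv e (partial_deriv e g) x"
    if e: "e \<in> Basis" for e
  proof -
    have "partial_deriv e (partial_deriv e (\<lambda>x. f x - g x)) x = partial_deriv e (\<lambda>x. partial_deriv e f x - partial_deriv e g x) x"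
      using assms(2,3) smooth_on_differentiable by (intro partial_deriv_cong[OF assms(1,4)] p) blast+
    also have "\<dots> = partial_deriv e (partial_deriv e f) x - partial_deriv e (partial_deriv e g) x"
      using assms smooth_on_partial_deriv[OF e] smooth_on_differentiable by (intro p) blast+
    finally show ?thesis .
  qed
  then show ?thesis by (simp add: laplacian_def sum_subtractf)
qed

lemma norm_inversion0: "norm (inversion 0 l x) = l\<^sup>2 / norm x"
  using norm_inversion[of x 0 l] by (cases "x = 0") (auto simp: inversion_self)

lemma inversion0_fixed: "norm x = l \<Longrightarrow> l > 0 \<Longrightarrow> inversion 0 l x = x"
  by (simp add: inversion_def dot_square_norm)

text \<open>Duality: a test function \<open>\<phi>\<close> of the larger annulus is replaced by its
  antisymmetrisation \<open>\<psi>\<close>. On each circle one reflection fixes \<open>x\<close> and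
  cancels \<open>\<phi> x\<close>, while the other sends \<open>x\<close> to norm 2 or
  \<open>1/4\<close>, where \<open>\<phi>\<close> vanishes. So \<open>\<psi>\<close> is admissible
  in the very weak formulation, and the adjoint relations move the reflections over to
  \<open>u\<close> and \<open>F\<close>.\<close>

lemma odd_extension:
  assumes d: "annulus_dirichlet u F"
  shows "wlap {x. 1/4 < norm x \<and> norm x < 2} (odd_ext u) (odd_ext_rhs F)"
    "integrable lborel (odd_ext u)" "integrable lborel (odd_ext_rhs F)"
proof -
  let ?I = "inversion 0 1" and ?J = "inversion 0 (1/2)"
  note iu = annulus_dirichletD(1)[OF d] and iF = annulus_dirichletD(2)[OF d]
  have z: "u x = 0" "F x = 0" if "norm (x - 0) < 1/2" for x
    using that annulus_dirichletD(3,4)[OF d] by (auto simp: annulus_def)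
  have i1: "integrable lborel (\<lambda>x. u (?I x))" and i2: "integrable lborel (\<lambda>x. u (?J x))"
    using integrable_compose_inversion[OF _ iu, where e="1/2" and Q=0] z(1) by auto
  show U: "integrable lborel (odd_ext u)" unfolding odd_ext_def[abs_def] using iu i1 i2 by auto
  show G: "integrable lborel (odd_ext_rhs F)" unfolding odd_ext_rhs_def[abs_def]
    using iF integrable_inversion(1)[OF _ iF] by auto
  show "wlap {x. 1/4 < norm x \<and> norm x < 2} (odd_ext u) (odd_ext_rhs F)"
    unfolding wlap_def
  proof (intro conjI ballI U G)
    fix \<phi> :: "real^2 \<Rightarrow> real" assume \<phi>: "\<phi> \<in> test_functions {x. 1/4 < norm x \<and> norm x < 2}"
    have \<phi>0: "\<phi> x = 0" if "norm x \<le> 1/4 \<or> norm x \<ge> 2" for x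
    proof -
      have "x \<notin> {x. 1/4 < norm x \<and> norm x < 2}" using that by auto
      then show ?thesis using test_functionsD(2)[OF \<phi>] by blast
    qed
    note s = test_functionsD(1)[OF \<phi>] and l = test_functions_laplacian[OF \<phi>]
    define \<psi> where "\<psi> x = \<phi> x - \<phi> (?I x) - \<phi> (?J x)" for x
    have s1: "smooth_on (-{0}) \<phi>" "smooth_on (-{0}) (\<lambda>x. \<phi> (?I x))" "smooth_on (-{0}) (\<lambda>x. \<phi> (?J x))"
      "smooth_on (-{0}) (\<lambda>x. \<phi> x - \<phi> (?I x))"
      using smooth_on_subset[OF s] smooth_on_compose_inversion[OF s, of 0] by (auto intro!: smooth_on_diff)
    have "smooth_on (-{0}) \<psi>" unfolding \<psi>_def[abs_def] using s1 by (intro smooth_on_diff) auto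
    moreover have "\<psi> x = 0" if "norm x = 1/2 \<or> norm x = 1" for x
      using that
    proof
      assume "norm x = 1/2"
      have "norm (?I x) = 2" using arg_cong[OF \<open>norm x = 1/2\<close>, of "\<lambda>t. 1 / t"] by (simp add: norm_inversion0)
      then show ?thesis using inversion0_fixed[of x "1/2"] \<phi>0[of "?I x"] \<open>norm x = 1/2\<close> by (simp add: \<psi>_def)
    next
      assume "norm x = 1"
      then show ?thesis using inversion0_fixed[of x 1] \<phi>0[of "?J x"] by (simp add: \<psi>_def norm_inversion0 power2_eq_square)
    qed
    ultimately have main: "- (\<integral>x. u x * laplacian \<psi> x \<partial>lborel) = (\<integral>x. F x * \<psi> x \<partial>lborel)"
      by (rule annulus_dirichletD(5)[OF d])
    have lap: "laplacian \<psi> x = laplacian \<phi> x - inv_jac 0 1 x * laplacian \<phi> (?I x) - inv_jac 0 (1/2) x * laplacian \<phi> (?J x)"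
      if "x \<noteq> 0" for x
    proof -
      have x: "x \<in> -{0}" "open (-{0::real^2})" using that by auto
      show ?thesis unfolding \<psi>_def[abs_def]
        using laplacian_diff[OF x(2) s1(4,3) x(1)] laplacian_diff[OF x(2) s1(1,2) x(1)]
          laplacian_inversion[OF s that, of 1] laplacian_inversion[OF s that, of "1/2"] by linarith
    qed
    have "(\<integral>x. u x * laplacian \<psi> x \<partial>lborel) = (\<integral>x. u x * laplacian \<phi> x - u x * (inv_jac 0 1 x * laplacian \<phi> (?I x))
        - u x * (inv_jac 0 (1/2) x * laplacian \<phi> (?J x)) \<partial>lborel)"
    proof (rule Bochner_Integration.integral_cong[OF refl])
      fix x
      show "u x * laplacian \<psi> x = u x * laplacian \<phi> x - u x * (inv_jac 0 1 x * laplacian \<phi> (?I x))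
        - u x * (inv_jac 0 (1/2) x * laplacian \<phi> (?J x))"
        using z(1)[of x] lap[of x] by (cases "x = 0") (simp_all add: right_diff_distrib)
    qed
    also have "\<dots> = (\<integral>x. u x * laplacian \<phi> x \<partial>lborel) - (\<integral>x. u (?I x) * laplacian \<phi> x \<partial>lborel) - (\<integral>x. u (?J x) * laplacian \<phi> x \<partial>lborel)"
      using integrable_mult_test[OF iu l] integral_inversion_test(3,4)[OF _ l i1] integral_inversion_test(3,4)[OF _ l i2] by simp
    also have "\<dots> = (\<integral>x. odd_ext u x * laplacian \<phi> x \<partial>lborel)"
      using integrable_mult_test[OF iu l] integrable_mult_test[OF i1 l] integrable_mult_test[OF i2 l]
      by (simp add: odd_ext_def left_diff_distrib)
    finally have A: "(\<integral>x. u x * laplacian \<psi> x \<partial>lborel) = (\<integral>x. odd_ext u x * laplacian \<phi> x \<partial>lborel)" .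
    have "(\<integral>x. F x * \<psi> x \<partial>lborel) = (\<integral>x. F x * \<phi> x \<partial>lborel) - (\<integral>x. F x * \<phi> (?I x) \<partial>lborel) - (\<integral>x. F x * \<phi> (?J x) \<partial>lborel)"
      using integrable_mult_test[OF iF \<phi>] integral_inversion_test(2)[OF _ \<phi> iF] by (simp add: \<psi>_def right_diff_distrib)
    also have "\<dots> = (\<integral>x. F x * \<phi> x \<partial>lborel) - (\<integral>x. inv_jac 0 1 x * F (?I x) * \<phi> x \<partial>lborel) - (\<integral>x. inv_jac 0 (1/2) x * F (?J x) * \<phi> x \<partial>lborel)"
      using integral_inversion_test(1)[OF _ \<phi> iF] by simp
    also have "\<dots> = (\<integral>x. odd_ext_rhs F x * \<phi> x \<partial>lborel)"
      using integrable_mult_test[OF iF \<phi>] integrable_mult_test[OF integrable_inversion(1)[OF _ iF] \<phi>]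
      by (simp add: odd_ext_rhs_def left_diff_distrib)
    finally show "- (\<integral>x. odd_ext u x * laplacian \<phi> x \<partial>lborel) = (\<integral>x. odd_ext_rhs F x * \<phi> x \<partial>lborel)"
      using main A by simp
  qed
qed

lemma odd_ext_annulus:
  assumes "\<And>x. x \<notin> annulus \<Longrightarrow> u x = 0" "x \<in> annulus"
  shows "odd_ext u x = u x"
proof -
  have "1/2 < norm x" "norm x < 1" using assms(2) by (auto simp: annulus_def)
  moreover from this have "0 < norm x" by linarith
  ultimately have "1 < 1 / norm x" "1/4 / norm x < 1/2" by (simp_all add: field_simps)
  then have "inversion 0 1 x \<notin> annulus" "inversion 0 (1/2) x \<notin> annulus"
    by (simp_all add: annulus_def norm_inversion0 power2_eq_square)
  then show ?thesis using assms(1) by (simp add: odd_ext_def)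
qed

text \<open>A neighbourhood of the closed annulus from which balls of radius \<open>1/16\<close>
  stay in the region where the odd extension solves its equation.\<close>

definition collar :: "(real^2) set" where
  "collar = {x. 3/8 < norm x \<and> norm x < 3/2}"

lemma open_collar: "open collar"
  unfolding collar_def by (intro open_Collect_conj open_Collect_less continuous_intros)

lemma collar_cball: "x \<in> collar \<Longrightarrow> cball x (1/16) \<subseteq> {x. 1/4 < norm x \<and> norm x < 2}"
proof
  fix y assume x: "x \<in> collar" and "y \<in> cball x (1/16)"
  then have "norm (x - y) \<le> 1/16" by (simp add: dist_norm)
  moreover have "norm x \<le> norm y + norm (x - y)" "norm y \<le> norm x + norm (x - y)"
    by norm+
  ultimately show "y \<in> {x. 1/4 < norm x \<and> norm x < 2}" using x by (simp add: collar_def)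
qed

text \<open>On the collar the odd extension is almost everywhere a bounded mollification plus the
  potential of an integrable function, so the estimate holds up to the boundary and not only in the
  interior.\<close>

lemma annulus_dirichlet_exp_integrable:
  assumes d: "annulus_dirichlet u F"
  shows "integrable lborel (\<lambda>x. indicator annulus x * exp (2 * u x))"
proof -
  let ?U = "odd_ext u" and ?G = "odd_ext_rhs F" and ?R = "1/16 :: real"
  note [measurable] = borel_measurable_integrable[OF annulus_dirichletD(1)[OF d]]
  have rep: "AE x in lborel. x \<in> collar \<longrightarrow> ?U x = molconv ?R ?U x + pot ?R ?G x"
    by (rule representation_AE[OF odd_extension(1)[OF d] _ open_collar collar_cball]) simp_all
  obtain C where C: "\<And>x. \<bar>molconv ?R ?U x\<bar> \<le> C"
    using test_convolution(2)[OF odd_extension(2)[OF d] moll_test[of ?R]] by (auto simp: molconv_def)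
  show ?thesis
  proof (rule Bochner_Integration.integrable_bound)
    show "integrable lborel (\<lambda>x. exp (2 * C) * (indicator annulus x * exp (2 * pot ?R ?G x)))"
      by (intro integrable_mult_right exp_pot_integrable[OF _ odd_extension(3)[OF d]]
          bounded_subset[OF bounded_ball annulus_subset_ball] annulus_borel) simp
    show "AE x in lborel. norm (indicator annulus x * exp (2 * u x)) \<le> norm (exp (2 * C) * (indicator annulus x * exp (2 * pot ?R ?G x)))"
      using rep
    proof eventually_elim
      case (elim x)
      show ?case
      proof (cases "x \<in> annulus")
        case True
        then have "x \<in> collar" by (auto simp: annulus_def collar_def)
        then have "u x = molconv ?R ?U x + pot ?R ?G x"
          using elim odd_ext_annulus[OF annulus_dirichletD(3)[OF d] True] by simp
        moreover have "molconv ?R ?U x \<le> C" using C[of x] by linarith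
        ultimately have "exp (2 * u x) \<le> exp (2 * C + 2 * pot ?R ?G x)" by simp
        then show ?thesis using True by (simp add: exp_add)
      qed simp
    qed
    show "(\<lambda>x. indicator annulus x * exp (2 * u x)) \<in> borel_measurable lborel" by measurable
  qed
qed

section \<open>Continuity up to the boundary\<close>

lemma AE_compose_inversion:
  assumes l: "l \<noteq> 0" and P: "AE x in lborel. P x"
  shows "AE x in lborel. P (inversion Q l x)"
proof -
  obtain N where "{x\<in>space lborel. \<not> P x} \<subseteq> N" "emeasure lborel N = 0" "N \<in> sets lborel"
    using P by (rule AE_E)
  then have N: "N \<in> null_sets lborel" "{x. \<not> P x} \<subseteq> N" by auto
  have "integrable lborel (indicator N :: real^2 \<Rightarrow> real)" using N(1) by (intro integrable_real_indicator) (auto simp: null_sets_def)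
  note i = integrable_inversion[OF l this, of Q]
  have "(\<integral>x. inv_jac Q l x * indicator N (inversion Q l x) \<partial>lborel) = 0"
    using i(2) N(1) by (simp add: null_sets_def measure_def)
  then have "AE x in lborel. inv_jac Q l x * indicator N (inversion Q l x) = 0"
    using integral_nonneg_eq_0_iff_AE[OF i(1)] inv_jac_nonneg by simp
  moreover have "AE x in lborel. x \<noteq> Q" by (rule AE_lborel_singleton)
  ultimately show ?thesis
  proof eventually_elim
    case (elim x)
    then have "inversion Q l x \<notin> N" using l by (auto simp: inv_jac_def indicator_def split: if_splits)
    then show ?case using N(2) by auto
  qed
qed

lemma continuous_AE_0_imp_0:
  fixes g :: "'a::euclidean_space \<Rightarrow> real"
  assumes N: "open N" and g: "continuous_on N g" and 0: "AE x in lborel. x \<in> N \<longrightarrow> g x = 0" and x: "x \<in> N"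
  shows "g x = 0"
proof (rule ccontr)
  assume "g x \<noteq> 0"
  have "open (N \<inter> g -` (-{0}))" by (rule continuous_open_preimage[OF g N]) auto
  moreover have "N \<inter> g -` (-{0}) = {x\<in>N. g x \<noteq> 0}" by auto
  ultimately have "open {x\<in>N. g x \<noteq> 0}" by simp
  moreover have "AE x in lborel. x \<notin> {x\<in>N. g x \<noteq> 0}" using 0 by eventually_elim auto
  ultimately have "emeasure lborel {x\<in>N. g x \<noteq> 0} = 0" using AE_iff_null_sets[of "{x\<in>N. g x \<noteq> 0}" lborel] by auto
  then show False using emeasure_lborel_open_neq_0[OF \<open>open {x\<in>N. g x \<noteq> 0}\<close>, of x] x \<open>g x \<noteq> 0\<close> by simp
qed

lemma continuous_on_inversion: "continuous_on (-{Q}) (inversion Q l)"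
  using smooth_on_continuous[OF smooth_on_inversion] by (auto intro: continuous_on_componentwise[THEN iffD2])

text \<open>A continuous function that is odd under a reflection vanishes at the fixed points. Here
  \<open>U\<close> is odd, but \<open>V\<close> agrees with it only almost everywhere; since
  inversion preserves null sets, oddness passes to \<open>V\<close> almost everywhere and then
  everywhere by continuity.\<close>

lemma odd_continuous_eq_0:
  fixes U V :: "real^2 \<Rightarrow> real"
  assumes l: "l > 0" and N: "open N" "0 \<notin> N" "\<And>x. x \<in> N \<Longrightarrow> inversion 0 l x \<in> N"
    and V: "continuous_on UNIV V" and eq: "AE x in lborel. x \<in> N \<longrightarrow> V x = U x"
    and odd: "\<And>x. x \<in> N \<Longrightarrow> U (inversion 0 l x) = - U x" and x: "x \<in> N" "norm x = l"
  shows "V x = 0"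
proof -
  have "AE x in lborel. x \<in> N \<longrightarrow> V (inversion 0 l x) + V x = 0"
    using eq AE_compose_inversion[OF _ eq, of l 0, OF less_imp_neq[OF l, symmetric]]
  proof eventually_elim
    case (elim x)
    then show ?case using odd[of x] N(3)[of x] by auto
  qed
  moreover have "continuous_on N (inversion 0 l)"
    by (rule continuous_on_subset[OF continuous_on_inversion]) (use N(2) in auto)
  then have "continuous_on N (\<lambda>x. V (inversion 0 l x) + V x)"
    using continuous_on_subset[OF V] by (intro continuous_intros continuous_on_compose2[OF V]) auto
  ultimately have "V (inversion 0 l x) + V x = 0" using continuous_AE_0_imp_0[OF N(1) _ _ x(1)] by blast
  then show ?thesis using inversion0_fixed[OF x(2) l] by simp
qed

text \<open>On the preimage of the annulus \<open>norm x\<close> exceeds \<open>l^2\<close>, so the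
  Jacobian is at most \<open>1 / l^4\<close>. One of the two Jacobian factors is estimated by this
  bound, the other is consumed by the change of variables.\<close>

lemma integrable_inversion_square:
  assumes l: "l > 0" and F: "integrable lborel F" "integrable lborel (\<lambda>x. (F x)\<^sup>2)" "\<And>x. x \<notin> annulus \<Longrightarrow> F x = 0"
  shows "integrable lborel (\<lambda>x. (inv_jac 0 l x * F (inversion 0 l x))\<^sup>2)"
proof (rule Bochner_Integration.integrable_bound)
  note [measurable] = borel_measurable_integrable[OF F(1)]
  show "integrable lborel (\<lambda>x. (1 / l ^ 4) * (inv_jac 0 l x * (F (inversion 0 l x))\<^sup>2))"
    using integrable_inversion(1)[OF _ F(2), of l 0] l by simp
  show "AE x in lborel. norm ((inv_jac 0 l x * F (inversion 0 l x))\<^sup>2) \<le> norm ((1 / l ^ 4) * (inv_jac 0 l x * (F (inversion 0 l x))\<^sup>2))"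
  proof (rule AE_I2)
    fix x
    show "norm ((inv_jac 0 l x * F (inversion 0 l x))\<^sup>2) \<le> norm ((1 / l ^ 4) * (inv_jac 0 l x * (F (inversion 0 l x))\<^sup>2))"
    proof (cases "inversion 0 l x \<in> annulus \<and> x \<noteq> 0")
      case True
      then have "l\<^sup>2 / norm x < 1" "norm x > 0" by (auto simp: annulus_def norm_inversion0)
      then have "(l\<^sup>2) ^ 4 \<le> norm x ^ 4" by (intro power_mono) (auto simp: field_simps)
      then have J: "inv_jac 0 l x \<le> 1 / l ^ 4"
        using l \<open>norm x > 0\<close> by (simp add: inv_jac_norm field_simps power_mult[symmetric] power_add[symmetric])
      have "inv_jac 0 l x * (inv_jac 0 l x * (F (inversion 0 l x))\<^sup>2) \<le> (1 / l ^ 4) * (inv_jac 0 l x * (F (inversion 0 l x))\<^sup>2)"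
        using J inv_jac_nonneg by (intro mult_right_mono) auto
      then show ?thesis using l inv_jac_nonneg[of 0 l x] by (simp add: power_mult_distrib power2_eq_square mult_ac)
    next
      case False
      then show ?thesis using F(3) by (auto simp: inv_jac_def)
    qed
  qed
  show "(\<lambda>x. (inv_jac 0 l x * F (inversion 0 l x))\<^sup>2) \<in> borel_measurable lborel" by measurable
qed

text \<open>A square integrable right-hand side gives a continuous potential for the odd extension.
  The resulting continuous function vanishes on both circles by antisymmetry, so it can be set to 0
  outside the annulus without losing continuity.\<close>

lemma annulus_dirichlet_continuous:
  assumes d: "annulus_dirichlet u F" and F2: "integrable lborel (\<lambda>x. (F x)\<^sup>2)"
  shows "\<exists>v. continuous_on UNIV v \<and> (\<forall>x. x \<notin> annulus \<longrightarrow> v x = 0) \<and> (AE x in lborel. u x = v x)"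
proof -
  let ?U = "odd_ext u" and ?G = "odd_ext_rhs F" and ?R = "1/16 :: real"
  let ?I = "inversion 0 1" and ?J = "inversion 0 (1/2)"
  note z = annulus_dirichletD(3)[OF d] and iF = annulus_dirichletD(2)[OF d]
  note [measurable] = borel_measurable_integrable[OF iF]
  define V where "V x = molconv ?R ?U x + pot ?R ?G x" for x
  have G2: "integrable lborel (\<lambda>x. (?G x)\<^sup>2)"
  proof (rule Bochner_Integration.integrable_bound)
    show "integrable lborel (\<lambda>x. 3 * ((F x)\<^sup>2 + (inv_jac 0 1 x * F (?I x))\<^sup>2 + (inv_jac 0 (1/2) x * F (?J x))\<^sup>2))"
      using F2 integrable_inversion_square[OF _ iF F2 annulus_dirichletD(4)[OF d]]
      by (intro integrable_mult_right Bochner_Integration.integrable_add) auto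
    have "(a - b - c)\<^sup>2 \<le> 3 * (a\<^sup>2 + b\<^sup>2 + c\<^sup>2)" for a b c :: real
    proof -
      have "0 \<le> (a + b)\<^sup>2 + (a + c)\<^sup>2 + (b - c)\<^sup>2" by simp
      then show ?thesis by (simp add: power2_eq_square algebra_simps)
    qed
    then show "AE x in lborel. norm ((?G x)\<^sup>2) \<le> norm (3 * ((F x)\<^sup>2 + (inv_jac 0 1 x * F (?I x))\<^sup>2 + (inv_jac 0 (1/2) x * F (?J x))\<^sup>2))"
      unfolding odd_ext_rhs_def by (intro AE_I2) (simp add: abs_of_nonneg add_nonneg_nonneg)
    show "(\<lambda>x. (?G x)\<^sup>2) \<in> borel_measurable lborel" unfolding odd_ext_rhs_def by measurable
  qed
  have Vc: "continuous_on UNIV V" unfolding V_def[abs_def]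
    using test_convolution(1)[OF odd_extension(2)[OF d] moll_test[of ?R]] pot_continuous[OF _ odd_extension(3)[OF d] G2, of ?R]
    by (intro continuous_intros) (auto simp: molconv_def[abs_def])
  have rep: "AE x in lborel. x \<in> collar \<longrightarrow> V x = ?U x"
  proof -
    have "AE x in lborel. x \<in> collar \<longrightarrow> ?U x = molconv ?R ?U x + pot ?R ?G x"
      by (rule representation_AE[OF odd_extension(1)[OF d] _ open_collar collar_cball]) simp_all
    then show ?thesis by eventually_elim (simp add: V_def)
  qed
  have V1: "V x = 0" if "norm x = 1" for x
  \<comment> \<open>The shell is invariant under \<open>r \<mapsto> 1 / r\<close>, and the
    reflection in the inner circle takes its points out of the annulus, so only one reflection term
    is present.\<close>
  proof (rule odd_continuous_eq_0[where l=1 and N="{x. 4/5 < norm x \<and> norm x < 5/4}" and V=V and U="?U"])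
    show "AE x in lborel. x \<in> {x. 4/5 < norm x \<and> norm x < 5/4} \<longrightarrow> V x = ?U x"
      using rep by eventually_elim (auto simp: collar_def)
    fix x :: "real^2" assume x: "x \<in> {x. 4/5 < norm x \<and> norm x < 5/4}"
    then have "0 < norm x" by (cases "x = 0") auto
    then have n: "4/5 < 1 / norm x" "1 / norm x < 5/4" "1/4 / norm x \<le> 1/2" "norm x / 4 \<le> 1/2"
      using x by (simp_all add: field_simps)
    then show "?I x \<in> {x. 4/5 < norm x \<and> norm x < 5/4}" by (simp add: norm_inversion0)
    have "?J x \<notin> annulus" "?J (?I x) \<notin> annulus"
      using n by (simp_all add: annulus_def norm_inversion0 power2_eq_square)
    then show "?U (?I x) = - ?U x" using z by (simp add: odd_ext_def inversion_involution)
  qed (use that Vc in \<open>auto intro!: open_Collect_conj open_Collect_less continuous_intros\<close>)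
  have V2: "V x = 0" if "norm x = 1/2" for x
  \<comment> \<open>Likewise invariant under \<open>r \<mapsto> 1 / (4 * r)\<close>, with the
    reflection in the unit circle contributing nothing.\<close>
  proof (rule odd_continuous_eq_0[where l="1/2" and N="{x. 2/5 < norm x \<and> norm x < 5/8}" and V=V and U="?U"])
    show "AE x in lborel. x \<in> {x. 2/5 < norm x \<and> norm x < 5/8} \<longrightarrow> V x = ?U x"
      using rep by eventually_elim (auto simp: collar_def)
    fix x :: "real^2" assume x: "x \<in> {x. 2/5 < norm x \<and> norm x < 5/8}"
    then have "0 < norm x" by (cases "x = 0") auto
    then have n: "2/5 < 1/4 / norm x" "1/4 / norm x < 5/8" "1 \<le> 1 / norm x" "1 \<le> norm x * 4"
      using x by (simp_all add: field_simps)
    then show "?J x \<in> {x. 2/5 < norm x \<and> norm x < 5/8}" by (simp add: norm_inversion0 power2_eq_square)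
    have "?I x \<notin> annulus" "?I (?J x) \<notin> annulus"
      using n by (simp_all add: annulus_def norm_inversion0 power2_eq_square)
    then show "?U (?J x) = - ?U x" using z by (simp add: odd_ext_def inversion_involution)
  qed (use that Vc in \<open>auto intro!: open_Collect_conj open_Collect_less continuous_intros\<close>)
  let ?A = "{x::real^2. 1/2 \<le> norm x \<and> norm x \<le> 1}" and ?B = "{x::real^2. norm x \<le> 1/2 \<or> 1 \<le> norm x}"
  have "continuous_on (?A \<union> ?B) (\<lambda>x. if x \<in> annulus then V x else 0)"
  proof (rule continuous_on_cases)
    show "closed ?A" "closed ?B"
      by (auto intro!: closed_Collect_conj closed_Collect_disj closed_Collect_le continuous_intros)
    show "continuous_on ?A V" using Vc continuous_on_subset by blast
    show "\<forall>x. x \<in> ?A \<and> x \<notin> annulus \<or> x \<in> ?B \<and> x \<in> annulus \<longrightarrow> V x = 0"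
      using V1 V2 by (force simp: annulus_def)
  qed auto
  moreover have "?A \<union> ?B = UNIV" by auto
  ultimately have c: "continuous_on UNIV (\<lambda>x. if x \<in> annulus then V x else 0)" by simp
  have "AE x in lborel. u x = (if x \<in> annulus then V x else 0)"
    using rep
  proof eventually_elim
    case (elim x)
    then show ?case using odd_ext_annulus[of u x] z by (auto simp: annulus_def collar_def)
  qed
  with c show ?thesis by (intro exI[of _ "\<lambda>x. if x \<in> annulus then V x else 0"]) auto
qed

lemma continuous_bounded_closed_annulus:
  fixes q :: "real^2 \<Rightarrow> real"
  assumes "continuous_on (-{0}) q"
  shows "\<exists>C\<ge>0. \<forall>x. 1/2 \<le> norm x \<longrightarrow> norm x \<le> 1 \<longrightarrow> \<bar>q x\<bar> \<le> C"
proof -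
  let ?A = "{x::real^2. 1/2 \<le> norm x \<and> norm x \<le> 1}"
  have "continuous_on ?A q" by (rule continuous_on_subset[OF assms]) auto
  then have "bounded (q ` ?A)" using compact_closed_annulus compact_continuous_image compact_imp_bounded by blast
  then obtain C where C: "\<And>x. x \<in> ?A \<Longrightarrow> \<bar>q x\<bar> \<le> C" by (auto simp: bounded_iff)
  have "C \<ge> 0" using C[of "axis 1 1"] by auto
  then show ?thesis using C by blast
qed

subsection \<open>From Sobolev solutions to the very weak formulation\<close>

definition defining_fun :: "real^2 \<Rightarrow> real" where
  "defining_fun x = (1 - x \<bullet> x) * (x \<bullet> x - 1/4)"

lemma smooth_on_defining_fun: "smooth_on UNIV defining_fun"
proof -
  have "smooth_on UNIV (\<lambda>x::real^2. (1 - x \<bullet> x) * (x \<bullet> x - 1/4))"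
    by (intro smooth_intros smooth_on_inner_self)
  then show ?thesis by (simp add: defining_fun_def[abs_def])
qed

lemma defining_fun_norm: "defining_fun x = (1 - norm x) * (norm x - 1/2) * ((1 + norm x) * (norm x + 1/2))"
  by (simp add: defining_fun_def dot_square_norm power2_eq_square field_simps)

lemma defining_fun_pos_iff: "defining_fun x > 0 \<longleftrightarrow> x \<in> annulus"
proof -
  have "(1 + norm x) * (norm x + 1/2) > 0" by (intro mult_pos_pos add_pos_nonneg add_nonneg_pos) auto
  then have "defining_fun x > 0 \<longleftrightarrow> (1 - norm x) * (norm x - 1/2) > 0"
    unfolding defining_fun_norm by (metis mult_pos_pos zero_less_mult_pos2)
  also have "\<dots> \<longleftrightarrow> x \<in> annulus" by (auto simp: zero_less_mult_iff annulus_def)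
  finally show ?thesis .
qed

text \<open>The mean value theorem along the ray through \<open>x\<close> bounds
  \<open>\<psi>\<close> linearly by the distance to either circle. One of the two distances is at
  least \<open>1/4\<close>; using the bound by the other one costs a factor 4.\<close>

lemma vanishing_le_defining_fun:
  assumes \<psi>: "smooth_on (-{0}) \<psi>" "\<And>x. norm x = 1/2 \<or> norm x = 1 \<Longrightarrow> \<psi> x = (0::real)"
  shows "\<exists>C\<ge>0. \<forall>x\<in>annulus. \<bar>\<psi> x\<bar> \<le> C * defining_fun x"
proof -
  have "\<exists>C\<ge>0. \<forall>x. 1/2 \<le> norm x \<longrightarrow> norm x \<le> 1 \<longrightarrow> \<bar>partial_deriv e \<psi> x\<bar> \<le> C" if "e \<in> Basis" for e
    using smooth_on_continuous[OF smooth_on_partial_deriv[OF that \<psi>(1)]] by (rule continuous_bounded_closed_annulus)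
  then obtain B where B: "\<And>e. e \<in> Basis \<Longrightarrow> B e \<ge> 0"
    "\<And>e x. e \<in> Basis \<Longrightarrow> 1/2 \<le> norm x \<Longrightarrow> norm x \<le> 1 \<Longrightarrow> \<bar>partial_deriv e \<psi> x\<bar> \<le> B e" by metis
  define C where "C = (\<Sum>e\<in>(Basis::(real^2) set). B e)"
  have C: "C \<ge> 0" unfolding C_def using B(1) by (intro sum_nonneg)
  have "\<bar>\<psi> x\<bar> \<le> 4 * C * defining_fun x" if x: "x \<in> annulus" for x
  proof -
    define r where "r = norm x"
    have r: "1/2 < r" "r < 1" using x by (auto simp: annulus_def r_def)
    define w where "w = x /\<^sub>R r"
    have "r \<noteq> 0" using r by simp
    then have w: "norm w = 1" "x = r *\<^sub>R w" by (simp_all add: w_def r_def)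
    define f where "f t = \<psi> (t *\<^sub>R w)" for t
    have der: "(f has_real_derivative (\<Sum>e\<in>Basis. (w \<bullet> e) * partial_deriv e \<psi> (t *\<^sub>R w))) (at t)" if "t > 0" for t
    proof -
      have "t *\<^sub>R w \<in> -{0}" using w(1) that by auto
      then have "(\<psi> has_derivative (\<lambda>h. \<Sum>e\<in>Basis. (h \<bullet> e) * partial_deriv e \<psi> (t *\<^sub>R w))) (at (t *\<^sub>R w))"
        by (intro has_derivative_partial_deriv smooth_on_differentiable[OF \<psi>(1)])
      moreover have "((\<lambda>t. t *\<^sub>R w) has_derivative (\<lambda>h. h *\<^sub>R w)) (at t)"
        by (auto intro!: derivative_eq_intros)
      ultimately have "(f has_derivative (\<lambda>h. \<Sum>e\<in>Basis. ((h *\<^sub>R w) \<bullet> e) * partial_deriv e \<psi> (t *\<^sub>R w))) (at t)"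
        unfolding f_def
        by (intro has_derivative_compose[where f="\<lambda>t. t *\<^sub>R w" and f'="\<lambda>h. h *\<^sub>R w" and g=\<psi>])
      then show ?thesis unfolding has_field_derivative_def
        by (rule has_derivative_eq_rhs) (simp add: fun_eq_iff sum_distrib_left sum_distrib_right mult_ac)
    qed
    have bd: "\<bar>\<Sum>e\<in>Basis. (w \<bullet> e) * partial_deriv e \<psi> (t *\<^sub>R w)\<bar> \<le> C" if "1/2 \<le> t" "t \<le> 1" for t
      unfolding C_def
    proof (rule order_trans[OF sum_abs], rule sum_mono)
      fix e :: "real^2" assume e: "e \<in> Basis"
      have "\<bar>w \<bullet> e\<bar> \<le> 1" using Basis_le_norm[OF e, of w] w(1) by simp
      moreover have "\<bar>partial_deriv e \<psi> (t *\<^sub>R w)\<bar> \<le> B e" using B(2)[OF e] w(1) that by simp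
      ultimately have "\<bar>w \<bullet> e\<bar> * \<bar>partial_deriv e \<psi> (t *\<^sub>R w)\<bar> \<le> 1 * B e" by (intro mult_mono) auto
      then show "\<bar>(w \<bullet> e) * partial_deriv e \<psi> (t *\<^sub>R w)\<bar> \<le> B e" by (simp add: abs_mult)
    qed
    have lip: "\<bar>f s - f t\<bar> \<le> C * (s - t)" if st: "1/2 \<le> t" "t < s" "s \<le> 1" for s t
    proof -
      obtain z where z: "t < z" "z < s" "f s - f t = (s - t) * (\<Sum>e\<in>Basis. (w \<bullet> e) * partial_deriv e \<psi> (z *\<^sub>R w))"
        using MVT2[OF st(2), of f "\<lambda>t. \<Sum>e\<in>Basis. (w \<bullet> e) * partial_deriv e \<psi> (t *\<^sub>R w)"] der st by force
      have "(s - t) * \<bar>\<Sum>e\<in>Basis. (w \<bullet> e) * partial_deriv e \<psi> (z *\<^sub>R w)\<bar> \<le> (s - t) * C"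
        using bd[of z] z st by (intro mult_left_mono) auto
      then show ?thesis using z(3) st by (simp add: abs_mult mult.commute)
    qed
    have f0: "f (1/2) = 0" "f 1 = 0" using w(1) by (auto simp: f_def intro!: \<psi>(2))
    have le: "\<bar>f r\<bar> \<le> C * (1 - r)" "\<bar>f r\<bar> \<le> C * (r - 1/2)"
      using lip[of r 1] lip[of "1/2" r] r f0 by auto
    have "\<bar>f r\<bar> \<le> 4 * C * ((1 - r) * (r - 1/2))"
    proof (cases "1 - r \<ge> 1/4")
      case True
      have "\<bar>f r\<bar> \<le> C * (r - 1/2) * 1" using le by simp
      also have "\<dots> \<le> C * (r - 1/2) * (4 * (1 - r))" using True C r by (intro mult_left_mono) auto
      finally show ?thesis by (simp add: field_simps)
    next
      case False
      have "\<bar>f r\<bar> \<le> C * (1 - r) * 1" using le by simp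
      also have "\<dots> \<le> C * (1 - r) * (4 * (r - 1/2))" using False C r by (intro mult_left_mono) auto
      finally show ?thesis by (simp add: field_simps)
    qed
    also have "\<dots> = 4 * C * ((1 - r) * (r - 1/2) * 1)" by simp
    also have "\<dots> \<le> 4 * C * ((1 - r) * (r - 1/2) * ((1 + r) * (r + 1/2)))"
    proof -
      have "1 \<le> (1 + r) * (r + 1/2)" using mult_mono[of 1 "1 + r" 1 "r + 1/2"] r by simp
      then show ?thesis using C r by (intro mult_left_mono mult_nonneg_nonneg) auto
    qed
    finally show ?thesis unfolding f_def w(2)[symmetric] defining_fun_norm r_def[symmetric] .
  qed
  then show ?thesis using C by (intro exI[of _ "4 * C"]) auto
qed

text \<open>Cutting off where the defining function is about \<open>1 / N\<close> costs a derivative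
  of size \<open>N\<close>, but only where \<open>\<psi>\<close> is at most \<open>C / N\<close>, so
  first derivatives stay bounded. Second derivatives need not, which is why the limit is taken only
  after one derivative has been moved away.\<close>

lemma cutoff_functions:
  assumes \<psi>: "smooth_on (-{0}) \<psi>" "\<And>x. norm x = 1/2 \<or> norm x = 1 \<Longrightarrow> \<psi> x = (0::real)"
  shows "\<exists>\<Psi> B. (\<forall>n::nat. \<Psi> n \<in> test_functions annulus) \<and>
     (\<forall>n x. \<bar>\<Psi> n x\<bar> \<le> B) \<and> (\<forall>n x. \<forall>e\<in>Basis. \<bar>partial_deriv e (\<Psi> n) x\<bar> \<le> B) \<and>
     (\<forall>x\<in>annulus. (\<lambda>n. \<Psi> n x) \<longlonglongrightarrow> \<psi> x) \<and>
     (\<forall>x\<in>annulus. \<forall>e\<in>Basis. (\<lambda>n. partial_deriv e (\<Psi> n) x) \<longlonglongrightarrow> partial_deriv e \<psi> x)"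
proof -
  let ?\<tau> = defining_fun
  define N where "N n = real (Suc n)" for n
  have N: "N n > 0" for n by (simp add: N_def)
  define \<Psi> where "\<Psi> n x = (if x \<in> -{0} then step (N n * ?\<tau> x) * \<psi> x else 0)" for n x
  have \<tau>s: "smooth_on (-{0}) ?\<tau>" using smooth_on_defining_fun smooth_on_subset by blast
  have sm: "smooth_on (-{0}) (\<lambda>x. step (N n * ?\<tau> x))" for n
    by (rule smooth_on_compose[OF smooth_on_step]) (auto intro!: smooth_on_mult smooth_on_const \<tau>s)
  \<comment> \<open>The complement is where \<open>N n\<close> times the defining function is below
    \<open>1/2\<close>, and the step is still 0 there.\<close>
  define K where "K n = {x. 1 / (2 * N n) \<le> ?\<tau> x}" for n
  have K: "compact (K n)" "K n \<subseteq> annulus" for n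
  proof -
    show sub: "K n \<subseteq> annulus"
    proof
      fix x assume "x \<in> K n"
      moreover have "0 < 1 / (2 * N n)" using N by simp
      ultimately have "?\<tau> x > 0" unfolding K_def by (simp only: mem_Collect_eq less_le_trans)
      then show "x \<in> annulus" using defining_fun_pos_iff by blast
    qed
    have "closed (K n)" unfolding K_def
      using smooth_on_continuous[OF smooth_on_defining_fun] by (intro closed_Collect_le continuous_intros)
    moreover have "bounded (K n)" using sub annulus_subset_ball bounded_subset[OF bounded_ball] by blast
    ultimately show "compact (K n)" by (simp add: compact_eq_bounded_closed)
  qed
  have \<Psi>t: "\<Psi> n \<in> test_functions annulus" for n
  proof -
    have "(\<lambda>x. if x \<in> -{0} then step (N n * ?\<tau> x) * \<psi> x else 0) \<in> test_functions annulus"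
    proof (rule test_functions_extend[of _ _ "K n"])
      show "smooth_on (-{0}) (\<lambda>x. step (N n * ?\<tau> x) * \<psi> x)" using sm \<psi>(1) by (intro smooth_on_mult) auto
      show "K n \<subseteq> -{0}" using K(2)[of n] by (auto simp: annulus_def)
      fix x assume "x \<in> -{0} - K n"
      then have "N n * ?\<tau> x \<le> 1/2" using N[of n] by (simp add: K_def not_le field_simps)
      then show "step (N n * ?\<tau> x) * \<psi> x = 0" by (simp add: step_eq_0)
    qed (use K in auto)
    then show ?thesis by (simp add: \<Psi>_def[abs_def])
  qed
  have \<Psi>0: "\<Psi> n x = 0" "partial_deriv e (\<Psi> n) x = 0" if "x \<notin> annulus" "e \<in> Basis" for n x e
    using test_functionsD(2)[OF \<Psi>t[of n]] test_functionsD(2)[OF test_functions_partial_deriv[OF \<Psi>t[of n] that(2)]] that(1) by blast+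
  have pd: "partial_deriv e (\<Psi> n) x = step (N n * ?\<tau> x) * partial_deriv e \<psi> x
      + (2 * bump (2 * (N n * ?\<tau> x) - 2) / hslope * (N n * partial_deriv e ?\<tau> x)) * \<psi> x"
    if "x \<in> annulus" for n e x
  proof -
    have x: "x \<in> -{0}" "open (-{0::real^2})" using that by (auto simp: annulus_def)
    have d\<psi>: "\<psi> differentiable (at x)" using smooth_on_differentiable[OF \<psi>(1) x(1)] .
    have "partial_deriv e (\<Psi> n) x = partial_deriv e (\<lambda>x. step (N n * ?\<tau> x) * \<psi> x) x"
      by (rule partial_deriv_cong[OF x(2,1)]) (simp add: \<Psi>_def)
    also have "\<dots> = step (N n * ?\<tau> x) * partial_deriv e \<psi> x + partial_deriv e (\<lambda>x. step (N n * ?\<tau> x)) x * \<psi> x"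
      using smooth_on_differentiable[OF sm x(1)] d\<psi> by (rule partial_deriv_mult)
    also have "partial_deriv e (\<lambda>x. step (N n * ?\<tau> x)) x = 2 * bump (2 * (N n * ?\<tau> x) - 2) / hslope * (N n * partial_deriv e ?\<tau> x)"
    proof -
      have "(?\<tau> has_derivative frechet_derivative ?\<tau> (at x)) (at x)"
        using smooth_on_differentiable[OF smooth_on_defining_fun] frechet_derivative_works by blast
      then have "((\<lambda>x. N n * ?\<tau> x) has_derivative (\<lambda>h. N n * frechet_derivative ?\<tau> (at x) h)) (at x)"
        by (rule has_derivative_mult_right)
      from partial_deriv_eqI[OF has_derivative_compose[OF this step_deriv[unfolded has_field_derivative_def]]]
      show ?thesis by (simp add: partial_deriv_def)
    qed
    finally show ?thesis .
  qed
  obtain C where C: "C \<ge> 0" "\<And>x. x \<in> annulus \<Longrightarrow> \<bar>\<psi> x\<bar> \<le> C * ?\<tau> x" using vanishing_le_defining_fun[OF \<psi>] by blast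
  have bd: "\<exists>C\<ge>0. \<forall>x\<in>annulus. \<bar>q x\<bar> \<le> C" if sq: "smooth_on (-{0}) q" for q :: "real^2 \<Rightarrow> real"
  proof -
    obtain C where "C \<ge> 0" "\<And>x. 1/2 \<le> norm x \<Longrightarrow> norm x \<le> 1 \<Longrightarrow> \<bar>q x\<bar> \<le> C"
      using continuous_bounded_closed_annulus[OF smooth_on_continuous[OF sq]] by blast
    then show ?thesis by (intro exI[of _ C]) (auto simp: annulus_def)
  qed
  obtain P where P: "P \<ge> 0" "\<And>x. x \<in> annulus \<Longrightarrow> \<bar>\<psi> x\<bar> \<le> P" using bd[OF \<psi>(1)] by blast
  have "\<exists>C\<ge>0. \<forall>x\<in>annulus. \<bar>partial_deriv e \<psi> x\<bar> \<le> C" if "e \<in> Basis" for e using bd that \<psi>(1) by blast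
  then obtain P1 where P1: "\<And>e. e \<in> Basis \<Longrightarrow> P1 e \<ge> 0" "\<And>e x. e \<in> Basis \<Longrightarrow> x \<in> annulus \<Longrightarrow> \<bar>partial_deriv e \<psi> x\<bar> \<le> P1 e" by metis
  have "\<exists>C\<ge>0. \<forall>x\<in>annulus. \<bar>partial_deriv e ?\<tau> x\<bar> \<le> C" if "e \<in> Basis" for e using bd that \<tau>s by blast
  then obtain T1 where T1: "\<And>e. e \<in> Basis \<Longrightarrow> T1 e \<ge> 0" "\<And>e x. e \<in> Basis \<Longrightarrow> x \<in> annulus \<Longrightarrow> \<bar>partial_deriv e ?\<tau> x\<bar> \<le> T1 e" by metis
  define B where "B = P + (\<Sum>e\<in>(Basis::(real^2) set). P1 e + 2 / hslope * (T1 e * C))"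
  have B1: "\<bar>\<Psi> n x\<bar> \<le> B" for n x
  proof (cases "x \<in> annulus")
    case True
    have "\<bar>step (N n * ?\<tau> x) * \<psi> x\<bar> \<le> 1 * P"
      unfolding abs_mult using step_bounds[of "N n * ?\<tau> x"] P(2)[OF True] by (intro mult_mono) auto
    then have "\<bar>\<Psi> n x\<bar> \<le> P" unfolding \<Psi>_def using P(1) by simp
    moreover have "0 \<le> (\<Sum>e\<in>(Basis::(real^2) set). P1 e + 2 / hslope * (T1 e * C))"
      using P1(1) T1(1) C(1) hslope_pos by (intro sum_nonneg add_nonneg_nonneg mult_nonneg_nonneg) auto
    ultimately show ?thesis by (simp add: B_def)
  next
    case False
    moreover have "0 \<le> (\<Sum>e\<in>(Basis::(real^2) set). P1 e + 2 / hslope * (T1 e * C))"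
      using P1(1) T1(1) C(1) hslope_pos by (intro sum_nonneg add_nonneg_nonneg mult_nonneg_nonneg) auto
    moreover have "axis 1 1 \<in> (Basis :: (real^2) set)" by simp
    ultimately show ?thesis using \<Psi>0(1)[OF False] P(1) unfolding B_def by fastforce
  qed
  have B2: "\<bar>partial_deriv e (\<Psi> n) x\<bar> \<le> B" if e: "e \<in> Basis" for n x e
  proof (cases "x \<in> annulus")
    case True
    let ?s = "N n * ?\<tau> x"
    have a: "\<bar>step ?s * partial_deriv e \<psi> x\<bar> \<le> 1 * P1 e"
      unfolding abs_mult using step_bounds[of ?s] P1[OF e] True by (intro mult_mono) auto
    have b: "\<bar>2 * bump (2 * ?s - 2) / hslope * (N n * partial_deriv e ?\<tau> x) * \<psi> x\<bar> \<le> 2 / hslope * (T1 e * C)"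
    proof (cases "?s < 1")
      case s: True
      have "N n * \<bar>\<psi> x\<bar> \<le> N n * (C * ?\<tau> x)" using C(2)[OF True] N[of n] by (intro mult_left_mono) auto
      also have "\<dots> = C * ?s" by simp
      also have "\<dots> \<le> C * 1" using s C(1) by (intro mult_left_mono) auto
      finally have 1: "N n * \<bar>\<psi> x\<bar> \<le> C" by simp
      have "\<bar>2 * bump (2 * ?s - 2) / hslope * (N n * partial_deriv e ?\<tau> x) * \<psi> x\<bar> =
         (2 * bump (2 * ?s - 2) / hslope) * (\<bar>partial_deriv e ?\<tau> x\<bar> * (N n * \<bar>\<psi> x\<bar>))"
        using hslope_pos bump_nonneg[of "2 * ?s - 2"] N[of n] by (simp add: abs_mult)
      also have "\<dots> \<le> (2 / hslope) * (T1 e * C)"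
        using hslope_pos bump_nonneg[of "2 * ?s - 2"] bump_le_1[of "2 * ?s - 2"] T1[OF e] True 1 N[of n] C(1)
        by (intro mult_mono divide_right_mono mult_nonneg_nonneg) auto
      finally show ?thesis .
    next
      case False
      then have "bump (2 * ?s - 2) = 0" by (intro bump_eq_0) auto
      then show ?thesis using hslope_pos T1(1)[OF e] C(1) by simp
    qed
    have "\<bar>partial_deriv e (\<Psi> n) x\<bar> \<le> P1 e + 2 / hslope * (T1 e * C)"
      unfolding pd[OF True] using a b by linarith
    also have "\<dots> \<le> (\<Sum>e\<in>(Basis::(real^2) set). P1 e + 2 / hslope * (T1 e * C))"
      using P1(1) T1(1) C(1) hslope_pos e by (intro member_le_sum add_nonneg_nonneg mult_nonneg_nonneg) auto
    also have "\<dots> \<le> B" using P(1) by (simp add: B_def)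
    finally show ?thesis .
  next
    case False
    then show ?thesis using \<Psi>0(2)[OF False e] B1[of n x] by simp
  qed
  have ev: "eventually (\<lambda>n. 1 \<le> N n * ?\<tau> x) sequentially" if "x \<in> annulus" for x
  proof -
    have \<tau>: "?\<tau> x > 0" using that defining_fun_pos_iff by blast
    obtain M where M: "real M > 1 / ?\<tau> x" using reals_Archimedean2 by blast
    have "1 \<le> N n * ?\<tau> x" if "n \<ge> M" for n
    proof -
      have "1 \<le> real M * ?\<tau> x" using M \<tau> by (simp add: field_simps)
      also have "\<dots> \<le> N n * ?\<tau> x" using that \<tau> by (intro mult_right_mono) (auto simp: N_def)
      finally show ?thesis .
    qed
    then show ?thesis by (auto simp: eventually_sequentially)
  qed
  have L1: "(\<lambda>n. \<Psi> n x) \<longlonglongrightarrow> \<psi> x" if x: "x \<in> annulus" for x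
  proof (rule tendsto_eventually)
    show "eventually (\<lambda>n. \<Psi> n x = \<psi> x) sequentially"
      using ev[OF x]
    proof eventually_elim
      case (elim n)
      then show ?case using x by (auto simp: \<Psi>_def step_eq_1 annulus_def)
    qed
  qed
  have L2: "(\<lambda>n. partial_deriv e (\<Psi> n) x) \<longlonglongrightarrow> partial_deriv e \<psi> x" if x: "x \<in> annulus" for x e
  proof (rule tendsto_eventually)
    show "eventually (\<lambda>n. partial_deriv e (\<Psi> n) x = partial_deriv e \<psi> x) sequentially"
      using ev[OF x]
    proof eventually_elim
      case (elim n)
      then have "bump (2 * (N n * ?\<tau> x) - 2) = 0" by (intro bump_eq_0) auto
      then show ?case using elim by (simp add: pd[OF x] step_eq_1)
    qed
  qed
  show ?thesis
    by (intro exI[of _ \<Psi>] exI[of _ B] conjI allI ballI \<Psi>t B1 B2 L1 L2)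
qed

text \<open>Two limits. With the cutoffs of \<open>\<psi>\<close> as test functions the equation
  becomes an identity between \<open>G\<close> and \<open>F\<close> that contains only first
  derivatives of \<open>\<psi>\<close>. Then the test functions approximating \<open>u\<close> are
  integrated by parts against \<open>\<psi>\<close> without boundary terms, which identifies the
  left-hand side. The second limit is where the zero boundary values of \<open>u\<close> are used,
  the first where those of \<open>\<psi>\<close> are.\<close>

lemma annulus_dirichletI:
  fixes u F :: "real^2 \<Rightarrow> real" and G :: "real^2 \<Rightarrow> real^2 \<Rightarrow> real"
  assumes u: "integrable lborel u" "\<And>x. x \<notin> annulus \<Longrightarrow> u x = 0"
    and F: "integrable lborel F" "\<And>x. x \<notin> annulus \<Longrightarrow> F x = 0"
    and G: "\<And>e. e \<in> Basis \<Longrightarrow> integrable lborel (G e)" "\<And>e x. e \<in> Basis \<Longrightarrow> x \<notin> annulus \<Longrightarrow> G e x = 0"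
    and grad: "\<And>\<phi> e. \<phi> \<in> test_functions annulus \<Longrightarrow> e \<in> Basis \<Longrightarrow>
      (\<integral>x. u x * partial_deriv e \<phi> x \<partial>lborel) = - (\<integral>x. G e x * \<phi> x \<partial>lborel)"
    and eq: "\<And>\<phi>. \<phi> \<in> test_functions annulus \<Longrightarrow> - (\<integral>x. u x * laplacian \<phi> x \<partial>lborel) = (\<integral>x. F x * \<phi> x \<partial>lborel)"
    and \<phi>: "\<And>n::nat. \<phi> n \<in> test_functions annulus"
    and lim: "(\<lambda>n. \<integral>x. \<bar>u x - \<phi> n x\<bar> \<partial>lborel) \<longlonglongrightarrow> 0"
      "\<And>e. e \<in> Basis \<Longrightarrow> (\<lambda>n. \<integral>x. \<bar>G e x - partial_deriv e (\<phi> n) x\<bar> \<partial>lborel) \<longlonglongrightarrow> 0"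
  shows "annulus_dirichlet u F"
  unfolding annulus_dirichlet_def
proof (intro conjI allI impI u(1) F(1))
  fix \<psi> :: "real^2 \<Rightarrow> real" assume s: "smooth_on (-{0}) \<psi>" and z: "\<forall>x. norm x = 1/2 \<or> norm x = 1 \<longrightarrow> \<psi> x = 0"
  obtain \<Psi> B where \<Psi>: "\<And>n::nat. \<Psi> n \<in> test_functions annulus" "\<And>n x. \<bar>\<Psi> n x\<bar> \<le> B"
     "\<And>n x e. e \<in> Basis \<Longrightarrow> \<bar>partial_deriv e (\<Psi> n) x\<bar> \<le> B"
     "\<And>x. x \<in> annulus \<Longrightarrow> (\<lambda>n. \<Psi> n x) \<longlonglongrightarrow> \<psi> x"
     "\<And>x e. x \<in> annulus \<Longrightarrow> e \<in> Basis \<Longrightarrow> (\<lambda>n. partial_deriv e (\<Psi> n) x) \<longlonglongrightarrow> partial_deriv e \<psi> x"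
    using cutoff_functions[OF s] z by metis
  have conv: "(\<lambda>n. \<integral>x. f x * q n x \<partial>lborel) \<longlonglongrightarrow> (\<integral>x. f x * r x \<partial>lborel)"
    if f: "integrable lborel f" "\<And>x. x \<notin> annulus \<Longrightarrow> f x = 0" and q: "\<And>n. q n \<in> test_functions annulus" "\<And>n x. \<bar>q n x\<bar> \<le> B"
      "\<And>x. x \<in> annulus \<Longrightarrow> (\<lambda>n. q n x) \<longlonglongrightarrow> r x" and r: "continuous_on (-{0}) r"
    for f r and q :: "nat \<Rightarrow> real^2 \<Rightarrow> real"
  proof (rule integral_dominated_convergence[where w="\<lambda>x. \<bar>f x\<bar> * B"])
    show "(\<lambda>x. f x * r x) \<in> borel_measurable lborel"
      by (rule borel_measurable_integrable[OF integrable_annulus_mult[OF f r]])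
    show "(\<lambda>x. f x * q n x) \<in> borel_measurable lborel" for n
      by (rule borel_measurable_integrable[OF integrable_mult_test[OF f(1) q(1)]])
    show "integrable lborel (\<lambda>x. \<bar>f x\<bar> * B)" using f(1) by auto
    show "AE x in lborel. (\<lambda>n. f x * q n x) \<longlonglongrightarrow> f x * r x"
    proof (rule AE_I2)
      fix x
      show "(\<lambda>n. f x * q n x) \<longlonglongrightarrow> f x * r x"
        using f(2)[of x] q(3)[of x] by (cases "x \<in> annulus") (auto intro: tendsto_mult_left)
    qed
    show "AE x in lborel. norm (f x * q n x) \<le> \<bar>f x\<bar> * B" for n
      using q(2) by (intro AE_I2) (simp add: abs_mult mult_left_mono)
  qed
  have cp: "continuous_on (-{0}) (partial_deriv e \<psi>)" if "e \<in> Basis" for e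
    using smooth_on_continuous[OF smooth_on_partial_deriv[OF that s]] .
  have 1: "(\<Sum>e\<in>Basis. \<integral>x. G e x * partial_deriv e (\<Psi> n) x \<partial>lborel) = (\<integral>x. F x * \<Psi> n x \<partial>lborel)" for n
  proof -
    have "(\<integral>x. u x * laplacian (\<Psi> n) x \<partial>lborel) = (\<Sum>e\<in>Basis. \<integral>x. u x * partial_deriv e (partial_deriv e (\<Psi> n)) x \<partial>lborel)"
      unfolding laplacian_def sum_distrib_left
      by (rule Bochner_Integration.integral_sum)
         (intro integrable_mult_test[OF u(1) test_functions_partial_deriv[OF test_functions_partial_deriv[OF \<Psi>(1)]]])
    also have "\<dots> = (\<Sum>e\<in>Basis. - (\<integral>x. G e x * partial_deriv e (\<Psi> n) x \<partial>lborel))"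
      by (rule sum.cong[OF refl]) (intro grad test_functions_partial_deriv \<Psi>(1))
    finally show ?thesis using eq[OF \<Psi>(1)[of n]] by (simp add: sum_negf)
  qed
  have "(\<lambda>n. \<Sum>e\<in>Basis. \<integral>x. G e x * partial_deriv e (\<Psi> n) x \<partial>lborel) \<longlonglongrightarrow> (\<Sum>e\<in>Basis. \<integral>x. G e x * partial_deriv e \<psi> x \<partial>lborel)"
  proof (rule tendsto_sum)
    fix e :: "real^2" assume e: "e \<in> Basis"
    show "(\<lambda>n. \<integral>x. G e x * partial_deriv e (\<Psi> n) x \<partial>lborel) \<longlonglongrightarrow> (\<integral>x. G e x * partial_deriv e \<psi> x \<partial>lborel)"
      by (rule conv[OF G(1)[OF e] G(2)[OF e] test_functions_partial_deriv[OF \<Psi>(1) e] \<Psi>(3)[OF e] \<Psi>(5)[OF _ e] cp[OF e]])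
  qed
  moreover have "(\<lambda>n. \<integral>x. F x * \<Psi> n x \<partial>lborel) \<longlonglongrightarrow> (\<integral>x. F x * \<psi> x \<partial>lborel)"
    by (rule conv[OF F \<Psi>(1,2,4) smooth_on_continuous[OF s]])
  ultimately have A: "(\<Sum>e\<in>Basis. \<integral>x. G e x * partial_deriv e \<psi> x \<partial>lborel) = (\<integral>x. F x * \<psi> x \<partial>lborel)"
    unfolding 1 using LIMSEQ_unique by blast
  have L1: "(\<lambda>n. \<integral>x. p n x * q x \<partial>lborel) \<longlonglongrightarrow> (\<integral>x. f x * q x \<partial>lborel)"
    if p: "\<And>n. p n \<in> test_functions annulus" and f: "integrable lborel f" "\<And>x. x \<notin> annulus \<Longrightarrow> f x = 0"
      and l: "(\<lambda>n. \<integral>x. \<bar>f x - p n x\<bar> \<partial>lborel) \<longlonglongrightarrow> 0" and q: "continuous_on (-{0}) q"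
    for f q and p :: "nat \<Rightarrow> real^2 \<Rightarrow> real"
  proof -
    obtain C where C: "C \<ge> 0" "\<And>x. 1/2 \<le> norm x \<Longrightarrow> norm x \<le> 1 \<Longrightarrow> \<bar>q x\<bar> \<le> C"
      using continuous_bounded_closed_annulus[OF q] by blast
    have p0: "p n x = 0" if "x \<notin> annulus" for n x using test_functionsD(2)[OF p[of n]] that by blast
    have ip: "integrable lborel (p n)" for n using integrable_test[OF p] .
    have bound: "norm ((\<integral>x. p n x * q x \<partial>lborel) - (\<integral>x. f x * q x \<partial>lborel)) \<le> C * (\<integral>x. \<bar>f x - p n x\<bar> \<partial>lborel)" for n
    proof -
      have i: "integrable lborel (\<lambda>x. p n x * q x)" "integrable lborel (\<lambda>x. f x * q x)"
        using integrable_annulus_mult[OF ip p0 q] integrable_annulus_mult[OF f q] by auto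
      have "\<bar>(\<integral>x. p n x * q x \<partial>lborel) - (\<integral>x. f x * q x \<partial>lborel)\<bar> = \<bar>\<integral>x. p n x * q x - f x * q x \<partial>lborel\<bar>"
        using i by simp
      also have "\<dots> \<le> (\<integral>x. C * \<bar>f x - p n x\<bar> \<partial>lborel)"
      proof (rule order_trans[OF integral_abs_bound], rule integral_mono)
        fix x
        show "\<bar>p n x * q x - f x * q x\<bar> \<le> C * \<bar>f x - p n x\<bar>"
        proof (cases "x \<in> annulus")
          case True
          then have "\<bar>q x\<bar> * \<bar>f x - p n x\<bar> \<le> C * \<bar>f x - p n x\<bar>" by (intro mult_right_mono C) (auto simp: annulus_def)
          moreover have "\<bar>p n x * q x - f x * q x\<bar> = \<bar>q x\<bar> * \<bar>f x - p n x\<bar>"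
            unfolding left_diff_distrib[symmetric] abs_mult by (simp add: abs_minus_commute mult.commute)
          ultimately show ?thesis by simp
        qed (use p0 f(2) in simp)
      qed (use i ip f in auto)
      finally show ?thesis by simp
    qed
    have Cl: "(\<lambda>n. C * (\<integral>x. \<bar>f x - p n x\<bar> \<partial>lborel)) \<longlonglongrightarrow> 0" using tendsto_mult_right_zero[OF l] .
    have "(\<lambda>n. (\<integral>x. p n x * q x \<partial>lborel) - (\<integral>x. f x * q x \<partial>lborel)) \<longlonglongrightarrow> 0"
      by (rule Lim_null_comparison[OF _ Cl], rule always_eventually, rule allI, rule bound)
    then show ?thesis by (rule LIM_zero_cancel)
  qed
  have sub: "test_functions annulus \<subseteq> test_functions (-{0})" by (rule test_functions_mono) (auto simp: annulus_def)
  have 2: "(\<integral>x. \<phi> n x * laplacian \<psi> x \<partial>lborel) = - (\<Sum>e\<in>Basis. \<integral>x. partial_deriv e (\<phi> n) x * partial_deriv e \<psi> x \<partial>lborel)" for n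
    by (rule integral_laplacian_by_parts[OF _ _ s]) (use \<phi> sub in auto)
  have "(\<lambda>n. \<integral>x. \<phi> n x * laplacian \<psi> x \<partial>lborel) \<longlonglongrightarrow> (\<integral>x. u x * laplacian \<psi> x \<partial>lborel)"
    by (rule L1[OF \<phi> u lim(1) smooth_on_continuous[OF smooth_on_laplacian[OF _ s]]]) auto
  moreover have "(\<lambda>n. - (\<Sum>e\<in>Basis. \<integral>x. partial_deriv e (\<phi> n) x * partial_deriv e \<psi> x \<partial>lborel)) \<longlonglongrightarrow>
      - (\<Sum>e\<in>Basis. \<integral>x. G e x * partial_deriv e \<psi> x \<partial>lborel)"
    by (intro tendsto_minus tendsto_sum L1 test_functions_partial_deriv \<phi> G lim(2) cp)
  ultimately have "(\<integral>x. u x * laplacian \<psi> x \<partial>lborel) = - (\<Sum>e\<in>Basis. \<integral>x. G e x * partial_deriv e \<psi> x \<partial>lborel)"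
    unfolding 2 using LIMSEQ_unique by blast
  then show "- (\<integral>x. u x * laplacian \<psi> x \<partial>lborel) = (\<integral>x. F x * \<psi> x \<partial>lborel)" using A by simp
qed (use u F in auto)

section \<open>From Lebesgue measurable functions on the annulus to Borel functions on the
  plane\<close>

lemma LINT_annulus_eq:
  fixes h k :: "real^2 \<Rightarrow> real"
  assumes "set_borel_measurable lebesgue annulus h" "k \<in> borel_measurable borel"
    "AE x in lebesgue. x \<in> annulus \<longrightarrow> h x = k x" "\<And>x. x \<notin> annulus \<Longrightarrow> k x = 0"
  shows "(LINT x:annulus|lebesgue. h x) = (\<integral>x. k x \<partial>lborel)"
proof -
  have "(LINT x:annulus|lebesgue. h x) = (\<integral>x. k x \<partial>lebesgue)"
    unfolding set_lebesgue_integral_def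
  proof (rule integral_cong_AE)
    show "(\<lambda>x. indicator annulus x *\<^sub>R h x) \<in> borel_measurable lebesgue"
      using assms(1) unfolding set_borel_measurable_def .
    show "k \<in> borel_measurable lebesgue" using assms(2) by (intro measurable_completion) simp
    show "AE x in lebesgue. indicator annulus x *\<^sub>R h x = k x"
      using assms(3) by eventually_elim (use assms(4) in \<open>auto simp: indicator_def\<close>)
  qed
  also have "\<dots> = (\<integral>x. k x \<partial>lborel)" using assms(2) by (intro integral_completion) simp
  finally show ?thesis .
qed

text \<open>The hypotheses are integrals over the annulus with respect to \<open>lebesgue\<close>,
  whereas convolutions and reflections live on the plane with \<open>lborel\<close>. The value 0
  outside turns every integral over the annulus into one over the plane.\<close>

definition borel_version :: "(real^2 \<Rightarrow> real) \<Rightarrow> (real^2 \<Rightarrow> real) \<Rightarrow> bool" where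
  "borel_version f g \<longleftrightarrow> set_borel_measurable lebesgue annulus f \<and> g \<in> borel_measurable borel \<and>
     (\<forall>x. x \<notin> annulus \<longrightarrow> g x = 0) \<and> (AE x in lebesgue. x \<in> annulus \<longrightarrow> f x = g x)"

lemma borel_version_exists:
  assumes "f absolutely_integrable_on annulus"
  shows "\<exists>g. borel_version f g"
proof -
  have m: "(\<lambda>x. indicator annulus x *\<^sub>R f x) \<in> borel_measurable lebesgue"
    using assms unfolding set_integrable_def by (rule borel_measurable_integrable)
  then obtain g where g: "g \<in> borel_measurable lborel" "AE x in lborel. indicator annulus x *\<^sub>R f x = g x"
    using completion_ex_borel_measurable_real by blast
  note [measurable] = g(1)
  have "AE x in lebesgue. indicator annulus x *\<^sub>R f x = g x" using g(2) by (rule AE_completion)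
  then have "AE x in lebesgue. x \<in> annulus \<longrightarrow> f x = indicator annulus x * g x"
    by eventually_elim (auto simp: indicator_def)
  moreover have "(\<lambda>x. indicator annulus x * g x) \<in> borel_measurable borel" using g(1) annulus_borel by simp
  ultimately show ?thesis using m unfolding borel_version_def set_borel_measurable_def
    by (intro exI[of _ "\<lambda>x. indicator annulus x * g x"]) auto
qed

lemma borel_versionD:
  assumes "borel_version f g"
  shows "g \<in> borel_measurable borel" "x \<notin> annulus \<Longrightarrow> g x = 0" "AE x in lebesgue. x \<in> annulus \<longrightarrow> f x = g x"
    "set_borel_measurable lebesgue annulus f"
  using assms by (auto simp: borel_version_def)

lemma borel_version_integrable:
  assumes v: "borel_version f g" and f: "f absolutely_integrable_on annulus"
  shows "integrable lborel g"
proof -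
  note g = borel_versionD[OF v]
  have "integrable lebesgue g"
  proof (rule integrable_cong_AE_imp)
    show "integrable lebesgue (\<lambda>x. indicator annulus x *\<^sub>R f x)" using f unfolding set_integrable_def .
    show "g \<in> borel_measurable lebesgue" using g(1) by (intro measurable_completion) simp
    show "AE x in lebesgue. indicator annulus x *\<^sub>R f x = g x"
      using g(3) by eventually_elim (use g(2) in \<open>auto simp: indicator_def\<close>)
  qed
  then show ?thesis using g(1) by (simp add: integrable_completion)
qed

lemma borel_version_LINT:
  assumes v: "borel_version f g" and q: "q \<in> borel_measurable borel"
  shows "(LINT x:annulus|lebesgue. f x * q x) = (\<integral>x. g x * q x \<partial>lborel)"
proof (rule LINT_annulus_eq)
  note g = borel_versionD[OF v]
  have "(\<lambda>x. (indicator annulus x *\<^sub>R f x) * q x) \<in> borel_measurable lebesgue"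
    using g(4) q unfolding set_borel_measurable_def
    by (intro borel_measurable_times) (auto intro: measurable_completion)
  then show "set_borel_measurable lebesgue annulus (\<lambda>x. f x * q x)"
    unfolding set_borel_measurable_def by (simp add: mult.assoc)
  show "(\<lambda>x. g x * q x) \<in> borel_measurable borel" using g(1) q by simp
  show "AE x in lebesgue. x \<in> annulus \<longrightarrow> f x * q x = g x * q x" using g(3) by eventually_elim auto
qed (use borel_versionD[OF v] in auto)

lemma borel_version_LINT_diff:
  assumes v: "borel_version f g" and q: "q \<in> borel_measurable borel" "\<And>x. x \<notin> annulus \<Longrightarrow> q x = 0"
  shows "(LINT x:annulus|lebesgue. \<bar>f x - q x\<bar>) = (\<integral>x. \<bar>g x - q x\<bar> \<partial>lborel)"
proof (rule LINT_annulus_eq)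
  note g = borel_versionD[OF v]
  have "(\<lambda>x. \<bar>indicator annulus x *\<^sub>R f x - q x\<bar>) \<in> borel_measurable lebesgue"
    using g(4) q(1) unfolding set_borel_measurable_def
    by (intro borel_measurable_abs borel_measurable_diff) (auto intro: measurable_completion)
  moreover have "(\<lambda>x. \<bar>indicator annulus x *\<^sub>R f x - q x\<bar>) = (\<lambda>x. indicator annulus x *\<^sub>R \<bar>f x - q x\<bar>)"
    using q(2) by (auto simp: indicator_def fun_eq_iff)
  ultimately show "set_borel_measurable lebesgue annulus (\<lambda>x. \<bar>f x - q x\<bar>)"
    unfolding set_borel_measurable_def by simp
  show "(\<lambda>x. \<bar>g x - q x\<bar>) \<in> borel_measurable borel" using g(1) q by simp
  show "AE x in lebesgue. x \<in> annulus \<longrightarrow> \<bar>f x - q x\<bar> = \<bar>g x - q x\<bar>" using g(3) by eventually_elim auto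
qed (use borel_versionD[OF v] q in auto)

lemma gradient_inner: "e \<in> Basis \<Longrightarrow> gradient f x \<bullet> e = partial_deriv e f x"
  unfolding gradient_def by (simp add: inner_sum_left inner_Basis if_distrib sum.delta cong: if_cong)

lemma absolutely_integrable_inner:
  fixes G :: "'a::euclidean_space \<Rightarrow> 'b::euclidean_space"
  assumes "G absolutely_integrable_on S" shows "(\<lambda>x. G x \<bullet> e) absolutely_integrable_on S"
proof -
  have "integrable lebesgue (\<lambda>x. (indicator S x *\<^sub>R G x) \<bullet> e)"
    using assms unfolding set_integrable_def by (rule integrable_inner_left)
  then show ?thesis unfolding set_integrable_def by simp
qed

lemma test_absolutely_integrable:
  assumes "\<phi> \<in> test_functions D" "S \<in> sets borel"
  shows "\<phi> absolutely_integrable_on S"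
proof -
  have "integrable lborel (\<lambda>x. indicator S x *\<^sub>R \<phi> x)"
    using integrable_mult_indicator[OF _ integrable_test[OF assms(1)], of S] assms(2) by simp
  then show ?thesis unfolding set_integrable_def
    using borel_measurable_integrable by (subst integrable_completion) auto
qed

text \<open>A translation between the two settings: each component of the weak gradient gets its own
  Borel version, and convergence of the gradients passes to the components because each is bounded
  by the norm.\<close>

lemma sobolev_annulus_dirichlet:
  assumes u: "u \<in> sobolev_W11_0 annulus" and eq: "neg_laplacian_distr annulus u F"
    and F: "F absolutely_integrable_on annulus"
    and v: "borel_version u u'" "borel_version F F'"
  shows "annulus_dirichlet u' F'"
proof -
  obtain G \<phi> where iu: "u absolutely_integrable_on annulus" and G: "has_weak_gradient annulus u G" "G absolutely_integrable_on annulus"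
    and \<phi>: "\<And>n::nat. \<phi> n \<in> test_functions annulus"
    and lim: "(\<lambda>n. LINT x:annulus|lebesgue. \<bar>u x - \<phi> n x\<bar>) \<longlonglongrightarrow> 0"
      "(\<lambda>n. LINT x:annulus|lebesgue. norm (G x - gradient (\<phi> n) x)) \<longlonglongrightarrow> 0"
    using u unfolding sobolev_W11_0_def sobolev_W11_def by blast
  have iG: "(\<lambda>x. G x \<bullet> e) absolutely_integrable_on annulus" for e using absolutely_integrable_inner[OF G(2)] .
  define g where "g e = (SOME g. borel_version (\<lambda>x. G x \<bullet> e) g)" for e
  have g: "borel_version (\<lambda>x. G x \<bullet> e) (g e)" for e
    unfolding g_def by (rule someI_ex[OF borel_version_exists[OF iG]])
  have z: "\<psi> x = 0" if "\<psi> \<in> test_functions annulus" "x \<notin> annulus" for \<psi> x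
    using test_functionsD(2)[OF that(1)] that(2) by blast
  show ?thesis
  proof (rule annulus_dirichletI[where G=g and \<phi>=\<phi>])
    show "integrable lborel u'" "integrable lborel F'" using borel_version_integrable v iu F by blast+
    show "integrable lborel (g e)" for e by (rule borel_version_integrable[OF g iG])
    show "u' x = 0" "F' x = 0" "g e x = 0" if "x \<notin> annulus" for x e
      using borel_versionD(2) v g that by blast+
    show "\<phi> n \<in> test_functions annulus" for n by (rule \<phi>)
    fix e :: "real^2" assume e: "e \<in> Basis"
    {
      fix \<psi> :: "real^2 \<Rightarrow> real" assume \<psi>: "\<psi> \<in> test_functions annulus"
      have "(LINT x:annulus|lebesgue. u x * partial_deriv e \<psi> x) = - (LINT x:annulus|lebesgue. (G x \<bullet> e) * \<psi> x)"
        using G(1) \<psi> e unfolding has_weak_gradient_def by blast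
      then show "(\<integral>x. u' x * partial_deriv e \<psi> x \<partial>lborel) = - (\<integral>x. g e x * \<psi> x \<partial>lborel)"
        using borel_version_LINT[OF v(1) borel_measurable_test[OF test_functions_partial_deriv[OF \<psi> e]]]
          borel_version_LINT[OF g borel_measurable_test[OF \<psi>], of e] by simp
    }
    show "(\<lambda>n. \<integral>x. \<bar>g e x - partial_deriv e (\<phi> n) x\<bar> \<partial>lborel) \<longlonglongrightarrow> 0"
    proof (rule Lim_null_comparison[OF _ lim(2)], rule always_eventually, rule allI)
      fix n
      note p = test_functions_partial_deriv[OF \<phi>[of n]]
      have "(\<integral>x. \<bar>g e x - partial_deriv e (\<phi> n) x\<bar> \<partial>lborel) = (LINT x:annulus|lebesgue. \<bar>G x \<bullet> e - partial_deriv e (\<phi> n) x\<bar>)"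
        using borel_version_LINT_diff[OF g borel_measurable_test[OF p[OF e]] z[OF p[OF e]]] by simp
      also have "\<dots> \<le> (LINT x:annulus|lebesgue. norm (G x - gradient (\<phi> n) x))"
      proof (rule set_integral_mono)
        have "gradient (\<phi> n) absolutely_integrable_on annulus"
        proof -
          have "(\<lambda>x. \<Sum>e\<in>Basis. partial_deriv e (\<phi> n) x *\<^sub>R e) absolutely_integrable_on annulus"
            by (intro absolutely_integrable_sum absolutely_integrable_scaleR_right finite_Basis)
               (use test_absolutely_integrable[OF p annulus_borel] in \<open>auto intro: absolutely_integrable_scaleR_right\<close>)
          then show ?thesis by (simp add: gradient_def[abs_def])
        qed
        then show "set_integrable lebesgue annulus (\<lambda>x. norm (G x - gradient (\<phi> n) x))"
          using G(2) by (intro absolutely_integrable_norm[unfolded o_def] set_integral_diff(1))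
        show "set_integrable lebesgue annulus (\<lambda>x. \<bar>G x \<bullet> e - partial_deriv e (\<phi> n) x\<bar>)"
          using iG test_absolutely_integrable[OF p[OF e] annulus_borel]
          by (intro set_integrable_abs set_integral_diff(1))
        show "\<bar>G x \<bullet> e - partial_deriv e (\<phi> n) x\<bar> \<le> norm (G x - gradient (\<phi> n) x)" for x
          using Basis_le_norm[OF e, of "G x - gradient (\<phi> n) x"] by (simp add: inner_diff_left gradient_inner[OF e])
      qed
      finally show "norm (\<integral>x. \<bar>g e x - partial_deriv e (\<phi> n) x\<bar> \<partial>lborel) \<le> (LINT x:annulus|lebesgue. norm (G x - gradient (\<phi> n) x))"
        by simp
    qed
  next
    fix \<psi> :: "real^2 \<Rightarrow> real" assume \<psi>: "\<psi> \<in> test_functions annulus"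
    have "- (LINT x:annulus|lebesgue. u x * laplacian \<psi> x) = (LINT x:annulus|lebesgue. F x * \<psi> x)"
      using eq \<psi> unfolding neg_laplacian_distr_def by blast
    then show "- (\<integral>x. u' x * laplacian \<psi> x \<partial>lborel) = (\<integral>x. F' x * \<psi> x \<partial>lborel)"
      using borel_version_LINT[OF v(1) borel_measurable_test[OF test_functions_laplacian[OF \<psi>]]]
        borel_version_LINT[OF v(2) borel_measurable_test[OF \<psi>]] by simp
  next
    show "(\<lambda>n. \<integral>x. \<bar>u' x - \<phi> n x\<bar> \<partial>lborel) \<longlonglongrightarrow> 0"
      using lim(1) borel_version_LINT_diff[OF v(1) borel_measurable_test[OF \<phi>] z[OF \<phi>]] by simp
  qed
qed

subsection \<open>Bounded weak gradients and Lipschitz bounds\<close>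

text \<open>Differentiation under the integral sign; the Lipschitz constant of \<open>\<phi>\<close>
  dominates the difference quotients.\<close>

lemma convolution_line_derivative:
  fixes \<phi> v :: "'a::euclidean_space \<Rightarrow> real"
  assumes v: "integrable lborel v" and \<phi>: "\<phi> \<in> test_functions UNIV"
  shows "((\<lambda>s. \<integral>z. v z * \<phi> (x + s *\<^sub>R h - z) \<partial>lborel) has_real_derivative
     (\<Sum>e\<in>Basis. (h \<bullet> e) * (\<integral>z. v z * partial_deriv e \<phi> (x + s *\<^sub>R h - z) \<partial>lborel))) (at s)"
proof -
  obtain L where L: "0 \<le> L" "\<And>x y. \<bar>\<phi> x - \<phi> y\<bar> \<le> L * norm (x - y)" using test_functions_Lipschitz[OF \<phi>] by blast
  let ?p = "\<lambda>t z. x + t *\<^sub>R h - z"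
  note iv = integrable_mult_test[OF v test_shift]
  have i1: "integrable lborel (\<lambda>z. v z * \<phi> (?p t z))" for t using iv[OF \<phi>] by simp
  have i2: "integrable lborel (\<lambda>z. v z * partial_deriv e \<phi> (?p t z))" if "e \<in> Basis" for t e
    using iv[OF test_functions_partial_deriv[OF \<phi> that]] by simp
  let ?D = "\<lambda>z. \<Sum>e\<in>Basis. (h \<bullet> e) * partial_deriv e \<phi> (?p s z)"
  have eqD: "(\<integral>z. v z * ?D z \<partial>lborel) = (\<Sum>e\<in>Basis. (h \<bullet> e) * (\<integral>z. v z * partial_deriv e \<phi> (?p s z) \<partial>lborel))"
  proof -
    have "v z * ?D z = (\<Sum>e\<in>Basis. (h \<bullet> e) * (v z * partial_deriv e \<phi> (?p s z)))" for z
      by (simp add: sum_distrib_left mult_ac)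
    then show ?thesis using i2 by (simp add: Bochner_Integration.integral_sum)
  qed
  have "((\<lambda>t. ((\<integral>z. v z * \<phi> (?p (s + t) z) \<partial>lborel) - (\<integral>z. v z * \<phi> (?p s z) \<partial>lborel)) / t) \<longlongrightarrow> (\<integral>z. v z * ?D z \<partial>lborel)) (at 0)"
    unfolding tendsto_at_iff_sequentially
  proof (intro allI impI)
    fix T :: "nat \<Rightarrow> real" assume T: "\<forall>i. T i \<in> UNIV - {0}" "T \<longlonglongrightarrow> 0"
    have T0: "T n \<noteq> 0" for n using T(1) by auto
    have "(\<lambda>n. \<integral>z. v z * ((\<phi> (?p (s + T n) z) - \<phi> (?p s z)) / T n) \<partial>lborel) \<longlonglongrightarrow> (\<integral>z. v z * ?D z \<partial>lborel)"
    proof (rule integral_dominated_convergence[where w="\<lambda>z. \<bar>v z\<bar> * (L * norm h)"])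
      show "integrable lborel (\<lambda>z. \<bar>v z\<bar> * (L * norm h))" using v by auto
      have "v z * ?D z = (\<Sum>e\<in>Basis. (h \<bullet> e) * (v z * partial_deriv e \<phi> (?p s z)))" for z
        by (simp add: sum_distrib_left mult_ac)
      moreover have "(\<lambda>z. \<Sum>e\<in>Basis. (h \<bullet> e) * (v z * partial_deriv e \<phi> (?p s z))) \<in> borel_measurable lborel"
        using i2 by (intro borel_measurable_sum borel_measurable_times borel_measurable_const borel_measurable_integrable) auto
      ultimately show "(\<lambda>z. v z * ?D z) \<in> borel_measurable lborel" by simp
      have eq: "v z * ((\<phi> (?p (s + T n) z) - \<phi> (?p s z)) / T n) = (v z * \<phi> (?p (s + T n) z) - v z * \<phi> (?p s z)) / T n" for n z
        by (simp add: right_diff_distrib)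
      show "(\<lambda>z. v z * ((\<phi> (?p (s + T n) z) - \<phi> (?p s z)) / T n)) \<in> borel_measurable lborel" for n
        unfolding eq by (intro borel_measurable_divide borel_measurable_diff borel_measurable_const borel_measurable_integrable[OF i1])
      show "AE z in lborel. norm (v z * ((\<phi> (?p (s + T n) z) - \<phi> (?p s z)) / T n)) \<le> \<bar>v z\<bar> * (L * norm h)" for n
      proof (rule AE_I2)
        fix z
        have "\<bar>\<phi> (?p (s + T n) z) - \<phi> (?p s z)\<bar> \<le> L * norm (T n *\<^sub>R h)"
          using L(2)[of "?p (s + T n) z" "?p s z"] by (simp add: algebra_simps)
        then have "\<bar>(\<phi> (?p (s + T n) z) - \<phi> (?p s z)) / T n\<bar> \<le> L * norm h"
          using T0[of n] by (simp add: field_simps)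
        then show "norm (v z * ((\<phi> (?p (s + T n) z) - \<phi> (?p s z)) / T n)) \<le> \<bar>v z\<bar> * (L * norm h)"
          unfolding real_norm_def abs_mult[of "v z"] by (intro mult_left_mono) auto
      qed
      show "AE z in lborel. (\<lambda>n. v z * ((\<phi> (?p (s + T n) z) - \<phi> (?p s z)) / T n)) \<longlonglongrightarrow> v z * ?D z"
      proof (intro AE_I2 tendsto_mult_left)
        fix z
        have "(\<phi> has_derivative (\<lambda>h. \<Sum>e\<in>Basis. (h \<bullet> e) * partial_deriv e \<phi> (?p s z))) (at (?p s z))"
          by (intro has_derivative_partial_deriv smooth_on_differentiable[OF test_functionsD(1)[OF \<phi>]]) auto
        moreover have "((\<lambda>t. ?p t z) has_derivative (\<lambda>t. t *\<^sub>R h)) (at s)"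
          by (auto intro!: derivative_eq_intros)
        ultimately have "((\<lambda>t. \<phi> (?p t z)) has_derivative (\<lambda>t. \<Sum>e\<in>Basis. ((t *\<^sub>R h) \<bullet> e) * partial_deriv e \<phi> (?p s z))) (at s)"
          by (intro has_derivative_compose[where f="\<lambda>t. ?p t z" and f'="\<lambda>t. t *\<^sub>R h" and g=\<phi>])
        then have "((\<lambda>t. \<phi> (?p t z)) has_real_derivative ?D z) (at s)"
          unfolding has_field_derivative_def
          by (rule has_derivative_eq_rhs) (simp add: fun_eq_iff sum_distrib_left sum_distrib_right mult_ac)
        then have "((\<lambda>t. (\<phi> (?p (s + t) z) - \<phi> (?p s z)) / t) \<longlongrightarrow> ?D z) (at 0)"
          by (simp add: DERIV_def)
        then show "(\<lambda>n. (\<phi> (?p (s + T n) z) - \<phi> (?p s z)) / T n) \<longlonglongrightarrow> ?D z"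
          unfolding tendsto_at_iff_sequentially using T by (simp add: o_def)
      qed
    qed
    moreover have eqT: "(\<integral>z. v z * ((\<phi> (?p (s + T n) z) - \<phi> (?p s z)) / T n) \<partial>lborel) =
        ((\<integral>z. v z * \<phi> (?p (s + T n) z) \<partial>lborel) - (\<integral>z. v z * \<phi> (?p s z) \<partial>lborel)) / T n" for n
    proof -
      have "(\<integral>z. v z * ((\<phi> (?p (s + T n) z) - \<phi> (?p s z)) / T n) \<partial>lborel) = (\<integral>z. (v z * \<phi> (?p (s + T n) z) - v z * \<phi> (?p s z)) / T n \<partial>lborel)"
        by (simp add: right_diff_distrib)
      also have "\<dots> = ((\<integral>z. v z * \<phi> (?p (s + T n) z) \<partial>lborel) - (\<integral>z. v z * \<phi> (?p s z) \<partial>lborel)) / T n"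
        using i1 by simp
      finally show ?thesis .
    qed
    ultimately show "((\<lambda>t. ((\<integral>z. v z * \<phi> (?p (s + t) z) \<partial>lborel) - (\<integral>z. v z * \<phi> (?p s z) \<partial>lborel)) / t) \<circ> T) \<longlonglongrightarrow> (\<integral>z. v z * ?D z \<partial>lborel)"
      unfolding o_def eqT by blast
  qed
  then show ?thesis unfolding DERIV_def eqD by simp
qed

text \<open>Mollification commutes with weak differentiation, and an average of vectors of norm at
  most \<open>A\<close> has norm at most \<open>A\<close>. So the mollifications satisfy the bound
  along the segment, and continuity of \<open>V\<close> lets the radius tend to 0. The annulus is
  not convex, which is why the segment has to lie in it.\<close>

lemma weak_gradient_segment_bound:
  assumes V: "continuous_on annulus V" "\<And>x. x \<in> annulus \<Longrightarrow> \<bar>V x\<bar> \<le> B"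
    and A: "gradient_Linf_le annulus V A" "A \<ge> 0" and seg: "closed_segment x y \<subseteq> annulus"
  shows "\<bar>V x - V y\<bar> \<le> A * norm (x - y)"
proof -
  obtain G where G: "has_weak_gradient annulus V G" "AE x in lebesgue_on annulus. norm (G x) \<le> A"
    using A(1) unfolding gradient_Linf_le_def by blast
  have Gb: "AE x in lebesgue. x \<in> annulus \<longrightarrow> norm (G x) \<le> A"
    using G(2) by (subst (asm) AE_restrict_space_iff) auto
  define v where "v x = indicator annulus x * V x" for x
  have vm: "v \<in> borel_measurable borel"
    using borel_measurable_continuous_on_indicator[OF annulus_borel V(1)] by (simp add: v_def[abs_def])
  have vi: "integrable lborel v"
  proof (rule Bochner_Integration.integrable_bound)
    show "integrable lborel (\<lambda>x. B * indicator annulus x)"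
      by (intro integrable_mult_right integrable_real_indicator emeasure_bounded_finite
          bounded_subset[OF bounded_ball annulus_subset_ball]) simp
    show "AE x in lborel. norm (v x) \<le> norm (B * indicator annulus x)"
      using V(2) by (intro AE_I2) (force simp: v_def indicator_def)
  qed (use vm in simp)
  have bv: "borel_version V v"
  proof -
    have "(\<lambda>x. indicator annulus x *\<^sub>R V x) \<in> borel_measurable lebesgue"
      using vm by (intro measurable_completion) (simp add: v_def[abs_def])
    then show ?thesis using vm by (auto simp: borel_version_def set_borel_measurable_def v_def)
  qed
  \<comment> \<open>A tube around the compact segment still lies in the annulus, so the mollifiers
    centred on the segment are test functions there.\<close>
  obtain R where R: "R > 0" "\<And>p. p \<in> closed_segment x y \<Longrightarrow> cball p R \<subseteq> annulus"
  proof -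
    obtain e where e: "e > 0" "{p. infdist p (closed_segment x y) \<le> e} \<subseteq> annulus"
      using compact_in_open_separated[OF _ compact_segment open_annulus seg] by auto
    have "cball p e \<subseteq> annulus" if p: "p \<in> closed_segment x y" for p
    proof
      fix q assume "q \<in> cball p e"
      then have "infdist q (closed_segment x y) \<le> e"
        using infdist_le[OF p, of q] by (simp add: dist_commute)
      then show "q \<in> annulus" using e(2) by auto
    qed
    then show ?thesis using that e(1) by blast
  qed
  let ?d = "\<lambda>n. R / real (Suc n)"
  have d: "0 < ?d n" "?d n \<le> R" for n
    using R by (auto simp: divide_le_eq mult_le_cancel_left1)
  define h where "h = y - x"
  have le: "\<bar>molconv (?d n) v x - molconv (?d n) v y\<bar> \<le> A * norm (x - y)" for n
  proof -
    let ?m = "moll (?d n)"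
    have mt: "?m \<in> test_functions UNIV" by (rule moll_test[OF d(1)])
    define f where "f s = molconv (?d n) v (x + s *\<^sub>R h)" for s
    define f' where "f' s = (\<Sum>e\<in>Basis. (h \<bullet> e) * (\<integral>z. v z * partial_deriv e ?m (x + s *\<^sub>R h - z) \<partial>lborel))" for s
    have der: "(f has_real_derivative f' s) (at s)" for s
      unfolding f_def molconv_def f'_def by (rule convolution_line_derivative[OF vi mt])
    have bd: "\<bar>f' s\<bar> \<le> A * norm h" if s: "0 \<le> s" "s \<le> 1" for s
    proof -
      define p where "p = x + s *\<^sub>R h"
      have "p \<in> closed_segment x y" using s unfolding closed_segment_def p_def h_def
        by (auto intro!: exI[of _ s] simp: algebra_simps)
      then have K: "cball p (?d n) \<subseteq> annulus" using R(2) d(2)[of n] subset_cball by blast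
      define q where "q z = ?m (p - z)" for z
      have q: "q \<in> test_functions annulus"
      proof (rule test_functionsI[of _ "cball p (?d n)"])
        show "smooth_on UNIV q" unfolding q_def[abs_def] by (rule test_functionsD(1)[OF test_shift[OF mt]])
        show "q z = 0" if "z \<notin> cball p (?d n)" for z
          using that moll_eq_0[OF d(1)[of n], of "p - z"] by (simp add: q_def dist_norm)
      qed (use K in auto)
      have pq: "partial_deriv e q z = - partial_deriv e ?m (p - z)" for e z
      proof -
        have "(?m has_derivative frechet_derivative ?m (at (p - z))) (at (p - z))"
          using smooth_on_differentiable[OF test_functionsD(1)[OF mt]] frechet_derivative_works by blast
        moreover have "((\<lambda>z. p - z) has_derivative (\<lambda>h. - h)) (at z)" by (auto intro!: derivative_eq_intros)
        ultimately have "((\<lambda>z. ?m (p - z)) has_derivative (\<lambda>h. frechet_derivative ?m (at (p - z)) (- h))) (at z)"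
          by (intro has_derivative_compose[where f="\<lambda>z. p - z" and f'="\<lambda>h. - h" and g="?m"])
        from partial_deriv_eqI[OF this] have "partial_deriv e q z = frechet_derivative ?m (at (p - z)) (- e)"
          by (simp add: q_def[abs_def])
        also have "\<dots> = - frechet_derivative ?m (at (p - z)) e"
          using linear_frechet_derivative[of ?m "at (p - z)"] smooth_on_differentiable[OF test_functionsD(1)[OF mt]]
          by (simp add: linear_neg)
        finally show ?thesis by (simp add: partial_deriv_def)
      qed
      have Gq: "(\<lambda>z. (G z \<bullet> e) * q z) absolutely_integrable_on annulus" for e
      proof -
        have c: "compact (cball p (?d n))" by simp
        then have "G absolutely_integrable_on cball p (?d n)"
          using G(1) K unfolding has_weak_gradient_def locally_integrable_def by blast
        then have i: "integrable lebesgue (\<lambda>z. indicator (cball p (?d n)) z *\<^sub>R (G z \<bullet> e))"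
          using absolutely_integrable_inner unfolding set_integrable_def by blast
        obtain C where C: "\<And>z. \<bar>q z\<bar> \<le> C" using test_functions_bounded[OF q] by blast
        have qm: "q \<in> borel_measurable lebesgue" using borel_measurable_test[OF q] by (intro measurable_completion) simp
        have "integrable lebesgue (\<lambda>z. (indicator (cball p (?d n)) z *\<^sub>R (G z \<bullet> e)) * q z)"
        proof (rule Bochner_Integration.integrable_bound[OF integrable_mult_right[OF i, of C]])
          show "(\<lambda>z. (indicator (cball p (?d n)) z *\<^sub>R (G z \<bullet> e)) * q z) \<in> borel_measurable lebesgue"
            using borel_measurable_integrable[OF i] qm by (intro borel_measurable_times)
          show "AE z in lebesgue. norm ((indicator (cball p (?d n)) z *\<^sub>R (G z \<bullet> e)) * q z) \<le>
             norm (C * (indicator (cball p (?d n)) z *\<^sub>R (G z \<bullet> e)))"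
          proof (rule AE_I2)
            fix z
            have "\<bar>q z\<bar> \<le> \<bar>C\<bar>" using C[of z] by linarith
            then show "norm ((indicator (cball p (?d n)) z *\<^sub>R (G z \<bullet> e)) * q z) \<le> norm (C * (indicator (cball p (?d n)) z *\<^sub>R (G z \<bullet> e)))"
              by (simp add: abs_mult mult.commute[of _ "\<bar>q z\<bar>"] mult_right_mono)
          qed
        qed
        moreover have eqz: "(indicator (cball p (?d n)) z *\<^sub>R (G z \<bullet> e)) * q z = indicator annulus z *\<^sub>R ((G z \<bullet> e) * q z)" for z
          using K moll_eq_0[OF d(1)[of n], of "p - z"] by (auto simp: indicator_def q_def dist_norm subset_iff)
        ultimately show ?thesis unfolding set_integrable_def by (simp only: eqz)
      qed
      \<comment> \<open>The mollifier depends on \<open>p - z\<close>; the sign from differentiating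
        in \<open>z\<close> cancels the one in the definition of the weak gradient.\<close>
      have "f' s = (\<Sum>e\<in>Basis. (h \<bullet> e) * (LINT z:annulus|lebesgue. (G z \<bullet> e) * q z))"
        unfolding f'_def
      proof (rule sum.cong[OF refl])
        fix e :: "real^2" assume e: "e \<in> Basis"
        have "(\<integral>z. v z * partial_deriv e ?m (x + s *\<^sub>R h - z) \<partial>lborel) = - (\<integral>z. v z * partial_deriv e q z \<partial>lborel)"
          by (simp add: pq p_def)
        also have "\<dots> = - (LINT z:annulus|lebesgue. V z * partial_deriv e q z)"
          using borel_version_LINT[OF bv borel_measurable_test[OF test_functions_partial_deriv[OF q e]]] by simp
        also have "\<dots> = (LINT z:annulus|lebesgue. (G z \<bullet> e) * q z)"
          using G(1) q e unfolding has_weak_gradient_def by simp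
        finally show "(h \<bullet> e) * (\<integral>z. v z * partial_deriv e ?m (x + s *\<^sub>R h - z) \<partial>lborel) =
          (h \<bullet> e) * (LINT z:annulus|lebesgue. (G z \<bullet> e) * q z)" by simp
      qed
      also have "\<dots> = (\<Sum>e\<in>Basis. (\<integral>z. indicator annulus z *\<^sub>R ((h \<bullet> e) * ((G z \<bullet> e) * q z)) \<partial>lebesgue))"
        unfolding set_lebesgue_integral_def
        by (rule sum.cong[OF refl], subst integral_mult_right_zero[symmetric]) (simp add: mult_ac)
      also have "\<dots> = (\<integral>z. (\<Sum>e\<in>Basis. indicator annulus z *\<^sub>R ((h \<bullet> e) * ((G z \<bullet> e) * q z))) \<partial>lebesgue)"
      proof (rule Bochner_Integration.integral_sum[symmetric])
        fix e :: "real^2"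
        show "integrable lebesgue (\<lambda>z. indicator annulus z *\<^sub>R ((h \<bullet> e) * ((G z \<bullet> e) * q z)))"
          using integrable_mult_right[OF Gq[of e, unfolded set_integrable_def], of "h \<bullet> e"] by (simp add: mult_ac)
      qed
      also have "\<dots> = (\<integral>z. indicator annulus z *\<^sub>R ((h \<bullet> G z) * q z) \<partial>lebesgue)"
        by (rule Bochner_Integration.integral_cong[OF refl])
           (subst (2) euclidean_inner, simp add: sum_distrib_left sum_distrib_right mult_ac)
      finally have f': "f' s = (\<integral>z. indicator annulus z *\<^sub>R ((h \<bullet> G z) * q z) \<partial>lebesgue)" .
      have qi: "integrable lborel q" by (rule integrable_test[OF q])
      have q1: "(\<integral>z. q z \<partial>lebesgue) = 1"
      proof -
        have "(\<integral>z. q z \<partial>lebesgue) = (\<integral>z. q z \<partial>lborel)"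
          using borel_measurable_test[OF q] by (intro integral_completion) simp
        also have "\<dots> = 1"
          using integral_lborel_reflect[of ?m p] moll_integral[OF d(1)[of n]] by (simp add: q_def)
        finally show ?thesis .
      qed
      have qil: "integrable lebesgue q"
        using qi borel_measurable_test[OF q] by (simp add: integrable_completion)
      have nn: "q z \<ge> 0" for z by (simp add: q_def moll_nonneg)
      have "\<bar>f' s\<bar> \<le> (\<integral>z. A * norm h * q z \<partial>lebesgue)"
        unfolding f'
      proof (rule order_trans[OF integral_abs_bound integral_mono_AE])
        have "integrable lebesgue (\<lambda>z. indicator annulus z *\<^sub>R ((h \<bullet> G z) * q z))"
        proof -
          have "integrable lebesgue (\<lambda>z. \<Sum>e\<in>Basis. (h \<bullet> e) * (indicator annulus z *\<^sub>R ((G z \<bullet> e) * q z)))"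
            using Gq unfolding set_integrable_def by (intro Bochner_Integration.integrable_sum integrable_mult_right)
          moreover have hG: "(\<Sum>e\<in>Basis. (h \<bullet> e) * (indicator annulus z *\<^sub>R ((G z \<bullet> e) * q z))) = indicator annulus z *\<^sub>R ((h \<bullet> G z) * q z)" for z
            by (subst euclidean_inner[of h "G z"], simp add: sum_distrib_left sum_distrib_right mult_ac)
          ultimately show ?thesis by (simp only: hG)
        qed
        then show "integrable lebesgue (\<lambda>z. \<bar>indicator annulus z *\<^sub>R ((h \<bullet> G z) * q z)\<bar>)"
          by (rule integrable_abs)
        show "integrable lebesgue (\<lambda>z. A * norm h * q z)" using qil by simp
        show "AE z in lebesgue. \<bar>indicator annulus z *\<^sub>R ((h \<bullet> G z) * q z)\<bar> \<le> A * norm h * q z"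
          using Gb
        proof eventually_elim
          case (elim z)
          show ?case
          proof (cases "z \<in> annulus")
            case True
            have "\<bar>h \<bullet> G z\<bar> \<le> norm h * norm (G z)" by (rule Cauchy_Schwarz_ineq2)
            also have "\<dots> \<le> norm h * A" using elim True by (intro mult_left_mono) auto
            finally have "\<bar>h \<bullet> G z\<bar> * q z \<le> A * norm h * q z" using nn by (intro mult_right_mono) (auto simp: mult.commute)
            then show ?thesis using True nn[of z] by (simp add: abs_mult)
          next
            case False
            then show ?thesis using nn[of z] A(2) by simp
          qed
        qed
      qed
      also have "\<dots> = A * norm h" using q1 by simp
      finally show ?thesis .
    qed
    obtain s where s: "0 < s" "s < 1" "f 1 - f 0 = (1 - 0) * f' s"
      using MVT2[of 0 1 f f'] der by auto
    have "molconv (?d n) v x - molconv (?d n) v y = - f' s" using s(3) by (simp add: f_def h_def)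
    then have "\<bar>molconv (?d n) v x - molconv (?d n) v y\<bar> \<le> A * norm h" using bd[of s] s by simp
    then show ?thesis by (simp add: h_def norm_minus_commute)
  qed
  have xy: "x \<in> annulus" "y \<in> annulus" using seg by auto
  have vc: "isCont v z" if "z \<in> annulus" for z
  proof -
    have "continuous_on annulus v" using V(1) by (rule continuous_on_eq) (simp add: v_def)
    then show ?thesis using that open_annulus by (simp add: continuous_on_eq_continuous_at)
  qed
  have "(\<lambda>n. \<bar>molconv (?d n) v x - molconv (?d n) v y\<bar>) \<longlonglongrightarrow> \<bar>v x - v y\<bar>"
    by (intro tendsto_intros molconv_tendsto[OF vi vc R(1)] xy)
  then have "\<bar>v x - v y\<bar> \<le> A * norm (x - y)" using le by (intro LIMSEQ_le_const2) auto
  then show ?thesis using xy by (simp add: v_def)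
qed

subsection \<open>Moving spheres\<close>

lemma wlap_reflected_difference:
  assumes l: "l \<noteq> 0" and w: "wlap D u F" and e: "e > 0" "\<And>x. norm (x - Q) < e \<Longrightarrow> u x = 0"
    and E: "Q \<notin> E" "E \<subseteq> D" "inversion Q l ` E \<subseteq> D"
  shows "wlap E (\<lambda>x. u x - u (inversion Q l x)) (\<lambda>x. F x - inv_jac Q l x * F (inversion Q l x))"
proof -
  have "integrable lborel (\<lambda>x. u (inversion Q l x))"
    by (rule integrable_compose_inversion[OF l wlapD(1)[OF w] e])
  from wlap_lin[OF wlap_subset[OF w E(2)] wlap_inversion[OF l w E(1,3) this], of 1 "-1"]
  show ?thesis by simp
qed

text \<open>The tangent of the exponential at \<open>p\<close>. The positive part gives the form in
  which the maximum principle for small sets takes its right-hand sides.\<close>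

lemma exp_diff_le: "exp p - exp q \<le> exp p * max 0 (p - (q::real))"
proof -
  have "1 + (q - p) \<le> exp (q - p)" by (rule exp_ge_add_one_self)
  then have "exp p * (1 + (q - p)) \<le> exp p * exp (q - p)" by (intro mult_left_mono) auto
  then have "exp p - exp q \<le> exp p * (p - q)" by (simp add: exp_diff algebra_simps)
  also have "\<dots> \<le> exp p * max 0 (p - q)" by (intro mult_left_mono) auto
  finally show ?thesis .
qed

lemma measure_ball_shell_small:
  fixes Q :: "'a::euclidean_space"
  assumes "\<delta> > 0" "l \<ge> 0"
  shows "\<exists>e>0. \<forall>m. l < m \<longrightarrow> m < l + e \<longrightarrow> measure lborel (ball Q m - ball Q l) < \<delta>"
proof -
  let ?g = "\<lambda>m. unit_ball_vol (real DIM('a)) * m ^ DIM('a)"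
  have "isCont ?g l" by (intro continuous_intros)
  then obtain e where e: "e > 0" "\<And>m. dist m l < e \<Longrightarrow> dist (?g m) (?g l) < \<delta>"
    unfolding continuous_at_eps_delta using assms(1) by (auto simp: dist_real_def)
  have "measure lborel (ball Q m - ball Q l) < \<delta>" if m: "l < m" "m < l + e" for m
  proof -
    have "measure lborel (ball Q m - ball Q l) = measure lborel (ball Q m) - measure lborel (ball Q l)"
      by (rule measure_Diff) (use m emeasure_bounded_finite[of "ball Q m"] in \<open>auto simp: less_top\<close>)
    also have "\<dots> = ?g m - ?g l" using m assms(2) by (simp add: content_ball)
    also have "\<dots> < \<delta>" using e(2)[of m] m by (simp add: dist_real_def)
    finally show ?thesis .
  qed
  then show ?thesis using e(1) by blast
qed

text \<open>The setting shared by both boundaries. At radius \<open>l0\<close> the ball does not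
  meet the annulus yet. The conditions \<open>mono_f\<close> and \<open>mono_g\<close> say that the
  coefficients, transformed like densities, strictly increase under reflection; strictness makes
  nonpositive defects strictly negative. The bound \<open>M\<close> may depend on the solutions,
  since it only controls how small a set must be.\<close>

locale moving_spheres =
  fixes u v f g :: "real^2 \<Rightarrow> real" and M :: real and Q :: "real^2" and l0 l1 :: real
  assumes cont: "continuous_on UNIV u" "continuous_on UNIV v"
    and nonneg: "\<And>x. u x \<ge> 0" "\<And>x. v x \<ge> 0"
    and outside: "\<And>x. x \<notin> annulus \<Longrightarrow> u x = 0" "\<And>x. x \<notin> annulus \<Longrightarrow> v x = 0"
    and eq_u: "wlap annulus u (\<lambda>x. indicator annulus x * (f x * exp (v x)))"
    and eq_v: "wlap annulus v (\<lambda>x. indicator annulus x * (g x * exp (u x)))"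
    and M: "M > 0" "\<And>x. x \<in> annulus \<Longrightarrow> f x * exp (v x) \<le> M" "\<And>x. x \<in> annulus \<Longrightarrow> g x * exp (u x) \<le> M"
    and pos: "\<And>x. x \<in> annulus \<Longrightarrow> f x > 0" "\<And>x. x \<in> annulus \<Longrightarrow> g x > 0"
    and radii: "0 < l0" "l0 < l1"
    and centre: "Q \<notin> closure annulus" "annulus \<inter> ball Q l0 = {}"
    and reflect: "\<And>l x. l0 < l \<Longrightarrow> l \<le> l1 \<Longrightarrow> x \<in> annulus \<Longrightarrow> norm (x - Q) < l \<Longrightarrow> inversion Q l x \<in> annulus"
    and mono_f: "\<And>l x. l0 < l \<Longrightarrow> l \<le> l1 \<Longrightarrow> x \<in> annulus \<Longrightarrow> norm (x - Q) < l \<Longrightarrow>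
        f x < inv_jac Q l x * f (inversion Q l x)"
    and mono_g: "\<And>l x. l0 < l \<Longrightarrow> l \<le> l1 \<Longrightarrow> x \<in> annulus \<Longrightarrow> norm (x - Q) < l \<Longrightarrow>
        g x < inv_jac Q l x * g (inversion Q l x)"
begin

definition cap :: "real \<Rightarrow> (real^2) set" where
  "cap l = annulus \<inter> ball Q l"

definition defect :: "(real^2 \<Rightarrow> real) \<Rightarrow> real \<Rightarrow> real^2 \<Rightarrow> real" where
  "defect h l x = h x - h (inversion Q l x)"

definition defect_rhs :: "(real^2 \<Rightarrow> real) \<Rightarrow> (real^2 \<Rightarrow> real) \<Rightarrow> real \<Rightarrow> real^2 \<Rightarrow> real" where
  "defect_rhs k h l x = indicator annulus x * (k x * exp (h x)) -
     inv_jac Q l x * (indicator annulus (inversion Q l x) * (k (inversion Q l x) * exp (h (inversion Q l x))))"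

definition good :: "real \<Rightarrow> bool" where
  "good l \<longleftrightarrow> (\<forall>x\<in>cap l. defect u l x \<le> 0 \<and> defect v l x \<le> 0)"

lemma cap_iff: "x \<in> cap l \<longleftrightarrow> x \<in> annulus \<and> norm (x - Q) < l"
  by (auto simp: cap_def dist_norm norm_minus_commute)

lemma open_cap: "open (cap l)"
  unfolding cap_def using open_annulus by auto

lemma cap_subset: "cap l \<subseteq> annulus" "cap l \<subseteq> ball 0 1"
  using annulus_subset_ball by (auto simp: cap_def)

lemma centre_notin: "Q \<notin> annulus" "Q \<notin> cap l" "Q \<notin> closure (cap l)"
proof -
  show "Q \<notin> annulus" using centre(1) closure_subset by blast
  then show "Q \<notin> cap l" by (simp add: cap_def)
  show "Q \<notin> closure (cap l)" using centre(1) closure_mono[OF cap_subset(1)] by blast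
qed

lemma continuous_on_defect:
  assumes "continuous_on UNIV h" "Q \<notin> S"
  shows "continuous_on S (defect h l)"
proof -
  have "continuous_on S (\<lambda>x. h (inversion Q l x))"
    using assms(2) by (intro continuous_on_compose2[OF assms(1) continuous_on_subset[OF continuous_on_inversion]]) auto
  then show ?thesis unfolding defect_def[abs_def]
    using continuous_on_subset[OF assms(1)] by (intro continuous_intros) auto
qed

text \<open>On the circle the reflection fixes \<open>x\<close>. On the rest of the frontier
  \<open>h\<close> is 0 and its reflected value is nonnegative, wherever the image lies.\<close>

lemma defect_frontier:
  assumes l: "l > 0" and x: "x \<in> frontier (cap l)" and h: "\<And>x. h x \<ge> 0" "\<And>x. x \<notin> annulus \<Longrightarrow> h x = 0"
  shows "defect h l x \<le> 0"
proof (cases "x \<in> annulus")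
  case True
  have "x \<notin> cap l" using x open_cap by (simp add: frontier_def interior_open)
  then have "norm (x - Q) \<ge> l" using True by (simp add: cap_iff)
  moreover have "closure (cap l) \<subseteq> cball Q l" by (rule closure_minimal) (auto simp: cap_def)
  then have "norm (x - Q) \<le> l" using x by (auto simp: frontier_def dist_norm norm_minus_commute)
  ultimately have "norm (x - Q) = l" by simp
  then have "inversion Q l x = x" using l by (simp add: inversion_def dot_square_norm)
  then show ?thesis by (simp add: defect_def)
next
  case False
  then show ?thesis using h by (simp add: defect_def)
qed

lemma vanish_near_centre: "\<exists>e>0. \<forall>x. norm (x - Q) < e \<longrightarrow> x \<notin> annulus"
proof -
  obtain e where "e > 0" "ball Q e \<subseteq> - closure annulus"
    using centre(1) open_contains_ball[of "- closure annulus"] by auto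
  then have "x \<notin> annulus" if "norm (x - Q) < e" for x
    using that closure_subset[of annulus] by (auto simp: subset_iff dist_norm norm_minus_commute)
  then show ?thesis using \<open>e > 0\<close> by blast
qed

lemma wlap_defect:
  assumes l: "l0 < l" "l \<le> l1" and w: "wlap annulus h (\<lambda>x. indicator annulus x * (k x * exp (h' x)))"
    and h: "\<And>x. x \<notin> annulus \<Longrightarrow> h x = 0"
  shows "wlap (cap l) (defect h l) (defect_rhs k h' l)"
proof -
  obtain e where e: "e > 0" "\<And>x. norm (x - Q) < e \<Longrightarrow> x \<notin> annulus" using vanish_near_centre by blast
  have sub: "inversion Q l ` cap l \<subseteq> annulus"
  proof
    fix y assume "y \<in> inversion Q l ` cap l"
    then obtain x where "x \<in> cap l" "y = inversion Q l x" by blast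
    then show "y \<in> annulus" using reflect[OF l, of x] by (simp add: cap_iff)
  qed
  have l': "l \<noteq> 0" using l radii by simp
  have hQ: "h x = 0" if "norm (x - Q) < e" for x by (rule h[OF e(2)[OF that]])
  have "wlap (cap l) (\<lambda>x. h x - h (inversion Q l x)) (\<lambda>x. indicator annulus x * (k x * exp (h' x)) -
      inv_jac Q l x * (indicator annulus (inversion Q l x) * (k (inversion Q l x) * exp (h' (inversion Q l x)))))"
    by (rule wlap_reflected_difference[OF l' w e(1) hQ centre_notin(2) cap_subset(1) sub])
  then show ?thesis unfolding defect_def defect_rhs_def .
qed

text \<open>Replacing the reflected coefficient by the smaller \<open>k x\<close> only increases the
  right-hand side. What remains is a difference of exponentials at \<open>x\<close> and at its
  image, controlled by the positive part of the defect of the exponent; the strict increase of the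
  coefficient gives the strict sign.\<close>

lemma
  assumes l: "l0 < l" "l \<le> l1" and x: "x \<in> cap l"
    and k: "k x > 0" "k x < inv_jac Q l x * k (inversion Q l x)"
  shows defect_rhs_le: "defect_rhs k h l x \<le> k x * exp (h x) * max 0 (defect h l x)"
    and defect_rhs_neg: "defect h l x \<le> 0 \<Longrightarrow> defect_rhs k h l x < 0"
proof -
  let ?I = "inversion Q l x" and ?J = "inv_jac Q l x"
  have xA: "x \<in> annulus" "?I \<in> annulus" using x reflect[OF l, of x] by (simp_all add: cap_iff)
  have L: "defect_rhs k h l x = k x * exp (h x) - (?J * k ?I) * exp (h ?I)" using xA by (simp add: defect_rhs_def)
  have lt: "k x * exp (h ?I) < (?J * k ?I) * exp (h ?I)" using k(2) by simp
  have "defect_rhs k h l x \<le> k x * (exp (h x) - exp (h ?I))" using lt unfolding L by (simp add: algebra_simps)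
  also have "\<dots> \<le> k x * (exp (h x) * max 0 (h x - h ?I))"
    using k(1) by (intro mult_left_mono exp_diff_le) auto
  finally show "defect_rhs k h l x \<le> k x * exp (h x) * max 0 (defect h l x)" by (simp add: defect_def mult.assoc)
  assume "defect h l x \<le> 0"
  then have "k x * exp (h x) \<le> k x * exp (h ?I)" using k(1) by (simp add: defect_def)
  then show "defect_rhs k h l x < 0" using lt unfolding L by linarith
qed

text \<open>The threshold is chosen before the radius and serves all radii, since it depends on
  \<open>M\<close> only. This permits both the start, with \<open>K\<close> empty, and the
  continuation, with one compact set kept for all nearby radii.\<close>

lemma small_measure_good:
  "\<exists>\<delta>>0. \<forall>l K. l0 < l \<longrightarrow> l \<le> l1 \<longrightarrow> compact K \<longrightarrow> measure lborel (cap l - K) < \<delta> \<longrightarrow>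
     (\<forall>x\<in>K. defect u l x \<le> 0 \<and> defect v l x \<le> 0) \<longrightarrow> good l"
proof -
  obtain \<delta> where \<delta>: "\<delta> > 0" "\<And>D K w z f g. open D \<Longrightarrow> D \<subseteq> ball 0 1 \<Longrightarrow> compact K \<Longrightarrow> measure lborel (D - K) < \<delta> \<Longrightarrow>
     continuous_on (closure D) w \<Longrightarrow> continuous_on (closure D) z \<Longrightarrow>
     (\<forall>x\<in>K \<union> frontier D. w x \<le> 0 \<and> z x \<le> 0) \<Longrightarrow> wlap D w f \<Longrightarrow> wlap D z g \<Longrightarrow>
     (\<forall>x\<in>D. f x \<le> M * max 0 (z x)) \<Longrightarrow> (\<forall>x\<in>D. g x \<le> M * max 0 (w x)) \<Longrightarrow>
     (\<forall>x\<in>D. w x \<le> 0 \<and> z x \<le> 0)"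
    using small_measure_max_principle[OF M(1)] by blast
  have "good l" if l: "l0 < l" "l \<le> l1" and K: "compact K" "measure lborel (cap l - K) < \<delta>"
      and Kle: "\<And>x. x \<in> K \<Longrightarrow> defect u l x \<le> 0 \<and> defect v l x \<le> 0" for l K
    unfolding good_def
  proof (rule \<delta>(2)[OF open_cap cap_subset(2) K])
    have l': "l > 0" using l radii by simp
    show "continuous_on (closure (cap l)) (defect u l)" "continuous_on (closure (cap l)) (defect v l)"
      using cont centre_notin by (intro continuous_on_defect; simp)+
    show "\<forall>x\<in>K \<union> frontier (cap l). defect u l x \<le> 0 \<and> defect v l x \<le> 0"
      using Kle defect_frontier[OF l'] nonneg outside by blast
    show "wlap (cap l) (defect u l) (defect_rhs f v l)"
      by (rule wlap_defect[OF l eq_u outside(1)])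
    show "wlap (cap l) (defect v l) (defect_rhs g u l)"
      by (rule wlap_defect[OF l eq_v outside(2)])
    show "\<forall>x\<in>cap l. defect_rhs f v l x \<le> M * max 0 (defect v l x)"
    proof
      fix x assume x: "x \<in> cap l"
      then have xA: "x \<in> annulus" "norm (x - Q) < l" by (auto simp: cap_iff)
      note defect_rhs_le[OF l x pos(1)[OF xA(1)] mono_f[OF l xA], of v]
      also have "f x * exp (v x) * max 0 (defect v l x) \<le> M * max 0 (defect v l x)"
        using M(2)[OF xA(1)] by (intro mult_right_mono) auto
      finally show "defect_rhs f v l x \<le> M * max 0 (defect v l x)" .
    qed
    show "\<forall>x\<in>cap l. defect_rhs g u l x \<le> M * max 0 (defect u l x)"
    proof
      fix x assume x: "x \<in> cap l"
      then have xA: "x \<in> annulus" "norm (x - Q) < l" by (auto simp: cap_iff)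
      note defect_rhs_le[OF l x pos(2)[OF xA(1)] mono_g[OF l xA], of u]
      also have "g x * exp (u x) * max 0 (defect u l x) \<le> M * max 0 (defect u l x)"
        using M(3)[OF xA(1)] by (intro mult_right_mono) auto
      finally show "defect_rhs g u l x \<le> M * max 0 (defect u l x)" .
    qed
  qed
  then show ?thesis using \<delta>(1) by blast
qed

text \<open>Once the defect of the exponent is nonpositive, the strict increase of the coefficient
  makes the right-hand side strictly negative.\<close>

lemma good_strict:
  assumes l: "l0 < l" "l \<le> l1" and G: "good l" and x: "x \<in> cap l"
  shows "defect u l x < 0" "defect v l x < 0"
proof -
  have G': "defect u l y \<le> 0" "defect v l y \<le> 0" if "y \<in> cap l" for y using G that by (auto simp: good_def)
  show "defect u l x < 0"
  proof (rule strictly_negative[OF open_cap wlap_defect[OF l eq_u outside(1)] _ _ _ x])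
    show "AE y in lborel. y \<in> cap l \<longrightarrow> defect_rhs f v l y < 0"
      using defect_rhs_neg[OF l _ _ _ G'(2)] pos(1) mono_f[OF l] by (intro AE_I2) (auto simp: cap_iff)
  qed (use G' continuous_on_defect[OF cont(1) centre_notin(2)] in auto)
  show "defect v l x < 0"
  proof (rule strictly_negative[OF open_cap wlap_defect[OF l eq_v outside(2)] _ _ _ x])
    show "AE y in lborel. y \<in> cap l \<longrightarrow> defect_rhs g u l y < 0"
      using defect_rhs_neg[OF l _ _ _ G'(1)] pos(2) mono_g[OF l] by (intro AE_I2) (auto simp: cap_iff)
  qed (use G' continuous_on_defect[OF cont(2) centre_notin(2)] in auto)
qed

lemma continuous_on_defect_joint:
  assumes "continuous_on UNIV h" "Q \<notin> K"
  shows "continuous_on (T \<times> K) (\<lambda>p. defect h (fst p) (snd p))"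
proof -
  have "continuous_on (T \<times> K) (\<lambda>p. h (snd p))"
    by (intro continuous_on_compose2[OF assms(1)] continuous_intros) auto
  moreover have "continuous_on (T \<times> K) (\<lambda>p. inversion Q (fst p) (snd p))"
    unfolding inversion_def using assms(2) by (intro continuous_intros) auto
  then have "continuous_on (T \<times> K) (\<lambda>p. h (inversion Q (fst p) (snd p)))"
    by (intro continuous_on_compose2[OF assms(1)]) auto
  ultimately show ?thesis unfolding defect_def by (intro continuous_intros)
qed

text \<open>A compact \<open>K\<close> fills the cap up to measure \<open>\<delta>/2\<close>. Strict
  negativity on \<open>K\<close> persists for nearby radii, and the rest of the larger cap,
  consisting of the old cap outside \<open>K\<close> and part of a thin shell, has measure below
  \<open>\<delta>\<close>, where the maximum principle takes over.\<close>

lemma good_open: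
  assumes l: "l0 < l" "l \<le> l1" and G: "good l"
  shows "\<exists>e>0. \<forall>m. l < m \<longrightarrow> m < l + e \<longrightarrow> m \<le> l1 \<longrightarrow> good m"
proof -
  obtain \<delta> where \<delta>: "\<delta> > 0" and d0: "\<forall>l K. l0 < l \<longrightarrow> l \<le> l1 \<longrightarrow> compact K \<longrightarrow>
      measure lborel (cap l - K) < \<delta> \<longrightarrow> (\<forall>x\<in>K. defect u l x \<le> 0 \<and> defect v l x \<le> 0) \<longrightarrow> good l"
    using small_measure_good by (elim exE conjE)
  note small = d0[rule_format]
  obtain K where K: "closed K" "K \<subseteq> cap l" "emeasure lebesgue (cap l - K) < ennreal (\<delta>/2)"
  proof (rule sets_lebesgue_inner_closed[of "cap l" "\<delta>/2"])
    show "cap l \<in> sets lebesgue" using open_cap by auto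
  qed (use \<delta> in auto)
  have Kc: "compact K"
    using K(1) bounded_subset[OF bounded_ball order_trans[OF K(2) cap_subset(2)]] by (simp add: compact_eq_bounded_closed)
  have dm: "cap l - K \<in> sets borel" using open_cap K(1) by auto
  have "emeasure lborel (cap l - K) < ennreal (\<delta>/2)" using K(3) dm by simp
  then have Km: "measure lborel (cap l - K) < \<delta>/2"
    unfolding measure_def using \<delta> by (subst enn2real_less_iff) (auto intro: less_trans)
  obtain e1 where e1: "e1 > 0" "\<And>m. l < m \<Longrightarrow> m < l + e1 \<Longrightarrow> measure lborel (ball Q m - ball Q l) < \<delta>/2"
    using measure_ball_shell_small[of "\<delta>/2" l Q] \<delta> l radii by auto
  have QK: "Q \<notin> K" using K(2) centre_notin(2) by blast
  let ?X = "{l..l1} \<times> K"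
  have X: "compact ?X" using Kc by (intro compact_Times) auto
  let ?B = "\<lambda>h. ?X \<inter> (\<lambda>p. defect h (fst p) (snd p)) -` {0..}"
  have cB: "compact (?B h)" if "continuous_on UNIV h" for h
  proof -
    have "closed (?B h)"
      by (rule continuous_closed_preimage[OF continuous_on_defect_joint[OF that QK] compact_imp_closed[OF X] closed_atLeast])
    then have "compact (?X \<inter> ?B h)" by (rule compact_Int_closed[OF X])
    then show ?thesis by (simp add: Int_assoc[symmetric])
  qed
  \<comment> \<open>The radii at which one of the defects is nonnegative somewhere on
    \<open>K\<close>: closed, as a projection of compact sets, and not containing
    \<open>l\<close>.\<close>
  define N where "N = fst ` ?B u \<union> fst ` ?B v"
  have "closed N" unfolding N_def
    by (intro closed_Un compact_imp_closed compact_continuous_image continuous_intros cB cont)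
  moreover have "l \<notin> N" unfolding N_def
    using good_strict[OF l G] K(2) by force
  ultimately obtain e2 where e2: "e2 > 0" "ball l e2 \<subseteq> - N"
    using open_contains_ball[of "- N"] by (auto simp: closed_def)
  have "good m" if m: "l < m" "m < l + min e1 e2" "m \<le> l1" for m
  proof (rule small[OF _ m(3) Kc])
    show "l0 < m" using l m by simp
    have "measure lborel (cap m - K) \<le> measure lborel ((cap l - K) \<union> (ball Q m - ball Q l))"
    proof (intro measure_mono_fmeasurable fmeasurableI)
      have "bounded (cap l - K)" "bounded (ball Q m - ball Q l)"
        using cap_subset(2) by (auto intro: bounded_subset[OF bounded_ball])
      then show "emeasure lborel ((cap l - K) \<union> (ball Q m - ball Q l)) < \<infinity>"
        by (intro emeasure_bounded_finite) simp
    qed (use dm open_cap K(1) in \<open>auto simp: cap_def\<close>)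
    also have "\<dots> \<le> measure lborel (cap l - K) + measure lborel (ball Q m - ball Q l)"
      using dm by (intro measure_Un_le) auto
    also have "\<dots> < \<delta>" using Km e1(2)[of m] m by linarith
    finally show "measure lborel (cap m - K) < \<delta>" .
    show "defect u m x \<le> 0 \<and> defect v m x \<le> 0" if x: "x \<in> K" for x
    proof -
      have "m \<in> ball l e2" using m by (simp add: dist_real_def)
      then have "m \<notin> N" using e2(2) by blast
      then have "(m, x) \<notin> ?B u" "(m, x) \<notin> ?B v"
        unfolding N_def using imageI[of "(m, x)" "?B u" fst] imageI[of "(m, x)" "?B v" fst] by auto
      then show "defect u m x \<le> 0 \<and> defect v m x \<le> 0" using x m by auto
    qed
  qed
  then show ?thesis using e1(1) e2(1) by (intro exI[of _ "min e1 e2"]) auto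
qed

text \<open>For fixed \<open>x\<close> the defect is continuous in the radius, and \<open>x\<close>
  belongs to the cap of every radius slightly below \<open>l\<close>.\<close>

lemma good_closed:
  assumes l: "l0 < l" and G: "\<And>m. l0 < m \<Longrightarrow> m < l \<Longrightarrow> good m"
  shows "good l"
  unfolding good_def
proof
  fix x assume x: "x \<in> cap l"
  have xQ: "norm (x - Q) < l" "x \<in> annulus" using x by (auto simp: cap_iff)
  have le: "defect h l x \<le> 0" if h: "continuous_on UNIV h"
    and hg: "\<And>m. l0 < m \<Longrightarrow> m < l \<Longrightarrow> norm (x - Q) < m \<Longrightarrow> defect h m x \<le> 0" for h
  proof -
    have "isCont (\<lambda>m. inversion Q m x) l"
      unfolding inversion_def using xQ(2) centre_notin(1) by (intro continuous_intros) auto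
    then have "isCont (\<lambda>m. h (inversion Q m x)) l"
      by (rule isCont_o2) (use h in \<open>simp add: continuous_on_eq_continuous_at\<close>)
    then have "isCont (\<lambda>m. defect h m x) l"
      unfolding defect_def by (rule continuous_diff[OF continuous_const])
    then have "((\<lambda>m. defect h m x) \<longlongrightarrow> defect h l x) (at_left l)"
      unfolding isCont_def by (rule tendsto_mono[OF at_le[OF subset_UNIV]])
    moreover have "eventually (\<lambda>m. defect h m x \<le> 0) (at_left l)"
      unfolding eventually_at_left_field using xQ(1) l
      by (intro exI[of _ "max l0 (norm (x - Q))"]) (auto intro: hg)
    ultimately show ?thesis by (rule tendsto_upperbound) simp
  qed
  show "defect u l x \<le> 0 \<and> defect v l x \<le> 0"
    using G xQ(2) by (intro conjI le cont) (auto simp: good_def cap_iff)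
qed

lemma good_start: "\<exists>e>0. \<forall>l. l0 < l \<longrightarrow> l < l0 + e \<longrightarrow> l \<le> l1 \<longrightarrow> good l"
proof -
  obtain \<delta> where \<delta>: "\<delta> > 0" and d0: "\<forall>l K. l0 < l \<longrightarrow> l \<le> l1 \<longrightarrow> compact K \<longrightarrow>
      measure lborel (cap l - K) < \<delta> \<longrightarrow> (\<forall>x\<in>K. defect u l x \<le> 0 \<and> defect v l x \<le> 0) \<longrightarrow> good l"
    using small_measure_good by (elim exE conjE)
  note small = d0[rule_format]
  obtain e where e: "e > 0" "\<And>m. l0 < m \<Longrightarrow> m < l0 + e \<Longrightarrow> measure lborel (ball Q m - ball Q l0) < \<delta>"
    using measure_ball_shell_small[of \<delta> l0 Q] \<delta> radii by auto
  have "good l" if l: "l0 < l" "l < l0 + e" "l \<le> l1" for l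
  proof (rule small[OF l(1,3) compact_empty])
    have "measure lborel (cap l - {}) \<le> measure lborel (ball Q l - ball Q l0)"
      using open_cap[of l] centre(2)
      by (intro measure_mono_fmeasurable fmeasurableI emeasure_bounded_finite)
         (auto simp: cap_def intro!: bounded_subset[OF bounded_ball])
    then show "measure lborel (cap l - {}) < \<delta>" using e(2)[OF l(1,2)] by simp
  qed simp
  then show ?thesis using e(1) by blast
qed

text \<open>A continuity method: the infimum \<open>m\<close> of the bad radii lies beyond the
  start, is good by closedness, and by openness all bad radii stay a fixed distance above it, a
  contradiction.\<close>

lemma reflection_le:
  assumes l: "l0 < l" "l \<le> l1" and x: "x \<in> annulus" "norm (x - Q) < l"
  shows "u x \<le> u (inversion Q l x)" "v x \<le> v (inversion Q l x)"
proof -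
  have "good l"
  proof (rule ccontr)
    assume "\<not> good l"
    define S where "S = {l. l0 < l \<and> l \<le> l1 \<and> \<not> good l}"
    define m where "m = Inf S"
    have S: "l \<in> S" "bdd_below S" using \<open>\<not> good l\<close> l by (auto simp: S_def intro: bdd_belowI[of _ l0])
    obtain e where e: "e > 0" "\<And>l. l0 < l \<Longrightarrow> l < l0 + e \<Longrightarrow> l \<le> l1 \<Longrightarrow> good l" using good_start by blast
    have "l0 + e \<le> m"
      unfolding m_def using S(1) e(2) by (intro cInf_greatest) (force simp: S_def)+
    then have m: "l0 < m" "m \<le> l1" using e(1) cInf_lower[OF S] l(2) by (auto simp: m_def)
    have "good k" if "l0 < k" "k < m" for k
      using cInf_lower[OF _ S(2), of k] that m(2) by (force simp: m_def S_def)
    then have G: "good m" by (rule good_closed[OF m(1)])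
    obtain e' where e': "e' > 0" "\<And>k. m < k \<Longrightarrow> k < m + e' \<Longrightarrow> k \<le> l1 \<Longrightarrow> good k" using good_open[OF m G] by blast
    have "m + e' \<le> k" if k: "k \<in> S" for k
    proof (rule ccontr)
      assume "\<not> m + e' \<le> k"
      moreover have "m \<le> k" unfolding m_def by (rule cInf_lower[OF k S(2)])
      ultimately have "good k" using G e'(2)[of k] k by (cases "k = m") (auto simp: S_def)
      then show False using k by (simp add: S_def)
    qed
    then have "m + e' \<le> m" using S(1) unfolding m_def[symmetric] by (subst (2) m_def) (intro cInf_greatest, auto)
    then show False using e'(1) by simp
  qed
  then show "u x \<le> u (inversion Q l x)" "v x \<le> v (inversion Q l x)"
    using x by (auto simp: good_def defect_def cap_iff)
qed

end

subsection \<open>Comparison across the boundary\<close>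

text \<open>With \<open>r = norm (x - Q)\<close> and \<open>d = norm (x - y)\<close> the Jacobian is
  \<open>((r + d) / r)^2\<close>, as \<open>x\<close> and its image lie on one ray from
  \<open>Q\<close>. After multiplication by \<open>r^2\<close> the claim is
  \<open>9/4 * r^2 * d + r^2 * d^2 / 2 < 2 * r * d + d^2\<close>, which holds for
  \<open>r < 8/9\<close>; the bound \<open>3/4\<close> leaves room. The factor
  \<open>1 + d / 4\<close> accounts for the gradient of the coefficient, \<open>1 + 2 * d\<close>
  for the weight.\<close>

lemma less_inv_jac_mult:
  assumes x: "x \<noteq> Q" "norm (x - Q) \<le> 3/4" "norm (x - Q) < l" and y: "y = inversion Q l x"
    and k: "k y > 0" "k x \<le> (1 + norm (x - y) / 4) * (1 + 2 * norm (x - y)) * k y"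
  shows "k x < inv_jac Q l x * k y"
proof -
  define r where "r = norm (x - Q)"
  define d where "d = l\<^sup>2 / r - r"
  have r: "0 < r" "r \<le> 3/4" "r < l" using x by (auto simp: r_def)
  have d: "d > 0"
  proof -
    have "r * r < l * l" using r by (intro mult_strict_mono) auto
    then show ?thesis using r by (simp add: d_def field_simps power2_eq_square)
  qed
  have "y - x = (l\<^sup>2 / r\<^sup>2 - 1) *\<^sub>R (x - Q)"
    unfolding y inversion_def by (simp add: r_def dot_square_norm algebra_simps)
  also have "l\<^sup>2 / r\<^sup>2 - 1 = d / r" using r by (simp add: d_def field_simps power2_eq_square)
  finally have "norm (y - x) = d" using d r by (simp add: r_def[symmetric])
  then have nd: "norm (x - y) = d" by (simp add: norm_minus_commute)
  have J: "inv_jac Q l x = (r + d)\<^sup>2 / r\<^sup>2"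
    using r by (simp add: inv_jac_norm r_def[symmetric] d_def power_divide power_mult[symmetric] field_simps)
  have "r\<^sup>2 * ((1 + d / 4) * (1 + 2 * d)) = r\<^sup>2 + (r * d) * (9/4 * r) + r\<^sup>2 * (d\<^sup>2 / 2)"
    by (simp add: algebra_simps power2_eq_square)
  also have "\<dots> < r\<^sup>2 + (r * d) * 2 + 1 * d\<^sup>2"
  proof -
    have "r\<^sup>2 \<le> 1" using r by (simp add: power_le_one)
    then have "r\<^sup>2 * (d\<^sup>2 / 2) \<le> 1 * d\<^sup>2" using d by (intro mult_mono) auto
    moreover have "(r * d) * (9/4 * r) < (r * d) * 2" using r d by (intro mult_strict_left_mono) auto
    ultimately show ?thesis by linarith
  qed
  finally have "r\<^sup>2 * ((1 + d / 4) * (1 + 2 * d)) < (r + d)\<^sup>2" by (simp add: power2_eq_square algebra_simps)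
  then have "(1 + d / 4) * (1 + 2 * d) < inv_jac Q l x" using r unfolding J by (simp add: field_simps)
  then have "(1 + d / 4) * (1 + 2 * d) * k y < inv_jac Q l x * k y" using k(1) by (intro mult_strict_right_mono)
  then show ?thesis using k(2) unfolding nd by linarith
qed

text \<open>By Cauchy--Schwarz \<open>x \<bullet> p \<le> x \<bullet> x\<close>, so along the ray
  the distance to \<open>p\<close> increases from \<open>x\<close> on. This is how reflection about
  the origin avoids the singularity of the weight at \<open>x0\<close>.\<close>

lemma norm_scaleR_diff_mono:
  fixes x p :: "'a::real_inner"
  assumes "norm p \<le> norm x" "t \<ge> 1"
  shows "norm (x - p) \<le> norm (t *\<^sub>R x - p)"
proof -
  have "x \<bullet> p \<le> norm x * norm p" by (rule norm_cauchy_schwarz)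
  also have "\<dots> \<le> norm x * norm x" using assms by (intro mult_left_mono) auto
  finally have "0 \<le> (t - 1) * (2 * (x \<bullet> x - x \<bullet> p) + (t - 1) * (x \<bullet> x))"
    using assms(2) by (intro mult_nonneg_nonneg add_nonneg_nonneg) (auto simp: dot_square_norm power2_eq_square)
  also have "\<dots> = (norm (t *\<^sub>R x - p))\<^sup>2 - (norm (x - p))\<^sup>2"
    by (simp add: power2_norm_eq_inner inner_diff algebra_simps inner_commute)
  finally show ?thesis by (simp add: power2_le_iff_abs_le)
qed

text \<open>Bernoulli's inequality \<open>(1 + d / p) powr s \<le> 1 + d / p\<close> leaves a growth
  of \<open>d * (p powr s / p)\<close>, and \<open>p \<ge> 1/4\<close> makes the quotient at most
  \<open>2 * (1 + p powr s)\<close>. The number \<open>1/4\<close> is the distance that outer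
  reflected points keep from \<open>x0\<close>.\<close>

lemma powr_add_le:
  fixes p d s :: real
  assumes "p \<ge> 1/4" "d \<ge> 0" "0 < s" "s < 1"
  shows "1 + (p + d) powr s \<le> (1 + 2 * d) * (1 + p powr s)"
proof -
  have "(p + d) powr s = p powr s * (1 + d / p) powr s"
  proof -
    have "p + d = p * (1 + d / p)" using assms by (simp add: field_simps)
    then show ?thesis using assms by (simp only: powr_mult)
  qed
  also have "\<dots> \<le> p powr s * (1 + d / p)"
    using assms powr_mono[of s 1 "1 + d / p"] by (intro mult_left_mono) auto
  finally have 1: "1 + (p + d) powr s \<le> 1 + p powr s + d * (p powr s / p)" using assms by (simp add: field_simps)
  have "p powr s / p \<le> 2 * (1 + p powr s)"
  proof (cases "p \<le> 1")
    case True
    then have "p powr s \<le> 1" using assms powr_mono2[of s p 1] by simp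
    moreover have "p powr s * 1 \<le> p powr s * (4 * p)" using assms by (intro mult_left_mono) auto
    ultimately have q: "p powr s \<le> p * (4 * p powr s)" "4 * p powr s \<le> 2 * (1 + p powr s)" by (simp_all add: mult_ac)
    have "p * (4 * p powr s) \<le> p * (2 * (1 + p powr s))" using q(2) assms by (intro mult_left_mono) auto
    then have "p powr s \<le> p * (2 * (1 + p powr s))" using q(1) by linarith
    then show ?thesis using assms by (simp add: field_simps)
  next
    case False
    then have "p powr s \<le> p" using assms powr_mono[of s 1 p] by simp
    then have "p powr s / p \<le> 1" using False by (simp add: divide_le_eq_1)
    also have "1 \<le> 2 * (1 + p powr s)"
    proof -
      have "1 \<le> 2 * (1 + z)" if "0 \<le> z" for z :: real using that by simp
      from this[OF powr_ge_zero] show ?thesis .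
    qed
    finally show ?thesis .
  qed
  then have "d * (p powr s / p) \<le> d * (2 * (1 + p powr s))" using assms by (intro mult_left_mono)
  with 1 show ?thesis by (simp add: algebra_simps)
qed

text \<open>The solutions enter as continuous representatives of the very weak problem. The constant
  \<open>a / 4\<close> is what the gradient bound on \<open>V\<close> becomes after
  \<open>2 powr (2 * \<beta>) \<ge> 1\<close>.\<close>

locale annulus_system =
  fixes x0 :: "real^2" and \<beta> a b c d :: real and V W u v :: "real^2 \<Rightarrow> real"
  assumes x0: "norm x0 = 1/2" and \<beta>: "0 < \<beta>" "\<beta> < 1/2" and ac: "0 < a" "0 < c"
    and V: "\<And>x. x \<in> annulus \<Longrightarrow> a \<le> V x" "\<And>x. x \<in> annulus \<Longrightarrow> V x \<le> b"
    and W: "\<And>x. x \<in> annulus \<Longrightarrow> c \<le> W x" "\<And>x. x \<in> annulus \<Longrightarrow> W x \<le> d"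
    and V_seg: "\<And>x y. closed_segment x y \<subseteq> annulus \<Longrightarrow> \<bar>V x - V y\<bar> \<le> a / 4 * norm (x - y)"
    and W_seg: "\<And>x y. closed_segment x y \<subseteq> annulus \<Longrightarrow> \<bar>W x - W y\<bar> \<le> c / 2 * norm (x - y)"
    and cont: "continuous_on UNIV u" "continuous_on UNIV v"
    and dir_u: "annulus_dirichlet u (\<lambda>x. indicator annulus x * ((1 + norm (x - x0) powr (2 * \<beta>)) * V x * exp (v x)))"
    and dir_v: "annulus_dirichlet v (\<lambda>x. indicator annulus x * (W x * exp (u x)))"
begin

definition weight :: "real^2 \<Rightarrow> real" where
  "weight x = (1 + norm (x - x0) powr (2 * \<beta>)) * V x"

lemma weight_ge: "x \<in> annulus \<Longrightarrow> a \<le> weight x"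
proof -
  assume x: "x \<in> annulus"
  have "1 * a \<le> (1 + norm (x - x0) powr (2 * \<beta>)) * V x" using V(1)[OF x] ac by (intro mult_mono) auto
  then show ?thesis by (simp add: weight_def)
qed

lemma eq_u: "annulus_dirichlet u (\<lambda>x. indicator annulus x * (weight x * exp (v x)))"
  using dir_u by (simp add: weight_def)

lemma outside: "x \<notin> annulus \<Longrightarrow> u x = 0" "x \<notin> annulus \<Longrightarrow> v x = 0"
  using annulus_dirichletD(3)[OF dir_u] annulus_dirichletD(3)[OF dir_v] by auto

lemma dirichlet_nonneg:
  assumes h: "annulus_dirichlet h (\<lambda>x. indicator annulus x * (k x * exp (w x)))" "continuous_on UNIV h"
    and k: "\<And>x. x \<in> annulus \<Longrightarrow> k x \<ge> 0"
  shows "h x \<ge> 0"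
proof (cases "x \<in> annulus")
  case True
  let ?F = "\<lambda>x. indicator annulus x * (k x * exp (w x))"
  have w: "wlap annulus (\<lambda>x. - h x) (\<lambda>x. - ?F x)"
    using wlap_lin[OF annulus_dirichlet_wlap[OF h(1)] annulus_dirichlet_wlap[OF h(1)], of "-1" 0] by simp
  have "- h x \<le> 0"
  proof (rule max_principle_continuous[OF open_annulus _ w _ _ _ True])
    show "bounded annulus" by (rule bounded_subset[OF bounded_ball annulus_subset_ball])
    show "AE y in lborel. y \<in> annulus \<longrightarrow> - ?F y \<le> 0" using k by (intro AE_I2) simp
    show "continuous_on (closure annulus) (\<lambda>x. - h x)"
      using continuous_on_subset[OF h(2)] by (intro continuous_intros) auto
    fix y :: "real^2" assume "y \<in> frontier annulus"
    then have "y \<notin> annulus" using frontier_annulus[of y] by (auto simp: annulus_def)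
    then show "- h y \<le> 0" using annulus_dirichletD(3)[OF h(1)] by simp
  qed
  then show ?thesis by simp
qed (use annulus_dirichletD(3)[OF h(1)] in simp)

lemma nonneg: "u x \<ge> 0" "v x \<ge> 0"
  by (rule dirichlet_nonneg[OF eq_u cont(1) order_trans[OF less_imp_le[OF ac(1)] weight_ge]], assumption)
    (rule dirichlet_nonneg[OF dir_v cont(2) order_trans[OF less_imp_le[OF ac(2)] W(1)]], assumption)

text \<open>A qualitative bound that depends on the solutions; it feeds only the thresholds of the
  moving spheres.\<close>

lemma rhs_bounded: "\<exists>M>0. \<forall>x\<in>annulus. weight x * exp (v x) \<le> M \<and> W x * exp (u x) \<le> M"
proof -
  obtain Bu where Bu: "\<And>x. 1/2 \<le> norm x \<Longrightarrow> norm x \<le> 1 \<Longrightarrow> \<bar>u x\<bar> \<le> Bu"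
    using continuous_bounded_closed_annulus[OF continuous_on_subset[OF cont(1)]] by blast
  obtain Bv where Bv: "\<And>x. 1/2 \<le> norm x \<Longrightarrow> norm x \<le> 1 \<Longrightarrow> \<bar>v x\<bar> \<le> Bv"
    using continuous_bounded_closed_annulus[OF continuous_on_subset[OF cont(2)]] by blast
  define M1 where "M1 = (1 + 2 powr (2 * \<beta>)) * b * exp Bv"
  define M2 where "M2 = d * exp Bu"
  have "weight x * exp (v x) \<le> M1 \<and> W x * exp (u x) \<le> M2" if x: "x \<in> annulus" for x
  proof
    have x': "1/2 \<le> norm x" "norm x \<le> 1" using x by (auto simp: annulus_def)
    have "norm (x - x0) \<le> 2" using norm_triangle_ineq4[of x x0] x' x0 by simp
    then have "norm (x - x0) powr (2 * \<beta>) \<le> 2 powr (2 * \<beta>)" using \<beta> by (intro powr_mono2) auto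
    then have "weight x \<le> (1 + 2 powr (2 * \<beta>)) * b"
      unfolding weight_def using V[OF x] ac by (intro mult_mono) auto
    moreover have "0 \<le> (1 + 2 powr (2 * \<beta>)) * b" using V[OF x] ac by simp
    ultimately show "weight x * exp (v x) \<le> M1"
      unfolding M1_def using Bv[OF x'] by (intro mult_mono) auto
    show "W x * exp (u x) \<le> M2" unfolding M2_def using Bu[OF x'] W[OF x] ac by (intro mult_mono) auto
  qed
  then show ?thesis by (intro exI[of _ "max 1 (max M1 M2)"]) (auto simp: le_max_iff_disj)
qed

lemma weight_le:
  assumes seg: "closed_segment x y \<subseteq> annulus"
    and w: "1 + norm (x - x0) powr (2 * \<beta>) \<le> (1 + 2 * norm (x - y)) * (1 + norm (y - x0) powr (2 * \<beta>))"
  shows "weight x \<le> (1 + norm (x - y) / 4) * (1 + 2 * norm (x - y)) * weight y"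
proof -
  have xy: "x \<in> annulus" "y \<in> annulus" using seg by auto
  have "V x \<le> V y + a / 4 * norm (x - y)" using V_seg[OF seg] by linarith
  also have "\<dots> \<le> V y + V y / 4 * norm (x - y)" using V(1)[OF xy(2)] by (intro add_left_mono mult_right_mono) auto
  finally have "V x \<le> (1 + norm (x - y) / 4) * V y" by (simp add: algebra_simps)
  then have "weight x \<le> ((1 + 2 * norm (x - y)) * (1 + norm (y - x0) powr (2 * \<beta>))) * ((1 + norm (x - y) / 4) * V y)"
    unfolding weight_def using V(1)[OF xy(1)] ac w by (intro mult_mono) auto
  then show ?thesis by (simp add: weight_def mult_ac)
qed

text \<open>Without a weight to pay for, the factor \<open>1 + n / 2\<close> coming from
  \<open>c / 2\<close>, where \<open>n = norm (x - y)\<close>, fits into the same form as the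
  estimate for \<open>weight\<close>.\<close>

lemma W_le:
  assumes seg: "closed_segment x y \<subseteq> annulus"
  shows "W x \<le> (1 + norm (x - y) / 4) * (1 + 2 * norm (x - y)) * W y"
proof -
  have xy: "x \<in> annulus" "y \<in> annulus" using seg by auto
  have "W x \<le> W y + c / 2 * norm (x - y)" using W_seg[OF seg] by linarith
  also have "\<dots> \<le> W y + W y / 2 * norm (x - y)" using W(1)[OF xy(2)] by (intro add_left_mono mult_right_mono) auto
  also have "\<dots> = (1 + norm (x - y) / 2) * W y" by (simp add: algebra_simps)
  also have "\<dots> \<le> (1 + norm (x - y) / 4) * (1 + 2 * norm (x - y)) * W y"
  proof (rule mult_right_mono)
    have "1 + n / 2 \<le> (1 + n / 4) * (1 + 2 * n)" if "n \<ge> 0" for n :: real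
    proof -
      have "(1 + n / 4) * (1 + 2 * n) = 1 + n / 2 + (7/4 * n + n * n / 2)" by (simp add: field_simps)
      moreover have "0 \<le> 7/4 * n + n * n / 2" using that by simp
      ultimately show ?thesis by linarith
    qed
    then show "1 + norm (x - y) / 2 \<le> (1 + norm (x - y) / 4) * (1 + 2 * norm (x - y))" by simp
    show "0 \<le> W y" using W(1)[OF xy(2)] ac by simp
  qed
  finally show ?thesis .
qed

lemma spheres:
  assumes radii: "0 < l0" "l0 < l1" "l1 \<le> 3/4" and Q: "Q \<notin> closure annulus" "annulus \<inter> ball Q l0 = {}"
    and seg: "\<And>l x. l0 < l \<Longrightarrow> l \<le> l1 \<Longrightarrow> x \<in> annulus \<Longrightarrow> norm (x - Q) < l \<Longrightarrow>
      closed_segment x (inversion Q l x) \<subseteq> annulus"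
    and wt: "\<And>l x. l0 < l \<Longrightarrow> l \<le> l1 \<Longrightarrow> x \<in> annulus \<Longrightarrow> norm (x - Q) < l \<Longrightarrow>
      1 + norm (x - x0) powr (2 * \<beta>) \<le> (1 + 2 * norm (x - inversion Q l x)) * (1 + norm (inversion Q l x - x0) powr (2 * \<beta>))"
    and l: "l0 < l" "l \<le> l1" and x: "x \<in> annulus" "norm (x - Q) < l"
  shows "u x \<le> u (inversion Q l x) \<and> v x \<le> v (inversion Q l x)"
proof -
  obtain M where M: "M > 0" "\<And>x. x \<in> annulus \<Longrightarrow> weight x * exp (v x) \<le> M" "\<And>x. x \<in> annulus \<Longrightarrow> W x * exp (u x) \<le> M"
    using rhs_bounded by blast
  have xQ: "x \<noteq> Q" if "x \<in> annulus" for x using Q(1) closure_subset[of annulus] that by auto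
  interpret moving_spheres u v weight W M Q l0 l1
  proof
    fix l x assume lx: "l0 < l" "l \<le> l1" "x \<in> annulus" "norm (x - Q) < l"
    have y: "inversion Q l x \<in> annulus" using seg[OF lx] by auto
    have r: "norm (x - Q) \<le> 3/4" using lx radii by simp
    show "inversion Q l x \<in> annulus" by (rule y)
    show "weight x < inv_jac Q l x * weight (inversion Q l x)"
      using weight_ge[OF y] ac by (intro less_inv_jac_mult[OF xQ[OF lx(3)] r lx(4) refl _ weight_le[OF seg[OF lx] wt[OF lx]]]) auto
    show "W x < inv_jac Q l x * W (inversion Q l x)"
      using W(1)[OF y] ac by (intro less_inv_jac_mult[OF xQ[OF lx(3)] r lx(4) refl _ W_le[OF seg[OF lx]]]) auto
  next
    fix x assume x: "x \<in> annulus"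
    show "0 < weight x" using weight_ge[OF x] ac by simp
    show "0 < W x" using W(1)[OF x] ac by simp
  qed (use cont nonneg outside M radii Q annulus_dirichlet_wlap[OF eq_u] annulus_dirichlet_wlap[OF dir_v] in auto)
  show ?thesis using reflection_le[OF l x] by simp
qed

text \<open>The radius \<open>l\<close> is the geometric mean of \<open>norm x\<close> and
  \<open>6/5 * norm x\<close>, so inversion about the origin maps \<open>x\<close> to
  \<open>(6/5) x\<close>; it stays below \<open>7/10\<close> as \<open>norm x \<le> 13/25\<close>.
  Radii \<open>m\<close> up to \<open>7/10\<close> are admissible because the image of
  \<open>y\<close> has norm \<open>m^2 / norm y\<close>, at most \<open>0.49\<close> divided by more
  than \<open>0.5\<close>.\<close>

lemma inner_comparison:
  assumes x: "1/2 < norm x" "norm x \<le> 13/25"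
  shows "u x \<le> u ((6/5) *\<^sub>R x) \<and> v x \<le> v ((6/5) *\<^sub>R x)"
proof -
  define l where "l = sqrt (6/5) * norm x"
  have l2: "l\<^sup>2 = 6/5 * (norm x)\<^sup>2" by (simp add: l_def power_mult_distrib)
  have x0': "x \<noteq> 0" using x by auto
  have "(norm x)\<^sup>2 < l\<^sup>2" using x0' unfolding l2 by simp
  then have xl: "norm x < l" by (rule power2_less_imp_less) (simp add: l_def)
  have xA: "x \<in> annulus" using x by (simp add: annulus_def)
  have "(norm x)\<^sup>2 \<le> (13/25)\<^sup>2" using x by (intro power_mono) auto
  then have "l\<^sup>2 \<le> (7/10)\<^sup>2" unfolding l2 by (simp add: power2_eq_square)
  then have l7: "l \<le> 7/10" by (rule power2_le_imp_le) simp
  have inv: "inversion 0 l x = (6/5) *\<^sub>R x"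
    using x0' by (simp add: inversion_def l2 dot_square_norm)
  have cl: "0 \<notin> closure annulus" using closure_annulus by auto
  have disj: "annulus \<inter> ball 0 (1/2) = {}" by (auto simp: annulus_def)
  have main: "closed_segment y (inversion 0 m y) \<subseteq> annulus \<and> norm (y - x0) \<le> norm (inversion 0 m y - x0)"
    if m: "1/2 < m" "m \<le> 7/10" and y: "y \<in> annulus" "norm y < m" for m y
  proof
    have ny: "1/2 < norm y" "norm y < 1" using y by (auto simp: annulus_def)
    define t where "t = m\<^sup>2 / (norm y)\<^sup>2"
    have I: "inversion 0 m y = t *\<^sub>R y" by (simp add: inversion_def t_def dot_square_norm)
    have "(norm y)\<^sup>2 \<le> m\<^sup>2" using y by (intro power_mono) auto
    then have t1: "t \<ge> 1" using ny unfolding t_def by (subst le_divide_eq_1_pos) auto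
    show "norm (y - x0) \<le> norm (inversion 0 m y - x0)"
      unfolding I using ny x0 by (intro norm_scaleR_diff_mono[OF _ t1]) simp
    have "m\<^sup>2 \<le> (7/10)\<^sup>2" using m by (intro power_mono) auto
    then have "m\<^sup>2 < norm y" using ny by (simp add: power2_eq_square)
    then have "m\<^sup>2 / norm y < 1" using ny by (subst divide_less_eq_1_pos) auto
    moreover have "t * norm y = m\<^sup>2 / norm y" using ny by (auto simp: t_def power2_eq_square)
    ultimately have tn: "t * norm y < 1" by simp
    show "closed_segment y (inversion 0 m y) \<subseteq> annulus"
    proof
      fix z assume "z \<in> closed_segment y (inversion 0 m y)"
      then obtain s where s: "0 \<le> s" "s \<le> 1" "z = (1 - s) *\<^sub>R y + s *\<^sub>R (t *\<^sub>R y)"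
        unfolding I by (auto simp: closed_segment_def)
      define q where "q = 1 + s * (t - 1)"
      have z: "z = q *\<^sub>R y" unfolding s(3) q_def by (simp add: algebra_simps)
      have "s * (t - 1) \<le> 1 * (t - 1)" using s t1 by (intro mult_right_mono) auto
      then have q: "1 \<le> q" "q \<le> t" using s t1 by (auto simp: q_def)
      have "1 * norm y \<le> q * norm y" "q * norm y \<le> t * norm y" using q by (intro mult_right_mono; simp)+
      then show "z \<in> annulus" using ny tn q unfolding z by (simp add: annulus_def)
    qed
  qed
  have "u x \<le> u (inversion 0 l x) \<and> v x \<le> v (inversion 0 l x)"
  proof (rule spheres[of "1/2" "7/10" 0])
    fix m y assume m: "1/2 < m" "m \<le> 7/10" and y: "y \<in> annulus" "norm (y - 0) < m"
    note mn = main[OF m y(1), simplified, OF y(2)[simplified]]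
    show "closed_segment y (inversion 0 m y) \<subseteq> annulus" using mn by blast
    have "1 + norm (y - x0) powr (2 * \<beta>) \<le> 1 * (1 + norm (inversion 0 m y - x0) powr (2 * \<beta>))"
      using mn \<beta> by (simp add: powr_mono2)
    also have "\<dots> \<le> (1 + 2 * norm (y - inversion 0 m y)) * (1 + norm (inversion 0 m y - x0) powr (2 * \<beta>))"
      by (intro mult_right_mono) auto
    finally show "1 + norm (y - x0) powr (2 * \<beta>) \<le>
      (1 + 2 * norm (y - inversion 0 m y)) * (1 + norm (inversion 0 m y - x0) powr (2 * \<beta>))" .
  qed (use xA xl x l7 cl disj in simp_all)
  then show ?thesis unfolding inv .
qed

text \<open>The centre lies on the ray through \<open>x\<close> at distance \<open>5/4\<close> from
  the origin, and \<open>l\<close> is the geometric mean of its distances to \<open>x\<close> and to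
  \<open>(9/10) x\<close>. Circles of radius up to \<open>35/100\<close> about it keep the images
  within \<open>1/2\<close> of the centre, hence at norm above \<open>3/4\<close> and at least
  \<open>1/4\<close> away from \<open>x0\<close>, so \<open>powr_add_le\<close> controls the
  weight.\<close>

lemma outer_comparison:
  assumes x: "19/20 \<le> norm x" "norm x < 1"
  shows "u x \<le> u ((9/10) *\<^sub>R x) \<and> v x \<le> v ((9/10) *\<^sub>R x)"
proof -
  define r where "r = norm x"
  have r: "19/20 \<le> r" "r < 1" using x by (auto simp: r_def)
  define e where "e = x /\<^sub>R r"
  have "r \<noteq> 0" using r by simp
  then have e: "norm e = 1" "x = r *\<^sub>R e" by (simp_all add: e_def r_def)
  define Q where "Q = (5/4) *\<^sub>R e"
  define l where "l = sqrt ((5/4 - r) * (5/4 - 9/10 * r))"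
  have l2: "l\<^sup>2 = (5/4 - r) * (5/4 - 9/10 * r)" using r by (simp add: l_def)
  have xQ: "x - Q = - ((5/4 - r) *\<^sub>R e)" by (simp add: Q_def e(2) algebra_simps)
  have nxQ: "norm (x - Q) = 5/4 - r" using r by (simp add: xQ e(1))
  have "(5/4 - r)\<^sup>2 < l\<^sup>2" unfolding l2 power2_eq_square[of "5/4 - r"] using r by (intro mult_strict_left_mono) auto
  then have xl: "norm (x - Q) < l" unfolding nxQ by (rule power2_less_imp_less) (use r in \<open>simp add: l_def\<close>)
  have "(1/4) * (35/100) \<le> l\<^sup>2" unfolding l2 using r by (intro mult_mono) auto
  then have "(1/4)\<^sup>2 < l\<^sup>2" by (simp add: power2_eq_square)
  then have l4: "1/4 < l" by (rule power2_less_imp_less) (use r in \<open>simp add: l_def\<close>)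
  have xA: "x \<in> annulus" using x by (simp add: annulus_def)
  have "l\<^sup>2 \<le> (3/10) * (395/1000)" unfolding l2 using r by (intro mult_mono) auto
  then have "l\<^sup>2 \<le> (35/100)\<^sup>2" by (simp add: power2_eq_square)
  then have l35: "l \<le> 35/100" by (rule power2_le_imp_le) simp
  have inv: "inversion Q l x = (9/10) *\<^sub>R x"
  proof -
    have "l\<^sup>2 / ((x - Q) \<bullet> (x - Q)) = (5/4 - 9/10 * r) / (5/4 - r)"
      using r unfolding dot_square_norm nxQ l2 by (simp add: power2_eq_square)
    then have "inversion Q l x = Q - (5/4 - 9/10 * r) *\<^sub>R e"
      unfolding inversion_def xQ using r by simp
    then show ?thesis by (simp add: Q_def e(2) algebra_simps)
  qed
  have nQ: "norm Q = 5/4" by (simp add: Q_def e(1))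
  have cl: "Q \<notin> closure annulus" using closure_annulus nQ by auto
  have far: "norm y < 1 \<Longrightarrow> norm (y - Q) > 1/4" for y
    using norm_triangle_ineq4[of y "y - Q"] nQ by simp
  then have disj: "annulus \<inter> ball Q (1/4) = {}" by (force simp: annulus_def dist_norm norm_minus_commute)
  have near: "norm (y - Q) < 1/2 \<Longrightarrow> norm y > 3/4" for y
    using norm_triangle_ineq4[of y "y - Q"] nQ by simp
  have main: "closed_segment y (inversion Q m y) \<subseteq> annulus \<and> norm (inversion Q m y) > 3/4"
    if m: "1/4 < m" "m \<le> 35/100" and y: "y \<in> annulus" "norm (y - Q) < m" for m y
  proof -
    define z where "z = y - Q"
    define t where "t = m\<^sup>2 / (norm z)\<^sup>2"
    have I: "inversion Q m y = Q + t *\<^sub>R z" by (simp add: inversion_def t_def z_def dot_square_norm)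
    have yz: "y = Q + z" by (simp add: z_def)
    have y1: "norm y < 1" using y by (simp add: annulus_def)
    have z: "1/4 < norm z" "norm z < m" using far[OF y1] y by (auto simp: z_def)
    have "(norm z)\<^sup>2 \<le> m\<^sup>2" using z by (intro power_mono) auto
    then have t1: "t \<ge> 1" using z unfolding t_def by (subst le_divide_eq_1_pos) auto
    have m2: "m\<^sup>2 \<le> 1225/10000" using power_mono[of m "35/100" 2] m by (simp add: power2_eq_square)
    have nI: "norm (inversion Q m y - Q) < 1/2"
    proof -
      have "norm (inversion Q m y - Q) = m\<^sup>2 / norm z"
      proof -
        have "y \<noteq> Q" using far[OF y1] by auto
        then show ?thesis unfolding z_def by (rule norm_inversion)
      qed
      also have "\<dots> < 1/2"
      proof (subst pos_divide_less_eq)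
        show "0 < norm z" "m\<^sup>2 < 1/2 * norm z" using m2 z by linarith+
      qed
      finally show ?thesis .
    qed
    have tz: "t * (z \<bullet> z) = m\<^sup>2" using z by (auto simp: t_def dot_square_norm)
    have QQ: "Q \<bullet> Q = 25/16" unfolding dot_square_norm nQ by (simp add: power2_eq_square)
    \<comment> \<open>The power of \<open>Q\<close> with respect to the unit circle is
      \<open>25/16 - 1 = 9/16\<close>, which exceeds \<open>m^2\<close>. Therefore the image of a
      point of the unit disc inside the small circle is again in the unit disc: its squared norm is
      below \<open>1 + (t - 1) * (m^2 - 9/16)\<close>.\<close>
    have "y \<bullet> y < 1" using y1 by (simp add: dot_square_norm abs_square_less_1)
    then have "2 * (Q \<bullet> z) < - 9/16 - z \<bullet> z" unfolding yz using QQ by (simp add: inner_add inner_commute)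
    then have "t * (2 * (Q \<bullet> z)) < t * (- 9/16 - z \<bullet> z)" using t1 by (intro mult_strict_left_mono) auto
    then have "(Q + t *\<^sub>R z) \<bullet> (Q + t *\<^sub>R z) < 25/16 + t * (- 9/16) - t * (z \<bullet> z) + t * (t * (z \<bullet> z))"
      using QQ by (simp add: inner_add inner_commute algebra_simps)
    also have "\<dots> = 1 + (t - 1) * (m\<^sup>2 - 9/16)" unfolding tz by (simp add: field_simps)
    also have "\<dots> \<le> 1" using t1 m2 by (simp add: mult_nonneg_nonpos)
    finally have "(norm (inversion Q m y))\<^sup>2 < 1\<^sup>2" unfolding I by (simp add: dot_square_norm)
    then have n1: "norm (inversion Q m y) < 1" by (rule power2_less_imp_less) simp
    have "closed_segment y (inversion Q m y) \<subseteq> ball 0 1 \<inter> ball Q (1/2)"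
      using y1 n1 nI z m
      by (intro closed_segment_subset convex_Int convex_ball) (auto simp: dist_norm norm_minus_commute z_def)
    then have "closed_segment y (inversion Q m y) \<subseteq> annulus"
      using near by (force simp: annulus_def dist_norm norm_minus_commute)
    then show ?thesis using near[OF nI] by simp
  qed
  have "u x \<le> u (inversion Q l x) \<and> v x \<le> v (inversion Q l x)"
  proof (rule spheres[of "1/4" "35/100" Q])
    fix m y assume m: "1/4 < m" "m \<le> 35/100" and y: "y \<in> annulus" "norm (y - Q) < m"
    note mn = main[OF m y]
    show "closed_segment y (inversion Q m y) \<subseteq> annulus" using mn by blast
    let ?I = "inversion Q m y"
    have p: "norm (?I - x0) \<ge> 1/4" using norm_triangle_ineq2[of ?I x0] x0 mn by linarith
    have "norm (y - x0) \<le> norm (?I - x0) + norm (y - ?I)" using norm_triangle_ineq[of "?I - x0" "y - ?I"] by simp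
    then have "1 + norm (y - x0) powr (2 * \<beta>) \<le> 1 + (norm (?I - x0) + norm (y - ?I)) powr (2 * \<beta>)"
      using \<beta> by (simp add: powr_mono2)
    also have "\<dots> \<le> (1 + 2 * norm (y - ?I)) * (1 + norm (?I - x0) powr (2 * \<beta>))"
      using \<beta> by (intro powr_add_le p) auto
    finally show "1 + norm (y - x0) powr (2 * \<beta>) \<le>
      (1 + 2 * norm (y - ?I)) * (1 + norm (?I - x0) powr (2 * \<beta>))" .
  qed (use xA xl l4 l35 cl disj in simp_all)
  then show ?thesis unfolding inv .
qed

end

subsection \<open>The interior estimate\<close>

text \<open>The quadratic term makes \<open>-\<Delta>\<close> of the barrier nonpositive on the boundary, where \<open>-\<Delta>\<close> of the
  defining function need not be; this is what allows a bound by a multiple of the barrier itself.\<close>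

definition barrier :: "real^2 \<Rightarrow> real" where
  "barrier x = defining_fun x + 4 * (defining_fun x)\<^sup>2"

lemma smooth_on_barrier: "smooth_on UNIV barrier"
proof -
  have "smooth_on UNIV (\<lambda>x. defining_fun x + 4 * (defining_fun x)\<^sup>2)"
    by (intro smooth_intros smooth_on_defining_fun)
  then show ?thesis by (simp add: barrier_def[abs_def])
qed

lemma barrier_ge: "defining_fun x \<le> barrier x"
  by (simp add: barrier_def)

text \<open>In the variable \<open>s = x \<bullet> x\<close>, with \<open>q\<close> the defining
  function, the squared derivative of \<open>q\<close> is \<open>9/16 - 4 * q\<close>, and the
  Laplacian of the barrier becomes \<open>5 + 2 * s + 40 * q - 256 * (s * q)\<close>, whose last
  term alone is negative. The Laplacian of \<open>q\<close> itself is \<open>5 - 16 * s\<close>; the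
  coefficient 4 of the square adds \<open>18 * s\<close> on the boundary and so reverses the sign of
  the \<open>s\<close> term.\<close>

lemma laplacian_barrier_ge:
  assumes x: "x \<in> annulus"
  shows "- laplacian barrier x \<le> 256 * barrier x"
proof -
  define s where "s = x \<bullet> x"
  define q where "q = defining_fun x"
  have q: "q = (1 - s) * (s - 1/4)" "q > 0"
    using x by (simp_all add: q_def s_def defining_fun_def[symmetric] defining_fun_pos_iff)
  have s: "0 \<le> s" "s \<le> 1"
    using x by (auto simp: s_def annulus_def dot_square_norm power_le_one)
  let ?k = "\<lambda>s. (1 - s) * (s - 1/4) + 4 * ((1 - s) * (s - 1/4))\<^sup>2 :: real"
  let ?k' = "\<lambda>s. (5/4 - 2 * s) * (1 + 8 * ((1 - s) * (s - 1/4))) :: real"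
  have "laplacian (\<lambda>y. ?k (y \<bullet> y)) x = 4 * (?k' (x \<bullet> x) + (x \<bullet> x) * (8 * (5/4 - 2 * s)\<^sup>2 - 2 * (1 + 8 * ((1 - s) * (s - 1/4)))))"
    by (rule laplacian_radial[OF open_UNIV UNIV_I])
       (auto simp: s_def power2_eq_square field_simps intro!: derivative_eq_intros)
  also have "(\<lambda>y::real^2. ?k (y \<bullet> y)) = barrier" by (simp add: barrier_def[abs_def] defining_fun_def)
  finally have "laplacian barrier x = 4 * ((5/4 - 2 * s) * (1 + 8 * q) + s * (8 * (5/4 - 2 * s)\<^sup>2 - 2 * (1 + 8 * q)))"
    by (simp add: q(1) s_def)
  also have "(5/4 - 2 * s)\<^sup>2 = 9/16 - 4 * q" unfolding q(1) by (simp add: power2_eq_square field_simps)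
  also have "4 * ((5/4 - 2 * s) * (1 + 8 * q) + s * (8 * (9/16 - 4 * q) - 2 * (1 + 8 * q))) = 5 + 2 * s + 40 * q - 256 * (s * q)"
    by (simp add: field_simps)
  finally have "- laplacian barrier x \<le> 256 * (s * q)" using s q by simp
  also have "\<dots> \<le> 256 * (1 * barrier x)"
    using s q(2) barrier_ge[of x] by (intro mult_left_mono mult_mono) (auto simp: q_def)
  finally show ?thesis by simp
qed

lemma barrier_nonneg: "x \<in> annulus \<Longrightarrow> barrier x \<ge> 0"
  using defining_fun_pos_iff[of x] barrier_ge[of x] by linarith

lemma integrable_annulus_continuous:
  fixes q :: "real^2 \<Rightarrow> real"
  assumes q: "continuous_on UNIV q"
  shows "integrable lborel (\<lambda>x. indicator annulus x * q x)"
proof -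
  have "integrable lborel (indicator annulus :: real^2 \<Rightarrow> real)"
    by (intro integrable_real_indicator emeasure_bounded_finite bounded_subset[OF bounded_ball annulus_subset_ball]) simp
  then show ?thesis by (rule integrable_annulus_mult) (auto intro: continuous_on_subset[OF q])
qed

text \<open>The tangent of the exponential at \<open>ln K\<close>; a large \<open>K\<close> makes
  the exponential term absorbable.\<close>

lemma le_exp_div_add_ln: "K > 0 \<Longrightarrow> t \<le> exp t / K + ln (K::real)"
  using exp_ge_add_one_self[of "t - ln K"] by (simp add: exp_diff)

text \<open>The barrier vanishes on both circles, so it may be used as a test function in the
  equation for \<open>h\<close>. Its Laplacian bound leaves \<open>256 * h * barrier\<close>, and
  the linear \<open>h\<close> is traded for a small multiple of \<open>exp h\<close>. Thus the mass
  of the other exponential is estimated by that of this one.\<close>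

lemma dirichlet_barrier_bound:
  assumes h: "annulus_dirichlet h (\<lambda>x. indicator annulus x * (k x * exp (w x)))"
    and hc: "continuous_on UNIV h" "\<And>x. h x \<ge> 0" and wc: "continuous_on UNIV w"
    and k: "\<And>x. x \<in> annulus \<Longrightarrow> m \<le> k x" and K: "K > 0"
  shows "m * (\<integral>x. indicator annulus x * (exp (w x) * barrier x) \<partial>lborel) \<le>
    256 / K * (\<integral>x. indicator annulus x * (exp (h x) * barrier x) \<partial>lborel) +
    256 * ln K * (\<integral>x. indicator annulus x * barrier x \<partial>lborel)"
proof -
  note bc = smooth_on_continuous[OF smooth_on_barrier]
  have lc: "continuous_on UNIV (laplacian barrier)"
    by (rule smooth_on_continuous[OF smooth_on_laplacian[OF open_UNIV smooth_on_barrier]])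
  have ie: "integrable lborel (\<lambda>x. indicator annulus x * (exp (f x) * barrier x))" if "continuous_on UNIV f" for f
    by (intro integrable_annulus_continuous continuous_intros that bc)
  have ih: "integrable lborel (\<lambda>x. indicator annulus x * (h x * barrier x))"
    by (intro integrable_annulus_continuous continuous_intros hc bc)
  have ib: "integrable lborel (\<lambda>x. indicator annulus x * barrier x)"
    by (intro integrable_annulus_continuous bc)
  have b0: "barrier x = 0" if "norm x = 1/2 \<or> norm x = 1" for x
  proof -
    have "(1 - norm x) * (norm x - 1/2) = 0" using that by auto
    then show ?thesis by (simp only: barrier_def defining_fun_norm) simp
  qed
  have eq: "- (\<integral>x. h x * laplacian barrier x \<partial>lborel) = (\<integral>x. indicator annulus x * (k x * exp (w x)) * barrier x \<partial>lborel)"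
    by (rule annulus_dirichletD(5)[OF h smooth_on_subset[OF smooth_on_barrier] b0]) auto
  have "m * (\<integral>x. indicator annulus x * (exp (w x) * barrier x) \<partial>lborel) =
      (\<integral>x. m * (indicator annulus x * (exp (w x) * barrier x)) \<partial>lborel)" by simp
  also have "\<dots> \<le> (\<integral>x. indicator annulus x * (k x * exp (w x)) * barrier x \<partial>lborel)"
  proof (rule integral_mono)
    show "integrable lborel (\<lambda>x. indicator annulus x * (k x * exp (w x)) * barrier x)"
      by (rule integrable_annulus_mult[OF annulus_dirichletD(2)[OF h]]) (auto intro: continuous_on_subset[OF bc])
    show "m * (indicator annulus x * (exp (w x) * barrier x)) \<le> indicator annulus x * (k x * exp (w x)) * barrier x" for x
    proof (cases "x \<in> annulus")
      case True
      have "m * (exp (w x) * barrier x) \<le> k x * (exp (w x) * barrier x)"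
        using k[OF True] barrier_nonneg[OF True] by (intro mult_right_mono) auto
      then show ?thesis using True by (simp add: mult.assoc)
    qed simp
  qed (use ie[OF wc] in simp)
  also have "\<dots> = (\<integral>x. h x * (- laplacian barrier x) \<partial>lborel)" unfolding eq[symmetric] by simp
  also have "\<dots> \<le> (\<integral>x. 256 * (indicator annulus x * (h x * barrier x)) \<partial>lborel)"
  proof (rule integral_mono)
    show "integrable lborel (\<lambda>x. h x * (- laplacian barrier x))"
      by (rule integrable_annulus_mult[OF annulus_dirichletD(1,3)[OF h]])
         (auto intro!: continuous_intros intro: continuous_on_subset[OF lc])
    show "h x * (- laplacian barrier x) \<le> 256 * (indicator annulus x * (h x * barrier x))" for x
    proof (cases "x \<in> annulus")
      case True
      have "h x * (- laplacian barrier x) \<le> h x * (256 * barrier x)"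
        using laplacian_barrier_ge[OF True] hc(2)[of x] by (intro mult_left_mono) auto
      then show ?thesis using True by (simp add: mult_ac)
    qed (use annulus_dirichletD(3)[OF h] in simp)
  qed (use ih in simp)
  also have "\<dots> \<le> (\<integral>x. 256 / K * (indicator annulus x * (exp (h x) * barrier x)) + 256 * ln K * (indicator annulus x * barrier x) \<partial>lborel)"
  proof (rule integral_mono)
    show "256 * (indicator annulus x * (h x * barrier x)) \<le>
      256 / K * (indicator annulus x * (exp (h x) * barrier x)) + 256 * ln K * (indicator annulus x * barrier x)" for x
    proof (cases "x \<in> annulus")
      case True
      have "h x * barrier x \<le> (exp (h x) / K + ln K) * barrier x"
        by (rule mult_right_mono[OF le_exp_div_add_ln[OF K] barrier_nonneg[OF True]])
      then have "256 * (h x * barrier x) \<le> 256 * ((exp (h x) / K + ln K) * barrier x)" by simp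
      also have "\<dots> = 256 / K * (exp (h x) * barrier x) + 256 * ln K * barrier x" by (simp add: algebra_simps)
      finally show ?thesis using True by simp
    qed simp
  qed (use ih ie[OF hc(1)] ib in simp_all)
  also have "\<dots> = 256 / K * (\<integral>x. indicator annulus x * (exp (h x) * barrier x) \<partial>lborel) +
    256 * ln K * (\<integral>x. indicator annulus x * barrier x \<partial>lborel)"
    using ie[OF hc(1)] ib by simp
  finally show ?thesis .
qed

text \<open>The dilations by \<open>6/5\<close> and \<open>9/10\<close> carry the two boundary
  layers into the region between norms \<open>13/25\<close> and \<open>19/20\<close>, where the
  barrier is at least \<open>1/1000\<close>. The substitutions produce the factors
  \<open>25/36\<close> and \<open>100/81\<close>, and \<open>1 + 25/36 + 100/81 \<le> 3\<close>,
  hence 3000.\<close>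

lemma annulus_exp_bound:
  assumes h: "continuous_on UNIV h"
    and inner: "\<And>x. 1/2 < norm x \<Longrightarrow> norm x \<le> 13/25 \<Longrightarrow> h x \<le> h ((6/5) *\<^sub>R x)"
    and outer: "\<And>x. 19/20 \<le> norm x \<Longrightarrow> norm x < 1 \<Longrightarrow> h x \<le> h ((9/10) *\<^sub>R x)"
  shows "(\<integral>x. indicator annulus x * exp (h x) \<partial>lborel) \<le>
    3000 * (\<integral>x. indicator annulus x * (exp (h x) * barrier x) \<partial>lborel)"
proof -
  define g where "g x = 1000 * (indicator annulus x * (exp (h x) * barrier x))" for x :: "real^2"
  have ig: "integrable lborel g" unfolding g_def
    by (intro integrable_mult_right integrable_annulus_continuous continuous_intros h smooth_on_continuous[OF smooth_on_barrier])
  have g0: "g x \<ge> 0" for x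
    by (cases "x \<in> annulus") (auto simp: g_def barrier_nonneg)
  have mid: "exp (h x) \<le> g x" if x: "13/25 \<le> norm x" "norm x \<le> 19/20" for x
  proof -
    have "(13/25)\<^sup>2 \<le> (norm x)\<^sup>2" "(norm x)\<^sup>2 \<le> (19/20)\<^sup>2" using x by (intro power_mono; simp)+
    \<comment> \<open>The two factors are \<open>1 - (19/20)^2\<close> and
      \<open>(13/25)^2 - 1/4\<close>.\<close>
    then have "(975/10000) * (204/10000) \<le> defining_fun x"
      unfolding defining_fun_def dot_square_norm by (intro mult_mono) (auto simp: power2_eq_square)
    then have "1 \<le> 1000 * barrier x" using barrier_ge[of x] by simp
    then have "exp (h x) * 1 \<le> exp (h x) * (1000 * barrier x)" by (intro mult_left_mono) auto
    moreover have "x \<in> annulus" using x by (auto simp: annulus_def)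
    ultimately show ?thesis by (simp add: g_def mult_ac)
  qed
  have le: "indicator annulus x * exp (h x) \<le> g x + g (0 + (6/5) *\<^sub>R x) + g (0 + (9/10) *\<^sub>R x)" for x
  proof (cases "x \<in> annulus")
    case True
    then have x: "1/2 < norm x" "norm x < 1" by (auto simp: annulus_def)
    consider "norm x \<le> 13/25" | "13/25 \<le> norm x" "norm x \<le> 19/20" | "19/20 \<le> norm x" by linarith
    then have "exp (h x) \<le> g x \<or> exp (h x) \<le> g ((6/5) *\<^sub>R x) \<or> exp (h x) \<le> g ((9/10) *\<^sub>R x)"
    proof cases
      case 1
      have "exp (h x) \<le> exp (h ((6/5) *\<^sub>R x))" using inner[OF x(1) 1] by simp
      also have "\<dots> \<le> g ((6/5) *\<^sub>R x)" using x 1 by (intro mid) auto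
      finally show ?thesis by simp
    next
      case 3
      have "exp (h x) \<le> exp (h ((9/10) *\<^sub>R x))" using outer[OF 3 x(2)] by simp
      also have "\<dots> \<le> g ((9/10) *\<^sub>R x)" using x 3 by (intro mid) auto
      finally show ?thesis by simp
    qed (use mid in blast)
    then show ?thesis using True g0[of x] g0[of "(6/5) *\<^sub>R x"] g0[of "(9/10) *\<^sub>R x"] by auto
  qed (use g0[of x] g0[of "(6/5) *\<^sub>R x"] g0[of "(9/10) *\<^sub>R x"] in simp)
  let ?G = "\<integral>x. g x \<partial>lborel"
  have G: "?G \<ge> 0" by (intro integral_nonneg_AE AE_I2 g0)
  note i1 = integrable_lborel_affine[OF ig, of "6/5" 0, simplified] integrable_lborel_affine[OF ig, of "9/10" 0, simplified]
  have "(\<integral>x. indicator annulus x * exp (h x) \<partial>lborel) \<le> (\<integral>x. g x + g (0 + (6/5) *\<^sub>R x) + g (0 + (9/10) *\<^sub>R x) \<partial>lborel)"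
    by (rule integral_mono[OF _ _ le]) (use ig i1 in \<open>auto intro!: integrable_annulus_continuous continuous_intros h\<close>)
  also have "\<dots> = ?G + (\<integral>x. g (0 + (6/5) *\<^sub>R x) \<partial>lborel) + (\<integral>x. g (0 + (9/10) *\<^sub>R x) \<partial>lborel)"
    using ig i1 by simp
  also have "(\<integral>x. g (0 + (6/5) *\<^sub>R x) \<partial>lborel) = 25/36 * ?G"
    using integral_lborel_affine[OF ig, of "6/5" 0] by (simp add: power2_eq_square)
  also have "(\<integral>x. g (0 + (9/10) *\<^sub>R x) \<partial>lborel) = 100/81 * ?G"
    using integral_lborel_affine[OF ig, of "9/10" 0] by (simp add: power2_eq_square)
  also have "?G + 25/36 * ?G + 100/81 * ?G \<le> 3 * ?G" using G by linarith
  also have "?G = 1000 * (\<integral>x. indicator annulus x * (exp (h x) * barrier x) \<partial>lborel)" by (simp add: g_def)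
  finally show ?thesis by simp
qed

text \<open>With \<open>K = 512 / m\<close>, absorption leaves the sum of the two weighted masses
  below \<open>1024 * ln K / m\<close> times the integral of the barrier; 3000 is the price of
  removing the weight.\<close>

definition exp_bound :: "real \<Rightarrow> real" where
  "exp_bound m = 3000 * (512 * ln (512 / m) / m * 2 * (\<integral>x. indicator annulus x * barrier x \<partial>lborel))"

context annulus_system
begin

lemma exp_integral_bounds:
  "(\<integral>x. indicator annulus x * exp (u x) \<partial>lborel) \<le> exp_bound (min a c)"
  "(\<integral>x. indicator annulus x * exp (v x) \<partial>lborel) \<le> exp_bound (min a c)"
proof -
  define m where "m = min a c"
  have m: "m > 0" "m \<le> a" "m \<le> c" using ac by (auto simp: m_def)
  \<comment> \<open>Chosen so that \<open>256 / K = m / 2\<close>: in the sum of the two coupled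
    estimates half of the left-hand side is then absorbed.\<close>
  define K where "K = 512 / m"
  have K: "K > 0" "256 / K = m / 2" using m by (auto simp: K_def)
  define P where "P = (\<integral>x. indicator annulus x * barrier x \<partial>lborel)"
  let ?E = "\<lambda>h. \<integral>x. indicator annulus x * (exp (h x) * barrier x) \<partial>lborel"
  have E0: "?E h \<ge> 0" for h
    by (intro integral_nonneg_AE AE_I2) (auto simp: indicator_def barrier_nonneg)
  have 1: "m * ?E v \<le> m / 2 * ?E u + 256 * ln K * P"
    using dirichlet_barrier_bound[OF eq_u cont(1) nonneg(1) cont(2) order_trans[OF m(2) weight_ge] K(1)]
    unfolding K(2) P_def .
  have 2: "m * ?E u \<le> m / 2 * ?E v + 256 * ln K * P"
    using dirichlet_barrier_bound[OF dir_v cont(2) nonneg(2) cont(1) order_trans[OF m(3) W(1)] K(1)]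
    unfolding K(2) P_def .
  have "m * (?E u + ?E v) \<le> 1024 * ln K * P" using 1 2 by (simp add: algebra_simps)
  then have s: "?E u + ?E v \<le> 1024 * ln K * P / m" using m(1) by (subst pos_le_divide_eq) (simp_all add: mult.commute)
  have "3000 * ?E u \<le> exp_bound m" "3000 * ?E v \<le> exp_bound m"
    using s E0[of u] E0[of v] by (simp_all add: exp_bound_def K_def P_def)
  moreover have "(\<integral>x. indicator annulus x * exp (u x) \<partial>lborel) \<le> 3000 * ?E u"
    "(\<integral>x. indicator annulus x * exp (v x) \<partial>lborel) \<le> 3000 * ?E v"
    using inner_comparison outer_comparison by (intro annulus_exp_bound cont; blast)+
  ultimately show "(\<integral>x. indicator annulus x * exp (u x) \<partial>lborel) \<le> exp_bound (min a c)"
    "(\<integral>x. indicator annulus x * exp (v x) \<partial>lborel) \<le> exp_bound (min a c)"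
    unfolding m_def by linarith+
qed

end

subsection \<open>Regularity of the solutions\<close>

text \<open>Continuity of \<open>k\<close> makes its extension by zero Borel, so that the right-hand
  side of each equation has an explicit Borel version built from that of the other unknown.\<close>

lemma
  assumes v: "borel_version v v'" and k: "continuous_on annulus k" "\<And>x. x \<in> annulus \<Longrightarrow> \<bar>k x\<bar> \<le> B"
    and e: "(\<lambda>x. exp (v x)) absolutely_integrable_on annulus"
  shows absolutely_integrable_mult_exp: "(\<lambda>x. k x * exp (v x)) absolutely_integrable_on annulus"
    and borel_version_mult_exp: "borel_version (\<lambda>x. k x * exp (v x)) (\<lambda>x. indicator annulus x * (k x * exp (v' x)))"
proof -
  define q where "q x = indicator annulus x * k x" for x
  have qm: "q \<in> borel_measurable borel"
    using borel_measurable_continuous_on_indicator[OF annulus_borel k(1)] by (simp add: q_def[abs_def])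
  note [measurable] = qm borel_versionD(1)[OF v]
  have i: "integrable lebesgue (\<lambda>x. indicator annulus x *\<^sub>R exp (v x))"
    using e by (simp add: set_integrable_def)
  have "integrable lebesgue (\<lambda>x. q x * (indicator annulus x *\<^sub>R exp (v x)))"
  proof (rule Bochner_Integration.integrable_bound[OF integrable_mult_right[OF i, of B]])
    show "(\<lambda>x. q x * (indicator annulus x *\<^sub>R exp (v x))) \<in> borel_measurable lebesgue"
    proof (rule borel_measurable_times[OF _ borel_measurable_integrable[OF i]])
      show "q \<in> borel_measurable lebesgue" using qm by (intro measurable_completion) simp
    qed
    show "AE x in lebesgue. norm (q x * (indicator annulus x *\<^sub>R exp (v x))) \<le> norm (B * (indicator annulus x *\<^sub>R exp (v x)))"
    proof (rule AE_I2)
      fix x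
      have "\<bar>k x\<bar> * exp (v x) \<le> \<bar>B\<bar> * exp (v x)" if "x \<in> annulus"
        using k(2)[OF that] by (intro mult_right_mono) auto
      then show "norm (q x * (indicator annulus x *\<^sub>R exp (v x))) \<le> norm (B * (indicator annulus x *\<^sub>R exp (v x)))"
        by (simp add: q_def abs_mult indicator_def)
    qed
  qed
  moreover have q': "q x * (indicator annulus x *\<^sub>R exp (v x)) = indicator annulus x *\<^sub>R (k x * exp (v x))" for x
    by (simp add: q_def indicator_def)
  ultimately have "integrable lebesgue (\<lambda>x. indicator annulus x *\<^sub>R (k x * exp (v x)))" by (simp only: q')
  then show ai: "(\<lambda>x. k x * exp (v x)) absolutely_integrable_on annulus" by (simp add: set_integrable_def)
  show "borel_version (\<lambda>x. k x * exp (v x)) (\<lambda>x. indicator annulus x * (k x * exp (v' x)))"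
    unfolding borel_version_def
  proof (intro conjI)
    show "set_borel_measurable lebesgue annulus (\<lambda>x. k x * exp (v x))"
      using ai unfolding set_integrable_def set_borel_measurable_def by (rule borel_measurable_integrable)
    have "(\<lambda>x. q x * exp (v' x)) \<in> borel_measurable borel" by measurable
    then show "(\<lambda>x. indicator annulus x * (k x * exp (v' x))) \<in> borel_measurable borel"
      by (simp add: q_def mult.assoc)
    show "AE x in lebesgue. x \<in> annulus \<longrightarrow> k x * exp (v x) = indicator annulus x * (k x * exp (v' x))"
      using borel_versionD(3)[OF v] by eventually_elim simp
  qed simp
qed

text \<open>One bootstrap step suffices: integrability of \<open>exp (2 * v)\<close> makes the
  right-hand side for \<open>u\<close> square integrable, and this gives continuity up to the
  boundary.\<close>

lemma continuous_representative:
  assumes u: "annulus_dirichlet u (\<lambda>x. indicator annulus x * (k x * exp (v x)))"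
    and v: "annulus_dirichlet v G" and k: "\<And>x. x \<in> annulus \<Longrightarrow> \<bar>k x\<bar> \<le> B"
  shows "\<exists>w. continuous_on UNIV w \<and> (\<forall>x. x \<notin> annulus \<longrightarrow> w x = 0) \<and> (AE x in lborel. u x = w x)"
proof (rule annulus_dirichlet_continuous[OF u])
  let ?F = "\<lambda>x. indicator annulus x * (k x * exp (v x))"
  note [measurable] = borel_measurable_integrable[OF annulus_dirichletD(2)[OF u]]
  show "integrable lborel (\<lambda>x. (?F x)\<^sup>2)"
  proof (rule Bochner_Integration.integrable_bound)
    show "integrable lborel (\<lambda>x. B\<^sup>2 * (indicator annulus x * exp (2 * v x)))"
      using annulus_dirichlet_exp_integrable[OF v] by simp
    show "(\<lambda>x. (?F x)\<^sup>2) \<in> borel_measurable lborel" by (intro borel_measurable_power) measurable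
    show "AE x in lborel. norm ((?F x)\<^sup>2) \<le> norm (B\<^sup>2 * (indicator annulus x * exp (2 * v x)))"
    proof (rule AE_I2)
      fix x
      have "(k x)\<^sup>2 * exp (2 * v x) \<le> B\<^sup>2 * exp (2 * v x)" if "x \<in> annulus"
        using k[OF that] by (intro mult_right_mono) (auto simp: abs_le_square_iff[symmetric])
      then show "norm ((?F x)\<^sup>2) \<le> norm (B\<^sup>2 * (indicator annulus x * exp (2 * v x)))"
        by (simp add: indicator_def power_mult_distrib exp_double)
    qed
  qed
qed

lemma annulus_dirichlet_cong_AE:
  assumes d: "annulus_dirichlet u F" and ae: "AE x in lborel. u x = u' x" "AE x in lborel. F x = F' x"
    and m: "u' \<in> borel_measurable borel" "F' \<in> borel_measurable borel"
    and z: "\<And>x. x \<notin> annulus \<Longrightarrow> u' x = 0" "\<And>x. x \<notin> annulus \<Longrightarrow> F' x = 0"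
  shows "annulus_dirichlet u' F'"
  unfolding annulus_dirichlet_def
proof (intro conjI allI impI)
  note iu = annulus_dirichletD(1,3)[OF d] and iF = annulus_dirichletD(2,4)[OF d]
  show u': "integrable lborel u'" by (rule integrable_cong_AE_imp[OF iu(1)]) (use m(1) ae(1) in \<open>simp_all add: eq_commute\<close>)
  show F': "integrable lborel F'" by (rule integrable_cong_AE_imp[OF iF(1)]) (use m(2) ae(2) in \<open>simp_all add: eq_commute\<close>)
  fix \<psi> :: "real^2 \<Rightarrow> real" assume \<psi>: "smooth_on (-{0}) \<psi>" "\<forall>x. norm x = 1/2 \<or> norm x = 1 \<longrightarrow> \<psi> x = 0"
  have c: "continuous_on (-{0}) \<psi>" "continuous_on (-{0}) (laplacian \<psi>)"
    using \<psi>(1) smooth_on_laplacian[OF _ \<psi>(1)] by (auto intro: smooth_on_continuous)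
  have "(\<integral>x. u x * laplacian \<psi> x \<partial>lborel) = (\<integral>x. u' x * laplacian \<psi> x \<partial>lborel)"
    by (rule integral_cong_AE[OF borel_measurable_integrable[OF integrable_annulus_mult[OF iu c(2)]]
          borel_measurable_integrable[OF integrable_annulus_mult[OF u' z(1) c(2)]]])
       (use ae(1) in \<open>auto elim: eventually_mono\<close>)
  moreover have "(\<integral>x. F x * \<psi> x \<partial>lborel) = (\<integral>x. F' x * \<psi> x \<partial>lborel)"
    by (rule integral_cong_AE[OF borel_measurable_integrable[OF integrable_annulus_mult[OF iF c(1)]]
          borel_measurable_integrable[OF integrable_annulus_mult[OF F' z(2) c(1)]]])
       (use ae(2) in \<open>auto elim: eventually_mono\<close>)
  ultimately show "- (\<integral>x. u' x * laplacian \<psi> x \<partial>lborel) = (\<integral>x. F' x * \<psi> x \<partial>lborel)"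
    using annulus_dirichletD(5)[OF d \<psi>(1)] \<psi>(2) by simp
qed (use z in auto)

lemma LINT_exp_eq:
  assumes v: "borel_version u u'" and e: "(\<lambda>x. exp (u x)) absolutely_integrable_on annulus"
    and w: "continuous_on UNIV w" "AE x in lborel. u' x = w x"
  shows "(LINT x:annulus|lebesgue. exp (u x)) = (\<integral>x. indicator annulus x * exp (w x) \<partial>lborel)"
proof (rule LINT_annulus_eq)
  note [measurable] = borel_measurable_continuous_onI[OF w(1)]
  show "set_borel_measurable lebesgue annulus (\<lambda>x. exp (u x))"
    using e unfolding set_integrable_def set_borel_measurable_def by (rule borel_measurable_integrable)
  show "(\<lambda>x. indicator annulus x * exp (w x)) \<in> borel_measurable borel" by measurable
  show "AE x in lebesgue. x \<in> annulus \<longrightarrow> exp (u x) = indicator annulus x * exp (w x)"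
    using borel_versionD(3)[OF v] AE_completion[OF w(2)] by eventually_elim simp
qed simp

theorem theorem1p1:
  fixes x0 :: "real^2" and \<beta> a b c d :: real
  assumes "norm x0 = 1/2" and "0 < \<beta>" and "\<beta> < 1/2"
    and "0 < a" and "0 < b" and "0 < c" and "0 < d"
  shows "\<exists>C C' :: real. \<forall>V W u v :: real^2 \<Rightarrow> real.
     (\<exists>L. L-lipschitz_on annulus V) \<and>
     (\<forall>x\<in>annulus. a \<le> V x \<and> V x \<le> b) \<and>
     gradient_Linf_le annulus V (a / (2 * (1 + 2 powr (2 * \<beta>)))) \<and>
     (\<exists>L. L-lipschitz_on annulus W) \<and>
     (\<forall>x\<in>annulus. c \<le> W x \<and> W x \<le> d) \<and>
     gradient_Linf_le annulus W (c / 2) \<and>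
     u \<in> sobolev_W11_0 annulus \<and> v \<in> sobolev_W11_0 annulus \<and>
     (\<lambda>x. exp (u x)) absolutely_integrable_on annulus \<and>
     (\<lambda>x. exp (v x)) absolutely_integrable_on annulus \<and>
     neg_laplacian_distr annulus u
       (\<lambda>x. (1 + norm (x - x0) powr (2 * \<beta>)) * V x * exp (v x)) \<and>
     neg_laplacian_distr annulus v (\<lambda>x. W x * exp (u x))
     \<longrightarrow> (LINT x:annulus|lebesgue. exp (u x)) \<le> C \<and>
         (LINT x:annulus|lebesgue. exp (v x)) \<le> C'"
proof (intro exI[of _ "exp_bound (min a c)"] allI impI)
  fix V W u v :: "real^2 \<Rightarrow> real"
  let ?A = "a / (2 * (1 + 2 powr (2 * \<beta>)))"
  let ?k = "\<lambda>x. (1 + norm (x - x0) powr (2 * \<beta>)) * V x"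
  assume H: "(\<exists>L. L-lipschitz_on annulus V) \<and>
     (\<forall>x\<in>annulus. a \<le> V x \<and> V x \<le> b) \<and>
     gradient_Linf_le annulus V ?A \<and>
     (\<exists>L. L-lipschitz_on annulus W) \<and>
     (\<forall>x\<in>annulus. c \<le> W x \<and> W x \<le> d) \<and>
     gradient_Linf_le annulus W (c / 2) \<and>
     u \<in> sobolev_W11_0 annulus \<and> v \<in> sobolev_W11_0 annulus \<and>
     (\<lambda>x. exp (u x)) absolutely_integrable_on annulus \<and>
     (\<lambda>x. exp (v x)) absolutely_integrable_on annulus \<and>
     neg_laplacian_distr annulus u (\<lambda>x. ?k x * exp (v x)) \<and>
     neg_laplacian_distr annulus v (\<lambda>x. W x * exp (u x))"
  then have V: "\<And>x. x \<in> annulus \<Longrightarrow> a \<le> V x" "\<And>x. x \<in> annulus \<Longrightarrow> V x \<le> b" "gradient_Linf_le annulus V ?A"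
    and W: "\<And>x. x \<in> annulus \<Longrightarrow> c \<le> W x" "\<And>x. x \<in> annulus \<Longrightarrow> W x \<le> d" "gradient_Linf_le annulus W (c / 2)"
    and uv: "u \<in> sobolev_W11_0 annulus" "v \<in> sobolev_W11_0 annulus"
    and ex: "(\<lambda>x. exp (u x)) absolutely_integrable_on annulus" "(\<lambda>x. exp (v x)) absolutely_integrable_on annulus"
    and eq: "neg_laplacian_distr annulus u (\<lambda>x. ?k x * exp (v x))" "neg_laplacian_distr annulus v (\<lambda>x. W x * exp (u x))"
    by blast+
  have Vc: "continuous_on annulus V" and Wc: "continuous_on annulus W"
    using H lipschitz_on_continuous_on by blast+
  have Vb: "\<bar>V x\<bar> \<le> b" and Wb: "\<bar>W x\<bar> \<le> d" if "x \<in> annulus" for x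
    using V(1,2)[OF that] W(1,2)[OF that] assms by linarith+
  have Vseg: "\<bar>V x - V y\<bar> \<le> a / 4 * norm (x - y)" if seg: "closed_segment x y \<subseteq> annulus" for x y
  proof -
    have "\<bar>V x - V y\<bar> \<le> ?A * norm (x - y)"
      using assms by (intro weak_gradient_segment_bound[OF Vc Vb V(3) _ seg]) auto
    also have "?A \<le> a / 4"
    proof (rule divide_left_mono)
      show "4 \<le> 2 * (1 + 2 powr (2 * \<beta>))" using ge_one_powr_ge_zero[of 2 "2 * \<beta>"] assms by simp
    qed (use assms in \<open>auto intro!: mult_pos_pos add_pos_nonneg\<close>)
    then have "?A * norm (x - y) \<le> a / 4 * norm (x - y)" by (rule mult_right_mono) simp
    finally show ?thesis .
  qed
  have Wseg: "\<bar>W x - W y\<bar> \<le> c / 2 * norm (x - y)" if seg: "closed_segment x y \<subseteq> annulus" for x y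
    using assms by (intro weak_gradient_segment_bound[OF Wc Wb W(3) _ seg]) auto
  have kc: "continuous_on annulus ?k"
    using assms(1) by (intro continuous_intros Vc) (auto simp: annulus_def)
  have kb: "\<bar>?k x\<bar> \<le> (1 + 2 powr (2 * \<beta>)) * b" if x: "x \<in> annulus" for x
  proof -
    have "norm (x - x0) \<le> 2" using norm_triangle_ineq4[of x x0] x assms(1) by (simp add: annulus_def)
    then have "norm (x - x0) powr (2 * \<beta>) \<le> 2 powr (2 * \<beta>)" using assms by (intro powr_mono2) auto
    then show ?thesis unfolding abs_mult using Vb[OF x] by (intro mult_mono) auto
  qed
  have "u absolutely_integrable_on annulus" "v absolutely_integrable_on annulus"
    using uv by (simp_all add: sobolev_W11_0_def sobolev_W11_def)
  then obtain u' v' where uv': "borel_version u u'" "borel_version v v'"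
    by (elim borel_version_exists[THEN exE])
  note Fu = absolutely_integrable_mult_exp[OF uv'(2) kc kb ex(2)] borel_version_mult_exp[OF uv'(2) kc kb ex(2)]
  note Fv = absolutely_integrable_mult_exp[OF uv'(1) Wc Wb ex(1)] borel_version_mult_exp[OF uv'(1) Wc Wb ex(1)]
  note du = sobolev_annulus_dirichlet[OF uv(1) eq(1) Fu(1) uv'(1) Fu(2)]
  note dv = sobolev_annulus_dirichlet[OF uv(2) eq(2) Fv(1) uv'(2) Fv(2)]
  \<comment> \<open>Each unknown is the exponent in the equation of the other, so both very weak
    problems are established before either representative is taken.\<close>
  obtain p where p: "continuous_on UNIV p" "\<And>x. x \<notin> annulus \<Longrightarrow> p x = 0" "AE x in lborel. u' x = p x"
    using continuous_representative[OF du dv kb] by blast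
  obtain q where q: "continuous_on UNIV q" "\<And>x. x \<notin> annulus \<Longrightarrow> q x = 0" "AE x in lborel. v' x = q x"
    using continuous_representative[OF dv du Wb] by blast
  have pm: "p \<in> borel_measurable borel" and qm: "q \<in> borel_measurable borel"
    using p(1) q(1) by (auto intro: borel_measurable_continuous_onI)
  have m: "(\<lambda>x. indicator annulus x * (k x * exp (w x))) \<in> borel_measurable borel"
    if "continuous_on annulus k" "w \<in> borel_measurable borel" for k w :: "real^2 \<Rightarrow> real"
  proof -
    have "(\<lambda>x. indicator annulus x *\<^sub>R k x) \<in> borel_measurable borel"
      by (rule borel_measurable_continuous_on_indicator[OF annulus_borel that(1)])
    then have "(\<lambda>x. (indicator annulus x *\<^sub>R k x) * exp (w x)) \<in> borel_measurable borel"
      using that(2) by measurable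
    then show ?thesis by (simp add: mult.assoc)
  qed
  interpret annulus_system x0 \<beta> a b c d V W p q
  proof
    show "norm x0 = 1/2" "0 < \<beta>" "\<beta> < 1/2" "0 < a" "0 < c" by (fact assms)+
    show "continuous_on UNIV p" "continuous_on UNIV q" by (fact p(1) q(1))+
    show "a \<le> V x" "V x \<le> b" "c \<le> W x" "W x \<le> d" if "x \<in> annulus" for x
      by (fact V(1,2)[OF that] W(1,2)[OF that])+
    show "\<bar>V x - V y\<bar> \<le> a / 4 * norm (x - y)" "\<bar>W x - W y\<bar> \<le> c / 2 * norm (x - y)"
      if "closed_segment x y \<subseteq> annulus" for x y
      by (fact Vseg[OF that] Wseg[OF that])+
    show "annulus_dirichlet p (\<lambda>x. indicator annulus x * (?k x * exp (q x)))"
    proof (rule annulus_dirichlet_cong_AE[OF du p(3) _ pm m[OF kc qm] p(2)])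
      show "AE x in lborel. indicator annulus x * (?k x * exp (v' x)) = indicator annulus x * (?k x * exp (q x))"
        using q(3) by eventually_elim simp
      show "indicator annulus x * (?k x * exp (q x)) = 0" if "x \<notin> annulus" for x using that by simp
    qed
    show "annulus_dirichlet q (\<lambda>x. indicator annulus x * (W x * exp (p x)))"
    proof (rule annulus_dirichlet_cong_AE[OF dv q(3) _ qm m[OF Wc pm] q(2)])
      show "AE x in lborel. indicator annulus x * (W x * exp (u' x)) = indicator annulus x * (W x * exp (p x))"
        using p(3) by eventually_elim simp
      show "indicator annulus x * (W x * exp (p x)) = 0" if "x \<notin> annulus" for x using that by simp
    qed
  qed
  show "(LINT x:annulus|lebesgue. exp (u x)) \<le> exp_bound (min a c) \<and>
    (LINT x:annulus|lebesgue. exp (v x)) \<le> exp_bound (min a c)"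
    unfolding LINT_exp_eq[OF uv'(1) ex(1) p(1,3)] LINT_exp_eq[OF uv'(2) ex(2) q(1,3)] using exp_integral_bounds by blast
qed

end
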